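(* Let $A$ be a Koszul DG algebra over a field $k$ and let $E=\operatorname{Ext}^*_A({}_Ak,{}_Ak)$ be its Ext-algebra. If ${}_Ak\in\mathcal{D}^c(A)$, then $$\operatorname{Ext}^*_E({}_Ek,{}_Ek)\cong H(A)$$ as graded algebras.
   Context: $k$ is a field and all algebras are $k$-algebras. A connected DG algebra is a cochain DG algebra $A=\bigoplus_{n\ge 0}A^n$ with $A^0=k$ and differential $d$ of degree $1$ which is a graded derivation. ${}_Ak$ is the trivial left DG $A$-module $A/A^{\ge1}$. $\mathcal{D}^c(A)$ is the full triangulated subcategory of compact objects in the derived category of left DG $A$-modules. A left DG $A$-module $P$ is semifree if it has a semibasis: a basis $B$ of the underlying graded $A$-module with a decomposition $B=\bigsqcup_{n\ge0}B^n$ into graded subsets such that $d(B^0)=0$ and $d(B^n)\subseteq\bigoplus_{e\in\bigsqcup_{i<n}B^i}Ae$ for $n>0$. $P$ is minimal if $d(P)\subseteq A^{\geq 1}P$. A connected DG algebra $A$ is a Koszul DG algebra if ${}_Ak$ has a minimal semifree resolution $P\to{}_Ak$ with a semibasis consisting of elements of degree $0$. $\operatorname{Ext}^n_A(M,N)=H^n(\operatorname{RHom}_A(M,N))$, and $E=\bigoplus_n\operatorname{Ext}^n_A({}_Ak,{}_Ak)$ is an algebra under composition; it is concentrated in degree $0$ and, when ${}_Ak\in\mathcal{D}^c(A)$, is a finite dimensional local algebra with $E/J\cong k$ ($J$ the Jacobson radical). ${}_Ek=E/J$ is the trivial left $E$-module, and $\operatorname{Ext}^*_E({}_Ek,{}_Ek)$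 is the usual Yoneda algebra. *)

theory Defs
  imports
    "HOL-Algebra.Module"
    "HOL-Algebra.QuotRing"
    "HOL-Algebra.Generated_Groups"
    "HOL-Library.Infinite_Typeclass"
begin

section \<open>Graded objects with a differential\<close>

text \<open>
  One record serves for DG algebras over a field \<open>K\<close> (type \<open>('k, 'a) dg\<close>, with \<^const>\<open>smult\<close> the
  action of \<open>K\<close>) and for left DG modules over a DG algebra \<open>A\<close> (type \<open>('a, 'm) dg\<close>, with
  \<^const>\<open>smult\<close> the action of \<open>A\<close>; as for \<^locale>\<open>Module.module\<close>, the fields \<^const>\<open>mult\<close> and \<^const>\<open>one\<close> are
  then irrelevant).  Objects are total: \<open>gr M n\<close> is the degree-\<open>n\<close> part inside
  \<open>carrier M = (\<Oplus>n. gr M n)\<close>.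
\<close>

record ('a, 'b) dg = "('a, 'b) module" +
  gr :: "int \<Rightarrow> 'b set"
  dif :: "'b \<Rightarrow> 'b"

definition is_decomp :: "('b, 'c) ring_scheme \<Rightarrow> (int \<Rightarrow> 'b set) \<Rightarrow> 'b \<Rightarrow> (int \<Rightarrow> 'b) \<Rightarrow> bool" where
  "is_decomp G V x c \<longleftrightarrow>
     (\<forall>n. c n \<in> V n) \<and> finite {n. c n \<noteq> \<zero>\<^bsub>G\<^esub>} \<and> x = (\<Oplus>\<^bsub>G\<^esub>n\<in>{n. c n \<noteq> \<zero>\<^bsub>G\<^esub>}. c n)"

definition graded_by :: "('b, 'c) ring_scheme \<Rightarrow> (int \<Rightarrow> 'b set) \<Rightarrow> bool" where
  "graded_by G V \<longleftrightarrow>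
     (\<forall>n. subgroup (V n) (add_monoid G)) \<and> (\<forall>x\<in>carrier G. \<exists>!c. is_decomp G V x c)"

definition hcomp :: "('b, 'c) ring_scheme \<Rightarrow> (int \<Rightarrow> 'b set) \<Rightarrow> 'b \<Rightarrow> int \<Rightarrow> 'b" where
  "hcomp G V x = (THE c. is_decomp G V x c)"

text \<open>\<open>sgn_pow G n x\<close> is $(-1)^n x$.\<close>

definition sgn_pow :: "('b, 'c) ring_scheme \<Rightarrow> int \<Rightarrow> 'b \<Rightarrow> 'b" where
  "sgn_pow G n x = (if even n then x else \<ominus>\<^bsub>G\<^esub> x)"


section \<open>DG algebras and left DG modules\<close>

locale dg_algebra =
  fixes K :: "('k, 'c) ring_scheme" (structure) and A :: "('k, 'a) dg" (structure)
  assumes field: "field K"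
    and ring: "ring A"
    and module: "Module.module K A"
    and smult_mult_left:
      "\<lbrakk>c \<in> carrier K; x \<in> carrier A; y \<in> carrier A\<rbrakk>
        \<Longrightarrow> c \<odot>\<^bsub>A\<^esub> (x \<otimes>\<^bsub>A\<^esub> y) = (c \<odot>\<^bsub>A\<^esub> x) \<otimes>\<^bsub>A\<^esub> y"
    and smult_mult_right:
      "\<lbrakk>c \<in> carrier K; x \<in> carrier A; y \<in> carrier A\<rbrakk>
        \<Longrightarrow> c \<odot>\<^bsub>A\<^esub> (x \<otimes>\<^bsub>A\<^esub> y) = x \<otimes>\<^bsub>A\<^esub> (c \<odot>\<^bsub>A\<^esub> y)"
    and graded: "graded_by A (gr A)"
    and smult_gr: "\<lbrakk>c \<in> carrier K; x \<in> gr A n\<rbrakk> \<Longrightarrow> c \<odot>\<^bsub>A\<^esub> x \<in> gr A n"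
    and one_gr: "\<one>\<^bsub>A\<^esub> \<in> gr A 0"
    and mult_gr: "\<lbrakk>x \<in> gr A i; y \<in> gr A j\<rbrakk> \<Longrightarrow> x \<otimes>\<^bsub>A\<^esub> y \<in> gr A (i + j)"
    and dif_gr: "x \<in> gr A n \<Longrightarrow> dif A x \<in> gr A (n + 1)"
    and dif_add:
      "\<lbrakk>x \<in> carrier A; y \<in> carrier A\<rbrakk> \<Longrightarrow> dif A (x \<oplus>\<^bsub>A\<^esub> y) = dif A x \<oplus>\<^bsub>A\<^esub> dif A y"
    and dif_smult: "\<lbrakk>c \<in> carrier K; x \<in> carrier A\<rbrakk> \<Longrightarrow> dif A (c \<odot>\<^bsub>A\<^esub> x) = c \<odot>\<^bsub>A\<^esub> dif A x"
    and dif_dif: "x \<in> carrier A \<Longrightarrow> dif A (dif A x) = \<zero>\<^bsub>A\<^esub>"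
    and leibniz:
      "\<lbrakk>x \<in> gr A i; y \<in> carrier A\<rbrakk>
        \<Longrightarrow> dif A (x \<otimes>\<^bsub>A\<^esub> y) = (dif A x \<otimes>\<^bsub>A\<^esub> y) \<oplus>\<^bsub>A\<^esub> sgn_pow A i (x \<otimes>\<^bsub>A\<^esub> dif A y)"

text \<open>The second axiom is $A^0 = k$: the unit map $k \to A^0$ is bijective.\<close>

locale connected_dg_algebra = dg_algebra +
  assumes gr_neg: "n < 0 \<Longrightarrow> gr A n = {\<zero>\<^bsub>A\<^esub>}"
    and gr_0: "bij_betw (\<lambda>c. c \<odot>\<^bsub>A\<^esub> \<one>\<^bsub>A\<^esub>) (carrier K) (gr A 0)"

text \<open>The axioms of \<^locale>\<open>Module.module\<close> over a ring that need not be commutative.\<close>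

locale left_module = R?: ring R + M?: abelian_group M
  for R :: "('a, 'c) ring_scheme" (structure) and M :: "('a, 'm, 'd) module_scheme" (structure) +
  assumes smult_closed: "\<lbrakk>a \<in> carrier R; x \<in> carrier M\<rbrakk> \<Longrightarrow> a \<odot>\<^bsub>M\<^esub> x \<in> carrier M"
    and smult_l_distr:
      "\<lbrakk>a \<in> carrier R; b \<in> carrier R; x \<in> carrier M\<rbrakk>
        \<Longrightarrow> (a \<oplus>\<^bsub>R\<^esub> b) \<odot>\<^bsub>M\<^esub> x = a \<odot>\<^bsub>M\<^esub> x \<oplus>\<^bsub>M\<^esub> b \<odot>\<^bsub>M\<^esub> x"
    and smult_r_distr:
      "\<lbrakk>a \<in> carrier R; x \<in> carrier M; y \<in> carrier M\<rbrakk>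
        \<Longrightarrow> a \<odot>\<^bsub>M\<^esub> (x \<oplus>\<^bsub>M\<^esub> y) = a \<odot>\<^bsub>M\<^esub> x \<oplus>\<^bsub>M\<^esub> a \<odot>\<^bsub>M\<^esub> y"
    and smult_assoc:
      "\<lbrakk>a \<in> carrier R; b \<in> carrier R; x \<in> carrier M\<rbrakk>
        \<Longrightarrow> (a \<otimes>\<^bsub>R\<^esub> b) \<odot>\<^bsub>M\<^esub> x = a \<odot>\<^bsub>M\<^esub> (b \<odot>\<^bsub>M\<^esub> x)"
    and smult_one: "x \<in> carrier M \<Longrightarrow> \<one>\<^bsub>R\<^esub> \<odot>\<^bsub>M\<^esub> x = x"

locale left_dg_module = left_module A M
  for A :: "('k, 'a) dg" (structure) and M :: "('a, 'm) dg" (structure) +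
  assumes graded: "graded_by M (gr M)"
    and smult_gr: "\<lbrakk>a \<in> gr A i; x \<in> gr M j\<rbrakk> \<Longrightarrow> a \<odot>\<^bsub>M\<^esub> x \<in> gr M (i + j)"
    and dif_gr: "x \<in> gr M n \<Longrightarrow> dif M x \<in> gr M (n + 1)"
    and dif_add:
      "\<lbrakk>x \<in> carrier M; y \<in> carrier M\<rbrakk> \<Longrightarrow> dif M (x \<oplus>\<^bsub>M\<^esub> y) = dif M x \<oplus>\<^bsub>M\<^esub> dif M y"
    and dif_dif: "x \<in> carrier M \<Longrightarrow> dif M (dif M x) = \<zero>\<^bsub>M\<^esub>"
    and leibniz:
      "\<lbrakk>a \<in> gr A i; x \<in> carrier M\<rbrakk>
        \<Longrightarrow> dif M (a \<odot>\<^bsub>M\<^esub> x) = (dif A a \<odot>\<^bsub>M\<^esub> x) \<oplus>\<^bsub>M\<^esub> sgn_pow M i (a \<odot>\<^bsub>M\<^esub> dif M x)"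

definition regular :: "('k, 'a) dg \<Rightarrow> ('a, 'a) dg" where
  "regular A =
     \<lparr>carrier = carrier A, mult = mult A, one = one A, zero = zero A, add = add A,
      smult = mult A, gr = gr A, dif = dif A\<rparr>"


section \<open>Subquotients, cohomology and quasi-isomorphisms\<close>

text \<open>
  \<open>subquot M Z B\<close> is $Z/B$, for $B \subseteq Z \subseteq M$, on the set of cosets of \<open>B\<close>, with the operations
  induced from \<open>M\<close> in the style of \<^const>\<open>FactRing\<close>.  Its degree-\<open>n\<close> part is the image of $Z \cap M^n$.
\<close>

definition subquot :: "('a, 'b) dg \<Rightarrow> 'b set \<Rightarrow> 'b set \<Rightarrow> ('a, 'b set) dg" where
  "subquot M Z B =
     \<lparr>carrier = (\<lambda>z. B +>\<^bsub>M\<^esub> z) ` Z,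
      mult = rcoset_mult M B,
      one = B +>\<^bsub>M\<^esub> \<one>\<^bsub>M\<^esub>,
      zero = B,
      add = set_add M,
      smult = (\<lambda>a X. \<Union>x\<in>X. B +>\<^bsub>M\<^esub> (a \<odot>\<^bsub>M\<^esub> x)),
      gr = (\<lambda>n. (\<lambda>z. B +>\<^bsub>M\<^esub> z) ` (Z \<inter> gr M n)),
      dif = (\<lambda>X. \<Union>x\<in>X. B +>\<^bsub>M\<^esub> dif M x)\<rparr>"

definition cocycles :: "('a, 'b) dg \<Rightarrow> 'b set" where
  "cocycles M = {x \<in> carrier M. dif M x = \<zero>\<^bsub>M\<^esub>}"

definition coboundaries :: "('a, 'b) dg \<Rightarrow> 'b set" where
  "coboundaries M = dif M ` carrier M"

definition cohom :: "('a, 'b) dg \<Rightarrow> ('a, 'b set) dg" where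
  "cohom M = subquot M (cocycles M) (coboundaries M)"

text \<open>The map $H(M) \to H(N)$ induced by a cochain map \<open>f\<close>.\<close>

definition cohom_map :: "('a, 'n) dg \<Rightarrow> ('m \<Rightarrow> 'n) \<Rightarrow> 'm set \<Rightarrow> 'n set" where
  "cohom_map N f X = (\<Union>x\<in>X. coboundaries N +>\<^bsub>N\<^esub> f x)"

text \<open>The left ideal $A^{\geq 1}$ and the trivial module ${}_Ak = A/A^{\geq 1}$.\<close>

definition pos_part :: "('k, 'a) dg \<Rightarrow> 'a set" where
  "pos_part A = generate (add_monoid A) (\<Union>n\<in>{1..}. gr A n)"

definition trivial_module :: "('k, 'a) dg \<Rightarrow> ('a, 'a set) dg" where
  "trivial_module A = subquot (regular A) (carrier A) (pos_part A)"


section \<open>Hom complexes\<close>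

text \<open>
  $\mathrm{Hom}_A^n(M,N)$: additive maps \<open>f\<close> of degree \<open>n\<close> with $f(ax) = (-1)^{n|a|} a f(x)$.
\<close>

definition hom_deg :: "('k, 'a) dg \<Rightarrow> ('a, 'm) dg \<Rightarrow> ('a, 'n) dg \<Rightarrow> int \<Rightarrow> ('m \<Rightarrow> 'n) set" where
  "hom_deg A M N n =
     {f \<in> carrier M \<rightarrow>\<^sub>E carrier N.
        (\<forall>x\<in>carrier M. \<forall>y\<in>carrier M. f (x \<oplus>\<^bsub>M\<^esub> y) = f x \<oplus>\<^bsub>N\<^esub> f y) \<and>
        (\<forall>i. f ` gr M i \<subseteq> gr N (i + n)) \<and>
        (\<forall>i. \<forall>a\<in>gr A i. \<forall>x\<in>carrier M. f (a \<odot>\<^bsub>M\<^esub> x) = sgn_pow N (n * i) (a \<odot>\<^bsub>N\<^esub> f x))}"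

text \<open>All functions $M \to N$, pointwise; a scalar \<open>c\<close> of the ground field acts through $c 1_A$.\<close>

definition fun_module ::
  "('k, 'a) dg \<Rightarrow> ('a, 'm) dg \<Rightarrow> ('a, 'n) dg \<Rightarrow> ('k, 'm \<Rightarrow> 'n) module" where
  "fun_module A M N =
     \<lparr>carrier = carrier M \<rightarrow>\<^sub>E carrier N,
      mult = undefined,
      one = undefined,
      zero = (\<lambda>x\<in>carrier M. \<zero>\<^bsub>N\<^esub>),
      add = (\<lambda>f g. \<lambda>x\<in>carrier M. f x \<oplus>\<^bsub>N\<^esub> g x),
      smult = (\<lambda>c f. \<lambda>x\<in>carrier M. (c \<odot>\<^bsub>A\<^esub> \<one>\<^bsub>A\<^esub>) \<odot>\<^bsub>N\<^esub> f x)\<rparr>"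

text \<open>
  The complex $\mathrm{Hom}_A(M,N) = \bigoplus_n \mathrm{Hom}_A^n(M,N)$ over the ground field, whose
  elements are the finite sums of homogeneous maps, with
  $d(f) = d_N \circ f - (-1)^n f \circ d_M$ for \<open>f\<close> of degree \<open>n\<close>.
\<close>

definition hom_dif :: "('a, 'm) dg \<Rightarrow> ('a, 'n) dg \<Rightarrow> int \<Rightarrow> ('m \<Rightarrow> 'n) \<Rightarrow> 'm \<Rightarrow> 'n" where
  "hom_dif M N n f = (\<lambda>x\<in>carrier M. dif N (f x) \<ominus>\<^bsub>N\<^esub> sgn_pow N n (f (dif M x)))"

definition hom_dg :: "('k, 'a) dg \<Rightarrow> ('a, 'm) dg \<Rightarrow> ('a, 'n) dg \<Rightarrow> ('k, 'm \<Rightarrow> 'n) dg" where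
  "hom_dg A M N =
     (let F = fun_module A M N; V = hom_deg A M N in
     \<lparr>carrier = {f. \<exists>c. is_decomp F V f c},
      mult = undefined,
      one = undefined,
      zero = zero F,
      add = add F,
      smult = smult F,
      gr = V,
      dif = (\<lambda>f. \<Oplus>\<^bsub>F\<^esub>n\<in>{n. hcomp F V f n \<noteq> \<zero>\<^bsub>F\<^esub>}. hom_dif M N n (hcomp F V f n))\<rparr>)"

definition end_dg :: "('k, 'a) dg \<Rightarrow> ('a, 'm) dg \<Rightarrow> ('k, 'm \<Rightarrow> 'm) dg" where
  "end_dg A M =
     (hom_dg A M M)\<lparr>mult := compose (carrier M), one := (\<lambda>x\<in>carrier M. x)\<rparr>"

definition quasi_iso :: "('k, 'a) dg \<Rightarrow> ('a, 'm) dg \<Rightarrow> ('a, 'n) dg \<Rightarrow> ('m \<Rightarrow> 'n) \<Rightarrow> bool" where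
  "quasi_iso A M N f \<longleftrightarrow>
     f \<in> hom_deg A M N 0 \<and>
     (\<forall>x\<in>carrier M. f (dif M x) = dif N (f x)) \<and>
     bij_betw (cohom_map N f) (carrier (cohom M)) (carrier (cohom N))"


section \<open>Semifree modules and Koszul DG algebras\<close>

definition lspan :: "('a, 'm) dg \<Rightarrow> 'a set \<Rightarrow> 'm set \<Rightarrow> 'm set" where
  "lspan M R S =
     {\<Oplus>\<^bsub>M\<^esub>b\<in>F. c b \<odot>\<^bsub>M\<^esub> b | F c. finite F \<and> F \<subseteq> S \<and> c \<in> F \<rightarrow> R}"

definition lbasis :: "('k, 'a) dg \<Rightarrow> ('a, 'm) dg \<Rightarrow> 'm set \<Rightarrow> bool" where
  "lbasis A M S \<longleftrightarrow>
     S \<subseteq> carrier M \<and>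
     (\<forall>x\<in>carrier M. \<exists>!c. c \<in> S \<rightarrow>\<^sub>E carrier A \<and> finite {b\<in>S. c b \<noteq> \<zero>\<^bsub>A\<^esub>} \<and>
        x = (\<Oplus>\<^bsub>M\<^esub>b\<in>{b\<in>S. c b \<noteq> \<zero>\<^bsub>A\<^esub>}. c b \<odot>\<^bsub>M\<^esub> b))"

definition semibasis :: "('k, 'a) dg \<Rightarrow> ('a, 'm) dg \<Rightarrow> (nat \<Rightarrow> 'm set) \<Rightarrow> bool" where
  "semibasis A P B \<longleftrightarrow>
     lbasis A P (\<Union>n. B n) \<and>
     (\<forall>m n. m \<noteq> n \<longrightarrow> B m \<inter> B n = {}) \<and>
     (\<forall>n. \<forall>b\<in>B n. \<exists>i. b \<in> gr P i) \<and>
     (\<forall>b\<in>B 0. dif P b = \<zero>\<^bsub>P\<^esub>) \<and>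
     (\<forall>n>0. dif P ` B n \<subseteq> lspan P (carrier A) (\<Union>i<n. B i))"

definition semifree_resolution ::
  "('k, 'a) dg \<Rightarrow> ('a, 'm) dg \<Rightarrow> ('a, 'p) dg \<Rightarrow> ('p \<Rightarrow> 'm) \<Rightarrow> bool" where
  "semifree_resolution A M P \<epsilon> \<longleftrightarrow>
     left_dg_module A P \<and> (\<exists>B. semibasis A P B) \<and> quasi_iso A P M \<epsilon>"

definition minimal_dg_module :: "('k, 'a) dg \<Rightarrow> ('a, 'p) dg \<Rightarrow> bool" where
  "minimal_dg_module A P \<longleftrightarrow> dif P ` carrier P \<subseteq> lspan P (pos_part A) (carrier P)"

text \<open>
  The type argument says in which type the resolution of ${}_Ak$ is realised; a statement with this
  predicate as a hypothesis for an arbitrary type covers every resolution.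
\<close>

definition koszul_dg_algebra ::
  "'p itself \<Rightarrow> ('k, 'c) ring_scheme \<Rightarrow> ('k, 'a) dg \<Rightarrow> bool" where
  "koszul_dg_algebra _ K A \<longleftrightarrow>
     connected_dg_algebra K A \<and>
     (\<exists>(P :: ('a, 'p) dg) \<epsilon> B.
        semifree_resolution A (trivial_module A) P \<epsilon> \<and> minimal_dg_module A P \<and>
        semibasis A P B \<and> (\<forall>n. B n \<subseteq> gr P 0))"


section \<open>Ext-algebra\<close>

text \<open>
  If \<open>P\<close> is a semifree resolution of \<open>M\<close>, then $\mathrm{RHom}_A(M,N) = \mathrm{Hom}_A(P,N)$, so that
  \<open>gr (ext_dg A P N) n\<close> is $\mathrm{Ext}^n_A(M,N)$ and in particular
  \<open>gr (ext_dg A P N) 0\<close> is the Hom space from \<open>M\<close> to \<open>N\<close> in the derived category.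
  The algebra $\mathrm{Ext}^*_A(M,M)$, under composition, is the cohomology of $\mathrm{Hom}_A(P,P)$.
\<close>

definition ext_dg :: "('k, 'a) dg \<Rightarrow> ('a, 'p) dg \<Rightarrow> ('a, 'n) dg \<Rightarrow> ('k, ('p \<Rightarrow> 'n) set) dg" where
  "ext_dg A P N = cohom (hom_dg A P N)"

definition ext_algebra :: "('k, 'a) dg \<Rightarrow> ('a, 'p) dg \<Rightarrow> ('k, ('p \<Rightarrow> 'p) set) dg" where
  "ext_algebra A P = cohom (end_dg A P)"


section \<open>Compact objects of the derived category\<close>

definition dsum :: "'i set \<Rightarrow> ('i \<Rightarrow> ('a, 'm) dg) \<Rightarrow> ('a, 'i \<Rightarrow> 'm) dg" where
  "dsum I M =
     (let C = {x \<in> (\<Pi>\<^sub>E i\<in>I. carrier (M i)). finite {i\<in>I. x i \<noteq> \<zero>\<^bsub>M i\<^esub>}} in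
     \<lparr>carrier = C,
      mult = undefined,
      one = undefined,
      zero = (\<lambda>i\<in>I. \<zero>\<^bsub>M i\<^esub>),
      add = (\<lambda>x y. \<lambda>i\<in>I. x i \<oplus>\<^bsub>M i\<^esub> y i),
      smult = (\<lambda>a x. \<lambda>i\<in>I. a \<odot>\<^bsub>M i\<^esub> x i),
      gr = (\<lambda>n. {x \<in> C. \<forall>i\<in>I. x i \<in> gr (M i) n}),
      dif = (\<lambda>x. \<lambda>i\<in>I. dif (M i) (x i))\<rparr>)"

definition dsum_inj :: "'i set \<Rightarrow> ('i \<Rightarrow> ('a, 'm) dg) \<Rightarrow> 'i \<Rightarrow> 'm \<Rightarrow> 'i \<Rightarrow> 'm" where
  "dsum_inj I M i x = (\<lambda>j\<in>I. if j = i then x else \<zero>\<^bsub>M j\<^esub>)"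

text \<open>
  The canonical map $\bigoplus_i \mathrm{Ext}_A(X, M_i) \to \mathrm{Ext}_A(X, \bigoplus_i M_i)$, where
  \<open>P\<close> is a semifree resolution of \<open>X\<close>.
\<close>

definition ext_dsum_map ::
  "('k, 'a) dg \<Rightarrow> ('a, 'p) dg \<Rightarrow> 'i set \<Rightarrow> ('i \<Rightarrow> ('a, 'm) dg)
    \<Rightarrow> ('i \<Rightarrow> ('p \<Rightarrow> 'm) set) \<Rightarrow> ('p \<Rightarrow> 'i \<Rightarrow> 'm) set" where
  "ext_dsum_map A P I M \<phi> =
     (\<Oplus>\<^bsub>ext_dg A P (dsum I M)\<^esub>i\<in>{i\<in>I. \<phi> i \<noteq> \<zero>\<^bsub>ext_dg A P (M i)\<^esub>}.
        cohom_map (hom_dg A P (dsum I M)) (compose (carrier P) (dsum_inj I M i)) (\<phi> i))"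

text \<open>
  \<open>X\<close> is compact if the functor of derived Hom out of \<open>X\<close> commutes with direct sums.
  HOL cannot quantify over all small families of DG modules, so the quantifier is bounded by an
  infinite type \<open>'u\<close> playing the role of the universe: families are indexed by subsets of \<open>'u\<close>, and the
  modules live in \<open>'u \<Rightarrow> 'a\<close>.  Up to isomorphism that type contains every DG \<open>A\<close>-module with a generating
  set no larger than \<open>'u\<close>: choose representatives in the free module of finitely supported functions.
  An object that is compact in the unbounded sense satisfies this for every \<open>'u\<close>; as for
  \<open>koszul_dg_algebra\<close>, the type of the resolution \<open>P\<close> is a parameter.
\<close>

definition compact_object ::
  "'u::infinite itself \<Rightarrow> 'p itself \<Rightarrow> ('k, 'a) dg \<Rightarrow> ('a, 'x) dg \<Rightarrow> bool" where
  "compact_object _ _ A X \<longleftrightarrow>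
     (\<exists>(P :: ('a, 'p) dg) \<epsilon>. semifree_resolution A X P \<epsilon> \<and>
        (\<forall>(I :: 'u set) (M :: 'u \<Rightarrow> ('a, 'u \<Rightarrow> 'a) dg).
           (\<forall>i\<in>I. left_dg_module A (M i)) \<longrightarrow>
           bij_betw (ext_dsum_map A P I M)
             (gr (dsum I (\<lambda>i. ext_dg A P (M i))) 0)
             (gr (ext_dg A P (dsum I M)) 0)))"


section \<open>The Yoneda algebra of the trivial module of an ordinary algebra\<close>

definition left_ideal :: "'a set \<Rightarrow> ('a, 'c) ring_scheme \<Rightarrow> bool" where
  "left_ideal I R \<longleftrightarrow>
     additive_subgroup I R \<and> (\<forall>r\<in>carrier R. \<forall>x\<in>I. r \<otimes>\<^bsub>R\<^esub> x \<in> I)"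

definition maximal_left_ideal :: "'a set \<Rightarrow> ('a, 'c) ring_scheme \<Rightarrow> bool" where
  "maximal_left_ideal I R \<longleftrightarrow>
     left_ideal I R \<and> I \<noteq> carrier R \<and>
     (\<forall>J. left_ideal J R \<and> I \<subseteq> J \<longrightarrow> J = I \<or> J = carrier R)"

definition jacobson_radical :: "('a, 'c) ring_scheme \<Rightarrow> 'a set" where
  "jacobson_radical R = carrier R \<inter> \<Inter>{I. maximal_left_ideal I R}"

text \<open>An algebra with its grading forgotten, seen as a DG algebra sitting in degree 0.\<close>

definition ungraded :: "('k, 'a) dg \<Rightarrow> ('k, 'a) dg" where
  "ungraded E = E\<lparr>gr := (\<lambda>n. if n = 0 then carrier E else {\<zero>\<^bsub>E\<^esub>}), dif := (\<lambda>_. \<zero>\<^bsub>E\<^esub>)\<rparr>"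

definition residue_module :: "('k, 'a) dg \<Rightarrow> ('a, 'a set) dg" where
  "residue_module E = subquot (regular E) (carrier E) (jacobson_radical E)"

definition linear_maps ::
  "('k, 'a) dg \<Rightarrow> ('a, 'm) dg \<Rightarrow> ('a, 'n) dg \<Rightarrow> ('m \<Rightarrow> 'n) set" where
  "linear_maps R M N =
     {f \<in> carrier M \<rightarrow> carrier N.
        (\<forall>x\<in>carrier M. \<forall>y\<in>carrier M. f (x \<oplus>\<^bsub>M\<^esub> y) = f x \<oplus>\<^bsub>N\<^esub> f y) \<and>
        (\<forall>a\<in>carrier R. \<forall>x\<in>carrier M. f (a \<odot>\<^bsub>M\<^esub> x) = a \<odot>\<^bsub>N\<^esub> f x)}"

text \<open>
  Projective means direct summand of a free module $R^{(S)}$; index sets \<open>S\<close> inside the type of \<open>M\<close>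
  suffice, since \<open>M\<close> is generated by its elements.
\<close>

definition projective_module :: "('k, 'a) dg \<Rightarrow> ('a, 'm) dg \<Rightarrow> bool" where
  "projective_module R M \<longleftrightarrow>
     (\<exists>(S :: 'm set) s r.
        s \<in> linear_maps R M (dsum S (\<lambda>_. regular R)) \<and>
        r \<in> linear_maps R (dsum S (\<lambda>_. regular R)) M \<and>
        (\<forall>x\<in>carrier M. r (s x) = x))"

text \<open>
  For \<open>R\<close> in degree 0, a left DG module over \<open>R\<close> is a cochain complex of \<open>R\<close>-modules; a projective
  resolution $\cdots \to Q^{-1} \to Q^0 \to N$ is cohomologically indexed.  The cohomology of its
  endomorphism complex is then the Yoneda algebra: \<open>ext_algebra R Q\<close> is $\mathrm{Ext}^*_R(N,N)$.
\<close>

definition projective_resolution ::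
  "('k, 'a) dg \<Rightarrow> ('a, 'n) dg \<Rightarrow> ('a, 'q) dg \<Rightarrow> ('q \<Rightarrow> 'n) \<Rightarrow> bool" where
  "projective_resolution R N Q \<eta> \<longleftrightarrow>
     left_dg_module R Q \<and>
     (\<forall>i>0. gr Q i = {\<zero>\<^bsub>Q\<^esub>}) \<and>
     (\<forall>i. projective_module R (Q\<lparr>carrier := gr Q i\<rparr>)) \<and>
     quasi_iso R Q N \<eta>"


section \<open>Isomorphism of graded algebras\<close>

definition graded_algebra_isomorphic ::
  "('k, 'c) ring_scheme \<Rightarrow> ('k, 'a) dg \<Rightarrow> ('k, 'b) dg \<Rightarrow> bool" where
  "graded_algebra_isomorphic K X Y \<longleftrightarrow>
     (\<exists>\<phi>\<in>ring_iso X Y.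
        (\<forall>c\<in>carrier K. \<forall>x\<in>carrier X. \<phi> (c \<odot>\<^bsub>X\<^esub> x) = c \<odot>\<^bsub>Y\<^esub> \<phi> x) \<and>
        (\<forall>n. \<phi> ` gr X n = gr Y n))"

end

theory Submission
  imports Defs
begin

text \<open>
  Let \<open>L\<close> be the minimal semifree resolution of the trivial module with a basis \<open>B\<close> in degree \<open>0\<close>, let \<open>e\<close>
  be its augmentation and \<open>w\<close> a cocycle in degree \<open>0\<close> with \<open>e w = 1\<close>.  The idea is that \<open>L\<close> is at the
  same time an injective resolution of the trivial module over the Ext-algebra \<open>E\<close>.

  As \<open>L\<close> has no nonzero endomorphisms of degree \<open>-1\<close>, homotopic chain endomorphisms of \<open>L\<close> are equal, so
  that \<open>E\<close> acts on \<open>L\<close> itself, faithfully and by all \<open>A\<close>-linear chain endomorphisms (locale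
  \<open>koszul_transfer\<close>).  Compactness forces \<open>B\<close> to be finite (\<open>finite_basis\<close>): an infinite basis would
  give a map into an infinite direct sum of copies of the ground field that meets infinitely many
  summands.  A chain endomorphism is determined by its composition with \<open>e\<close> on \<open>B\<close>, which can be
  prescribed at will (\<open>lift_functional\<close>).  So \<open>E\<close> is the dual of the span of \<open>B\<close>, linear maps from an
  \<open>E\<close>-module to \<open>L\<close> are the same as maps to \<open>A\<close> that are linear over the field, and \<open>L\<close> consists of injective
  \<open>E\<close>-modules (\<open>injective_extension\<close>).  The radical of \<open>E\<close> is the annihilator of \<open>w\<close>
  (\<open>jacobson_radical_eq\<close>), and what the radical annihilates in \<open>L\<close> is \<open>A w\<close>, a copy of \<open>A\<close> (\<open>socle\<close>).

  Now let \<open>Q\<close> be a projective resolution of the trivial \<open>E\<close>-module, and let \<open>aug\<close> be the map from \<open>Q\<close> to \<open>L\<close> that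
  covers the embedding of the trivial module as the line through \<open>w\<close>.  In
  \[ \mathrm{End}_E(Q) \to \mathrm{Hom}_E(Q,L) \leftarrow A, \quad g \mapsto \mathrm{aug} \circ g, \quad a \mapsto a \cdot \mathrm{aug} \]
  the first map is a quasi-isomorphism because \<open>Q\<close> is projective and bounded above
  (\<open>hom_quasi_iso\<close>), and the second one because \<open>L\<close> is injective and bounded below
  (\<open>hom_into_dual\<close>).  Neither the middle term nor the first arrow is multiplicative, but the relation
  that \<open>aug \<circ> g\<close> is homotopic to \<open>a \<cdot> aug\<close> is: the actions of \<open>A\<close> and \<open>E\<close> on \<open>L\<close> commute.  A relation between
  cocycles that is total, onto, compatible with the operations and respects coboundaries in both
  directions induces an isomorphism of cohomology algebras (locale \<open>graded_correspondence\<close>).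
\<close>

text \<open>Notation: an operation of the structure \<open>M\<close> is written with the subscript \<open>M\<close> also without
  the usual brackets, and \<open>x \<in>: M\<close> is membership in the carrier.\<close>

syntax "_index" :: "id \<Rightarrow> index" ("\<^sub>_")
syntax "_index" :: "longid \<Rightarrow> index" ("\<^sub>_")

abbreviation (input) elem :: "'b \<Rightarrow> ('b, 'c) partial_object_scheme \<Rightarrow> bool" (infix "\<in>:" 50) where
  "x \<in>: M \<equiv> x \<in> carrier M"

lemmas (in abelian_group) is_ab = abelian_group_axioms
lemmas (in left_dg_module) is_dgm = left_dg_module_axioms


section \<open>Additive maps and graded groups\<close>

lemma (in abelian_group) sgn_closed [simp]: "x \<in>: G ==> sgn_pow G n x \<in>: G"
 by (simp add: sgn_pow_def)

lemma (in abelian_group) inv_zero [simp]: "\<ominus> \<zero> = \<zero>"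
 using minus_equality l_zero zero_closed by blast

lemma (in abelian_group) sgn_zero [simp]: "sgn_pow G n \<zero> = \<zero>"
 by (simp add: sgn_pow_def)

lemma (in abelian_group) sgn_add:
 "x \<in>: G ==> y \<in>: G ==> sgn_pow G n (x \<oplus> y) = sgn_pow G n x \<oplus> sgn_pow G n y"
 by (simp add: sgn_pow_def minus_add)

lemma (in abelian_group) sgn_sgn [simp]:
 "x \<in>: G ==> sgn_pow G m (sgn_pow G n x) = sgn_pow G (m + n) x"
 by (simp add: sgn_pow_def)

lemma (in abelian_group) sgn_even [simp]: "even n ==> sgn_pow G n x = x"
 by (simp add: sgn_pow_def)

lemma (in abelian_group) sgn_odd: "odd n ==> sgn_pow G n x = \<ominus> x"
 by (simp add: sgn_pow_def)

lemma (in abelian_group) sgn_neg: "x \<in>: G ==> sgn_pow G n (\<ominus> x) = \<ominus> sgn_pow G n x"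
 by (simp add: sgn_pow_def)

lemma (in abelian_group) minus_zero_iff:
 "x \<in>: G ==> y \<in>: G ==> x \<ominus> y = \<zero> \<longleftrightarrow> x = y"
 by (metis a_minus_def a_inv_closed minus_equality minus_minus r_neg)

lemma (in abelian_group) minus_cancel:
 "x \<in>: G ==> y \<in>: G ==> (x \<ominus> y) \<oplus> y = x"
 by (simp add: a_minus_def a_assoc l_neg)

lemma (in abelian_group) add_minus_cancel:
 "x \<in>: G ==> y \<in>: G ==> (x \<oplus> y) \<ominus> y = x"
 by (simp add: a_minus_def a_assoc r_neg)

lemma (in abelian_group) add_subgroupI:
 assumes "H \<subseteq> carrier G" "\<zero> \<in> H" "!!a. a \<in> H ==> \<ominus> a \<in> H"
  "!!a b. a \<in> H ==> b \<in> H ==> a \<oplus> b \<in> H"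
 shows "subgroup H (add_monoid G)"
 using assms by (auto simp: subgroup_def a_inv_def)

definition additive_map :: "('b, 'c) ring_scheme => ('d, 'e) ring_scheme => ('b => 'd) => bool" where
 "additive_map G H f \<longleftrightarrow>
  f \<in> carrier G \<rightarrow> carrier H \<and>
  (\<forall>x\<in>carrier G. \<forall>y\<in>carrier G. f (x \<oplus>\<^sub>G y) = f x \<oplus>\<^sub>H f y)"

lemma additive_mapI:
 assumes "!!x. x \<in>: G ==> f x \<in>: H"
  and "!!x y. x \<in>: G ==> y \<in>: G ==> f (x \<oplus>\<^sub>G y) = f x \<oplus>\<^sub>H f y"
 shows "additive_map G H f"
 using assms by (auto simp: additive_map_def)

lemma additive_map_closed: "additive_map G H f ==> x \<in>: G ==> f x \<in>: H"
 by (auto simp: additive_map_def)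

lemma additive_map_add:
 "additive_map G H f ==> x \<in>: G ==> y \<in>: G ==> f (x \<oplus>\<^sub>G y) = f x \<oplus>\<^sub>H f y"
 by (auto simp: additive_map_def)

lemma additive_map_hom:
 assumes "abelian_group G" "abelian_group H" "additive_map G H f"
 shows "abelian_group_hom G H f"
proof -
 interpret G: abelian_group G by fact
 interpret H: abelian_group H by fact
 show ?thesis
  by (intro abelian_group_homI G.is_ab H.is_ab)
   (use assms in \<open>auto simp: additive_map_def group_hom_def group_hom_axioms_def hom_def
     intro: G.a_group H.a_group\<close>)
qed

lemma additive_map_zero:
 assumes "abelian_group G" "abelian_group H" "additive_map G H f"
 shows "f \<zero>\<^sub>G = \<zero>\<^sub>H"
 using abelian_group_hom.hom_zero[OF additive_map_hom[OF assms]] .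

lemma additive_map_inv:
 assumes "abelian_group G" "abelian_group H" "additive_map G H f" "x \<in>: G"
 shows "f (\<ominus>\<^sub>G x) = \<ominus>\<^sub>H f x"
 using abelian_group_hom.hom_a_inv[OF additive_map_hom[OF assms(1-3)]] assms(4) .

lemma additive_map_minus:
 assumes "abelian_group G" "abelian_group H" "additive_map G H f" "x \<in>: G" "y \<in>: G"
 shows "f (x \<ominus>\<^sub>G y) = f x \<ominus>\<^sub>H f y"
 using assms by (simp add: a_minus_def additive_map_add additive_map_inv abelian_group.a_inv_closed)

lemma additive_map_sgn:
 assumes "abelian_group G" "abelian_group H" "additive_map G H f" "x \<in>: G"
 shows "f (sgn_pow G n x) = sgn_pow H n (f x)"
 using assms by (simp add: sgn_pow_def additive_map_inv)

lemma additive_map_finsum: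
 assumes "abelian_group G" "abelian_group H" "additive_map G H f"
  and "!!i. i \<in> S ==> g i \<in>: G"
 shows "f (\<Oplus>\<^sub>G i\<in>S. g i) = (\<Oplus>\<^sub>H i\<in>S. f (g i))"
proof -
 interpret G: abelian_group G by fact
 interpret H: abelian_group H by fact
 note f = additive_map_closed[OF assms(3)] additive_map_add[OF assms(3)]
 show ?thesis using assms(4)
 proof (induction S rule: infinite_finite_induct)
  case (infinite A)
  thus ?case by (simp add: additive_map_zero[OF assms(1-3)])
 next
  case empty
  thus ?case by (simp add: additive_map_zero[OF assms(1-3)])
 next
  case (insert x F)
  have g: "g \<in> F \<rightarrow> carrier G" "g x \<in>: G" using insert by auto
  hence "(%i. f (g i)) \<in> F \<rightarrow> carrier H" using f by auto
  with g insert show ?case by (simp add: f)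
 qed
qed

lemma finsum_cong_structure:
 assumes "carrier G = carrier H" "add G = add H" "zero G = zero H"
 shows "finsum G f S = finsum H f S"
 using assms by (simp add: finsum_def finprod_def)

lemma abelian_group_cong_structure:
 assumes "abelian_group G" "carrier G = carrier H" "add G = add H" "zero G = zero H"
 shows "abelian_group H"
 using abelian_groupE[OF assms(1)] assms(2-4) by (intro abelian_groupI) auto

lemma a_inv_cong_structure:
 assumes "carrier G = carrier H" "add G = add H" "zero G = zero H"
 shows "\<ominus>\<^sub>G x = \<ominus>\<^sub>H x"
 using assms by (simp add: a_inv_def m_inv_def)

lemma sgn_cong_structure:
 assumes "carrier G = carrier H" "add G = add H" "zero G = zero H"
 shows "sgn_pow G n x = sgn_pow H n x"
 using a_inv_cong_structure[OF assms] by (simp add: sgn_pow_def)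

lemma a_minus_cong_structure:
 assumes "carrier G = carrier H" "add G = add H" "zero G = zero H"
 shows "x \<ominus>\<^sub>G y = x \<ominus>\<^sub>H y"
 using a_inv_cong_structure[OF assms] assms by (simp add: a_minus_def)

lemma graded_by_cong_structure:
 assumes "graded_by G V" "abelian_group H" "carrier G = carrier H" "add G = add H" "zero G = zero H"
 shows "graded_by H V"
proof -
 interpret H: abelian_group H by fact
 have 1: "is_decomp H V = is_decomp G V"
  using assms(3-5) by (auto simp: is_decomp_def fun_eq_iff finsum_cong_structure[OF assms(3-5)])
 have "subgroup (V n) (add_monoid H)" for n
  using assms(1,3-5) a_inv_cong_structure[OF assms(3-5)] unfolding graded_by_def subgroup_def a_inv_def
  by fastforce
 thus ?thesis using assms(1,3) unfolding graded_by_def 1 by auto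
qed

lemma (in abelian_group) finsum_superset:
 assumes "finite B" "A \<subseteq> B" "!!i. i \<in> B - A ==> h i = \<zero>" "!!i. i \<in> B ==> h i \<in>: G"
 shows "(\<Oplus>i\<in>A. h i) = (\<Oplus>i\<in>B. h i)"
 by (rule add.finprod_mono_neutral_cong_left) (use assms in auto)

lemma (in abelian_group) finsum_delta:
 assumes "finite S" "x \<in>: G"
 shows "(\<Oplus>i\<in>S. if i = j then x else \<zero>) = (if j \<in> S then x else \<zero>)"
proof (cases "j \<in> S")
 case True
 have "(\<Oplus>i\<in>{j}. if i = j then x else \<zero>) = (\<Oplus>i\<in>S. if i = j then x else \<zero>)"
  by (rule finsum_superset) (use assms True in auto)
 with True assms show ?thesis by simp
next
 case False
 thus ?thesis by (intro trans[OF add.finprod_one_eqI]) auto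
qed

locale graded_group = abelian_group G for G (structure) +
 fixes V :: "int => 'a set"
 assumes graded: "graded_by G V"
begin

abbreviation comp :: "'a => int => 'a" where "comp \<equiv> hcomp G V"

lemma V_subgroup: "subgroup (V n) (add_monoid G)"
 using graded by (simp add: graded_by_def)

lemma V_closed [simp]: "x \<in> V n ==> x \<in>: G"
 using subgroup.subset[OF V_subgroup] by auto

lemma V_zero [simp]: "\<zero> \<in> V n"
 using subgroup.one_closed[OF V_subgroup] by simp

lemma V_add [simp]: "x \<in> V n ==> y \<in> V n ==> x \<oplus> y \<in> V n"
 using subgroup.m_closed[OF V_subgroup] by simp

lemma V_inv [simp]: "x \<in> V n ==> \<ominus> x \<in> V n"
 using subgroup.m_inv_closed[OF V_subgroup] by (simp add: a_inv_def)

lemma V_minus [simp]: "x \<in> V n ==> y \<in> V n ==> x \<ominus> y \<in> V n"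
 by (simp add: a_minus_def)

lemma V_sgn [simp]: "x \<in> V n ==> sgn_pow G m x \<in> V n"
 by (simp add: sgn_pow_def)

lemma V_finsum: "(!!i. i \<in> S ==> f i \<in> V n) ==> (\<Oplus>i\<in>S. f i) \<in> V n"
proof (induction S rule: infinite_finite_induct)
 case (insert x F)
 have "f i \<in>: G" if "i \<in> insert x F" for i using V_closed[OF insert.prems[OF that]] .
 hence "f \<in> F \<rightarrow> carrier G" "f x \<in>: G" by auto
 with insert show ?case by simp
qed auto

lemma is_decomp_comp: "x \<in>: G ==> is_decomp G V x (comp x)"
 using graded unfolding graded_by_def hcomp_def by (metis (mono_tags, lifting) theI')

lemma comp_eqI: "x \<in>: G ==> is_decomp G V x c ==> comp x = c"
 using graded is_decomp_comp unfolding graded_by_def by blast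

lemma comp_V [simp]: "x \<in>: G ==> comp x n \<in> V n"
 using is_decomp_comp by (auto simp: is_decomp_def)

lemma comp_closed [simp]: "x \<in>: G ==> comp x n \<in>: G"
 using comp_V V_closed by blast

lemma finite_comp: "x \<in>: G ==> finite {n. comp x n ~= \<zero>}"
 using is_decomp_comp by (auto simp: is_decomp_def)

lemma sum_comp: "x \<in>: G ==> (\<Oplus>n\<in>{n. comp x n ~= \<zero>}. comp x n) = x"
 using is_decomp_comp by (auto simp: is_decomp_def)

lemma sum_comp_superset:
 assumes "x \<in>: G" "finite S" "{n. comp x n ~= \<zero>} \<subseteq> S"
 shows "(\<Oplus>n\<in>S. comp x n) = x"
 using finsum_superset[OF assms(2,3), of "comp x"] assms(1) sum_comp by auto

lemma is_decompI:
 assumes "!!n. c n \<in> V n" "finite S" "!!n. n \<notin> S ==> c n = \<zero>" "x = (\<Oplus>n\<in>S. c n)"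
 shows "is_decomp G V x c"
proof -
 have sub: "{n. c n ~= \<zero>} \<subseteq> S" using assms(3) by auto
 have "(\<Oplus>n\<in>{n. c n ~= \<zero>}. c n) = (\<Oplus>n\<in>S. c n)"
  by (rule finsum_superset) (use assms sub in \<open>auto intro: V_closed\<close>)
 thus ?thesis using assms finite_subset[OF sub] by (auto simp: is_decomp_def)
qed

lemma comp_V_eq:
 assumes "x \<in> V n"
 shows "comp x m = (if m = n then x else \<zero>)"
proof -
 have "is_decomp G V x (%m. if m = n then x else \<zero>)"
  using assms by (intro is_decompI[where S = "{n}"]) auto
 hence "comp x = (%m. if m = n then x else \<zero>)" using assms by (intro comp_eqI) auto
 thus ?thesis by (rule fun_cong)
qed

lemma comp_same [simp]: "x \<in> V n ==> comp x n = x"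
 by (simp add: comp_V_eq)

lemma comp_zero [simp]: "comp \<zero> n = \<zero>"
 using comp_V_eq[OF V_zero] by simp

lemma V_disjoint: "x \<in> V m ==> x \<in> V n ==> m ~= n ==> x = \<zero>"
 using comp_V_eq[of x m m] comp_V_eq[of x n m] by simp

lemma comp_add:
 assumes "x \<in>: G" "y \<in>: G"
 shows "comp (x \<oplus> y) n = comp x n \<oplus> comp y n"
proof -
 let ?S = "{n. comp x n ~= \<zero>} \<union> {n. comp y n ~= \<zero>}"
 have S: "finite ?S" using assms finite_comp by simp
 have "x \<oplus> y = (\<Oplus>n\<in>?S. comp x n) \<oplus> (\<Oplus>n\<in>?S. comp y n)"
  using sum_comp_superset[OF _ S] assms by simp
 also have "... = (\<Oplus>n\<in>?S. comp x n \<oplus> comp y n)"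
  using assms by (intro finsum_addf[symmetric]) auto
 finally have "is_decomp G V (x \<oplus> y) (%n. comp x n \<oplus> comp y n)"
  using assms S by (intro is_decompI[where S = ?S]) auto
 hence "comp (x \<oplus> y) = (%n. comp x n \<oplus> comp y n)" using assms by (intro comp_eqI) auto
 thus ?thesis by (rule fun_cong)
qed

lemma comp_additive: "additive_map G G (%x. comp x n)"
 by (rule additive_mapI) (auto simp: comp_add)

lemma comp_minus: "x \<in>: G ==> y \<in>: G ==> comp (x \<ominus> y) n = comp x n \<ominus> comp y n"
 using additive_map_minus[OF is_ab is_ab comp_additive] .

lemma comp_eq_zeroI: "x \<in>: G ==> (!!n. comp x n = \<zero>) ==> x = \<zero>"
 using sum_comp[of x] add.finprod_one_eqI[of "{n. comp x n ~= \<zero>}" "comp x"] unfolding finsum_def by metis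

lemma finsum_induct_closed:
 assumes "!!i. i \<in> S ==> P (f i)" "!!i. i \<in> S ==> f i \<in>: G" "P \<zero>"
  "!!x y. x \<in>: G ==> y \<in>: G ==> P x ==> P y ==> P (x \<oplus> y)"
 shows "P (\<Oplus>i\<in>S. f i)"
 using assms(1,2)
proof (induction S rule: infinite_finite_induct)
 case (insert x F)
 hence "f \<in> F \<rightarrow> carrier G" "f x \<in>: G" by auto
 with insert show ?case by (auto intro!: assms(4))
qed (use assms in auto)

lemma graded_induct [consumes 1, case_names homogeneous add]:
 assumes "x \<in>: G"
  and hom: "!!n x. x \<in> V n ==> P x"
  and add: "!!x y. x \<in>: G ==> y \<in>: G ==> P x ==> P y ==> P (x \<oplus> y)"
 shows "P x"
proof -
 have "P (\<Oplus>n\<in>{n. comp x n ~= \<zero>}. comp x n)"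
  by (rule finsum_induct_closed) (use hom[OF comp_V[OF assms(1)]] hom[OF V_zero] add assms(1) in auto)
 thus ?thesis using sum_comp assms by simp
qed

end

lemma comp_additive_map:
 assumes "graded_group G V" "graded_group H W" "additive_map G H f"
  and deg: "!!n x. x \<in> V n ==> f x \<in> W (n + k)" and x: "x \<in>: G"
 shows "hcomp H W (f x) (n + k) = f (hcomp G V x n)"
proof -
 interpret G: graded_group G V by fact
 interpret H: graded_group H W by fact
 note f = additive_map_closed[OF assms(3)] additive_map_add[OF assms(3)]
 have f0: "f \<zero>\<^sub>G = \<zero>\<^sub>H"
  using additive_map_zero G.is_ab H.is_ab assms(3) by blast
 show ?thesis using x
 proof (induction rule: G.graded_induct)
  case (homogeneous m x)
  show ?case
   using G.comp_V_eq[OF homogeneous, of n] H.comp_V_eq[OF deg[OF homogeneous], of "n + k"] f0 by simp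
 next
  case (add x y)
  thus ?case by (simp add: f G.comp_add H.comp_add)
 qed
qed

text \<open>A grading can be read off from projections: additive maps that are the identity on one degree
 and zero on the others.\<close>

lemma graded_byI:
 assumes G: "abelian_group G"
  and sub: "!!n. subgroup (V n) (add_monoid G)"
  and p: "!!n. additive_map G G (p n)"
  and pV: "!!m n x. x \<in> V m ==> p n x = (if n = m then x else \<zero>\<^sub>G)"
  and ex: "!!x. x \<in>: G ==> \<exists>c. is_decomp G V x c"
 shows "graded_by G V"
proof -
 interpret G: abelian_group G by fact
 have V: "x \<in>: G" if "x \<in> V n" for n x using subgroup.mem_carrier[OF sub that] by simp
 have "c = (%n. p n x)" if x: "x \<in>: G" and c: "is_decomp G V x c" for x c
 proof
  fix n
  let ?S = "{n. c n ~= \<zero>\<^sub>G}"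
  have cV: "c n \<in> V n" "finite ?S" "x = (\<Oplus>\<^sub>G n\<in>?S. c n)" for n
   using c by (auto simp: is_decomp_def)
  have "p n x = (\<Oplus>\<^sub>G m\<in>?S. p n (c m))"
   using additive_map_finsum[OF G G p, of ?S c n] cV V by auto
  also have "... = (\<Oplus>\<^sub>G m\<in>?S. if m = n then c n else \<zero>\<^sub>G)"
   using pV[OF cV(1)] V[OF cV(1)] by (intro G.finsum_cong') (auto split: if_splits)
  also have "... = c n"
   using G.finsum_delta[OF cV(2) V[OF cV(1)]] by auto
  finally show "c n = p n x" by simp
 qed
 thus ?thesis using sub ex unfolding graded_by_def by metis
qed

section \<open>Cochain complexes and their subquotients\<close>

locale cochain_complex = abelian_group M for M :: "('a, 'm) dg" (structure) +
 assumes graded: "graded_by M (gr M)"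
  and dif_gr: "x \<in> gr M n ==> dif M x \<in> gr M (n + 1)"
  and dif_add:
   "\<lbrakk>x \<in>: M; y \<in> carrier M\<rbrakk> \<Longrightarrow> dif M (x \<oplus> y) = dif M x \<oplus> dif M y"
  and dif_dif: "x \<in>: M ==> dif M (dif M x) = \<zero>"
begin

lemmas is_cpx = cochain_complex_axioms

sublocale graded_group M "gr M"
 by unfold_locales (rule graded)

lemma dif_closed [simp]: "x \<in>: M ==> dif M x \<in>: M"
proof (induction rule: graded_induct)
 case (homogeneous n x)
 thus ?case using V_closed[OF dif_gr] by blast
qed (simp add: dif_add)

lemma dif_additive: "additive_map M M (dif M)"
 by (rule additive_mapI) (auto simp: dif_add)

lemma dif_zero [simp]: "dif M \<zero> = \<zero>"
 by (rule additive_map_zero[OF is_ab is_ab dif_additive])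

lemma dif_inv: "x \<in>: M ==> dif M (\<ominus> x) = \<ominus> dif M x"
 by (rule additive_map_inv[OF is_ab is_ab dif_additive])

lemma dif_minus:
 "x \<in>: M ==> y \<in>: M ==> dif M (x \<ominus> y) = dif M x \<ominus> dif M y"
 by (rule additive_map_minus[OF is_ab is_ab dif_additive])

lemma dif_sgn: "x \<in>: M ==> dif M (sgn_pow M n x) = sgn_pow M n (dif M x)"
 by (rule additive_map_sgn[OF is_ab is_ab dif_additive])

lemma comp_dif: "x \<in>: M ==> comp (dif M x) (n + 1) = dif M (comp x n)"
 by (rule comp_additive_map[OF graded_group_axioms graded_group_axioms dif_additive])
  (auto intro: dif_gr)

lemma comp_dif': "x \<in>: M ==> comp (dif M x) n = dif M (comp x (n - 1))"
 using comp_dif[of x "n - 1"] by simp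

lemma cocycles_subgroup: "additive_subgroup (cocycles M) M"
 by (rule additive_subgroupI, rule add_subgroupI) (auto simp: cocycles_def dif_add dif_inv)

lemma coboundaries_subgroup: "additive_subgroup (coboundaries M) M"
proof (rule additive_subgroupI, rule add_subgroupI)
 show "\<ominus> a \<in> coboundaries M" if "a \<in> coboundaries M" for a
  using that dif_inv[symmetric] by (auto simp: coboundaries_def)
 show "a \<oplus> b \<in> coboundaries M" if "a \<in> coboundaries M" "b \<in> coboundaries M" for a b
  using that dif_add[symmetric] by (auto simp: coboundaries_def)
qed (use dif_zero zero_closed in \<open>force simp: coboundaries_def\<close>)+

lemma coboundaries_le_cocycles: "coboundaries M \<subseteq> cocycles M"
 by (auto simp: coboundaries_def cocycles_def dif_dif)

lemma comp_cocycle: "x \<in> cocycles M ==> comp x n \<in> cocycles M"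
 using comp_dif[of x n] by (auto simp: cocycles_def)

lemma comp_coboundary:
 assumes "x \<in> coboundaries M"
 shows "\<exists>y\<in>gr M (n - 1). dif M y = comp x n"
proof -
 obtain y where "y \<in>: M" "x = dif M y" using assms by (auto simp: coboundaries_def)
 thus ?thesis using comp_dif' by (intro bexI[of _ "comp y (n - 1)"]) auto
qed

lemma homogeneous_coboundary:
 assumes "x \<in> coboundaries M" "x \<in> gr M n"
 shows "\<exists>y\<in>gr M (n - 1). dif M y = x"
 using comp_coboundary[OF assms(1), of n] assms(2) by simp

lemma coboundary_comp_iff:
 assumes "x \<in>: M"
 shows "x \<in> coboundaries M \<longleftrightarrow> (\<forall>n. comp x n \<in> coboundaries M)"
proof
 show "\<forall>n. comp x n \<in> coboundaries M" if "x \<in> coboundaries M"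
 proof
  fix n
  obtain y where "y \<in> gr M (n - 1)" "dif M y = comp x n" using comp_coboundary[OF \<open>x \<in> coboundaries M\<close>] by blast
  thus "comp x n \<in> coboundaries M" unfolding coboundaries_def by (metis V_closed imageI)
 qed
next
 interpret B: additive_subgroup "coboundaries M" M by (rule coboundaries_subgroup)
 assume *: "\<forall>n. comp x n \<in> coboundaries M"
 have "(\<Oplus>n\<in>{n. comp x n ~= \<zero>}. comp x n) \<in> coboundaries M"
  by (rule finsum_induct_closed[where P = "%x. x \<in> coboundaries M"]) (use * assms in auto)
 thus "x \<in> coboundaries M" using sum_comp[OF assms] by simp
qed

end

text \<open>A homogeneous subquotient of a complex is again a complex; this covers the cohomology
 and the trivial and residue modules alike.\<close>

locale subquotient = cochain_complex M for M :: "('a, 'm) dg" (structure) +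
 fixes Z B
 assumes Z_subgroup: "additive_subgroup Z M" and B_subgroup: "additive_subgroup B M"
  and B_le_Z: "B \<subseteq> Z"
  and Z_comp: "x \<in> Z ==> comp x n \<in> Z" and B_comp: "x \<in> B ==> comp x n \<in> B"
  and Z_dif: "x \<in> Z ==> dif M x \<in> Z" and B_dif: "x \<in> B ==> dif M x \<in> B"
begin

sublocale Z: additive_subgroup Z M by (rule Z_subgroup)

sublocale B: abelian_subgroup B M
 by (rule abelian_subgroupI3[OF B_subgroup is_ab])

abbreviation SQ where "SQ \<equiv> subquot M Z B"
abbreviation cls where "cls z \<equiv> B +> z"

lemma cls_self: "z \<in>: M ==> z \<in> cls z"
 by (rule B.a_rcos_self)

lemma cls_eq_iff: "z \<in>: M ==> z' \<in>: M ==> cls z = cls z' \<longleftrightarrow> z \<ominus> z' \<in> B"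
 by (metis B.a_rcos_module B.a_rcos_self B.a_repr_independence' a_minus_def)

lemma cls_memD: "x \<in> cls z ==> z \<in>: M ==> x \<in>: M \<and> cls x = cls z"
 by (metis B.a_repr_independence' B.a_elemrcos_carrier)

lemma cls_zero: "z \<in> B ==> cls z = B"
 by (simp add: B.a_rcos_const)

lemma cls_eq_zero_iff: "z \<in>: M ==> cls z = B \<longleftrightarrow> z \<in> B"
 using B.a_rcos_self B.a_rcos_const by auto

lemma cls_add: "z \<in>: M ==> z' \<in>: M ==> cls z <+> cls z' = cls (z \<oplus> z')"
 by (rule B.a_rcos_sum)

text \<open>How an operation that respects the cosets of \<open>B\<close> is computed on representatives.\<close>

lemma UN_cls:
 assumes "z \<in>: M" "!!x. x \<in> cls z ==> F x = F z"
 shows "(\<Union>x\<in>cls z. F x) = F z"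
 using assms cls_self[OF assms(1)] by blast

lemma UN_cls_additive:
 assumes z: "z \<in>: M" and f: "additive_map M M f" and fB: "!!b. b \<in> B ==> f b \<in> B"
 shows "(\<Union>x\<in>cls z. cls (f x)) = cls (f z)"
proof (rule UN_cls[OF z])
 fix x assume x: "x \<in> cls z"
 hence xc: "x \<in>: M" "cls x = cls z" using cls_memD[OF x z] by auto
 hence "x \<ominus> z \<in> B" using cls_eq_iff z by simp
 hence "f x \<ominus> f z \<in> B"
  using fB additive_map_minus[OF is_ab is_ab f xc(1) z] by metis
 thus "cls (f x) = cls (f z)"
  using cls_eq_iff xc z additive_map_closed[OF f] by simp
qed

lemma SQ_carrier: "carrier SQ = cls ` Z" by (simp add: subquot_def)
lemma SQ_zero: "\<zero>\<^sub>SQ = B" by (simp add: subquot_def)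
lemma SQ_gr: "gr SQ n = cls ` (Z \<inter> gr M n)" by (simp add: subquot_def)

lemma SQ_add: "z \<in>: M ==> z' \<in>: M ==> cls z \<oplus>\<^sub>SQ cls z' = cls (z \<oplus> z')"
 by (simp add: subquot_def cls_add)

lemma SQ_dif: "z \<in>: M ==> dif SQ (cls z) = cls (dif M z)"
 using UN_cls_additive[OF _ dif_additive B_dif] by (simp add: subquot_def)

lemma SQ_smult:
 assumes "z \<in>: M" "additive_map M M (%x. a \<odot> x)" "!!b. b \<in> B ==> a \<odot> b \<in> B"
 shows "a \<odot>\<^sub>SQ cls z = cls (a \<odot> z)"
 using UN_cls_additive[OF assms] by (simp add: subquot_def)

lemma SQ_abelian_group: "abelian_group SQ"
proof (rule abelian_groupI)
 show "\<exists>y\<in>carrier SQ. y \<oplus>\<^sub>SQ x = \<zero>\<^sub>SQ" if x: "x \<in>: SQ" for x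
 proof -
  obtain z where z: "z \<in> Z" "x = cls z" using x by (auto simp: SQ_carrier)
  hence "cls (\<ominus> z) \<oplus>\<^sub>SQ x = \<zero>\<^sub>SQ"
   by (simp add: SQ_add SQ_zero l_neg cls_zero)
  thus ?thesis using z SQ_carrier by auto
 qed
 show "\<zero>\<^sub>SQ \<in>: SQ"
  unfolding SQ_zero SQ_carrier using cls_zero[OF B.zero_closed] Z.zero_closed by (metis imageI)
 show "\<zero>\<^sub>SQ \<oplus>\<^sub>SQ x = x" if x: "x \<in>: SQ" for x
 proof -
  obtain z where z: "z \<in> Z" "x = cls z" using x by (auto simp: SQ_carrier)
  thus ?thesis using SQ_add[OF zero_closed, of z] cls_zero[OF B.zero_closed] by (simp add: SQ_zero)
 qed
qed (auto simp: SQ_carrier SQ_add a_ac)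

lemma SQ_finsum:
 assumes "!!i. i \<in> S ==> g i \<in> Z"
 shows "(\<Oplus>\<^sub>SQ i\<in>S. cls (g i)) = cls (\<Oplus>i\<in>S. g i)"
proof -
 interpret SQ: abelian_group SQ by (rule SQ_abelian_group)
 show ?thesis using assms
 proof (induction S rule: infinite_finite_induct)
  case (insert x F)
  have g: "g \<in> F \<rightarrow> carrier M" "g x \<in>: M"
   and cg: "(%i. cls (g i)) \<in> F \<rightarrow> carrier SQ" "cls (g x) \<in>: SQ"
   using insert.prems by (auto simp: SQ_carrier)
  have "(\<Oplus>\<^sub>SQ i\<in>insert x F. cls (g i)) = cls (g x) \<oplus>\<^sub>SQ cls (\<Oplus>i\<in>F. g i)"
   using insert cg by simp
  also have "... = cls (g x \<oplus> (\<Oplus>i\<in>F. g i))" using g by (intro SQ_add) auto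
  finally show ?case using insert g by simp
 qed (auto simp: SQ_zero cls_zero)
qed

lemma SQ_complex: "cochain_complex SQ"
proof -
 interpret SQ: abelian_group SQ by (rule SQ_abelian_group)
 have sub: "subgroup (gr SQ n) (add_monoid SQ)" for n
 proof (rule SQ.add_subgroupI)
  show "\<ominus>\<^sub>SQ a \<in> gr SQ n" if a: "a \<in> gr SQ n" for a
  proof -
   obtain z where z: "z \<in> Z" "z \<in> gr M n" "a = cls z" using a by (auto simp: SQ_gr)
   have "cls (\<ominus> z) \<oplus>\<^sub>SQ a = \<zero>\<^sub>SQ"
    using z by (simp add: SQ_add SQ_zero l_neg cls_zero)
   hence "\<ominus>\<^sub>SQ a = cls (\<ominus> z)"
    using z by (intro SQ.minus_equality) (auto simp: SQ_carrier)
   thus ?thesis using z by (auto simp: SQ_gr)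
  qed
  show "a \<oplus>\<^sub>SQ b \<in> gr SQ n" if ab: "a \<in> gr SQ n" "b \<in> gr SQ n" for a b
  proof -
   obtain z z' where z: "z \<in> Z" "z \<in> gr M n" "a = cls z" "z' \<in> Z" "z' \<in> gr M n" "b = cls z'"
    using ab by (auto simp: SQ_gr)
   thus ?thesis by (auto simp: SQ_add SQ_gr)
  qed
  show "\<zero>\<^sub>SQ \<in> gr SQ n"
   unfolding SQ_zero SQ_gr using cls_zero[OF B.zero_closed] Z.zero_closed V_zero by (metis IntI imageI)
 qed (auto simp: SQ_gr SQ_carrier)
 define p where "p n X = (\<Union>x\<in>X. cls (comp x n))" for n X
 have p: "p n (cls z) = cls (comp z n)" if "z \<in>: M" for z n
  unfolding p_def using UN_cls_additive[OF that comp_additive B_comp] .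
 have graded: "graded_by SQ (gr SQ)"
 proof (rule graded_byI[OF SQ_abelian_group sub])
  show "additive_map SQ SQ (p n)" for n
   by (rule additive_mapI) (auto simp: SQ_carrier p SQ_add comp_add Z_comp)
  show "p n x = (if n = m then x else \<zero>\<^sub>SQ)" if x: "x \<in> gr SQ m" for m n x
  proof -
   obtain z where z: "z \<in> Z" "z \<in> gr M m" "x = cls z" using x by (auto simp: SQ_gr)
   hence "p n x = cls (comp z n)" by (simp add: p)
   also have "... = (if n = m then x else B)"
    unfolding comp_V_eq[OF z(2)] z(3) using cls_zero[OF B.zero_closed] by (simp only: split: if_split) simp
   finally show ?thesis unfolding SQ_zero .
  qed
  show "\<exists>c. is_decomp SQ (gr SQ) x c" if x: "x \<in>: SQ" for x
  proof -
   obtain z where z: "z \<in> Z" "x = cls z" using x by (auto simp: SQ_carrier)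
   let ?S = "{n. comp z n ~= \<zero>}" and ?c = "%n. cls (comp z n)"
   have zc: "z \<in>: M" using z by simp
   have sub: "{n. ?c n ~= \<zero>\<^sub>SQ} \<subseteq> ?S"
    unfolding SQ_zero using cls_zero[OF B.zero_closed] by (metis (mono_tags, lifting) mem_Collect_eq subsetI)
   have cc: "?c n \<in>: SQ" for n using z Z_comp by (auto simp: SQ_carrier)
   have "(\<Oplus>\<^sub>SQ n\<in>{n. ?c n ~= \<zero>\<^sub>SQ}. ?c n) = (\<Oplus>\<^sub>SQ n\<in>?S. ?c n)"
    by (rule SQ.finsum_superset) (use sub cc finite_comp[OF zc] in auto)
   also have "... = x" using SQ_finsum[of ?S "comp z"] Z_comp z sum_comp[OF zc] by simp
   finally have "is_decomp SQ (gr SQ) x ?c"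
    using finite_subset[OF sub finite_comp[OF zc]] Z_comp z zc by (auto simp: is_decomp_def SQ_gr)
   thus ?thesis by blast
  qed
 qed
 show ?thesis
 proof (unfold_locales)
  show "graded_by SQ (gr SQ)" by (rule graded)
  show "dif SQ x \<in> gr SQ (n + 1)" if "x \<in> gr SQ n" for x n
   using that Z_dif dif_gr by (auto simp: SQ_gr SQ_dif)
  show "dif SQ (x \<oplus>\<^sub>SQ y) = dif SQ x \<oplus>\<^sub>SQ dif SQ y"
   if "x \<in>: SQ" "y \<in>: SQ" for x y
   using that by (auto simp: SQ_carrier SQ_add SQ_dif dif_add)
  show "dif SQ (dif SQ x) = \<zero>\<^sub>SQ" if "x \<in>: SQ" for x
   using that by (auto simp: SQ_carrier SQ_dif dif_dif SQ_zero cls_zero)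
 qed
qed

end

lemma cocyclesI: "x \<in>: M ==> dif M x = \<zero>\<^sub>M ==> x \<in> cocycles M"
 by (simp add: cocycles_def)

lemma cocyclesD: "x \<in> cocycles M ==> x \<in>: M" "x \<in> cocycles M ==> dif M x = \<zero>\<^sub>M"
 by (simp_all add: cocycles_def)

lemma (in cochain_complex) subquotient_cohom: "subquotient M (cocycles M) (coboundaries M)"
proof (intro subquotient.intro subquotient_axioms.intro is_cpx
  cocycles_subgroup coboundaries_subgroup coboundaries_le_cocycles comp_cocycle)
 show "comp x n \<in> coboundaries M" if "x \<in> coboundaries M" for x n
  using that coboundary_comp_iff[of x] additive_subgroup.a_Hcarr[OF coboundaries_subgroup that] by blast
qed (auto simp: cocycles_def coboundaries_def dif_dif)

text \<open>A quasi-isomorphism onto a complex without differential, spelled out on elements.\<close>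

lemma quasi_iso_zero_dif:
 assumes M: "cochain_complex M" and N: "cochain_complex N"
  and f: "additive_map M N f" and deg: "!!n x. x \<in> gr M n ==> f x \<in> gr N n"
  and fd: "!!x. x \<in>: M ==> f (dif M x) = dif N (f x)"
  and dN: "!!y. y \<in>: N ==> dif N y = \<zero>\<^sub>N"
  and bij: "bij_betw (cohom_map N f) (carrier (cohom M)) (carrier (cohom N))"
 shows quasi_iso_zero_dif_surj:
   "!!y n. y \<in> gr N n ==> \<exists>x\<in>gr M n. dif M x = \<zero>\<^sub>M \<and> f x = y"
  and quasi_iso_zero_dif_exact:
   "!!x n. x \<in> gr M n ==> dif M x = \<zero>\<^sub>M ==> f x = \<zero>\<^sub>N ==> \<exists>y\<in>gr M (n - 1). dif M y = x"
proof -
 interpret M: cochain_complex M by fact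
 interpret N: cochain_complex N by fact
 interpret HM: subquotient M "cocycles M" "coboundaries M" by (rule M.subquotient_cohom)
 interpret HN: subquotient N "cocycles N" "coboundaries N" by (rule N.subquotient_cohom)
 note f_simps = additive_map_closed[OF f] additive_map_add[OF f]
 have f0: "f \<zero>\<^sub>M = \<zero>\<^sub>N"
  using additive_map_zero[OF M.is_ab N.is_ab f] .
 have map: "cohom_map N f (HM.cls x) = HN.cls (f x)" if x: "x \<in>: M" for x
  unfolding cohom_map_def
 proof (rule HM.UN_cls[OF x])
  fix x' assume x': "x' \<in> HM.cls x"
  hence x'c: "x' \<in>: M" "HM.cls x' = HM.cls x" using HM.cls_memD[OF x' x] by auto
  then obtain y where y: "y \<in>: M" "x' \<ominus>\<^sub>M x = dif M y"
   using HM.cls_eq_iff x by (auto simp: coboundaries_def)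
  have "f x' \<ominus>\<^sub>N f x = dif N (f y)"
   using additive_map_minus[OF M.is_ab N.is_ab f x'c(1) x] y fd by simp
  thus "HN.cls (f x') = HN.cls (f x)"
   using HN.cls_eq_iff[of "f x'" "f x"] x'c x f_simps y by (auto simp: coboundaries_def)
 qed
 have carM: "carrier (cohom M) = HM.cls ` cocycles M" by (simp add: cohom_def HM.SQ_carrier)
 have carN: "carrier (cohom N) = HN.cls ` cocycles N" by (simp add: cohom_def HN.SQ_carrier)
 have BN: "coboundaries N = {\<zero>\<^sub>N}"
 proof -
  have "dif N ` carrier N = (%_. \<zero>\<^sub>N) ` carrier N" by (rule image_cong) (auto simp: dN)
  thus ?thesis unfolding coboundaries_def using N.zero_closed by auto
 qed
 show "\<exists>x\<in>gr M n. dif M x = \<zero>\<^sub>M \<and> f x = y" if y: "y \<in> gr N n" for y n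
 proof -
  have yc: "y \<in>: N" using y by simp
  have "HN.cls y \<in>: (cohom N)"
   unfolding carN by (intro imageI cocyclesI yc dN)
  hence "HN.cls y \<in> cohom_map N f ` carrier (cohom M)" using bij unfolding bij_betw_def by blast
  then obtain x where x: "x \<in> cocycles M" "HN.cls y = cohom_map N f (HM.cls x)"
   unfolding carM image_image by blast
  note xc = cocyclesD[OF x(1)]
  have fx: "f x \<in>: N" using f_simps xc by simp
  have "y \<ominus>\<^sub>N f x \<in> coboundaries N"
   using x(2) HN.cls_eq_iff[OF yc fx] unfolding map[OF xc(1)] by blast
  hence "f x = y" using N.minus_zero_iff[OF yc fx] BN by simp
  moreover have "hcomp N (gr N) (f x) (n + 0) = f (M.comp x n)"
   by (rule comp_additive_map[OF M.graded_group_axioms N.graded_group_axioms f])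
    (use deg xc in auto)
  ultimately have "f (M.comp x n) = y" using N.comp_same[OF y] by simp
  moreover have "dif M (M.comp x n) = \<zero>\<^sub>M" by (rule cocyclesD(2)[OF M.comp_cocycle[OF x(1)]])
  ultimately show ?thesis by (intro bexI[OF _ M.comp_V[OF xc(1)]] conjI)
 qed
 show "\<exists>y\<in>gr M (n - 1). dif M y = x"
  if x: "x \<in> gr M n" "dif M x = \<zero>\<^sub>M" "f x = \<zero>\<^sub>N" for x n
 proof -
  have xc: "x \<in>: M" using x by simp
  have "cohom_map N f (HM.cls x) = cohom_map N f (HM.cls \<zero>\<^sub>M)"
   using map[OF xc] map[OF M.zero_closed] x f0 by simp
  moreover have "HM.cls x \<in>: (cohom M)" "HM.cls \<zero>\<^sub>M \<in>: (cohom M)"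
   unfolding carM by (intro imageI cocyclesI xc x(2) M.zero_closed M.dif_zero)+
  ultimately have "HM.cls x = HM.cls \<zero>\<^sub>M"
   using bij by (meson bij_betw_def inj_on_def)
  hence "x \<in> coboundaries M" using HM.cls_eq_zero_iff[OF xc] HM.cls_zero[OF HM.B.zero_closed] by simp
  thus ?thesis using M.homogeneous_coboundary[OF _ x(1)] by simp
 qed
qed

lemma (in abelian_group) cancel_simps:
 assumes "x \<in>: G" "y \<in>: G" "z \<in>: G"
 shows "x \<oplus> (y \<oplus> \<ominus> x) = y" "x \<oplus> (y \<oplus> (\<ominus> x \<oplus> z)) = y \<oplus> z" "x \<oplus> (y \<oplus> (z \<oplus> \<ominus> x)) = y \<oplus> z"
  "\<ominus> x \<oplus> (y \<oplus> x) = y" "\<ominus> x \<oplus> (y \<oplus> (x \<oplus> z)) = y \<oplus> z" "\<ominus> x \<oplus> (y \<oplus> (z \<oplus> x)) = y \<oplus> z"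
 using assms a_lcomm[of x y] a_lcomm[of "\<ominus> x" y] a_lcomm[of x z] a_lcomm[of "\<ominus> x" z]
 by (simp_all add: r_neg l_neg r_neg1 r_neg2)

section \<open>Left modules and DG modules\<close>

context left_module
begin

lemma smult_additive: "a \<in>: R ==> additive_map M M (%x. a \<odot>\<^sub>M x)"
 by (rule additive_mapI) (auto simp: smult_closed smult_r_distr)

lemma smult_additive_left: "x \<in>: M ==> additive_map R M (%a. a \<odot>\<^sub>M x)"
 by (rule additive_mapI) (auto simp: smult_closed smult_l_distr)

lemma smult_zero_right: "a \<in>: R ==> a \<odot>\<^sub>M \<zero>\<^sub>M = \<zero>\<^sub>M"
 by (rule additive_map_zero[OF M.is_ab M.is_ab smult_additive])

lemma smult_zero_left: "x \<in>: M ==> \<zero>\<^sub>R \<odot>\<^sub>M x = \<zero>\<^sub>M"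
 using additive_map_zero[OF R.is_ab M.is_ab smult_additive_left] by blast

lemma smult_inv_right: "a \<in>: R ==> x \<in>: M ==> a \<odot>\<^sub>M (\<ominus>\<^sub>M x) = \<ominus>\<^sub>M (a \<odot>\<^sub>M x)"
 by (rule additive_map_inv[OF M.is_ab M.is_ab smult_additive])

lemma smult_inv_left: "a \<in>: R ==> x \<in>: M ==> (\<ominus>\<^sub>R a) \<odot>\<^sub>M x = \<ominus>\<^sub>M (a \<odot>\<^sub>M x)"
 using additive_map_inv[OF R.is_ab M.is_ab smult_additive_left] by blast

lemma smult_minus_right:
 "a \<in>: R ==> x \<in>: M ==> y \<in>: M ==> a \<odot>\<^sub>M (x \<ominus>\<^sub>M y) = a \<odot>\<^sub>M x \<ominus>\<^sub>M a \<odot>\<^sub>M y"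
 by (rule additive_map_minus[OF M.is_ab M.is_ab smult_additive])

lemma smult_sgn_right:
 "a \<in>: R ==> x \<in>: M ==> a \<odot>\<^sub>M (sgn_pow M n x) = sgn_pow M n (a \<odot>\<^sub>M x)"
 by (rule additive_map_sgn[OF M.is_ab M.is_ab smult_additive])

lemma smult_finsum_right:
 "a \<in>: R ==> (!!i. i \<in> S ==> g i \<in>: M)
  ==> a \<odot>\<^sub>M (\<Oplus>\<^sub>M i\<in>S. g i) = (\<Oplus>\<^sub>M i\<in>S. a \<odot>\<^sub>M g i)"
 by (rule additive_map_finsum[OF M.is_ab M.is_ab smult_additive])

end

sublocale left_dg_module \<subseteq> cx: cochain_complex M
 by (intro cochain_complex.intro cochain_complex_axioms.intro M.is_ab)
  (use graded dif_gr dif_add dif_dif in auto)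

sublocale dg_algebra \<subseteq> alg: ring A
 by (rule ring)

sublocale dg_algebra \<subseteq> cx: cochain_complex A
 by (intro cochain_complex.intro cochain_complex_axioms.intro alg.is_ab)
  (use graded dif_gr dif_add dif_dif in auto)

section \<open>Hom complexes\<close>

text \<open>The uniqueness half of a grading can be tested after additive maps that kill all but one degree.\<close>

lemma graded_by_testI:
 assumes G: "abelian_group G" and N: "abelian_group N"
  and sub: "!!n. subgroup (V n) (add_monoid G)"
  and q: "!!n j. j \<in> J n ==> additive_map G N (q n j)"
  and q0: "!!m n j x. x \<in> V m ==> m ~= n ==> j \<in> J n ==> q n j x = \<zero>\<^sub>N"
  and inj: "!!n x y. x \<in> V n ==> y \<in> V n ==> (!!j. j \<in> J n ==> q n j x = q n j y) ==> x = y"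
  and ex: "!!x. x \<in>: G ==> \<exists>c. is_decomp G V x c"
 shows "graded_by G V"
proof -
 interpret G: abelian_group G by fact
 interpret N: abelian_group N by fact
 have V: "x \<in>: G" if "x \<in> V n" for n x using subgroup.mem_carrier[OF sub that] by simp
 have test: "q n j (c n) = q n j x" if c: "is_decomp G V x c" and j: "j \<in> J n" for x c n j
 proof -
  let ?S = "{n. c n ~= \<zero>\<^sub>G}"
  have cV: "c n \<in> V n" "finite ?S" "x = (\<Oplus>\<^sub>G n\<in>?S. c n)" for n
   using c by (auto simp: is_decomp_def)
  have qc: "q n j (c n) \<in>: N" using additive_map_closed[OF q[OF j] V[OF cV(1)]] .
  have "q n j x = (\<Oplus>\<^sub>N m\<in>?S. q n j (c m))"
   unfolding cV(3) by (rule additive_map_finsum[OF G N q[OF j]]) (rule V[OF cV(1)])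
  also have "... = (\<Oplus>\<^sub>N m\<in>?S. if m = n then q n j (c n) else \<zero>\<^sub>N)"
   using q0[OF cV(1) _ j] qc by (intro N.finsum_cong') auto
  also have "... = (if n \<in> ?S then q n j (c n) else \<zero>\<^sub>N)" by (rule N.finsum_delta[OF cV(2) qc])
  also have "... = q n j (c n)" using additive_map_zero[OF G N q[OF j]] by simp
  finally show ?thesis by simp
 qed
 have "c = c'" if c: "is_decomp G V x c" and c': "is_decomp G V x c'" for x c c'
 proof
  fix n
  have cV: "c n \<in> V n" "c' n \<in> V n" using c c' by (auto simp: is_decomp_def)
  show "c n = c' n" by (rule inj[OF cV]) (simp add: test[OF c] test[OF c'])
 qed
 thus ?thesis using sub ex unfolding graded_by_def by metis
qed

lemma hom_degI:
 assumes "f \<in> extensional (carrier M)"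
  and "!!x. x \<in>: M ==> f x \<in>: N"
  and "!!x y. x \<in>: M ==> y \<in>: M ==> f (x \<oplus>\<^sub>M y) = f x \<oplus>\<^sub>N f y"
  and "!!i x. x \<in> gr M i ==> f x \<in> gr N (i + n)"
  and "!!i a x. a \<in> gr A i ==> x \<in>: M ==> f (a \<odot>\<^sub>M x) = sgn_pow N (n * i) (a \<odot>\<^sub>N f x)"
 shows "f \<in> hom_deg A M N n"
 using assms unfolding hom_deg_def by (auto simp: PiE_def)

lemma hom_degD:
 assumes "f \<in> hom_deg A M N n"
 shows hom_ext: "f \<in> extensional (carrier M)"
  and hom_closed: "!!x. x \<in>: M ==> f x \<in>: N"
  and hom_add: "!!x y. x \<in>: M ==> y \<in>: M ==> f (x \<oplus>\<^sub>M y) = f x \<oplus>\<^sub>N f y"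
  and hom_gr: "!!i x. x \<in> gr M i ==> f x \<in> gr N (i + n)"
  and hom_smult: "!!i a x. a \<in> gr A i ==> x \<in>: M
   ==> f (a \<odot>\<^sub>M x) = sgn_pow N (n * i) (a \<odot>\<^sub>N f x)"
 using assms unfolding hom_deg_def by (auto simp: PiE_def image_subset_iff)

lemma hom_additive: "f \<in> hom_deg A M N n ==> additive_map M N f"
 by (rule additive_mapI) (auto simp: hom_closed hom_add)

lemma hom_eqI:
 assumes "f \<in> hom_deg A M N n" "g \<in> hom_deg A M N m" "!!x. x \<in>: M ==> f x = g x"
 shows "f = g"
 using assms by (intro extensionalityI[of f "carrier M" g]) (auto intro: hom_ext)

locale hom_complex = A: cochain_complex A + M: left_dg_module A M + N: left_dg_module A N
 for A :: "('k, 'a) dg" and M :: "('a, 'm) dg" and N :: "('a, 'n) dg"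
begin

abbreviation F where "F \<equiv> fun_module A M N"
abbreviation H where "H \<equiv> hom_dg A M N"
abbreviation V where "V \<equiv> hom_deg A M N"
abbreviation D where "D \<equiv> hom_dif M N"

lemma hom_zero: "f \<in> V n ==> f \<zero>\<^sub>M = \<zero>\<^sub>N"
 by (rule additive_map_zero[OF M.M.is_ab N.M.is_ab hom_additive])

lemma hom_inv: "f \<in> V n ==> x \<in>: M ==> f (\<ominus>\<^sub>M x) = \<ominus>\<^sub>N f x"
 by (rule additive_map_inv[OF M.M.is_ab N.M.is_ab hom_additive])

lemma hom_minus: "f \<in> V n ==> x \<in>: M ==> y \<in>: M ==> f (x \<ominus>\<^sub>M y) = f x \<ominus>\<^sub>N f y"
 by (rule additive_map_minus[OF M.M.is_ab N.M.is_ab hom_additive])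

lemma hom_sgn: "f \<in> V n ==> x \<in>: M ==> f (sgn_pow M m x) = sgn_pow N m (f x)"
 by (rule additive_map_sgn[OF M.M.is_ab N.M.is_ab hom_additive])

lemma hom_finsum:
 "f \<in> V n ==> (!!i. i \<in> S ==> g i \<in>: M) ==> f (\<Oplus>\<^sub>M i\<in>S. g i) = (\<Oplus>\<^sub>N i\<in>S. f (g i))"
 by (rule additive_map_finsum[OF M.M.is_ab N.M.is_ab hom_additive])

lemma hom_eq_homogeneous:
 assumes f: "f \<in> V n" and g: "g \<in> V m" and eq: "!!i x. x \<in> gr M i ==> f x = g x"
 shows "f = g"
proof (rule hom_eqI[OF f g])
 fix x assume "x \<in>: M"
 thus "f x = g x"
  by (induction rule: M.cx.graded_induct) (use eq f g in \<open>auto simp: hom_add\<close>)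
qed

lemma F_carrier: "carrier F = carrier M \<rightarrow>\<^sub>E carrier N" by (simp add: fun_module_def)
lemma F_zero: "\<zero>\<^sub>F = (\<lambda>x\<in>carrier M. \<zero>\<^sub>N)" by (simp add: fun_module_def)
lemma F_add: "f \<oplus>\<^sub>F g = (\<lambda>x\<in>carrier M. f x \<oplus>\<^sub>N g x)" by (simp add: fun_module_def)

lemma F_abelian_group: "abelian_group F"
proof (rule abelian_groupI)
 show "\<exists>g\<in>carrier F. g \<oplus>\<^sub>F f = \<zero>\<^sub>F" if f: "f \<in>: F" for f
  by (rule bexI[of _ "\<lambda>x\<in>carrier M. \<ominus>\<^sub>N f x"])
   (use f in \<open>auto simp: F_carrier F_add F_zero PiE_iff N.M.l_neg\<close>)
 show "(f \<oplus>\<^sub>F g) \<oplus>\<^sub>F h = f \<oplus>\<^sub>F (g \<oplus>\<^sub>F h)"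
  if "f \<in>: F" "g \<in>: F" "h \<in>: F" for f g h
  using that by (intro ext) (auto simp: F_carrier F_add PiE_iff N.M.a_assoc)
 show "f \<oplus>\<^sub>F g = g \<oplus>\<^sub>F f" if "f \<in>: F" "g \<in>: F" for f g
  using that by (intro ext) (auto simp: F_carrier F_add PiE_iff N.M.a_comm)
 show "\<zero>\<^sub>F \<oplus>\<^sub>F f = f" if f: "f \<in>: F" for f
 proof
  fix x show "(\<zero>\<^sub>F \<oplus>\<^sub>F f) x = f x"
   using f by (cases "x \<in>: M") (auto simp: F_carrier F_add F_zero PiE_iff extensional_def)
 qed
qed (auto simp: F_carrier F_add F_zero)

sublocale F: abelian_group F by (rule F_abelian_group)

lemma eval_additive: "x \<in>: M ==> additive_map F N (%f. f x)"
 by (rule additive_mapI) (auto simp: F_carrier F_add)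

lemma F_eval_inv: "f \<in>: F ==> x \<in>: M ==> (\<ominus>\<^sub>F f) x = \<ominus>\<^sub>N f x"
 using additive_map_inv[OF F.is_ab N.M.is_ab eval_additive] by blast

lemma F_eval_minus:
 "f \<in>: F ==> g \<in>: F ==> x \<in>: M ==> (f \<ominus>\<^sub>F g) x = f x \<ominus>\<^sub>N g x"
 using additive_map_minus[OF F.is_ab N.M.is_ab eval_additive] by blast

lemma F_eval_add: "x \<in>: M ==> (f \<oplus>\<^sub>F g) x = f x \<oplus>\<^sub>N g x"
 by (simp add: F_add)

lemma F_eval_zero: "x \<in>: M ==> \<zero>\<^sub>F x = \<zero>\<^sub>N"
 by (simp add: F_zero)

lemma V_F: "f \<in> V n ==> f \<in>: F"
 by (simp add: F_carrier PiE_iff hom_closed hom_ext)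

lemma zero_V: "\<zero>\<^sub>F \<in> V n"
 by (rule hom_degI)
  (auto simp: F_zero M.smult_closed N.smult_zero_right intro: M.cx.V_closed N.cx.V_zero
   dest: A.V_closed M.cx.V_closed)

lemma add_V:
 assumes "f \<in> V n" "g \<in> V n"
 shows "f \<oplus>\<^sub>F g \<in> V n"
proof (rule hom_degI)
 note c = hom_closed[OF assms(1)] hom_closed[OF assms(2)]
 show "(f \<oplus>\<^sub>F g) (x \<oplus>\<^sub>M y) = (f \<oplus>\<^sub>F g) x \<oplus>\<^sub>N (f \<oplus>\<^sub>F g) y"
  if "x \<in>: M" "y \<in>: M" for x y
  using that c by (simp add: F_add hom_add[OF assms(1)] hom_add[OF assms(2)] N.M.a_ac)
 show "(f \<oplus>\<^sub>F g) (a \<odot>\<^sub>M x) = sgn_pow N (n * i) (a \<odot>\<^sub>N (f \<oplus>\<^sub>F g) x)"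
  if a: "a \<in> gr A i" and x: "x \<in>: M" for i a x
 proof -
  have ac: "a \<in>: A" using A.V_closed[OF a] .
  show ?thesis using x c ac
   by (simp add: F_add hom_smult[OF assms(1) a x] hom_smult[OF assms(2) a x] M.smult_closed
     N.smult_r_distr N.smult_closed N.M.sgn_add)
 qed
 show "(f \<oplus>\<^sub>F g) x \<in> gr N (i + n)" if x: "x \<in> gr M i" for i x
  using M.cx.V_closed[OF x] hom_gr[OF assms(1) x] hom_gr[OF assms(2) x] by (simp add: F_add)
qed (use assms in \<open>auto simp: F_add hom_closed\<close>)

lemma inv_V:
 assumes f: "f \<in> V n"
 shows "\<ominus>\<^sub>F f \<in> V n"
proof (rule hom_degI)
 note e = F_eval_inv[OF V_F[OF f]] and c = hom_closed[OF f]
 show "\<ominus>\<^sub>F f \<in> extensional (carrier M)" using F.a_inv_closed[OF V_F[OF f]] by (auto simp: F_carrier PiE_iff)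
 show "(\<ominus>\<^sub>F f) (x \<oplus>\<^sub>M y) = (\<ominus>\<^sub>F f) x \<oplus>\<^sub>N (\<ominus>\<^sub>F f) y"
  if "x \<in>: M" "y \<in>: M" for x y
  using that c by (simp add: e hom_add[OF f] N.M.minus_add)
 show "(\<ominus>\<^sub>F f) (a \<odot>\<^sub>M x) = sgn_pow N (n * i) (a \<odot>\<^sub>N (\<ominus>\<^sub>F f) x)"
  if a: "a \<in> gr A i" and x: "x \<in>: M" for i a x
 proof -
  have ac: "a \<in>: A" using A.V_closed[OF a] .
  show ?thesis using x c ac
   by (simp add: e hom_smult[OF f a x] M.smult_closed N.smult_inv_right N.smult_closed N.M.sgn_neg)
 qed
 show "(\<ominus>\<^sub>F f) x \<in> gr N (i + n)" if x: "x \<in> gr M i" for i x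
  using M.cx.V_closed[OF x] hom_gr[OF f x] by (simp add: e)
 show "(\<ominus>\<^sub>F f) x \<in>: N" if "x \<in>: M" for x
  using that e c by simp
qed

lemma minus_V: "f \<in> V n ==> g \<in> V n ==> f \<ominus>\<^sub>F g \<in> V n"
 by (simp add: a_minus_def add_V inv_V)

lemma D_apply: "x \<in>: M ==> D n f x = dif N (f x) \<ominus>\<^sub>N sgn_pow N n (f (dif M x))"
 by (simp add: hom_dif_def)

lemma D_V:
 assumes f: "f \<in> V n"
 shows "D n f \<in> V (n + 1)"
proof (rule hom_degI)
 note c = hom_closed[OF f]
 show "D n f \<in> extensional (carrier M)" by (simp add: hom_dif_def)
 show cl: "D n f x \<in>: N" if "x \<in>: M" for x
  using that c by (simp add: D_apply)
 show "D n f (x \<oplus>\<^sub>M y) = D n f x \<oplus>\<^sub>N D n f y" if "x \<in>: M" "y \<in>: M" for x y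
  using that c by (simp add: D_apply M.cx.dif_add N.cx.dif_add hom_add[OF f] N.M.sgn_add a_minus_def
    N.M.minus_add N.M.a_ac)
 show "D n f x \<in> gr N (i + (n + 1))" if x: "x \<in> gr M i" for i x
 proof -
  have "dif N (f x) \<in> gr N (i + (n + 1))" using N.cx.dif_gr[OF hom_gr[OF f x]] by (simp add: add.assoc)
  moreover have "f (dif M x) \<in> gr N (i + (n + 1))"
   using hom_gr[OF f M.cx.dif_gr[OF x]] by (simp add: algebra_simps)
  ultimately show ?thesis using M.cx.V_closed[OF x] by (simp add: D_apply)
 qed
 show "D n f (a \<odot>\<^sub>M x) = sgn_pow N ((n + 1) * i) (a \<odot>\<^sub>N D n f x)"
  if a: "a \<in> gr A i" and x: "x \<in>: M" for i a x
 proof -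
  have ac: "a \<in>: A" and dac: "dif A a \<in>: A" using A.V_closed[OF a] by auto
  have da: "dif A a \<in> gr A (i + 1)" using A.dif_gr[OF a] .
  define p where "p = dif A a \<odot>\<^sub>N f x"
  define q where "q = a \<odot>\<^sub>N dif N (f x)"
  define r where "r = a \<odot>\<^sub>N f (dif M x)"
  have pqr: "p \<in>: N" "q \<in>: N" "r \<in>: N"
   using ac dac x c by (auto simp: p_def q_def r_def N.smult_closed)
  have "dif N (f (a \<odot>\<^sub>M x)) = sgn_pow N (n * i) (p \<oplus>\<^sub>N sgn_pow N i q)"
   using x c ac by (simp add: hom_smult[OF f a x] N.cx.dif_sgn N.smult_closed N.leibniz[OF a] p_def q_def)
  moreover have "f (dif M (a \<odot>\<^sub>M x)) = sgn_pow N (n * (i + 1)) p \<oplus>\<^sub>N sgn_pow N i (sgn_pow N (n * i) r)"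
   using x c ac dac
   by (simp only: M.leibniz[OF a x] hom_add[OF f] hom_sgn[OF f] M.smult_closed M.M.sgn_closed
     M.cx.dif_closed hom_smult[OF f a] hom_smult[OF f da x] p_def r_def)
  moreover have "a \<odot>\<^sub>N D n f x = q \<ominus>\<^sub>N sgn_pow N n r"
   using x c ac by (simp add: D_apply N.smult_minus_right N.smult_sgn_right q_def r_def)
  ultimately show ?thesis
   using pqr x ac M.smult_closed[OF ac x]
   by (cases "even n"; cases "even i")
    (simp_all add: D_apply N.M.sgn_odd a_minus_def N.M.minus_add N.M.a_ac N.M.r_neg N.M.r_neg1
     N.M.r_neg2 N.M.l_neg N.M.cancel_simps)
 qed
qed

lemma D_add: "f \<in> V m ==> g \<in> V m' ==> D n (f \<oplus>\<^sub>F g) = D n f \<oplus>\<^sub>F D n g"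
 by (rule ext) (auto simp: hom_dif_def F_add hom_closed N.cx.dif_add N.M.sgn_add a_minus_def
    N.M.minus_add N.M.a_ac)

lemma D_zero: "D n \<zero>\<^sub>F = \<zero>\<^sub>F"
 by (rule ext) (auto simp: hom_dif_def F_zero N.M.minus_zero_iff)

lemma D_inv: "f \<in> V n ==> D n (\<ominus>\<^sub>F f) = \<ominus>\<^sub>F D n f"
proof (rule hom_eqI[OF D_V inv_V[OF D_V]])
 assume f: "f \<in> V n"
 note e = F_eval_inv[OF V_F[OF f]] F_eval_inv[OF V_F[OF D_V[OF f]]]
 show "D n (\<ominus>\<^sub>F f) x = (\<ominus>\<^sub>F D n f) x" if "x \<in>: M" for x
  using that hom_closed[OF f]
  by (simp add: e D_apply N.cx.dif_inv N.M.sgn_neg a_minus_def N.M.minus_add N.M.a_ac)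
qed (auto intro: inv_V)

lemma D_minus: "f \<in> V n ==> g \<in> V n ==> D n (f \<ominus>\<^sub>F g) = D n f \<ominus>\<^sub>F D n g"
 by (simp add: a_minus_def D_add[OF _ inv_V] D_inv)

lemma D_D:
 assumes f: "f \<in> V n"
 shows "D (n + 1) (D n f) = \<zero>\<^sub>F"
proof (rule hom_eqI[OF D_V[OF D_V[OF f]] zero_V])
 fix x assume x: "x \<in>: M"
 show "D (n + 1) (D n f) x = \<zero>\<^sub>F x"
  using x hom_closed[OF f]
  by (cases "even n")
   (simp_all add: D_apply F_eval_zero M.cx.dif_dif N.cx.dif_dif N.cx.dif_minus N.cx.dif_inv hom_zero[OF f]
    N.M.sgn_odd a_minus_def N.M.minus_add N.M.r_neg N.M.l_neg N.cx.dif_add)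
qed

subsection \<open>The Hom complex as a graded group\<close>

lemma H_carrier: "carrier H = {f. \<exists>c. is_decomp F V f c}" by (simp add: hom_dg_def Let_def)
lemma H_add: "add H = add F" by (simp add: hom_dg_def Let_def)
lemma H_zero: "\<zero>\<^sub>H = \<zero>\<^sub>F" by (simp add: hom_dg_def Let_def)
lemma H_gr: "gr H = V" by (simp add: hom_dg_def Let_def)
lemma H_smult: "smult H = smult F" by (simp add: hom_dg_def Let_def)

lemma F_decompI:
 assumes "!!n. c n \<in> V n" "finite S" "!!n. n \<notin> S ==> c n = \<zero>\<^sub>F" "f = (\<Oplus>\<^sub>F n\<in>S. c n)"
 shows "is_decomp F V f c"
proof -
 have sub: "{n. c n ~= \<zero>\<^sub>F} \<subseteq> S" using assms(3) by auto
 have "(\<Oplus>\<^sub>F n\<in>{n. c n ~= \<zero>\<^sub>F}. c n) = (\<Oplus>\<^sub>F n\<in>S. c n)"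
  by (rule F.finsum_superset) (use assms(2) sub V_F[OF assms(1)] in auto)
 thus ?thesis using assms finite_subset[OF sub] by (auto simp: is_decomp_def)
qed

lemma V_H:
 assumes f: "f \<in> V n"
 shows "f \<in>: H"
proof -
 have "is_decomp F V f (%m. if m = n then f else \<zero>\<^sub>F)"
  by (rule F_decompI[where S = "{n}"]) (use f V_F[OF f] zero_V in auto)
 thus ?thesis unfolding H_carrier by blast
qed

lemma H_F: "f \<in>: H ==> f \<in>: F"
proof -
 assume "f \<in>: H"
 then obtain c where c: "is_decomp F V f c" by (auto simp: H_carrier)
 hence cV: "c n \<in> V n" "f = (\<Oplus>\<^sub>F n\<in>{n. c n ~= \<zero>\<^sub>F}. c n)" for n by (auto simp: is_decomp_def)
 show ?thesis unfolding cV(2) by (rule F.finsum_closed) (use V_F[OF cV(1)] in auto)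
qed

lemma H_add_closed:
 assumes "f \<in>: H" "g \<in>: H"
 shows "f \<oplus>\<^sub>F g \<in>: H"
proof -
 obtain c e where c: "is_decomp F V f c" and e: "is_decomp F V g e" using assms by (auto simp: H_carrier)
 let ?C = "{n. c n ~= \<zero>\<^sub>F}" and ?E = "{n. e n ~= \<zero>\<^sub>F}"
 have cV: "c n \<in> V n" "finite ?C" "f = (\<Oplus>\<^sub>F n\<in>?C. c n)"
  and eV: "e n \<in> V n" "finite ?E" "g = (\<Oplus>\<^sub>F n\<in>?E. e n)" for n
  using c e by (auto simp: is_decomp_def)
 note cF = V_F[OF cV(1)] and eF = V_F[OF eV(1)]
 have "(\<Oplus>\<^sub>F n\<in>?C. c n) = (\<Oplus>\<^sub>F n\<in>?C \<union> ?E. c n)"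
  by (rule F.finsum_superset) (use cV(2) eV(2) cF in auto)
 moreover have "(\<Oplus>\<^sub>F n\<in>?E. e n) = (\<Oplus>\<^sub>F n\<in>?C \<union> ?E. e n)"
  by (rule F.finsum_superset) (use cV(2) eV(2) eF in auto)
 ultimately have "f \<oplus>\<^sub>F g = (\<Oplus>\<^sub>F n\<in>?C \<union> ?E. c n \<oplus>\<^sub>F e n)"
  using cV(3) eV(3) F.finsum_addf[of c "?C \<union> ?E" e] cF eF by auto
 hence "is_decomp F V (f \<oplus>\<^sub>F g) (%n. c n \<oplus>\<^sub>F e n)"
  by (intro F_decompI[where S = "?C \<union> ?E"]) (use cV(1,2) eV(1,2) add_V in auto)
 thus ?thesis unfolding H_carrier by blast
qed

lemma H_inv_closed:
 assumes "f \<in>: H"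
 shows "\<ominus>\<^sub>F f \<in>: H"
proof -
 obtain c where c: "is_decomp F V f c" using assms by (auto simp: H_carrier)
 let ?C = "{n. c n ~= \<zero>\<^sub>F}"
 have cV: "c n \<in> V n" "finite ?C" "f = (\<Oplus>\<^sub>F n\<in>?C. c n)" for n
  using c by (auto simp: is_decomp_def)
 have "additive_map F F (%f. \<ominus>\<^sub>F f)" by (rule additive_mapI) (auto simp: F.minus_add)
 from additive_map_finsum[OF F.is_ab F.is_ab this, of ?C c]
 have "\<ominus>\<^sub>F f = (\<Oplus>\<^sub>F n\<in>?C. \<ominus>\<^sub>F c n)" using cV(3) V_F[OF cV(1)] by auto
 hence "is_decomp F V (\<ominus>\<^sub>F f) (%n. \<ominus>\<^sub>F c n)"
  by (intro F_decompI[where S = ?C]) (use cV(1,2) inv_V in auto)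
 thus ?thesis unfolding H_carrier by blast
qed

lemma H_abelian_group: "abelian_group H"
proof (rule abelian_groupI)
 show "\<exists>g\<in>carrier H. g \<oplus>\<^sub>H f = \<zero>\<^sub>H" if "f \<in>: H" for f
  using that by (intro bexI[of _ "\<ominus>\<^sub>F f"]) (auto simp: H_add H_zero H_inv_closed H_F F.l_neg)
qed (auto simp: H_add H_zero H_add_closed H_F F.a_ac V_H[OF zero_V])

sublocale H: abelian_group H by (rule H_abelian_group)

lemma H_inv: "f \<in>: H ==> \<ominus>\<^sub>H f = \<ominus>\<^sub>F f"
 by (rule H.minus_equality) (auto simp: H_add H_zero H_inv_closed H_F F.l_neg)

lemma H_minus: "f \<in>: H ==> g \<in>: H ==> f \<ominus>\<^sub>H g = f \<ominus>\<^sub>F g"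
 by (simp add: a_minus_def H_inv H_add)

lemma H_finsum:
 assumes "!!i. i \<in> S ==> g i \<in>: H"
 shows "(\<Oplus>\<^sub>H i\<in>S. g i) = (\<Oplus>\<^sub>F i\<in>S. g i)"
proof -
 have "additive_map H F (%x. x)" by (rule additive_mapI) (auto simp: H_add H_F)
 from additive_map_finsum[OF H.is_ab F.is_ab this] assms show ?thesis .
qed

lemma is_decomp_H: "is_decomp H V = is_decomp F V"
proof (intro ext)
 fix f c
 have "(\<Oplus>\<^sub>H n\<in>S. c n) = (\<Oplus>\<^sub>F n\<in>S. c n)" if "\<forall>n. c n \<in> V n" for S
  by (rule H_finsum) (use that V_H in blast)
 thus "is_decomp H V f c = is_decomp F V f c" unfolding is_decomp_def H_zero by metis
qed

lemma H_eval_additive: "x \<in>: M ==> additive_map H N (%f. f x)"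
 by (rule additive_mapI) (auto simp: H_add F_add dest!: H_F, auto simp: F_carrier)

text \<open>A sum of homogeneous maps determines its summands, since their values on a homogeneous element
 lie in different degrees.\<close>

lemma H_graded: "graded_by H V"
proof (rule graded_by_testI[OF H.is_ab N.M.is_ab,
   where J = "%_. {(x, i). x \<in> gr M i}" and q = "%n (x, i) f. hcomp N (gr N) (f x) (i + n)"])
 show "subgroup (V n) (add_monoid H)" for n
  by (rule H.add_subgroupI) (auto simp: V_H H_zero zero_V H_inv inv_V H_add add_V)
 show "additive_map H N ((%(x, i) f. hcomp N (gr N) (f x) (i + n)) j)" if j: "j \<in> {(x, i). x \<in> gr M i}" for n j
 proof -
  obtain x i where xi: "j = (x, i)" "x \<in> gr M i" using j by auto
  note a = H_eval_additive[OF M.cx.V_closed[OF xi(2)]]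
  show ?thesis unfolding xi(1)
   by (rule additive_mapI)
    (simp_all add: additive_map_closed[OF a] additive_map_add[OF a] N.cx.comp_add)
 qed
 show "(%(x, i) f. hcomp N (gr N) (f x) (i + n)) j f = \<zero>\<^sub>N"
  if f: "f \<in> V m" and mn: "m ~= n" and j: "j \<in> {(x, i). x \<in> gr M i}" for m n j f
 proof -
  obtain x i where xi: "j = (x, i)" "x \<in> gr M i" using j by auto
  show ?thesis unfolding xi(1) using N.cx.comp_V_eq[OF hom_gr[OF f xi(2)], of "i + n"] mn by simp
 qed
 show "f = g" if f: "f \<in> V n" and g: "g \<in> V n"
  and eq: "!!j. j \<in> {(x, i). x \<in> gr M i} ==> (%(x, i) f. hcomp N (gr N) (f x) (i + n)) j f
     = (%(x, i) f. hcomp N (gr N) (f x) (i + n)) j g" for n f g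
 proof (rule hom_eq_homogeneous[OF f g])
  fix i x assume x: "x \<in> gr M i"
  show "f x = g x" using eq[of "(x, i)"] x N.cx.comp_same[OF hom_gr[OF f x]] N.cx.comp_same[OF hom_gr[OF g x]]
   by simp
 qed
 show "\<exists>c. is_decomp H V f c" if "f \<in>: H" for f
  using that unfolding is_decomp_H H_carrier by blast
qed

sublocale Hg: graded_group H V by unfold_locales (rule H_graded)

lemma hcomp_H: "hcomp F V = hcomp H V"
 by (intro ext) (simp add: hcomp_def is_decomp_H)

lemma H_dif_superset:
 assumes "f \<in>: H" "finite S" "{n. Hg.comp f n ~= \<zero>\<^sub>F} \<subseteq> S"
 shows "dif H f = (\<Oplus>\<^sub>H n\<in>S. D n (Hg.comp f n))"
proof -
 have c: "D n (Hg.comp f n) \<in>: H" for n using V_H[OF D_V[OF Hg.comp_V[OF assms(1)]]] .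
 have "dif H f = (\<Oplus>\<^sub>F n\<in>{n. Hg.comp f n ~= \<zero>\<^sub>F}. D n (Hg.comp f n))"
  unfolding hcomp_H[symmetric] by (simp add: hom_dg_def Let_def)
 also have "... = (\<Oplus>\<^sub>H n\<in>{n. Hg.comp f n ~= \<zero>\<^sub>F}. D n (Hg.comp f n))"
  by (rule H_finsum[symmetric]) (rule c)
 also have "... = (\<Oplus>\<^sub>H n\<in>S. D n (Hg.comp f n))"
  by (rule H.finsum_superset[OF assms(2,3)]) (use c in \<open>auto simp: D_zero H_zero\<close>)
 finally show ?thesis .
qed

lemma H_dif:
 assumes f: "f \<in> V n"
 shows "dif H f = D n f"
proof -
 have "dif H f = (\<Oplus>\<^sub>H m\<in>{n}. D m (Hg.comp f m))"
  by (rule H_dif_superset[OF V_H[OF f]])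
   (use Hg.comp_V_eq[OF f] H_zero in \<open>auto split: if_splits\<close>)
 thus ?thesis using f V_H[OF D_V[OF f]] by simp
qed

lemma H_complex: "cochain_complex H"
proof -
 have add: "dif H (f \<oplus>\<^sub>H g) = dif H f \<oplus>\<^sub>H dif H g" if fg: "f \<in>: H" "g \<in>: H" for f g
 proof -
  let ?S = "{n. Hg.comp f n ~= \<zero>\<^sub>F} \<union> {n. Hg.comp g n ~= \<zero>\<^sub>F}"
  have S: "finite ?S" using Hg.finite_comp[OF fg(1)] Hg.finite_comp[OF fg(2)] by (simp add: H_zero)
  have z: "\<zero>\<^sub>F \<oplus>\<^sub>F \<zero>\<^sub>F = \<zero>\<^sub>F" by simp
  have cV: "Hg.comp f n \<in> V n" "Hg.comp g n \<in> V n" for n using fg Hg.comp_V by auto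
  have c: "D n (Hg.comp f n) \<in>: H" "D n (Hg.comp g n) \<in>: H" for n
   using V_H[OF D_V[OF cV(1)]] V_H[OF D_V[OF cV(2)]] .
  have "dif H (f \<oplus>\<^sub>H g) = (\<Oplus>\<^sub>H n\<in>?S. D n (Hg.comp (f \<oplus>\<^sub>H g) n))"
   by (rule H_dif_superset[OF _ S]) (use fg in \<open>auto simp: Hg.comp_add, auto simp: H_add z\<close>)
  also have "... = (\<Oplus>\<^sub>H n\<in>?S. D n (Hg.comp f n) \<oplus>\<^sub>H D n (Hg.comp g n))"
  proof -
   have "D n (Hg.comp (f \<oplus>\<^sub>H g) n) = D n (Hg.comp f n) \<oplus>\<^sub>H D n (Hg.comp g n)" for n
    using Hg.comp_add[OF fg, of n] D_add[OF cV(1) cV(2), of n n n] by (simp only: H_add)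
   thus ?thesis by simp
  qed
  also have "... = (\<Oplus>\<^sub>H n\<in>?S. D n (Hg.comp f n)) \<oplus>\<^sub>H (\<Oplus>\<^sub>H n\<in>?S. D n (Hg.comp g n))"
   by (rule H.finsum_addf) (use c in auto)
  also have "... = dif H f \<oplus>\<^sub>H dif H g"
   using H_dif_superset[OF fg(1) S] H_dif_superset[OF fg(2) S] by simp
  finally show ?thesis .
 qed
 have closed: "dif H f \<in>: H" if "f \<in>: H" for f
  using that by (induction rule: Hg.graded_induct) (auto simp: H_dif add intro: V_H D_V)
 show ?thesis
 proof (intro cochain_complex.intro cochain_complex_axioms.intro H.is_ab)
  show "graded_by H (gr H)" using H_graded by (simp add: H_gr)
  show "dif H f \<in> gr H (n + 1)" if "f \<in> gr H n" for f n
   using that D_V by (simp add: H_gr H_dif)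
  show "dif H (f \<oplus>\<^sub>H g) = dif H f \<oplus>\<^sub>H dif H g" if "f \<in>: H" "g \<in>: H" for f g
   using add that .
  show "dif H (dif H f) = \<zero>\<^sub>H" if "f \<in>: H" for f
   using that
  proof (induction rule: Hg.graded_induct)
   case (homogeneous n f)
   thus ?case using H_dif[OF D_V[OF homogeneous]] D_D[OF homogeneous] by (simp add: H_dif H_zero)
  qed (simp add: add closed)
 qed
qed

sublocale Hx: cochain_complex H by (rule H_complex)

lemma H_additive: "f \<in>: H ==> additive_map M N f"
proof (induction rule: Hg.graded_induct)
 case (homogeneous n f)
 thus ?case by (rule hom_additive)
next
 case (add f g)
 thus ?case
  by (intro additive_mapI) (auto simp: H_add F_add additive_map_closed additive_map_add N.M.a_ac)
qed

lemma H_cocycle_iff: "f \<in> V n ==> f \<in> cocycles H \<longleftrightarrow> D n f = \<zero>\<^sub>F"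
 by (simp add: cocycles_def V_H H_dif H_zero)

lemma H_coboundary_iff:
 assumes f: "f \<in> V n"
 shows "f \<in> coboundaries H \<longleftrightarrow> (\<exists>h\<in>V (n - 1). D (n - 1) h = f)"
proof
 show "\<exists>h\<in>V (n - 1). D (n - 1) h = f" if c: "f \<in> coboundaries H"
 proof -
  obtain h where h: "h \<in> V (n - 1)" "dif H h = f"
   using Hx.homogeneous_coboundary[OF c, of n] f unfolding H_gr by blast
  show ?thesis using h(2) unfolding H_dif[OF h(1)] by (rule bexI[OF _ h(1)])
 qed
 show "f \<in> coboundaries H" if hf: "\<exists>h\<in>V (n - 1). D (n - 1) h = f"
 proof -
  obtain h where h: "h \<in> V (n - 1)" "D (n - 1) h = f" using hf by blast
  show ?thesis unfolding coboundaries_def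
   by (rule image_eqI[OF _ V_H[OF h(1)]]) (simp add: H_dif[OF h(1)] h(2))
 qed
qed

end

subsection \<open>Composition\<close>

lemma compose_V:
 assumes L: "left_dg_module A L" and M: "left_dg_module A M" and N: "left_dg_module A N" and A: "cochain_complex A"
  and f: "f \<in> hom_deg A M N n" and g: "g \<in> hom_deg A L M m"
 shows "compose (carrier L) f g \<in> hom_deg A L N (n + m)"
proof (rule hom_degI)
 interpret A: cochain_complex A by fact
 interpret L: left_dg_module A L by fact
 interpret M: left_dg_module A M by fact
 interpret N: left_dg_module A N by fact
 interpret MN: hom_complex A M N by unfold_locales
 note c = hom_closed[OF f] hom_closed[OF g]
 show "compose (carrier L) f g (a \<odot>\<^sub>L x) = sgn_pow N ((n + m) * i) (a \<odot>\<^sub>N compose (carrier L) f g x)"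
  if a: "a \<in> gr A i" and x: "x \<in>: L" for i a x
 proof -
  have ac: "a \<in>: A" using A.V_closed[OF a] .
  show ?thesis
   using x ac c by (simp add: compose_eq L.smult_closed hom_smult[OF g a] MN.hom_sgn[OF f] M.smult_closed
     hom_smult[OF f a] N.smult_closed algebra_simps)
 qed
 show "compose (carrier L) f g x \<in> gr N (i + (n + m))" if x: "x \<in> gr L i" for i x
  using hom_gr[OF f hom_gr[OF g x]] L.cx.V_closed[OF x] by (simp add: compose_eq algebra_simps)
 show "compose (carrier L) f g (x \<oplus>\<^sub>L y) = compose (carrier L) f g x \<oplus>\<^sub>N compose (carrier L) f g y"
  if "x \<in>: L" "y \<in>: L" for x y
  using that c by (simp add: compose_eq hom_add[OF f] hom_add[OF g])
qed (use assms in \<open>auto simp: compose_eq compose_extensional hom_closed\<close>)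

text \<open>The Leibniz rule for the composition of maps between complexes.\<close>

lemma compose_D:
 assumes L: "left_dg_module A L" and M: "left_dg_module A M" and N: "left_dg_module A N" and A: "cochain_complex A"
  and f: "f \<in> hom_deg A M N n" and g: "g \<in> hom_deg A L M m" and x: "x \<in>: L"
 shows "hom_dif L N (n + m) (compose (carrier L) f g) x =
  hom_dif M N n f (g x) \<oplus>\<^sub>N sgn_pow N n (f (hom_dif L M m g x))"
proof -
 interpret A: cochain_complex A by fact
 interpret L: left_dg_module A L by fact
 interpret M: left_dg_module A M by fact
 interpret N: left_dg_module A N by fact
 interpret MN: hom_complex A M N by unfold_locales
 interpret LM: hom_complex A L M by unfold_locales
 interpret LN: hom_complex A L N by unfold_locales
 note c = hom_closed[OF f] hom_closed[OF g]
 define p where "p = dif N (f (g x))"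
 define q where "q = f (dif M (g x))"
 define r where "r = f (g (dif L x))"
 have pqr: "p \<in>: N" "q \<in>: N" "r \<in>: N" using c x by (auto simp: p_def q_def r_def)
 have 1: "hom_dif L N (n + m) (compose (carrier L) f g) x = p \<ominus>\<^sub>N sgn_pow N (n + m) r"
  using x by (simp add: LN.D_apply compose_eq p_def r_def)
 have 2: "hom_dif M N n f (g x) = p \<ominus>\<^sub>N sgn_pow N n q"
  using x c by (simp add: MN.D_apply p_def q_def)
 have 3: "f (hom_dif L M m g x) = q \<ominus>\<^sub>N sgn_pow N m r"
  using x c by (simp add: LM.D_apply MN.hom_minus[OF f] MN.hom_sgn[OF f] q_def r_def)
 show ?thesis unfolding 1 2 3 using pqr
  by (cases "even n"; cases "even m")
   (simp_all add: N.M.sgn_odd a_minus_def N.M.minus_add N.M.a_ac N.M.r_neg N.M.l_neg N.M.r_neg1 N.M.r_neg2 N.M.cancel_simps)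
qed

section \<open>Endomorphism and cohomology algebras\<close>

context dg_algebra
begin

abbreviation scal :: "'k => 'a" where "scal c \<equiv> c \<odot>\<^sub>A \<one>\<^sub>A"

lemma one_closed [simp]: "\<one>\<^sub>A \<in>: A" by (rule alg.one_closed)

lemma smult_closed [simp]: "c \<in>: K ==> x \<in>: A ==> c \<odot>\<^sub>A x \<in>: A"
 by (rule module.smult_closed[OF module])

lemma scal_gr [simp]: "c \<in>: K ==> scal c \<in> gr A 0"
 by (rule smult_gr[OF _ one_gr])

lemma smult_conv_left: "c \<in>: K ==> x \<in>: A ==> c \<odot>\<^sub>A x = scal c \<otimes>\<^sub>A x"
 using smult_mult_left[of c "\<one>\<^sub>A" x] by simp

lemma smult_conv_right: "c \<in>: K ==> x \<in>: A ==> c \<odot>\<^sub>A x = x \<otimes>\<^sub>A scal c"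
 using smult_mult_right[of c x "\<one>\<^sub>A"] by simp

lemma scal_add: "c \<in>: K ==> c' \<in>: K ==> scal (c \<oplus>\<^sub>K c') = scal c \<oplus>\<^sub>A scal c'"
 by (rule module.smult_l_distr[OF module]) auto

lemma scal_mult: "c \<in>: K ==> c' \<in>: K ==> scal (c \<otimes>\<^sub>K c') = scal c \<otimes>\<^sub>A scal c'"
 using module.smult_assoc1[OF module, of c c' "\<one>\<^sub>A"] smult_conv_left[of c "scal c'"] by simp

lemma scal_one: "scal \<one>\<^sub>K = \<one>\<^sub>A"
 by (rule module.smult_one[OF module]) simp

lemma K_ring: "ring K" using field field.is_ring by blast
lemma K_cring: "cring K" using field by (simp add: field_def domain_def)
lemma K_one [simp]: "\<one>\<^sub>K \<in>: K" using K_ring ring.ring_simprules(6) by blast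

lemma dif_one: "dif A \<one>\<^sub>A = \<zero>\<^sub>A"
proof -
 have "dif A (\<one>\<^sub>A \<otimes>\<^sub>A \<one>\<^sub>A) = dif A \<one>\<^sub>A \<oplus>\<^sub>A dif A \<one>\<^sub>A"
  using leibniz[OF one_gr, of "\<one>\<^sub>A"] by simp
 hence "dif A \<one>\<^sub>A = dif A \<one>\<^sub>A \<oplus>\<^sub>A dif A \<one>\<^sub>A" by simp
 thus ?thesis using alg.add.l_cancel_one' cx.dif_closed one_closed by metis
qed

lemma one_cocycle: "\<one>\<^sub>A \<in> cocycles A"
 by (rule cocyclesI) (auto simp: dif_one)

end

lemma cochain_complex_cong_structure:
 assumes "cochain_complex M" "carrier M = carrier N" "add M = add N" "zero M = zero N"
  "gr M = gr N" "dif M = dif N"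
 shows "cochain_complex N"
proof -
 interpret M: cochain_complex M by fact
 have N: "abelian_group N" by (rule abelian_group_cong_structure[OF M.is_ab assms(2-4)])
 have "graded_by N (gr N)"
  using graded_by_cong_structure[OF M.graded N assms(2-4)] assms(5) by simp
 thus ?thesis
  using M.dif_gr M.dif_add M.dif_dif unfolding assms(2-6)
  by (intro cochain_complex.intro cochain_complex_axioms.intro N) auto
qed

locale dg_end = A: dg_algebra K A + M: left_dg_module A M
 for K :: "('k, 'c) ring_scheme" and A :: "('k, 'a) dg" and M :: "('a, 'm) dg"
begin

sublocale hc: hom_complex A M M
 by unfold_locales

abbreviation E where "E \<equiv> end_dg A M"

lemma E_simps:
 "carrier E = carrier hc.H" "add E = add hc.H" "zero E = zero hc.H" "gr E = hom_deg A M M"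
 "dif E = dif hc.H" "mult E = compose (carrier M)" "\<one>\<^sub>E = (\<lambda>x\<in>carrier M. x)"
 "smult E = smult hc.F"
 by (simp_all add: end_dg_def hc.H_gr hc.H_smult)

lemma E_smult: "c \<odot>\<^sub>E f = (\<lambda>x\<in>carrier M. A.scal c \<odot>\<^sub>M f x)"
 by (simp add: E_simps fun_module_def)

lemma E_complex: "cochain_complex E"
 by (rule cochain_complex_cong_structure[OF hc.H_complex]) (simp_all add: E_simps hc.H_gr)

sublocale Ex: cochain_complex E by (rule E_complex)

lemma E_add_apply: "x \<in>: M ==> (f \<oplus>\<^sub>E g) x = f x \<oplus>\<^sub>M g x"
 by (simp add: E_simps hc.H_add hc.F_add)

lemma E_closed: "f \<in>: E ==> x \<in>: M ==> f x \<in>: M"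
 using hc.H_F by (auto simp: E_simps hc.F_carrier)

lemma E_extensional: "f \<in>: E ==> f \<in> extensional (carrier M)"
 using hc.H_F by (auto simp: E_simps hc.F_carrier PiE_iff)

lemma E_additive: "f \<in>: E ==> additive_map M M f"
 using hc.H_additive by (simp add: E_simps)

lemma E_eqI:
 assumes "f \<in>: E" "g \<in>: E" "!!x. x \<in>: M ==> f x = g x"
 shows "f = g"
 by (rule extensionalityI[OF E_extensional[OF assms(1)] E_extensional[OF assms(2)]]) (rule assms(3))

lemma gr_E: "f \<in> hom_deg A M M n ==> f \<in>: E"
 using hc.V_H by (simp add: E_simps)

lemma E_induct [consumes 1, case_names homogeneous add]:
 assumes "f \<in>: E" "!!n f. f \<in> hom_deg A M M n ==> P f"
  "!!f g. f \<in>: E ==> g \<in>: E ==> P f ==> P g ==> P (f \<oplus>\<^sub>E g)"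
 shows "P f"
 using assms Ex.graded_induct[of f P] by (simp add: E_simps(4))

lemma E_linear0:
 assumes "f \<in>: E" and a: "a \<in> gr A 0" and x: "x \<in>: M"
 shows "f (a \<odot>\<^sub>M x) = a \<odot>\<^sub>M f x"
 using assms(1)
proof (induction rule: E_induct)
 case (homogeneous n f)
 thus ?case using hom_smult[OF homogeneous a x] by simp
next
 case (add f g)
 have "a \<in>: A" using A.cx.V_closed[OF a] .
 thus ?case using add x by (simp add: E_add_apply M.smult_closed M.smult_r_distr E_closed)
qed

lemma E_smult_gr:
 assumes f: "f \<in> hom_deg A M M n" and c: "c \<in>: K"
 shows "c \<odot>\<^sub>E f \<in> hom_deg A M M n"
proof (rule hom_degI)
 note fc = hom_closed[OF f]
 have cc: "A.scal c \<in>: A" using c by simp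
 show "(c \<odot>\<^sub>E f) (a \<odot>\<^sub>M x) = sgn_pow M (n * i) (a \<odot>\<^sub>M (c \<odot>\<^sub>E f) x)"
  if a: "a \<in> gr A i" and x: "x \<in>: M" for i a x
 proof -
  have ac: "a \<in>: A" using A.cx.V_closed[OF a] .
  have "A.scal c \<odot>\<^sub>M (a \<odot>\<^sub>M f x) = a \<odot>\<^sub>M (A.scal c \<odot>\<^sub>M f x)"
   using M.smult_assoc[OF cc ac fc[OF x]] M.smult_assoc[OF ac cc fc[OF x]]
    A.smult_conv_left[OF c ac] A.smult_conv_right[OF c ac] by simp
  thus ?thesis using x ac cc fc
   by (simp add: E_smult M.smult_closed hom_smult[OF f a x] M.smult_sgn_right)
 qed
 show "(c \<odot>\<^sub>E f) x \<in> gr M (i + n)" if x: "x \<in> gr M i" for i x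
  using M.smult_gr[OF A.scal_gr[OF c] hom_gr[OF f x]] M.cx.V_closed[OF x]
  by (simp add: E_smult)
 show "(c \<odot>\<^sub>E f) (x \<oplus>\<^sub>M y) = (c \<odot>\<^sub>E f) x \<oplus>\<^sub>M (c \<odot>\<^sub>E f) y"
  if "x \<in>: M" "y \<in>: M" for x y
  using that fc cc by (simp add: E_smult hom_add[OF f] M.smult_r_distr)
 show "(c \<odot>\<^sub>E f) x \<in>: M" if "x \<in>: M" for x
  using that fc cc by (simp add: E_smult M.smult_closed)
qed (simp add: E_smult)

lemma E_smult_closed:
 assumes "f \<in>: E" and c: "c \<in>: K"
 shows "c \<odot>\<^sub>E f \<in>: E"
 using assms(1)
proof (induction rule: E_induct)
 case (homogeneous n f)
 show ?case by (rule gr_E[OF E_smult_gr[OF homogeneous c]])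
next
 case (add f g)
 have cc: "A.scal c \<in>: A" using c by simp
 have "c \<odot>\<^sub>E (f \<oplus>\<^sub>E g) = (c \<odot>\<^sub>E f) \<oplus>\<^sub>E (c \<odot>\<^sub>E g)"
 proof (rule extensionalityI[of _ "carrier M"])
  show "c \<odot>\<^sub>E (f \<oplus>\<^sub>E g) \<in> extensional (carrier M)" by (simp add: E_smult)
  show "c \<odot>\<^sub>E f \<oplus>\<^sub>E c \<odot>\<^sub>E g \<in> extensional (carrier M)"
   using E_extensional[OF Ex.a_closed[OF add(3,4)]] .
  show "(c \<odot>\<^sub>E (f \<oplus>\<^sub>E g)) x = (c \<odot>\<^sub>E f \<oplus>\<^sub>E c \<odot>\<^sub>E g) x" if x: "x \<in>: M" for x
  proof -
   have "(c \<odot>\<^sub>E (f \<oplus>\<^sub>E g)) x = A.scal c \<odot>\<^sub>M (f x \<oplus>\<^sub>M g x)"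
    using x by (simp add: E_smult E_add_apply)
   also have "... = A.scal c \<odot>\<^sub>M f x \<oplus>\<^sub>M A.scal c \<odot>\<^sub>M g x"
    using x cc E_closed add by (intro M.smult_r_distr) auto
   also have "... = (c \<odot>\<^sub>E f \<oplus>\<^sub>E c \<odot>\<^sub>E g) x"
    using x by (simp add: E_add_apply E_smult)
   finally show ?thesis .
  qed
 qed
 thus ?case using add by simp
qed

lemma compose_gr:
 "f \<in> hom_deg A M M n ==> g \<in> hom_deg A M M m ==> compose (carrier M) f g \<in> hom_deg A M M (n + m)"
 by (rule compose_V[OF M.is_dgm M.is_dgm M.is_dgm
    A.cx.is_cpx])

lemma E_l_distr:
 assumes "f \<in>: E" "f' \<in>: E" "g \<in>: E"
 shows "(f \<oplus>\<^sub>E f') \<otimes>\<^sub>E g = f \<otimes>\<^sub>E g \<oplus>\<^sub>E f' \<otimes>\<^sub>E g"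
proof
 fix x show "((f \<oplus>\<^sub>E f') \<otimes>\<^sub>E g) x = (f \<otimes>\<^sub>E g \<oplus>\<^sub>E f' \<otimes>\<^sub>E g) x"
  by (cases "x \<in>: M")
   (use E_closed[OF assms(3)] in \<open>auto simp: E_simps(6) E_simps(2) hc.H_add hc.F_add compose_def\<close>)
qed

lemma E_r_distr:
 assumes "f \<in>: E" "g \<in>: E" "g' \<in>: E"
 shows "f \<otimes>\<^sub>E (g \<oplus>\<^sub>E g') = f \<otimes>\<^sub>E g \<oplus>\<^sub>E f \<otimes>\<^sub>E g'"
proof
 fix x show "(f \<otimes>\<^sub>E (g \<oplus>\<^sub>E g')) x = (f \<otimes>\<^sub>E g \<oplus>\<^sub>E f \<otimes>\<^sub>E g') x"
  by (cases "x \<in>: M")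
   (use E_closed[OF assms(2)] E_closed[OF assms(3)] additive_map_add[OF E_additive[OF assms(1)]] in
    \<open>auto simp: E_simps(6) E_simps(2) hc.H_add hc.F_add compose_def\<close>)
qed

lemma E_mult_closed:
 assumes f: "f \<in>: E" and g: "g \<in>: E"
 shows "f \<otimes>\<^sub>E g \<in>: E"
 using f
proof (induction rule: E_induct)
 case (homogeneous n f)
 note f = homogeneous
 show ?case using g
 proof (induction rule: E_induct)
  case (homogeneous m g)
  show ?case using gr_E[OF compose_gr[OF f homogeneous]] by (simp add: E_simps(6))
 qed (simp add: E_r_distr gr_E[OF f])
qed (simp add: E_l_distr g)

lemma E_one_gr: "\<one>\<^sub>E \<in> hom_deg A M M 0"
 by (rule hom_degI) (auto simp: E_simps(7) M.smult_closed dest: A.cx.V_closed M.cx.V_closed)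

lemma E_ring: "ring E"
proof (rule ringI[OF Ex.is_ab])
 show "Group.monoid E"
 proof (rule monoidI)
  show "\<one>\<^sub>E \<in>: E" by (rule gr_E[OF E_one_gr])
  show "f \<otimes>\<^sub>E g \<otimes>\<^sub>E h = f \<otimes>\<^sub>E (g \<otimes>\<^sub>E h)"
   if "f \<in>: E" "g \<in>: E" "h \<in>: E" for f g h
   using E_closed[OF that(3)] by (auto simp: E_simps(6) compose_def)
  show "\<one>\<^sub>E \<otimes>\<^sub>E f = f" if "f \<in>: E" for f
   by (rule extensionalityI[OF _ E_extensional[OF that]])
    (use E_closed[OF that] in \<open>auto simp: E_simps(6,7) compose_def\<close>)
  show "f \<otimes>\<^sub>E \<one>\<^sub>E = f" if "f \<in>: E" for f
   by (rule extensionalityI[OF _ E_extensional[OF that]]) (auto simp: E_simps(6,7) compose_def)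
 qed (rule E_mult_closed)
qed (auto intro: E_l_distr E_r_distr)

lemma E_sgn_apply: "f \<in>: E ==> x \<in>: M ==> sgn_pow E n f x = sgn_pow M n (f x)"
proof -
 assume "f \<in>: E" and x: "x \<in>: M"
 have "additive_map E M (%f. f x)"
  by (rule additive_mapI) (auto simp: E_closed E_add_apply x)
 from additive_map_sgn[OF Ex.is_ab M.M.is_ab this \<open>f \<in> carrier E\<close>]
 show ?thesis .
qed

lemma E_dif: "f \<in> hom_deg A M M n ==> dif E f = hom_dif M M n f"
 by (simp add: E_simps hc.H_dif)

lemma E_leibniz:
 assumes f: "f \<in> hom_deg A M M i" and g: "g \<in>: E"
 shows "dif E (f \<otimes>\<^sub>E g) = (dif E f \<otimes>\<^sub>E g) \<oplus>\<^sub>E sgn_pow E i (f \<otimes>\<^sub>E dif E g)"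
 using g
proof (induction rule: E_induct)
 case (homogeneous m g)
 have fE: "f \<in>: E" and gE: "g \<in>: E" using f homogeneous gr_E by auto
 have fg: "f \<otimes>\<^sub>E g \<in> hom_deg A M M (i + m)" using compose_gr[OF f homogeneous] by (simp add: E_simps(6))
 have dfg: "f \<otimes>\<^sub>E dif E g \<in>: E" using fE gE Ex.dif_closed E_mult_closed by blast
 show ?case
 proof (rule E_eqI)
  fix x assume x: "x \<in>: M"
  have 1: "dif E (f \<otimes>\<^sub>E g) x = hom_dif M M i f (g x) \<oplus>\<^sub>M sgn_pow M i (f (hom_dif M M m g x))"
   unfolding E_dif[OF fg] unfolding E_simps(6)
   by (rule compose_D[OF M.is_dgm M.is_dgm M.is_dgm
    A.cx.is_cpx f homogeneous x])
  have 2: "(dif E f \<otimes>\<^sub>E g) x = hom_dif M M i f (g x)"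
   using x by (simp add: E_simps(6) compose_eq E_dif[OF f])
  have 3: "(f \<otimes>\<^sub>E dif E g) x = f (hom_dif M M m g x)"
   using x by (simp add: E_simps(6) compose_eq E_dif[OF homogeneous])
  show "dif E (f \<otimes>\<^sub>E g) x = (dif E f \<otimes>\<^sub>E g \<oplus>\<^sub>E sgn_pow E i (f \<otimes>\<^sub>E dif E g)) x"
   unfolding E_add_apply[OF x] E_sgn_apply[OF dfg x] 1 2 3 ..
 qed (use fE gE dfg E_mult_closed Ex.dif_closed in auto)
next
 case (add g h)
 have fE: "f \<in>: E" using f gr_E by auto
 have c: "dif E f \<otimes>\<^sub>E g \<in>: E" "dif E f \<otimes>\<^sub>E h \<in>: E" "f \<otimes>\<^sub>E dif E g \<in>: E"
  "f \<otimes>\<^sub>E dif E h \<in>: E" "f \<otimes>\<^sub>E g \<in>: E" "f \<otimes>\<^sub>E h \<in>: E"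
  using fE add(1,2) Ex.dif_closed E_mult_closed by auto
 have "dif E (f \<otimes>\<^sub>E (g \<oplus>\<^sub>E h)) = dif E (f \<otimes>\<^sub>E g) \<oplus>\<^sub>E dif E (f \<otimes>\<^sub>E h)"
  unfolding E_r_distr[OF fE add(1,2)] by (rule Ex.dif_add[OF c(5,6)])
 moreover have "dif E f \<otimes>\<^sub>E (g \<oplus>\<^sub>E h) = dif E f \<otimes>\<^sub>E g \<oplus>\<^sub>E dif E f \<otimes>\<^sub>E h"
  using E_r_distr[OF Ex.dif_closed[OF fE] add(1,2)] .
 moreover have "f \<otimes>\<^sub>E dif E (g \<oplus>\<^sub>E h) = f \<otimes>\<^sub>E dif E g \<oplus>\<^sub>E f \<otimes>\<^sub>E dif E h"
  unfolding Ex.dif_add[OF add(1,2)] by (rule E_r_distr) (use fE add in auto)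
 ultimately show ?case unfolding add(3,4)
  using c Ex.sgn_closed by (simp add: Ex.sgn_add Ex.a_ac)
qed

lemma E_module: "Module.module K E"
proof (rule moduleI[OF A.K_cring Ex.is_ab])
 fix c f assume c: "c \<in>: K" and f: "f \<in>: E"
 show cf: "c \<odot>\<^sub>E f \<in>: E" using E_smult_closed[OF f c] .
 have cc: "A.scal c \<in>: A" using c by simp
 show "(c \<oplus>\<^sub>K c') \<odot>\<^sub>E f = (c \<odot>\<^sub>E f) \<oplus>\<^sub>E (c' \<odot>\<^sub>E f)" if c': "c' \<in>: K" for c'
 proof (rule E_eqI)
  show "(c \<oplus>\<^sub>K c') \<odot>\<^sub>E f \<in>: E"
   using E_smult_closed[OF f] c c' ring.ring_simprules(1)[OF A.K_ring] by blast
  show "c \<odot>\<^sub>E f \<oplus>\<^sub>E c' \<odot>\<^sub>E f \<in>: E" using cf E_smult_closed[OF f c'] by simp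
  show "((c \<oplus>\<^sub>K c') \<odot>\<^sub>E f) x = (c \<odot>\<^sub>E f \<oplus>\<^sub>E c' \<odot>\<^sub>E f) x" if x: "x \<in>: M" for x
   unfolding E_add_apply[OF x] using x c c' E_closed[OF f x]
   by (simp add: E_smult A.scal_add M.smult_l_distr)
 qed
 show "c \<odot>\<^sub>E (f \<oplus>\<^sub>E g) = (c \<odot>\<^sub>E f) \<oplus>\<^sub>E (c \<odot>\<^sub>E g)" if g: "g \<in>: E" for g
 proof (rule E_eqI)
  show "c \<odot>\<^sub>E (f \<oplus>\<^sub>E g) \<in>: E" using E_smult_closed[OF Ex.a_closed[OF f g] c] .
  show "c \<odot>\<^sub>E f \<oplus>\<^sub>E c \<odot>\<^sub>E g \<in>: E" using cf E_smult_closed[OF g c] by simp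
  show "(c \<odot>\<^sub>E (f \<oplus>\<^sub>E g)) x = (c \<odot>\<^sub>E f \<oplus>\<^sub>E c \<odot>\<^sub>E g) x" if x: "x \<in>: M" for x
   unfolding E_add_apply[OF x] using x cc E_closed[OF f x] E_closed[OF g x]
   by (simp add: E_smult E_add_apply M.smult_r_distr)
 qed
 show "(c \<otimes>\<^sub>K c') \<odot>\<^sub>E f = c \<odot>\<^sub>E (c' \<odot>\<^sub>E f)" if c': "c' \<in>: K" for c'
 proof (rule E_eqI)
  show "(c \<otimes>\<^sub>K c') \<odot>\<^sub>E f \<in>: E"
   using E_smult_closed[OF f] c c' ring.ring_simprules(5)[OF A.K_ring] by blast
  show "c \<odot>\<^sub>E (c' \<odot>\<^sub>E f) \<in>: E" using E_smult_closed[OF E_smult_closed[OF f c'] c] .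
  show "((c \<otimes>\<^sub>K c') \<odot>\<^sub>E f) x = (c \<odot>\<^sub>E (c' \<odot>\<^sub>E f)) x" if x: "x \<in>: M" for x
   using x c c' E_closed[OF f x] by (simp add: E_smult A.scal_mult M.smult_assoc)
 qed
next
 show "\<one>\<^sub>K \<odot>\<^sub>E f = f" if f: "f \<in>: E" for f
  by (rule E_eqI) (use f E_smult_closed[OF f A.K_one] E_closed[OF f] in
   \<open>auto simp: E_smult A.scal_one M.smult_one\<close>)
qed

theorem E_dg_algebra: "dg_algebra K E"
proof (intro dg_algebra.intro A.field E_ring E_module)
 fix c f g assume c: "c \<in>: K" and f: "f \<in>: E" and g: "g \<in>: E"
 show "c \<odot>\<^sub>E (f \<otimes>\<^sub>E g) = (c \<odot>\<^sub>E f) \<otimes>\<^sub>E g"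
  using E_closed[OF g] by (auto simp: E_smult E_simps(6) compose_def)
 show "c \<odot>\<^sub>E (f \<otimes>\<^sub>E g) = f \<otimes>\<^sub>E (c \<odot>\<^sub>E g)"
  using E_linear0[OF f A.scal_gr[OF c]] E_closed[OF g] by (auto simp: E_smult E_simps(6) compose_def)
next
 show "graded_by E (gr E)" by (rule Ex.graded)
 show "\<one>\<^sub>E \<in> gr E 0" using E_one_gr by (simp add: E_simps(4))
 show "c \<odot>\<^sub>E f \<in> gr E n" if "c \<in>: K" "f \<in> gr E n" for c f n
  using E_smult_gr that by (simp add: E_simps(4))
 show "f \<otimes>\<^sub>E g \<in> gr E (i + j)" if "f \<in> gr E i" "g \<in> gr E j" for f g i j
  using compose_gr that by (simp add: E_simps(4,6))
 show "dif E f \<in> gr E (n + 1)" if "f \<in> gr E n" for f n using Ex.dif_gr[OF that] .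
 show "dif E (f \<oplus>\<^sub>E g) = dif E f \<oplus>\<^sub>E dif E g" if "f \<in>: E" "g \<in>: E" for f g
  using Ex.dif_add[OF that] .
 show "dif E (dif E f) = \<zero>\<^sub>E" if "f \<in>: E" for f using Ex.dif_dif[OF that] .
 show "dif E (f \<otimes>\<^sub>E g) = dif E f \<otimes>\<^sub>E g \<oplus>\<^sub>E sgn_pow E i (f \<otimes>\<^sub>E dif E g)"
  if "f \<in> gr E i" "g \<in>: E" for f g i
  using E_leibniz that by (simp add: E_simps(4))
 show "dif E (c \<odot>\<^sub>E f) = c \<odot>\<^sub>E dif E f" if c: "c \<in>: K" and f: "f \<in>: E" for c f
  using f
 proof (induction rule: E_induct)
  case (homogeneous n f)
  have cc: "A.scal c \<in>: A" using c by simp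
  have dc: "dif A (A.scal c) = \<zero>\<^sub>A"
   unfolding A.dif_smult[OF c A.one_closed] A.dif_one by (rule Module.module.smult_r_null[OF A.module c])
  have lin: "dif M (A.scal c \<odot>\<^sub>M x) = A.scal c \<odot>\<^sub>M dif M x" if x: "x \<in>: M" for x
  proof -
   have cl: "A.scal c \<odot>\<^sub>M dif M x \<in>: M" by (rule M.smult_closed[OF cc M.cx.dif_closed[OF x]])
   have "dif M (A.scal c \<odot>\<^sub>M x) = \<zero>\<^sub>M \<oplus>\<^sub>M sgn_pow M 0 (A.scal c \<odot>\<^sub>M dif M x)"
    unfolding M.leibniz[OF A.scal_gr[OF c] x] dc M.smult_zero_left[OF x] ..
   thus ?thesis using M.M.l_zero[OF cl] by (simp add: sgn_pow_def)
  qed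
  have cf: "c \<odot>\<^sub>E f \<in> hom_deg A M M n" by (rule E_smult_gr[OF homogeneous c])
  show ?case
  proof (rule E_eqI)
   show "dif E (c \<odot>\<^sub>E f) x = (c \<odot>\<^sub>E dif E f) x" if x: "x \<in>: M" for x
    unfolding E_dif[OF cf] E_dif[OF homogeneous]
    using x M.cx.dif_closed[OF x] lin[OF hom_closed[OF homogeneous x]]
     M.smult_minus_right[OF cc] M.smult_sgn_right[OF cc] hom_closed[OF homogeneous]
    by (simp add: E_smult hc.D_apply)
  qed (use gr_E[OF cf] gr_E[OF homogeneous] E_smult_closed c in auto)
 next
  case (add f g)
  note s = Module.module.smult_r_distr[OF E_module c]
  show ?case using add E_smult_closed c by (simp add: s Ex.dif_add)
 qed
qed

end

context dg_algebra
begin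

sublocale HA: subquotient A "cocycles A" "coboundaries A"
 by (rule cx.subquotient_cohom)

lemma cohom_SQ: "cohom A = HA.SQ" by (simp add: cohom_def)

lemma cohom_carrier: "carrier (cohom A) = HA.cls ` cocycles A"
 by (simp add: cohom_SQ HA.SQ_carrier)

lemma cocycle_induct [consumes 1, case_names homogeneous add]:
 assumes x: "x \<in> cocycles A"
  and hom: "!!n x. x \<in> gr A n ==> dif A x = \<zero>\<^sub>A ==> P x"
  and add: "!!x y. x \<in>: A ==> y \<in>: A ==> P x ==> P y ==> P (x \<oplus>\<^sub>A y)"
 shows "P x"
proof -
 note xc = cocyclesD(1)[OF x]
 have "P (cx.comp x n)" for n
  by (rule hom[OF cx.comp_V[OF xc] cocyclesD(2)[OF cx.comp_cocycle[OF x]]])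
 moreover have "P \<zero>\<^sub>A" by (rule hom[OF cx.V_zero]) simp
 ultimately have "P (\<Oplus>\<^sub>A n\<in>{n. cx.comp x n ~= \<zero>\<^sub>A}. cx.comp x n)"
  by (intro cx.finsum_induct_closed[where P = P] add) (use cx.comp_closed[OF xc] in auto)
 thus ?thesis unfolding cx.sum_comp[OF xc] .
qed

lemma mult_cocycles:
 assumes "x \<in> cocycles A" "y \<in> cocycles A"
 shows "x \<otimes>\<^sub>A y \<in> cocycles A"
proof (rule cocyclesI)
 note c = cocyclesD[OF assms(1)] cocyclesD[OF assms(2)]
 show "x \<otimes>\<^sub>A y \<in>: A" using c by simp
 show "dif A (x \<otimes>\<^sub>A y) = \<zero>\<^sub>A" using assms(1)
 proof (induction rule: cocycle_induct)
  case (homogeneous n x)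
  thus ?case using leibniz[OF homogeneous(1) c(3)] c cx.V_closed[OF homogeneous(1)] by simp
 next
  case (add x x')
  thus ?case using c by (simp add: alg.l_distr cx.dif_add)
 qed
qed

lemma mult_coboundary_left:
 assumes b: "b \<in> coboundaries A" and y: "y \<in> cocycles A"
 shows "b \<otimes>\<^sub>A y \<in> coboundaries A"
proof -
 note c = cocyclesD[OF y]
 obtain u where u: "u \<in>: A" "b = dif A u" using b by (auto simp: coboundaries_def)
 have "dif A u \<otimes>\<^sub>A y = dif A (u \<otimes>\<^sub>A y)" using u(1)
 proof (induction rule: cx.graded_induct)
  case (homogeneous n u)
  thus ?case using leibniz[OF homogeneous c(1)] c cx.V_closed[OF homogeneous] by simp
 next
  case (add u u')
  thus ?case using c by (simp add: alg.l_distr cx.dif_add)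
 qed
 thus ?thesis unfolding coboundaries_def using u c by (intro image_eqI[of _ _ "u \<otimes>\<^sub>A y"]) auto
qed

lemma mult_coboundary_right:
 assumes x: "x \<in> cocycles A" and b: "b \<in> coboundaries A"
 shows "x \<otimes>\<^sub>A b \<in> coboundaries A"
proof -
 note c = cocyclesD[OF x]
 obtain u where u: "u \<in>: A" "b = dif A u" using b by (auto simp: coboundaries_def)
 have "x \<otimes>\<^sub>A dif A u \<in> coboundaries A" using x
 proof (induction rule: cocycle_induct)
  case (homogeneous n x)
  have xc: "x \<in>: A" using cx.V_closed[OF homogeneous(1)] .
  have "dif A (x \<otimes>\<^sub>A u) = sgn_pow A n (x \<otimes>\<^sub>A dif A u)"
   using leibniz[OF homogeneous(1) u(1)] homogeneous(2) xc u(1) by simp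
  hence "dif A (sgn_pow A n (x \<otimes>\<^sub>A u)) = x \<otimes>\<^sub>A dif A u"
   using xc u(1) by (simp add: cx.dif_sgn)
  thus ?case unfolding coboundaries_def
   using xc u(1) by (intro image_eqI[of _ _ "sgn_pow A n (x \<otimes>\<^sub>A u)"]) auto
 next
  case (add x x')
  thus ?case using u(1) by (simp add: alg.l_distr)
 qed
 thus ?thesis using u by simp
qed

lemma cohom_mult:
 assumes x: "x \<in> cocycles A" and y: "y \<in> cocycles A"
 shows "HA.cls x \<otimes>\<^bsub>cohom A\<^esub> HA.cls y = HA.cls (x \<otimes>\<^sub>A y)"
proof -
 note xc = cocyclesD(1)[OF x] and yc = cocyclesD(1)[OF y]
 have eq: "HA.cls (x' \<otimes>\<^sub>A y') = HA.cls (x \<otimes>\<^sub>A y)" if x': "x' \<in> HA.cls x" and y': "y' \<in> HA.cls y" for x' y'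
 proof -
  have x'c: "x' \<in>: A" "x' \<ominus>\<^sub>A x \<in> coboundaries A"
   using HA.cls_memD[OF x' xc] HA.cls_eq_iff[of x' x] xc by auto
  have y'c: "y' \<in>: A" "y' \<ominus>\<^sub>A y \<in> coboundaries A"
   using HA.cls_memD[OF y' yc] HA.cls_eq_iff[of y' y] yc by auto
  have "x' = (x' \<ominus>\<^sub>A x) \<oplus>\<^sub>A x" using alg.minus_cancel[OF x'c(1) xc] by simp
  moreover have "(x' \<ominus>\<^sub>A x) \<oplus>\<^sub>A x \<in> cocycles A"
   using x x'c(2) HA.B_le_Z by (intro HA.Z.a_closed) auto
  ultimately have x'z: "x' \<in> cocycles A" by simp
  have "x' \<otimes>\<^sub>A y' \<ominus>\<^sub>A x \<otimes>\<^sub>A y = x' \<otimes>\<^sub>A (y' \<ominus>\<^sub>A y) \<oplus>\<^sub>A (x' \<ominus>\<^sub>A x) \<otimes>\<^sub>A y"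
   using xc yc x'c y'c by (simp add: a_minus_def alg.r_distr alg.l_distr alg.l_minus alg.r_minus
     alg.a_ac alg.r_neg1 alg.r_neg2 alg.r_neg alg.l_neg alg.cancel_simps)
  also have "... \<in> coboundaries A"
   using mult_coboundary_right[OF x'z y'c(2)] mult_coboundary_left[OF x'c(2) y] by (rule HA.B.a_closed)
  finally show ?thesis using HA.cls_eq_iff[of "x' \<otimes>\<^sub>A y'" "x \<otimes>\<^sub>A y"] xc yc x'c y'c by simp
 qed
 have "HA.cls x \<otimes>\<^bsub>cohom A\<^esub> HA.cls y = (\<Union>x'\<in>HA.cls x. \<Union>y'\<in>HA.cls y. HA.cls (x' \<otimes>\<^sub>A y'))"
  by (simp add: cohom_def subquot_def rcoset_mult_def)
 also have "... = (\<Union>x'\<in>HA.cls x. \<Union>y'\<in>HA.cls y. HA.cls (x \<otimes>\<^sub>A y))"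
  using eq by (intro SUP_cong refl)
 also have "... = HA.cls (x \<otimes>\<^sub>A y)"
  using HA.cls_self[OF xc] HA.cls_self[OF yc] by blast
 finally show ?thesis .
qed

lemma smult_additive: "c \<in>: K ==> additive_map A A (%x. c \<odot>\<^sub>A x)"
 by (rule additive_mapI) (auto simp: Module.module.smult_r_distr[OF module])

lemma smult_cocycles: "c \<in>: K ==> x \<in> cocycles A ==> c \<odot>\<^sub>A x \<in> cocycles A"
 using cocyclesD[of x A] Module.module.smult_r_null[OF module, of c]
 by (intro cocyclesI) (auto simp: dif_smult)

lemma smult_coboundaries: "c \<in>: K ==> x \<in> coboundaries A ==> c \<odot>\<^sub>A x \<in> coboundaries A"
 unfolding coboundaries_def by (auto simp: dif_smult[symmetric])

lemma cohom_smult: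
 assumes c: "c \<in>: K" and x: "x \<in> cocycles A"
 shows "c \<odot>\<^bsub>cohom A\<^esub> HA.cls x = HA.cls (c \<odot>\<^sub>A x)"
 unfolding cohom_SQ using cocyclesD(1)[OF x]
 by (rule HA.SQ_smult[OF _ smult_additive[OF c] smult_coboundaries[OF c]])

lemma cohom_add:
 "x \<in> cocycles A ==> y \<in> cocycles A ==> HA.cls x \<oplus>\<^bsub>cohom A\<^esub> HA.cls y = HA.cls (x \<oplus>\<^sub>A y)"
 unfolding cohom_SQ using cocyclesD(1) by (metis HA.SQ_add)

lemma cohom_one: "\<one>\<^bsub>cohom A\<^esub> = HA.cls \<one>\<^sub>A"
 by (simp add: cohom_def subquot_def)

lemma cohom_zero: "\<zero>\<^bsub>cohom A\<^esub> = coboundaries A"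
 by (simp add: cohom_def subquot_def)

lemma cohom_gr: "gr (cohom A) n = HA.cls ` (cocycles A \<inter> gr A n)"
 by (simp add: cohom_def subquot_def)

lemma cohom_dif: "X \<in>: (cohom A) ==> dif (cohom A) X = \<zero>\<^bsub>cohom A\<^esub>"
proof -
 assume "X \<in>: (cohom A)"
 then obtain x where x: "x \<in> cocycles A" "X = HA.cls x" unfolding cohom_carrier by blast
 show ?thesis unfolding x(2) cohom_zero unfolding cohom_SQ HA.SQ_dif[OF cocyclesD(1)[OF x(1)]] cocyclesD(2)[OF x(1)]
  by (rule HA.cls_zero[OF HA.B.zero_closed])
qed

text \<open>Cohomology is again a DG algebra, with zero differential; this makes the Ext-algebra available
 as a ground algebra for modules.\<close>

theorem cohom_dg_algebra: "dg_algebra K (cohom A)"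
proof -
 interpret C: cochain_complex "cohom A" unfolding cohom_SQ by (rule HA.SQ_complex)
 have cls: "\<exists>x\<in>cocycles A. X = HA.cls x" if "X \<in>: (cohom A)" for X
  using that unfolding cohom_carrier by blast
 have clsI: "HA.cls x \<in>: (cohom A)" if "x \<in> cocycles A" for x
  using that unfolding cohom_carrier by blast
 have grI: "HA.cls x \<in> gr (cohom A) n" if "x \<in> cocycles A" "x \<in> gr A n" for x n
  using that unfolding cohom_gr by blast
 have cls_gr: "\<exists>x\<in>cocycles A. x \<in> gr A n \<and> X = HA.cls x" if "X \<in> gr (cohom A) n" for X n
  using that unfolding cohom_gr by blast
 note simps = cohom_mult cohom_add cohom_smult mult_cocycles smult_cocycles
 have mc: "X \<otimes>\<^bsub>cohom A\<^esub> Y \<in>: (cohom A)" if "X \<in>: (cohom A)" "Y \<in>: (cohom A)" for X Y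
  using cls[OF that(1)] cls[OF that(2)] clsI[OF mult_cocycles] cohom_mult by auto
 have sc: "c \<odot>\<^bsub>cohom A\<^esub> X \<in>: (cohom A)" if "c \<in>: K" "X \<in>: (cohom A)" for c X
  using cls[OF that(2)] clsI[OF smult_cocycles[OF that(1)]] cohom_smult[OF that(1)] by auto
 have zc: "\<zero>\<^bsub>cohom A\<^esub> \<in>: (cohom A)" by simp
 have aZ: "x \<oplus>\<^sub>A y \<in> cocycles A" if "x \<in> cocycles A" "y \<in> cocycles A" for x y
  using that by (rule HA.Z.a_closed)
 have ring: "ring (cohom A)"
 proof (rule ringI[OF C.is_ab])
  show "Group.monoid (cohom A)"
  proof (rule monoidI)
   show "\<one>\<^bsub>cohom A\<^esub> \<in>: (cohom A)" unfolding cohom_one by (rule clsI[OF one_cocycle])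
   fix X assume X: "X \<in>: (cohom A)"
   obtain x where x: "x \<in> cocycles A" "X = HA.cls x" using cls[OF X] by blast
   show "\<one>\<^bsub>cohom A\<^esub> \<otimes>\<^bsub>cohom A\<^esub> X = X"
    unfolding cohom_one x(2) cohom_mult[OF one_cocycle x(1)] alg.l_one[OF cocyclesD(1)[OF x(1)]] ..
   show "X \<otimes>\<^bsub>cohom A\<^esub> \<one>\<^bsub>cohom A\<^esub> = X"
    unfolding cohom_one x(2) cohom_mult[OF x(1) one_cocycle] alg.r_one[OF cocyclesD(1)[OF x(1)]] ..
   fix Y Z assume Y: "Y \<in>: (cohom A)" and Z: "Z \<in>: (cohom A)"
   obtain y z where y: "y \<in> cocycles A" "Y = HA.cls y" and z: "z \<in> cocycles A" "Z = HA.cls z"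
    using cls[OF Y] cls[OF Z] by blast
   show "X \<otimes>\<^bsub>cohom A\<^esub> Y \<otimes>\<^bsub>cohom A\<^esub> Z = X \<otimes>\<^bsub>cohom A\<^esub> (Y \<otimes>\<^bsub>cohom A\<^esub> Z)"
    unfolding x(2) y(2) z(2) using x(1) y(1) z(1) cocyclesD(1) by (simp add: simps alg.m_assoc)
  qed (rule mc)
  fix X Y Z assume "X \<in>: (cohom A)" "Y \<in>: (cohom A)" "Z \<in>: (cohom A)"
  then obtain x y z where x: "x \<in> cocycles A" "X = HA.cls x" and y: "y \<in> cocycles A" "Y = HA.cls y"
   and z: "z \<in> cocycles A" "Z = HA.cls z" using cls by metis
  note c = cocyclesD(1)[OF x(1)] cocyclesD(1)[OF y(1)] cocyclesD(1)[OF z(1)]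
  show "(X \<oplus>\<^bsub>cohom A\<^esub> Y) \<otimes>\<^bsub>cohom A\<^esub> Z = X \<otimes>\<^bsub>cohom A\<^esub> Z \<oplus>\<^bsub>cohom A\<^esub> Y \<otimes>\<^bsub>cohom A\<^esub> Z"
   unfolding x(2) y(2) z(2) using x(1) y(1) z(1) by (simp add: simps aZ alg.l_distr c)
  show "Z \<otimes>\<^bsub>cohom A\<^esub> (X \<oplus>\<^bsub>cohom A\<^esub> Y) = Z \<otimes>\<^bsub>cohom A\<^esub> X \<oplus>\<^bsub>cohom A\<^esub> Z \<otimes>\<^bsub>cohom A\<^esub> Y"
   unfolding x(2) y(2) z(2) using x(1) y(1) z(1) by (simp add: simps aZ alg.r_distr c)
 qed
 interpret CR: ring "cohom A" by (rule ring)
 show ?thesis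
 proof (intro dg_algebra.intro field ring)
  show "Module.module K (cohom A)"
  proof (rule moduleI[OF K_cring C.is_ab sc])
   fix c X assume c: "c \<in>: K" and X: "X \<in>: (cohom A)"
   obtain x where x: "x \<in> cocycles A" "X = HA.cls x" using cls[OF X] by blast
   note xc = cocyclesD(1)[OF x(1)]
   show "(c \<oplus>\<^sub>K c') \<odot>\<^bsub>cohom A\<^esub> X = c \<odot>\<^bsub>cohom A\<^esub> X \<oplus>\<^bsub>cohom A\<^esub> c' \<odot>\<^bsub>cohom A\<^esub> X" if c': "c' \<in>: K" for c'
    unfolding x(2) using c c' x(1) ring.ring_simprules(1)[OF K_ring c c'] module.smult_l_distr[OF module c c' xc]
    by (simp add: simps)
   show "(c \<otimes>\<^sub>K c') \<odot>\<^bsub>cohom A\<^esub> X = c \<odot>\<^bsub>cohom A\<^esub> (c' \<odot>\<^bsub>cohom A\<^esub> X)" if c': "c' \<in>: K" for c'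
    unfolding x(2) using c c' x(1) ring.ring_simprules(5)[OF K_ring c c'] module.smult_assoc1[OF module c c' xc]
    by (simp add: simps)
   fix Y assume Y: "Y \<in>: (cohom A)"
   obtain y where y: "y \<in> cocycles A" "Y = HA.cls y" using cls[OF Y] by blast
   note yc = cocyclesD(1)[OF y(1)]
   show "c \<odot>\<^bsub>cohom A\<^esub> (X \<oplus>\<^bsub>cohom A\<^esub> Y) = c \<odot>\<^bsub>cohom A\<^esub> X \<oplus>\<^bsub>cohom A\<^esub> c \<odot>\<^bsub>cohom A\<^esub> Y"
    unfolding x(2) y(2) using c x(1) y(1) module.smult_r_distr[OF module c xc yc]
    by (simp add: simps aZ)
  next
   fix X assume X: "X \<in>: (cohom A)"
   obtain x where x: "x \<in> cocycles A" "X = HA.cls x" using cls[OF X] by blast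
   show "\<one>\<^sub>K \<odot>\<^bsub>cohom A\<^esub> X = X"
    unfolding x(2) cohom_smult[OF K_one x(1)] module.smult_one[OF module cocyclesD(1)[OF x(1)]] ..
  qed
  show "c \<odot>\<^bsub>cohom A\<^esub> (X \<otimes>\<^bsub>cohom A\<^esub> Y) = (c \<odot>\<^bsub>cohom A\<^esub> X) \<otimes>\<^bsub>cohom A\<^esub> Y"
   and "c \<odot>\<^bsub>cohom A\<^esub> (X \<otimes>\<^bsub>cohom A\<^esub> Y) = X \<otimes>\<^bsub>cohom A\<^esub> (c \<odot>\<^bsub>cohom A\<^esub> Y)"
   if c: "c \<in>: K" and XY: "X \<in>: (cohom A)" "Y \<in>: (cohom A)" for c X Y
  proof -
   obtain x y where x: "x \<in> cocycles A" "X = HA.cls x" and y: "y \<in> cocycles A" "Y = HA.cls y"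
    using cls[OF XY(1)] cls[OF XY(2)] by blast
   note m = smult_mult_left[OF c cocyclesD(1)[OF x(1)] cocyclesD(1)[OF y(1)]]
    and m' = smult_mult_right[OF c cocyclesD(1)[OF x(1)] cocyclesD(1)[OF y(1)]]
   show "c \<odot>\<^bsub>cohom A\<^esub> (X \<otimes>\<^bsub>cohom A\<^esub> Y) = (c \<odot>\<^bsub>cohom A\<^esub> X) \<otimes>\<^bsub>cohom A\<^esub> Y"
    unfolding x(2) y(2) using c x(1) y(1) by (simp add: simps m[symmetric])
   show "c \<odot>\<^bsub>cohom A\<^esub> (X \<otimes>\<^bsub>cohom A\<^esub> Y) = X \<otimes>\<^bsub>cohom A\<^esub> (c \<odot>\<^bsub>cohom A\<^esub> Y)"
    unfolding x(2) y(2) using c x(1) y(1) by (simp add: simps m'[symmetric])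
  qed
  show "graded_by (cohom A) (gr (cohom A))" by (rule C.graded)
  show "c \<odot>\<^bsub>cohom A\<^esub> X \<in> gr (cohom A) n" if c: "c \<in>: K" and X: "X \<in> gr (cohom A) n" for c X n
  proof -
   obtain x where x: "x \<in> cocycles A" "x \<in> gr A n" "X = HA.cls x" using cls_gr[OF X] by blast
   show ?thesis unfolding x(3) cohom_smult[OF c x(1)] by (rule grI[OF smult_cocycles[OF c x(1)] smult_gr[OF c x(2)]])
  qed
  show "\<one>\<^bsub>cohom A\<^esub> \<in> gr (cohom A) 0" unfolding cohom_one by (rule grI[OF one_cocycle one_gr])
  show "X \<otimes>\<^bsub>cohom A\<^esub> Y \<in> gr (cohom A) (i + j)" if XY: "X \<in> gr (cohom A) i" "Y \<in> gr (cohom A) j" for X Y i j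
  proof -
   obtain x y where x: "x \<in> cocycles A" "x \<in> gr A i" "X = HA.cls x"
    and y: "y \<in> cocycles A" "y \<in> gr A j" "Y = HA.cls y" using cls_gr[OF XY(1)] cls_gr[OF XY(2)] by blast
   show ?thesis unfolding x(3) y(3) cohom_mult[OF x(1) y(1)]
    by (rule grI[OF mult_cocycles[OF x(1) y(1)] mult_gr[OF x(2) y(2)]])
  qed
  show "dif (cohom A) X \<in> gr (cohom A) (n + 1)" if "X \<in> gr (cohom A) n" for X n using C.dif_gr[OF that] .
  show "dif (cohom A) (X \<oplus>\<^bsub>cohom A\<^esub> Y) = dif (cohom A) X \<oplus>\<^bsub>cohom A\<^esub> dif (cohom A) Y"
   if "X \<in>: (cohom A)" "Y \<in>: (cohom A)" for X Y using C.dif_add[OF that] .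
  show "dif (cohom A) (c \<odot>\<^bsub>cohom A\<^esub> X) = c \<odot>\<^bsub>cohom A\<^esub> dif (cohom A) X"
   if c: "c \<in>: K" and X: "X \<in>: (cohom A)" for c X
  proof -
   have "c \<odot>\<^bsub>cohom A\<^esub> \<zero>\<^bsub>cohom A\<^esub> = \<zero>\<^bsub>cohom A\<^esub>"
    using cohom_smult[OF c HA.Z.zero_closed] Module.module.smult_r_null[OF module c]
     HA.cls_zero[OF HA.B.zero_closed] unfolding cohom_zero by simp
   thus ?thesis unfolding cohom_dif[OF sc[OF c X]] cohom_dif[OF X] by simp
  qed
  show "dif (cohom A) (dif (cohom A) X) = \<zero>\<^bsub>cohom A\<^esub>" if "X \<in>: (cohom A)" for X
   using C.dif_dif[OF that] .
  show "dif (cohom A) (X \<otimes>\<^bsub>cohom A\<^esub> Y) = dif (cohom A) X \<otimes>\<^bsub>cohom A\<^esub> Y \<oplus>\<^bsub>cohom A\<^esub>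
    sgn_pow (cohom A) i (X \<otimes>\<^bsub>cohom A\<^esub> dif (cohom A) Y)"
   if "X \<in> gr (cohom A) i" and Y: "Y \<in>: (cohom A)" for X Y i
  proof -
   have X: "X \<in>: (cohom A)" using C.V_closed[OF that(1)] .
   show ?thesis unfolding cohom_dif[OF X] cohom_dif[OF Y] cohom_dif[OF mc[OF X Y]] using X Y by simp
  qed
 qed
qed

end

lemma concentrated_graded:
 assumes "abelian_group G"
 shows "graded_by G (%n::int. if n = 0 then carrier G else {\<zero>\<^sub>G})"
proof (rule graded_byI[OF assms, where p = "%n x. if n = 0 then x else \<zero>\<^sub>G"])
 interpret G: abelian_group G by fact
 show "subgroup (if n = 0 then carrier G else {\<zero>\<^sub>G}) (add_monoid G)" for n :: int
  by (rule G.add_subgroupI) (auto split: if_splits)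
 show "additive_map G G (%x. if n = 0 then x else \<zero>\<^sub>G)" for n :: int
  by (rule additive_mapI) auto
 show "\<exists>c. is_decomp G (%n. if n = 0 then carrier G else {\<zero>\<^sub>G}) x c" if x: "x \<in>: G" for x
 proof (rule exI[of _ "%n. if n = 0 then x else \<zero>\<^sub>G"])
  have eq: "{n::int. (if n = 0 then x else \<zero>\<^sub>G) ~= \<zero>\<^sub>G} = (if x = \<zero>\<^sub>G then {} else {0})" by auto
  show "is_decomp G (%n. if n = 0 then carrier G else {\<zero>\<^sub>G}) x (%n. if n = 0 then x else \<zero>\<^sub>G)"
   unfolding is_decomp_def eq using x by auto
 qed
qed (auto split: if_splits)

lemma ungraded_simps [simp]:
 "carrier (ungraded E) = carrier E" "add (ungraded E) = add E" "zero (ungraded E) = zero E"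
 "mult (ungraded E) = mult E" "one (ungraded E) = one E" "smult (ungraded E) = smult E"
 "gr (ungraded E) n = (if n = 0 then carrier E else {\<zero>\<^sub>E})" "dif (ungraded E) x = \<zero>\<^sub>E"
 by (simp_all add: ungraded_def)

lemma ring_cong_structure:
 assumes "ring R" "carrier R = carrier S" "add R = add S" "zero R = zero S" "mult R = mult S" "one R = one S"
 shows "ring S"
proof -
 interpret R: ring R by fact
 show ?thesis
 proof (rule ringI)
  show "abelian_group S" by (rule abelian_group_cong_structure[OF R.is_ab assms(2-4)])
  show "Group.monoid S"
   using R.one_closed R.m_closed R.m_assoc R.l_one R.r_one unfolding assms(2-6) by (intro monoidI) auto
 qed (use R.l_distr R.r_distr in \<open>auto simp: assms(2-6)\<close>)
qed

theorem ungraded_dg_algebra: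
 assumes "dg_algebra K E"
 shows "dg_algebra K (ungraded E)"
proof -
 interpret E: dg_algebra K E by fact
 note cong = ring_cong_structure[OF E.ring, of "ungraded E"]
 have R: "ring (ungraded E)" by (rule cong) simp_all
 interpret R: ring "ungraded E" by (rule R)
 have M: "Module.module K (ungraded E)"
  using Module.module.smult_l_distr[OF E.module] Module.module.smult_r_distr[OF E.module]
   Module.module.smult_assoc1[OF E.module] Module.module.smult_one[OF E.module]
  by (intro moduleI[OF E.K_cring R.is_ab]) simp_all
 note [simp] = Module.module.smult_r_null[OF E.module]
 have z: "\<zero>\<^sub>E = \<zero>\<^bsub>ungraded E\<^esub>" by simp
 have gr: "gr (ungraded E) = (%n. if n = 0 then carrier (ungraded E) else {\<zero>\<^bsub>ungraded E\<^esub>})"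
  by (rule ext) simp
 show ?thesis
 proof (intro dg_algebra.intro E.field R M)
  show "graded_by (ungraded E) (gr (ungraded E))"
   unfolding gr by (rule concentrated_graded[OF R.is_ab])
  show "dif (ungraded E) (x \<otimes>\<^bsub>ungraded E\<^esub> y) =
   dif (ungraded E) x \<otimes>\<^bsub>ungraded E\<^esub> y \<oplus>\<^bsub>ungraded E\<^esub> sgn_pow (ungraded E) i (x \<otimes>\<^bsub>ungraded E\<^esub> dif (ungraded E) y)"
   if "x \<in> gr (ungraded E) i" "y \<in>: (ungraded E)" for x y i
  proof -
   have x: "x \<in>: (ungraded E)" using that(1) by (auto split: if_splits)
   have "dif (ungraded E) u = \<zero>\<^bsub>ungraded E\<^esub>" for u by simp
   thus ?thesis using R.l_null[OF that(2)] R.r_null[OF x] R.sgn_zero R.l_zero R.zero_closed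
    by presburger
  qed
 qed (auto simp: E.smult_mult_left[symmetric] E.smult_mult_right[symmetric] split: if_splits)
qed

section \<open>Correspondences between DG algebras\<close>

text \<open>A zigzag of quasi-isomorphisms whose middle term is no algebra can still be multiplicative: the
 locale records the relation between cocycles that such a zigzag defines, and
 \<open>cohomology_isomorphic\<close> turns it into an isomorphism.\<close>

locale graded_correspondence = X: dg_algebra K X + Y: dg_algebra K Y
 for K :: "('k, 'c) ring_scheme" and X :: "('k, 'x) dg" and Y :: "('k, 'y) dg" +
 fixes R :: "int => 'x => 'y => bool"
 assumes R_dom: "R n x y ==> x \<in> gr X n" "R n x y ==> dif X x = \<zero>\<^sub>X"
  and R_ran: "R n x y ==> y \<in> gr Y n" "R n x y ==> dif Y y = \<zero>\<^sub>Y"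
  and R_zero: "R n \<zero>\<^sub>X \<zero>\<^sub>Y"
  and R_add: "R n x y ==> R n x' y' ==> R n (x \<oplus>\<^sub>X x') (y \<oplus>\<^sub>Y y')"
  and R_minus: "R n x y ==> R n x' y' ==> R n (x \<ominus>\<^sub>X x') (y \<ominus>\<^sub>Y y')"
  and R_smult: "c \<in>: K ==> R n x y ==> R n (c \<odot>\<^sub>X x) (c \<odot>\<^sub>Y y)"
  and R_mult: "R m x y ==> R n x' y' ==> R (m + n) (x \<otimes>\<^sub>X x') (y \<otimes>\<^sub>Y y')"
  and R_one: "R 0 \<one>\<^sub>X \<one>\<^sub>Y"
  and R_total: "x \<in> gr X n ==> dif X x = \<zero>\<^sub>X ==> \<exists>y. R n x y"
  and R_onto: "y \<in> gr Y n ==> dif Y y = \<zero>\<^sub>Y ==> \<exists>x. R n x y"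
  and R_coboundary: "R n x y ==> x \<in> coboundaries X \<longleftrightarrow> y \<in> coboundaries Y"
begin

text \<open>The relation extended to arbitrary elements, degree by degree.\<close>

definition rel :: "'x => 'y => bool" where
 "rel x y \<longleftrightarrow> x \<in>: X \<and> y \<in>: Y \<and> (\<forall>n. R n (X.cx.comp x n) (Y.cx.comp y n))"

lemma rel_closed: "rel x y ==> x \<in>: X" "rel x y ==> y \<in>: Y"
 by (simp_all add: rel_def)

lemma rel_R: "rel x y ==> R n (X.cx.comp x n) (Y.cx.comp y n)"
 by (simp add: rel_def)

lemma R_rel:
 assumes r: "R n x y"
 shows "rel x y"
 unfolding rel_def
proof (intro conjI allI)
 show "x \<in>: X" "y \<in>: Y"
  using X.cx.V_closed[OF R_dom(1)[OF r]] Y.cx.V_closed[OF R_ran(1)[OF r]] .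
 show "R m (X.cx.comp x m) (Y.cx.comp y m)" for m
  unfolding X.cx.comp_V_eq[OF R_dom(1)[OF r]] Y.cx.comp_V_eq[OF R_ran(1)[OF r]]
  using r R_zero by simp
qed

lemma rel_add: "rel x y ==> rel x' y' ==> rel (x \<oplus>\<^sub>X x') (y \<oplus>\<^sub>Y y')"
 unfolding rel_def by (simp add: X.cx.comp_add Y.cx.comp_add R_add)

lemma rel_minus: "rel x y ==> rel x' y' ==> rel (x \<ominus>\<^sub>X x') (y \<ominus>\<^sub>Y y')"
 unfolding rel_def by (simp add: X.cx.comp_minus Y.cx.comp_minus R_minus)

lemma rel_cocycle:
 assumes "rel x y"
 shows "x \<in> cocycles X" "y \<in> cocycles Y"
proof -
 note c = rel_closed[OF assms]
 show "x \<in> cocycles X"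
 proof (rule cocyclesI[OF c(1)], rule X.cx.comp_eq_zeroI[OF X.cx.dif_closed[OF c(1)]])
  show "X.cx.comp (dif X x) n = \<zero>\<^sub>X" for n
   unfolding X.cx.comp_dif'[OF c(1)] by (rule R_dom(2)[OF rel_R[OF assms]])
 qed
 show "y \<in> cocycles Y"
 proof (rule cocyclesI[OF c(2)], rule Y.cx.comp_eq_zeroI[OF Y.cx.dif_closed[OF c(2)]])
  show "Y.cx.comp (dif Y y) n = \<zero>\<^sub>Y" for n
   unfolding Y.cx.comp_dif'[OF c(2)] by (rule R_ran(2)[OF rel_R[OF assms]])
 qed
qed

lemma rel_induct [consumes 1, case_names homogeneous add]:
 assumes r: "rel x y" and hom: "!!n x y. R n x y ==> P x y"
  and add: "!!x y x' y'. rel x y ==> rel x' y' ==> P x y ==> P x' y' ==> P (x \<oplus>\<^sub>X x') (y \<oplus>\<^sub>Y y')"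
 shows "P x y"
proof -
 note c = rel_closed[OF r]
 let ?S = "{n. X.cx.comp x n ~= \<zero>\<^sub>X} \<union> {n. Y.cx.comp y n ~= \<zero>\<^sub>Y}"
 have fin: "finite ?S" using X.cx.finite_comp[OF c(1)] Y.cx.finite_comp[OF c(2)] by simp
 have "rel (\<Oplus>\<^sub>X n\<in>S. X.cx.comp x n) (\<Oplus>\<^sub>Y n\<in>S. Y.cx.comp y n) \<and>
   P (\<Oplus>\<^sub>X n\<in>S. X.cx.comp x n) (\<Oplus>\<^sub>Y n\<in>S. Y.cx.comp y n)" if "finite S" for S
  using that
 proof (induction S)
  case empty
  show ?case using R_rel[OF R_zero] hom[OF R_zero] by simp
 next
  case (insert n S)
  have "(\<Oplus>\<^sub>X n\<in>insert n S. X.cx.comp x n) = X.cx.comp x n \<oplus>\<^sub>X (\<Oplus>\<^sub>X n\<in>S. X.cx.comp x n)"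
   using insert(1,2) X.cx.comp_closed[OF c(1)] by (intro X.alg.finsum_insert) auto
  moreover have "(\<Oplus>\<^sub>Y n\<in>insert n S. Y.cx.comp y n) = Y.cx.comp y n \<oplus>\<^sub>Y (\<Oplus>\<^sub>Y n\<in>S. Y.cx.comp y n)"
   using insert(1,2) Y.cx.comp_closed[OF c(2)] by (intro Y.alg.finsum_insert) auto
  ultimately show ?case
   using insert(3) rel_R[OF r, of n] R_rel hom rel_add add by simp
 qed
 from this[OF fin] show ?thesis
  unfolding X.cx.sum_comp_superset[OF c(1) fin Un_upper1] Y.cx.sum_comp_superset[OF c(2) fin Un_upper2]
  by simp
qed

lemma rel_mult:
 assumes "rel x y" "rel x' y'"
 shows "rel (x \<otimes>\<^sub>X x') (y \<otimes>\<^sub>Y y')"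
 using assms(1)
proof (induction rule: rel_induct)
 case (homogeneous m x y)
 note xy = homogeneous
 have c: "x \<in>: X" "y \<in>: Y" using rel_closed[OF R_rel[OF xy]] .
 show ?case using assms(2)
 proof (induction rule: rel_induct)
  case (homogeneous n x' y')
  show ?case by (rule R_rel[OF R_mult[OF xy homogeneous]])
 next
  case (add u v u' v')
  show ?case using rel_add[OF add(3,4)] c rel_closed[OF add(1)] rel_closed[OF add(2)]
   by (simp add: X.alg.r_distr Y.alg.r_distr)
 qed
next
 case (add u v u' v')
 show ?case using rel_add[OF add(3,4)] rel_closed[OF assms(2)] rel_closed[OF add(1)] rel_closed[OF add(2)]
  by (simp add: X.alg.l_distr Y.alg.l_distr)
qed

lemma rel_smult:
 assumes c: "c \<in>: K" and "rel x y"
 shows "rel (c \<odot>\<^sub>X x) (c \<odot>\<^sub>Y y)"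
 using assms(2)
proof (induction rule: rel_induct)
 case (homogeneous n x y)
 show ?case by (rule R_rel[OF R_smult[OF c homogeneous]])
next
 case (add u v u' v')
 show ?case using rel_add[OF add(3,4)] rel_closed[OF add(1)] rel_closed[OF add(2)]
  by (simp add: module.smult_r_distr[OF X.module c] module.smult_r_distr[OF Y.module c])
qed

lemma rel_total:
 assumes "x \<in> cocycles X"
 shows "\<exists>y. rel x y"
 using assms
proof (induction rule: X.cocycle_induct)
 case (homogeneous n x)
 thus ?case using R_total R_rel by blast
next
 case (add x y)
 thus ?case using rel_add by blast
qed

lemma rel_onto:
 assumes "y \<in> cocycles Y"
 shows "\<exists>x. rel x y"
 using assms
proof (induction rule: Y.cocycle_induct)
 case (homogeneous n x)
 thus ?case using R_onto R_rel by blast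
next
 case (add x y)
 thus ?case using rel_add by blast
qed

lemma rel_coboundary:
 assumes "rel x y"
 shows "x \<in> coboundaries X \<longleftrightarrow> y \<in> coboundaries Y"
 unfolding X.cx.coboundary_comp_iff[OF rel_closed(1)[OF assms]]
  Y.cx.coboundary_comp_iff[OF rel_closed(2)[OF assms]]
 using R_coboundary[OF rel_R[OF assms]] by simp

lemma rel_cls_iff:
 assumes "rel x y" "rel x' y'"
 shows "X.HA.cls x = X.HA.cls x' \<longleftrightarrow> Y.HA.cls y = Y.HA.cls y'"
 unfolding X.HA.cls_eq_iff[OF rel_closed(1)[OF assms(1)] rel_closed(1)[OF assms(2)]]
  Y.HA.cls_eq_iff[OF rel_closed(2)[OF assms(1)] rel_closed(2)[OF assms(2)]]
 by (rule rel_coboundary[OF rel_minus[OF assms]])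

definition iso :: "'x set => 'y set" where
 "iso U = (THE W. \<exists>x y. rel x y \<and> U = X.HA.cls x \<and> W = Y.HA.cls y)"

lemma iso_cls:
 assumes "rel x y"
 shows "iso (X.HA.cls x) = Y.HA.cls y"
 unfolding iso_def
proof (rule the_equality)
 show "\<exists>x' y'. rel x' y' \<and> X.HA.cls x = X.HA.cls x' \<and> Y.HA.cls y = Y.HA.cls y'"
  by (intro exI conjI) (rule assms, rule refl, rule refl)
 fix W assume "\<exists>x' y'. rel x' y' \<and> X.HA.cls x = X.HA.cls x' \<and> W = Y.HA.cls y'"
 then obtain x' y' where r: "rel x' y'" and eq: "X.HA.cls x = X.HA.cls x'" and W: "W = Y.HA.cls y'"
  by (elim exE conjE)
 show "W = Y.HA.cls y" unfolding W by (rule sym, rule iffD1[OF rel_cls_iff[OF assms r] eq])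
qed

theorem cohomology_isomorphic: "graded_algebra_isomorphic K (cohom X) (cohom Y)"
 unfolding graded_algebra_isomorphic_def
proof (intro bexI[of _ iso] conjI ballI allI)
 have ex: "\<exists>x y. rel x y \<and> U = X.HA.cls x" if "U \<in>: (cohom X)" for U
  using that rel_total unfolding X.cohom_carrier by (elim imageE) (metis (no_types))
 show smult: "iso (c \<odot>\<^bsub>cohom X\<^esub> U) = c \<odot>\<^bsub>cohom Y\<^esub> iso U"
  if c: "c \<in>: K" and U: "U \<in>: (cohom X)" for c U
 proof -
  obtain x y where r: "rel x y" and u: "U = X.HA.cls x" using ex[OF U] by (elim exE conjE)
  show ?thesis unfolding u iso_cls[OF r] X.cohom_smult[OF c rel_cocycle(1)[OF r]]
    Y.cohom_smult[OF c rel_cocycle(2)[OF r]] by (rule iso_cls[OF rel_smult[OF c r]])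
 qed
 show "iso ` gr (cohom X) n = gr (cohom Y) n" for n
 proof (intro equalityI subsetI)
  fix W assume "W \<in> iso ` gr (cohom X) n"
  then obtain x where x: "x \<in> cocycles X" "x \<in> gr X n" and W: "W = iso (X.HA.cls x)"
   unfolding X.cohom_gr by (elim imageE IntE) (simp only:)
  obtain y where r: "R n x y" using R_total[OF x(2) cocyclesD(2)[OF x(1)]] by (elim exE)
  show "W \<in> gr (cohom Y) n" unfolding W iso_cls[OF R_rel[OF r]] Y.cohom_gr
   by (intro imageI IntI R_ran(1)[OF r] rel_cocycle(2)[OF R_rel[OF r]])
 next
  fix W assume "W \<in> gr (cohom Y) n"
  then obtain y where y: "y \<in> cocycles Y" "y \<in> gr Y n" and W: "W = Y.HA.cls y"
   unfolding Y.cohom_gr by (elim imageE IntE) (simp only:)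
  obtain x where r: "R n x y" using R_onto[OF y(2) cocyclesD(2)[OF y(1)]] by (elim exE)
  show "W \<in> iso ` gr (cohom X) n" unfolding W iso_cls[OF R_rel[OF r], symmetric] X.cohom_gr
   by (intro imageI IntI R_dom(1)[OF r] rel_cocycle(1)[OF R_rel[OF r]])
 qed
 show "iso \<in> ring_iso (cohom X) (cohom Y)"
  unfolding ring_iso_def
 proof (intro CollectI conjI)
  have img: "iso ` carrier (cohom X) = carrier (cohom Y)"
  proof (intro equalityI subsetI)
   fix W assume "W \<in> iso ` carrier (cohom X)"
   then obtain U where U: "U \<in>: (cohom X)" "W = iso U" by (elim imageE) (simp only:)
   obtain x y where r: "rel x y" and u: "U = X.HA.cls x" using ex[OF U(1)] by (elim exE conjE)
   show "W \<in>: (cohom Y)" unfolding U(2) u iso_cls[OF r] Y.cohom_carrier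
    by (rule imageI[OF rel_cocycle(2)[OF r]])
  next
   fix W assume "W \<in>: (cohom Y)"
   then obtain y where y: "y \<in> cocycles Y" "W = Y.HA.cls y" unfolding Y.cohom_carrier by (elim imageE) (simp only:)
   obtain x where r: "rel x y" using rel_onto[OF y(1)] by (elim exE)
   show "W \<in> iso ` carrier (cohom X)" unfolding y(2) iso_cls[OF r, symmetric] X.cohom_carrier
    by (rule imageI[OF imageI[OF rel_cocycle(1)[OF r]]])
  qed
  show "bij_betw iso (carrier (cohom X)) (carrier (cohom Y))"
   unfolding bij_betw_def
  proof (intro conjI img inj_onI)
   fix U U' assume U: "U \<in>: (cohom X)" and U': "U' \<in>: (cohom X)" and eq: "iso U = iso U'"
   obtain x y where r: "rel x y" and u: "U = X.HA.cls x" using ex[OF U] by (elim exE conjE)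
   obtain x' y' where r': "rel x' y'" and u': "U' = X.HA.cls x'" using ex[OF U'] by (elim exE conjE)
   have "Y.HA.cls y = Y.HA.cls y'" using eq unfolding u u' iso_cls[OF r] iso_cls[OF r'] .
   thus "U = U'" unfolding u u' by (rule iffD2[OF rel_cls_iff[OF r r']])
  qed
  show "iso \<in> ring_hom (cohom X) (cohom Y)"
  proof (rule ring_hom_memI)
   fix U assume U: "U \<in>: (cohom X)"
   show "iso U \<in>: (cohom Y)" unfolding img[symmetric] by (rule imageI[OF U])
   fix U' assume U': "U' \<in>: (cohom X)"
   obtain x y where r: "rel x y" and u: "U = X.HA.cls x" using ex[OF U] by (elim exE conjE)
   obtain x' y' where r': "rel x' y'" and u': "U' = X.HA.cls x'" using ex[OF U'] by (elim exE conjE)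
   note z = rel_cocycle[OF r] and z' = rel_cocycle[OF r']
   show "iso (U \<otimes>\<^bsub>cohom X\<^esub> U') = iso U \<otimes>\<^bsub>cohom Y\<^esub> iso U'"
    unfolding u u' iso_cls[OF r] iso_cls[OF r'] X.cohom_mult[OF z(1) z'(1)] Y.cohom_mult[OF z(2) z'(2)]
    by (rule iso_cls[OF rel_mult[OF r r']])
   show "iso (U \<oplus>\<^bsub>cohom X\<^esub> U') = iso U \<oplus>\<^bsub>cohom Y\<^esub> iso U'"
    unfolding u u' iso_cls[OF r] iso_cls[OF r'] X.cohom_add[OF z(1) z'(1)] Y.cohom_add[OF z(2) z'(2)]
    by (rule iso_cls[OF rel_add[OF r r']])
  next
   show "iso \<one>\<^bsub>cohom X\<^esub> = \<one>\<^bsub>cohom Y\<^esub>"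
    unfolding X.cohom_one Y.cohom_one by (rule iso_cls[OF R_rel[OF R_one]])
  qed
 qed
qed

end

section \<open>Free DG modules\<close>

lemma (in graded_group) glue:
 assumes H: "abelian_group H" and h: "!!n x. x \<in> V n ==> h n x \<in>: H"
  and h_add: "!!n x y. x \<in> V n ==> y \<in> V n ==> h n (x \<oplus> y) = h n x \<oplus>\<^sub>H h n y"
 shows "\<exists>f. additive_map G H f \<and> (\<forall>n. \<forall>x\<in>V n. f x = h n x)"
proof -
 interpret H: abelian_group H by fact
 have h0: "h n \<zero> = \<zero>\<^sub>H" for n
  using h_add[OF V_zero V_zero, of n] h[OF V_zero, of n] H.add.l_cancel_one'[of "h n \<zero>" "h n \<zero>"]
  by simp
 define f where "f x = (\<Oplus>\<^sub>H n\<in>{n. comp x n ~= \<zero>}. h n (comp x n))" for x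
 have hc: "h n (comp x n) \<in>: H" if "x \<in>: G" for x n by (rule h[OF comp_V[OF that]])
 have f: "f x = (\<Oplus>\<^sub>H n\<in>S. h n (comp x n))"
  if "x \<in>: G" "finite S" "{n. comp x n ~= \<zero>} \<subseteq> S" for x S
  unfolding f_def by (rule H.finsum_superset) (use that h0 hc in auto)
 show ?thesis
 proof (intro exI[of _ f] conjI allI ballI)
  show "additive_map G H f"
  proof (rule additive_mapI)
   show "f x \<in>: H" if "x \<in>: G" for x
    unfolding f_def by (rule H.finsum_closed) (use hc[OF that] in auto)
   fix x y assume xy: "x \<in>: G" "y \<in>: G"
   let ?S = "{n. comp x n ~= \<zero>} \<union> {n. comp y n ~= \<zero>}"
   have S: "finite ?S" using xy finite_comp by simp
   have "f (x \<oplus> y) = (\<Oplus>\<^sub>H n\<in>?S. h n (comp (x \<oplus> y) n))"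
    by (rule f[OF a_closed[OF xy] S]) (auto simp: comp_add[OF xy])
   also have "... = (\<Oplus>\<^sub>H n\<in>?S. h n (comp x n) \<oplus>\<^sub>H h n (comp y n))"
    unfolding comp_add[OF xy] h_add[OF comp_V[OF xy(1)] comp_V[OF xy(2)]] ..
   also have "... = (\<Oplus>\<^sub>H n\<in>?S. h n (comp x n)) \<oplus>\<^sub>H (\<Oplus>\<^sub>H n\<in>?S. h n (comp y n))"
    by (rule H.finsum_addf) (use hc xy in auto)
   finally show "f (x \<oplus> y) = f x \<oplus>\<^sub>H f y"
    using f[OF xy(1) S] f[OF xy(2) S] by simp
  qed
  show "f x = h n x" if "x \<in> V n" for n x
  proof -
   have "f x = (\<Oplus>\<^sub>H m\<in>{n}. h m (comp x m))"
    by (rule f[OF V_closed[OF that]]) (use comp_V_eq[OF that] in \<open>auto split: if_splits\<close>)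
   thus ?thesis using that h[OF that] by simp
  qed
 qed
qed

text \<open>Multiplying the degree-\<open>i\<close> part of the algebra by \<open>(-1)\<^sup>n\<^sup>i\<close>: the sign that a linear map of
 degree \<open>n\<close> picks up.\<close>

context dg_algebra
begin

definition twist :: "int => 'a => 'a" where
 "twist n = (SOME f. additive_map A A f \<and> (\<forall>i. \<forall>a\<in>gr A i. f a = sgn_pow A (n * i) a))"

lemma twist_props: "additive_map A A (twist n) \<and> (\<forall>i. \<forall>a\<in>gr A i. twist n a = sgn_pow A (n * i) a)"
proof -
 have "\<exists>f. additive_map A A f \<and> (\<forall>i. \<forall>a\<in>gr A i. f a = sgn_pow A (n * i) a)"
  by (rule cx.glue[OF alg.is_ab]) (auto simp: alg.sgn_add dest: cx.V_closed)
 from someI_ex[OF this] show ?thesis unfolding twist_def .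
qed

lemma twist_additive: "additive_map A A (twist n)" using twist_props by blast
lemma twist_gr: "a \<in> gr A i ==> twist n a = sgn_pow A (n * i) a" using twist_props by blast
lemma twist_closed: "a \<in>: A ==> twist n a \<in>: A"
 by (rule additive_map_closed[OF twist_additive])

lemma twist_mult:
 assumes a: "a \<in> gr A i" and b: "b \<in>: A"
 shows "twist n (a \<otimes>\<^sub>A b) = sgn_pow A (n * i) (a \<otimes>\<^sub>A twist n b)"
 using b
proof (induction rule: cx.graded_induct)
 case (homogeneous j b)
 have c: "a \<in>: A" "b \<in>: A" using a homogeneous cx.V_closed by blast+
 have "a \<otimes>\<^sub>A sgn_pow A (n * j) b = sgn_pow A (n * j) (a \<otimes>\<^sub>A b)"
  using c by (simp add: sgn_pow_def alg.r_minus)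
 thus ?case
  using c by (simp add: twist_gr[OF mult_gr[OF a homogeneous]] twist_gr[OF homogeneous] distrib_left)
next
 case (add x y)
 have c: "a \<in>: A" using a cx.V_closed by blast
 show ?case using add c twist_closed
  by (simp add: alg.r_distr additive_map_add[OF twist_additive] alg.sgn_add)
qed

end

locale free_dg_module = A: dg_algebra K A + P: left_dg_module A P
 for K :: "('k, 'c) ring_scheme" and A :: "('k, 'a) dg" and P :: "('a, 'p) dg" +
 fixes B
 assumes basis: "lbasis A P B" and homogeneous: "b \<in> B ==> \<exists>i. b \<in> gr P i"
begin

definition deg :: "'p => int" where "deg b = (SOME i. b \<in> gr P i)"

lemma deg: "b \<in> B ==> b \<in> gr P (deg b)"
 unfolding deg_def using homogeneous by (rule someI_ex)

lemma B_closed: "b \<in> B ==> b \<in>: P"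
 using basis by (auto simp: lbasis_def)

definition is_coord :: "'p => ('p => 'a) => bool" where
 "is_coord x c \<longleftrightarrow> c \<in> B \<rightarrow>\<^sub>E carrier A \<and> finite {b\<in>B. c b ~= \<zero>\<^sub>A} \<and>
  x = (\<Oplus>\<^sub>P b\<in>{b\<in>B. c b ~= \<zero>\<^sub>A}. c b \<odot>\<^sub>P b)"

definition coord :: "'p => 'p => 'a" where "coord x = (THE c. is_coord x c)"

lemma ex1_coord: "x \<in>: P ==> \<exists>!c. is_coord x c"
 using basis unfolding lbasis_def is_coord_def by blast

lemma is_coord_coord: "x \<in>: P ==> is_coord x (coord x)"
 unfolding coord_def by (rule theI'[OF ex1_coord])

lemma coord_closed: "x \<in>: P ==> b \<in> B ==> coord x b \<in>: A"
 using is_coord_coord[of x] by (auto simp: is_coord_def)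

lemma finite_coord: "x \<in>: P ==> finite {b\<in>B. coord x b ~= \<zero>\<^sub>A}"
 using is_coord_coord[of x] by (auto simp: is_coord_def)

lemma term_closed: "c b \<in>: A ==> b \<in> B ==> c b \<odot>\<^sub>P b \<in>: P"
 by (rule P.smult_closed[OF _ B_closed])

lemma sum_coord:
 assumes "x \<in>: P" "finite S" "S \<subseteq> B" "{b\<in>B. coord x b ~= \<zero>\<^sub>A} \<subseteq> S"
 shows "(\<Oplus>\<^sub>P b\<in>S. coord x b \<odot>\<^sub>P b) = x"
proof -
 have "(\<Oplus>\<^sub>P b\<in>{b\<in>B. coord x b ~= \<zero>\<^sub>A}. coord x b \<odot>\<^sub>P b) = (\<Oplus>\<^sub>P b\<in>S. coord x b \<odot>\<^sub>P b)"
 proof (rule P.M.finsum_superset[OF assms(2,4)])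
  show "coord x b \<odot>\<^sub>P b = \<zero>\<^sub>P" if b: "b \<in> S - {b\<in>B. coord x b ~= \<zero>\<^sub>A}" for b
  proof -
   have "b \<in> B" "coord x b = \<zero>\<^sub>A" using b assms(3) by auto
   thus ?thesis using P.smult_zero_left[OF B_closed] by simp
  qed
  show "coord x b \<odot>\<^sub>P b \<in>: P" if "b \<in> S" for b
   using that assms(3) term_closed[of "coord x"] coord_closed[OF assms(1)] by blast
 qed
 thus ?thesis using is_coord_coord[OF assms(1)] by (simp add: is_coord_def)
qed

lemma coord_eqI:
 assumes S: "finite S" "S \<subseteq> B" and c: "!!b. b \<in> S ==> c b \<in>: A" and c0: "!!b. b \<in> B - S ==> c b = \<zero>\<^sub>A"
  and x: "x = (\<Oplus>\<^sub>P b\<in>S. c b \<odot>\<^sub>P b)" and b: "b \<in> B"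
 shows "coord x b = c b"
proof -
 have cB: "c b \<in>: A" if "b \<in> B" for b using that c c0 by (cases "b \<in> S") auto
 have xc: "x \<in>: P" unfolding x by (rule P.M.finsum_closed) (use S cB term_closed in auto)
 let ?c = "restrict c B"
 have sub: "{b\<in>B. ?c b ~= \<zero>\<^sub>A} \<subseteq> S" using c0 by auto
 have "(\<Oplus>\<^sub>P b\<in>{b\<in>B. ?c b ~= \<zero>\<^sub>A}. ?c b \<odot>\<^sub>P b) = (\<Oplus>\<^sub>P b\<in>S. ?c b \<odot>\<^sub>P b)"
  by (rule P.M.finsum_superset[OF S(1) sub])
   (use S cB term_closed P.smult_zero_left[OF B_closed] in auto)
 also have "... = x" unfolding x by (rule P.M.finsum_cong') (use S cB term_closed in auto)
 finally have "is_coord x ?c"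
  unfolding is_coord_def using finite_subset[OF sub S(1)] cB by auto
 hence "coord x = ?c" using ex1_coord[OF xc] is_coord_coord[OF xc] by blast
 thus ?thesis using b by simp
qed

lemma coord_add:
 assumes x: "x \<in>: P" and y: "y \<in>: P" and b: "b \<in> B"
 shows "coord (x \<oplus>\<^sub>P y) b = coord x b \<oplus>\<^sub>A coord y b"
proof -
 let ?S = "{b\<in>B. coord x b ~= \<zero>\<^sub>A} \<union> {b\<in>B. coord y b ~= \<zero>\<^sub>A}"
 have S: "finite ?S" "?S \<subseteq> B" using finite_coord x y by auto
 have cB: "coord x b \<in>: A" "coord y b \<in>: A" if "b \<in> B" for b using coord_closed x y that by auto
 have "x \<oplus>\<^sub>P y = (\<Oplus>\<^sub>P b\<in>?S. coord x b \<odot>\<^sub>P b) \<oplus>\<^sub>P (\<Oplus>\<^sub>P b\<in>?S. coord y b \<odot>\<^sub>P b)"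
  using sum_coord[OF x S Un_upper1] sum_coord[OF y S Un_upper2] by simp
 also have "... = (\<Oplus>\<^sub>P b\<in>?S. coord x b \<odot>\<^sub>P b \<oplus>\<^sub>P coord y b \<odot>\<^sub>P b)"
  by (rule P.M.finsum_addf[symmetric]) (use S cB P.smult_closed B_closed in auto)
 also have "... = (\<Oplus>\<^sub>P b\<in>?S. (coord x b \<oplus>\<^sub>A coord y b) \<odot>\<^sub>P b)"
  by (rule P.M.finsum_cong') (use S cB P.smult_closed B_closed in \<open>auto simp: P.smult_l_distr\<close>)
 finally show ?thesis
  by (rule coord_eqI[OF S, rotated -2]) (use b cB in auto)
qed

lemma coord_smult:
 assumes a: "a \<in>: A" and x: "x \<in>: P" and b: "b \<in> B"
 shows "coord (a \<odot>\<^sub>P x) b = a \<otimes>\<^sub>A coord x b"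
proof -
 let ?S = "{b\<in>B. coord x b ~= \<zero>\<^sub>A}"
 have S: "finite ?S" "?S \<subseteq> B" using finite_coord x by auto
 have cB: "coord x b \<in>: A" if "b \<in> B" for b using coord_closed x that by auto
 have "a \<odot>\<^sub>P x = a \<odot>\<^sub>P (\<Oplus>\<^sub>P b\<in>?S. coord x b \<odot>\<^sub>P b)"
  using sum_coord[OF x S order_refl] by simp
 also have "... = (\<Oplus>\<^sub>P b\<in>?S. a \<odot>\<^sub>P (coord x b \<odot>\<^sub>P b))"
  by (rule P.smult_finsum_right[OF a]) (use cB P.smult_closed B_closed in auto)
 also have "... = (\<Oplus>\<^sub>P b\<in>?S. (a \<otimes>\<^sub>A coord x b) \<odot>\<^sub>P b)"
  by (rule P.M.finsum_cong') (use a cB P.smult_closed B_closed in \<open>auto simp: P.smult_assoc\<close>)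
 finally show ?thesis
  by (rule coord_eqI[OF S, rotated -2]) (use a b cB in auto)
qed

lemma coord_basis:
 assumes b: "b \<in> B" and b': "b' \<in> B"
 shows "coord b b' = (if b' = b then \<one>\<^sub>A else \<zero>\<^sub>A)"
 by (rule coord_eqI[where S = "{b}"])
  (use b b' B_closed in \<open>auto simp: P.smult_one P.smult_closed\<close>)

lemma coord_gr:
 assumes x: "x \<in> gr P n" and b: "b \<in> B"
 shows "coord x b \<in> gr A (n - deg b)"
proof -
 have xc: "x \<in>: P" using P.cx.V_closed[OF x] .
 let ?S = "{b\<in>B. coord x b ~= \<zero>\<^sub>A}"
 let ?c = "%b. A.cx.comp (coord x b) (n - deg b)"
 have S: "finite ?S" "?S \<subseteq> B" using finite_coord xc by auto
 have cB: "coord x b \<in>: A" if "b \<in> B" for b using coord_closed xc that by auto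
 have part: "P.cx.comp (coord x b \<odot>\<^sub>P b) n = ?c b \<odot>\<^sub>P b" if b: "b \<in> B" for b
  using comp_additive_map[OF A.cx.graded_group_axioms P.cx.graded_group_axioms
    P.smult_additive_left[OF B_closed[OF b]] P.smult_gr[OF _ deg[OF b]] cB[OF b], of "n - deg b"] by simp
 have "x = P.cx.comp (\<Oplus>\<^sub>P b\<in>?S. coord x b \<odot>\<^sub>P b) n"
  unfolding sum_coord[OF xc S order_refl] using P.cx.comp_same[OF x] by simp
 also have "... = (\<Oplus>\<^sub>P b\<in>?S. P.cx.comp (coord x b \<odot>\<^sub>P b) n)"
  by (rule additive_map_finsum[OF P.M.is_ab P.M.is_ab P.cx.comp_additive])
   (use cB term_closed in auto)
 also have "... = (\<Oplus>\<^sub>P b\<in>?S. ?c b \<odot>\<^sub>P b)"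
  by (rule P.M.finsum_cong')
   (use part A.cx.comp_closed[OF cB] P.smult_closed[OF A.cx.comp_closed[OF cB] B_closed] in auto)
 finally have "coord x b = ?c b"
  by (rule coord_eqI[OF S, rotated -2]) (use b A.cx.comp_closed[OF cB] in auto)
 thus ?thesis using A.cx.comp_V[OF cB[OF b]] by metis
qed

definition ext :: "('a, 'm) dg => int => ('p => 'm) => 'p => 'm" where
 "ext N n s = (\<lambda>x\<in>carrier P. \<Oplus>\<^sub>N b\<in>{b\<in>B. coord x b ~= \<zero>\<^sub>A}. A.twist n (coord x b) \<odot>\<^sub>N s b)"

context
 fixes N :: "('a, 'm) dg" and n s
 assumes N: "left_dg_module A N" and s: "!!b. b \<in> B ==> s b \<in> gr N (deg b + n)"
begin

interpretation N: left_dg_module A N by (rule N)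

lemma s_closed: "b \<in> B ==> s b \<in>: N"
 using N.cx.V_closed[OF s] .

lemma ext_term_closed: "x \<in>: P ==> b \<in> B ==> A.twist n (coord x b) \<odot>\<^sub>N s b \<in>: N"
 by (rule N.smult_closed[OF A.twist_closed[OF coord_closed] s_closed])

lemma ext_superset:
 assumes "x \<in>: P" "finite S" "S \<subseteq> B" "{b\<in>B. coord x b ~= \<zero>\<^sub>A} \<subseteq> S"
 shows "ext N n s x = (\<Oplus>\<^sub>N b\<in>S. A.twist n (coord x b) \<odot>\<^sub>N s b)"
proof -
 have t0: "A.twist n \<zero>\<^sub>A = \<zero>\<^sub>A"
  by (rule additive_map_zero[OF A.alg.is_ab A.alg.is_ab A.twist_additive])
 have "(\<Oplus>\<^sub>N b\<in>{b\<in>B. coord x b ~= \<zero>\<^sub>A}. A.twist n (coord x b) \<odot>\<^sub>N s b)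
   = (\<Oplus>\<^sub>N b\<in>S. A.twist n (coord x b) \<odot>\<^sub>N s b)"
  by (rule N.M.finsum_superset[OF assms(2,4)])
   (use assms(1,3) ext_term_closed t0 N.smult_zero_left[OF s_closed] in auto)
 thus ?thesis using assms(1) by (simp add: ext_def)
qed

lemma ext_basis:
 assumes b: "b \<in> B"
 shows "ext N n s b = s b"
proof -
 have "{b'\<in>B. coord b b' ~= \<zero>\<^sub>A} \<subseteq> {b}" using coord_basis[OF b] by (auto split: if_splits)
 from ext_superset[OF B_closed[OF b] _ _ this] b
 have "ext N n s b = (\<Oplus>\<^sub>N b'\<in>{b}. A.twist n (coord b b') \<odot>\<^sub>N s b')" by simp
 also have "... = A.twist n (coord b b) \<odot>\<^sub>N s b"
  using N.smult_closed[OF A.twist_closed[OF coord_closed[OF B_closed[OF b] b]] s_closed[OF b]] by simp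
 also have "... = s b"
  using b A.twist_gr[OF A.one_gr] s_closed[OF b] by (simp add: coord_basis N.smult_one)
 finally show ?thesis .
qed

lemma ext_hom: "ext N n s \<in> hom_deg A P N n"
proof (rule hom_degI)
 show "ext N n s \<in> extensional (carrier P)" by (simp add: ext_def)
 show "ext N n s x \<in>: N" if x: "x \<in>: P" for x
  using x ext_term_closed[OF x] by (auto simp: ext_def intro!: N.M.finsum_closed)
 show "ext N n s (x \<oplus>\<^sub>P y) = ext N n s x \<oplus>\<^sub>N ext N n s y"
  if x: "x \<in>: P" and y: "y \<in>: P" for x y
 proof -
  let ?S = "{b\<in>B. coord x b ~= \<zero>\<^sub>A} \<union> {b\<in>B. coord y b ~= \<zero>\<^sub>A}"
  have S: "finite ?S" "?S \<subseteq> B" using finite_coord x y by auto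
  have "{b\<in>B. coord (x \<oplus>\<^sub>P y) b ~= \<zero>\<^sub>A} \<subseteq> ?S" using coord_add[OF x y] by auto
  from ext_superset[OF P.M.a_closed[OF x y] S this]
  have "ext N n s (x \<oplus>\<^sub>P y) = (\<Oplus>\<^sub>N b\<in>?S. A.twist n (coord (x \<oplus>\<^sub>P y) b) \<odot>\<^sub>N s b)" .
  also have "... = (\<Oplus>\<^sub>N b\<in>?S. A.twist n (coord x b) \<odot>\<^sub>N s b \<oplus>\<^sub>N A.twist n (coord y b) \<odot>\<^sub>N s b)"
  proof (rule N.M.finsum_cong'[OF refl])
   show "A.twist n (coord (x \<oplus>\<^sub>P y) b) \<odot>\<^sub>N s b = A.twist n (coord x b) \<odot>\<^sub>N s b \<oplus>\<^sub>N A.twist n (coord y b) \<odot>\<^sub>N s b"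
    if "b \<in> ?S" for b
   proof -
    have b: "b \<in> B" using that by auto
    note cc = coord_closed[OF x b] coord_closed[OF y b]
    show ?thesis unfolding coord_add[OF x y b] additive_map_add[OF A.twist_additive cc]
     by (rule N.smult_l_distr[OF A.twist_closed[OF cc(1)] A.twist_closed[OF cc(2)] s_closed[OF b]])
   qed
  qed (use ext_term_closed x y in auto)
  also have "... = (\<Oplus>\<^sub>N b\<in>?S. A.twist n (coord x b) \<odot>\<^sub>N s b) \<oplus>\<^sub>N (\<Oplus>\<^sub>N b\<in>?S. A.twist n (coord y b) \<odot>\<^sub>N s b)"
   by (rule N.M.finsum_addf) (use ext_term_closed x y in auto)
  finally show ?thesis
   using ext_superset[OF x S Un_upper1] ext_superset[OF y S Un_upper2] by simp
 qed
 show "ext N n s x \<in> gr N (i + n)" if x: "x \<in> gr P i" for x i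
 proof -
  have xc: "x \<in>: P" using P.cx.V_closed[OF x] .
  have "A.twist n (coord x b) \<odot>\<^sub>N s b \<in> gr N (i + n)" if b: "b \<in> B" for b
  proof -
   have "A.twist n (coord x b) \<in> gr A (i - deg b)"
    unfolding A.twist_gr[OF coord_gr[OF x b]] by (rule A.cx.V_sgn[OF coord_gr[OF x b]])
   from N.smult_gr[OF this s[OF b]] show ?thesis by (simp add: algebra_simps)
  qed
  thus ?thesis using xc by (auto simp: ext_def intro!: N.cx.V_finsum)
 qed
 show "ext N n s (a \<odot>\<^sub>P x) = sgn_pow N (n * i) (a \<odot>\<^sub>N ext N n s x)"
  if a: "a \<in> gr A i" and x: "x \<in>: P" for i a x
 proof -
  have ac: "a \<in>: A" using A.cx.V_closed[OF a] .
  let ?S = "{b\<in>B. coord x b ~= \<zero>\<^sub>A}"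
  let ?t = "%b. A.twist n (coord x b) \<odot>\<^sub>N s b"
  have S: "finite ?S" "?S \<subseteq> B" using finite_coord x by auto
  have "{b\<in>B. coord (a \<odot>\<^sub>P x) b ~= \<zero>\<^sub>A} \<subseteq> ?S" using coord_smult[OF ac x] ac by auto
  from ext_superset[OF P.smult_closed[OF ac x] S this]
  have "ext N n s (a \<odot>\<^sub>P x) = (\<Oplus>\<^sub>N b\<in>?S. A.twist n (coord (a \<odot>\<^sub>P x) b) \<odot>\<^sub>N s b)" .
  also have "... = (\<Oplus>\<^sub>N b\<in>?S. sgn_pow N (n * i) (a \<odot>\<^sub>N ?t b))"
  proof (rule N.M.finsum_cong'[OF refl])
   show "A.twist n (coord (a \<odot>\<^sub>P x) b) \<odot>\<^sub>N s b = sgn_pow N (n * i) (a \<odot>\<^sub>N ?t b)" if "b \<in> ?S" for b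
   proof -
    have b: "b \<in> B" using that by auto
    note cc = coord_closed[OF x b] and tc = A.twist_closed[OF coord_closed[OF x b], of n]
    have "A.twist n (coord (a \<odot>\<^sub>P x) b) \<odot>\<^sub>N s b
      = sgn_pow A (n * i) (a \<otimes>\<^sub>A A.twist n (coord x b)) \<odot>\<^sub>N s b"
     unfolding coord_smult[OF ac x b] A.twist_mult[OF a cc] ..
    also have "... = sgn_pow N (n * i) ((a \<otimes>\<^sub>A A.twist n (coord x b)) \<odot>\<^sub>N s b)"
     using additive_map_sgn[OF A.alg.is_ab N.M.is_ab
       N.smult_additive_left[OF s_closed[OF b]]] ac tc by simp
    finally show ?thesis unfolding N.smult_assoc[OF ac tc s_closed[OF b]] .
   qed
  qed (use ext_term_closed[OF x] N.smult_closed[OF ac] in auto)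
  also have "... = sgn_pow N (n * i) (a \<odot>\<^sub>N (\<Oplus>\<^sub>N b\<in>?S. ?t b))"
  proof -
   have "additive_map N N (%y. sgn_pow N (n * i) (a \<odot>\<^sub>N y))"
    by (rule additive_mapI) (auto simp: N.smult_closed[OF ac] N.smult_r_distr[OF ac] N.M.sgn_add)
   from additive_map_finsum[OF N.M.is_ab N.M.is_ab this, of ?S ?t]
   show ?thesis using ext_term_closed[OF x] by auto
  qed
  finally show ?thesis using ext_superset[OF x S order_refl] by simp
 qed
qed

end

lemma hom_eq_on_span:
 assumes N: "left_dg_module A N" and f: "f \<in> hom_deg A P N n" and g: "g \<in> hom_deg A P N n"
  and S: "S \<subseteq> carrier P" and eq: "!!b. b \<in> S ==> f b = g b" and x: "x \<in> lspan P (carrier A) S"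
 shows "f x = g x"
proof -
 interpret N: left_dg_module A N by fact
 interpret PN: hom_complex A P N by unfold_locales
 obtain F c where F: "finite F" "F \<subseteq> S" "c \<in> F \<rightarrow> carrier A" and xF: "x = (\<Oplus>\<^sub>P b\<in>F. c b \<odot>\<^sub>P b)"
  using x by (auto simp: lspan_def)
 have scal: "f (a \<odot>\<^sub>P b) = g (a \<odot>\<^sub>P b)" if b: "b \<in> S" and a: "a \<in>: A" for a b
 proof -
  have bc: "b \<in>: P" using b S by auto
  show ?thesis using a
  proof (induction rule: A.cx.graded_induct)
   case (homogeneous i a)
   show ?case using hom_smult[OF f homogeneous bc] hom_smult[OF g homogeneous bc] eq[OF b] by simp
  next
   case (add a a')
   thus ?case using bc by (simp add: P.smult_l_distr P.smult_closed hom_add[OF f] hom_add[OF g])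
  qed
 qed
 have t: "c b \<odot>\<^sub>P b \<in>: P" if "b \<in> F" for b using that F S P.smult_closed by blast
 have "f x = (\<Oplus>\<^sub>N b\<in>F. f (c b \<odot>\<^sub>P b))" unfolding xF by (rule PN.hom_finsum[OF f]) (rule t)
 also have "... = (\<Oplus>\<^sub>N b\<in>F. g (c b \<odot>\<^sub>P b))"
 proof (rule N.M.finsum_cong'[OF refl])
  show "f (c b \<odot>\<^sub>P b) = g (c b \<odot>\<^sub>P b)" if b: "b \<in> F" for b
   using b F by (intro scal) auto
 qed (use t hom_closed[OF g] in auto)
 also have "... = g x" unfolding xF by (rule PN.hom_finsum[OF g, symmetric]) (rule t)
 finally show ?thesis .
qed

lemma span_basis: "x \<in>: P ==> x \<in> lspan P (carrier A) B"
 unfolding lspan_def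
 by (intro CollectI exI[of _ "{b\<in>B. coord x b ~= \<zero>\<^sub>A}"] exI[of _ "coord x"])
  (auto simp: sum_coord finite_coord coord_closed)

lemma hom_eq_on_basis:
 assumes N: "left_dg_module A N" and f: "f \<in> hom_deg A P N n" and g: "g \<in> hom_deg A P N n"
  and eq: "!!b. b \<in> B ==> f b = g b"
 shows "f = g"
proof (rule hom_eqI[OF f g])
 show "f x = g x" if "x \<in>: P" for x
  by (rule hom_eq_on_span[OF N f g _ eq span_basis[OF that]]) (auto intro: B_closed)
qed

end

section \<open>Resolutions of the ground field\<close>

text \<open>The ground field as a module on the degree-\<open>0\<close> part of the algebra.  Unlike the
 quotient that defines the trivial module, its elements are elements of the algebra, and its
 scalar multiplication is a multiplication in the algebra.\<close>

definition ground :: "('k, 'a) dg => ('a, 'a) dg" where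
 "ground A =
  \<lparr>carrier = gr A 0, mult = mult A, one = one A, zero = zero A, add = add A,
   smult = (%a x. hcomp A (gr A) a 0 \<otimes>\<^sub>A x),
   gr = (%n. if n = 0 then gr A 0 else {\<zero>\<^sub>A}), dif = (%_. \<zero>\<^sub>A)\<rparr>"

lemma ground_simps [simp]:
 "carrier (ground A) = gr A 0" "zero (ground A) = zero A" "add (ground A) = add A"
 "a \<odot>\<^bsub>ground A\<^esub> x = hcomp A (gr A) a 0 \<otimes>\<^sub>A x"
 "gr (ground A) n = (if n = 0 then gr A 0 else {\<zero>\<^sub>A})" "dif (ground A) x = \<zero>\<^sub>A"
 by (simp_all add: ground_def)

text \<open>What is used of a resolution of the ground field: the augmentation is a chain map that hits
 \<open>1\<close> at a cocycle, and its cocycles in the kernel are coboundaries.\<close>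

definition ground_resolution :: "('k, 'a) dg => ('a, 'p) dg => ('p => 'a) => bool" where
 "ground_resolution A P \<epsilon> \<longleftrightarrow>
  \<epsilon> \<in> hom_deg A P (ground A) 0 \<and>
  (\<forall>x\<in>carrier P. \<epsilon> (dif P x) = \<zero>\<^sub>A) \<and>
  (\<exists>w\<in>gr P 0. dif P w = \<zero>\<^sub>P \<and> \<epsilon> w = \<one>\<^sub>A) \<and>
  (\<forall>n. \<forall>x\<in>gr P n. dif P x = \<zero>\<^sub>P \<and> \<epsilon> x = \<zero>\<^sub>A \<longrightarrow> (\<exists>y\<in>gr P (n - 1). dif P y = x))"

context dg_algebra
begin

lemma regular_simps [simp]:
 "carrier (regular A) = carrier A" "zero (regular A) = zero A" "add (regular A) = add A"
 "a \<odot>\<^bsub>regular A\<^esub> x = a \<otimes>\<^sub>A x" "gr (regular A) = gr A" "dif (regular A) = dif A"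
 by (simp_all add: regular_def)

lemma regular_complex: "cochain_complex (regular A)"
 by (rule cochain_complex_cong_structure[OF cx.is_cpx]) simp_all

lemma hcomp_regular: "hcomp (regular A) (gr A) = hcomp A (gr A)"
proof -
 have "is_decomp (regular A) (gr A) = is_decomp A (gr A)"
  by (intro ext) (simp add: is_decomp_def finsum_cong_structure[of "regular A" A])
 thus ?thesis by (intro ext) (simp add: hcomp_def)
qed

end

context connected_dg_algebra
begin

lemma gr_neg_zero: "x \<in> gr A n ==> n < 0 ==> x = \<zero>\<^sub>A"
 using gr_neg by auto

lemma comp_mult_0:
 assumes a: "a \<in>: A" and b: "b \<in>: A"
 shows "cx.comp (a \<otimes>\<^sub>A b) 0 = cx.comp a 0 \<otimes>\<^sub>A cx.comp b 0"
 using a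
proof (induction rule: cx.graded_induct)
 case (homogeneous i a)
 note a = homogeneous
 have ac: "a \<in>: A" using cx.V_closed[OF a] .
 show ?case using b
 proof (induction rule: cx.graded_induct)
  case (homogeneous j b)
  have bc: "b \<in>: A" using cx.V_closed[OF homogeneous] .
  show ?case
  proof (cases "i < 0 \<or> j < 0")
   case True
   hence "a = \<zero>\<^sub>A \<or> b = \<zero>\<^sub>A" using gr_neg_zero a homogeneous by blast
   thus ?thesis using ac bc by auto
  next
   case False
   hence "i + j = 0 \<longleftrightarrow> i = 0 \<and> j = 0" by auto
   thus ?thesis
    unfolding cx.comp_V_eq[OF mult_gr[OF a homogeneous]] cx.comp_V_eq[OF a] cx.comp_V_eq[OF homogeneous]
    using ac bc by auto
  qed
 next
  case (add x y)
  thus ?case using ac by (simp add: alg.r_distr cx.comp_add)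
 qed
next
 case (add x y)
 thus ?case using b by (simp add: alg.l_distr cx.comp_add)
qed

lemma comp_dif_0: "x \<in>: A ==> cx.comp (dif A x) 0 = \<zero>\<^sub>A"
 using cx.comp_dif'[of x 0] gr_neg_zero[OF cx.comp_V, of x "-1"] by simp

lemma ground_dg_module: "left_dg_module A (ground A)"
proof -
 have ab: "abelian_group (ground A)"
 proof (rule abelian_groupI)
  show "\<exists>y\<in>carrier (ground A). y \<oplus>\<^bsub>ground A\<^esub> x = \<zero>\<^bsub>ground A\<^esub>" if "x \<in>: (ground A)" for x
   using that cx.V_closed[of x 0] by (intro bexI[of _ "\<ominus>\<^sub>A x"]) (auto simp: alg.l_neg)
 qed (use cx.V_closed[of _ 0] in \<open>auto simp: alg.a_ac\<close>)
 have gr: "gr (ground A) = (%n. if n = 0 then carrier (ground A) else {\<zero>\<^bsub>ground A\<^esub>})"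
  by (rule ext) simp
 interpret G: abelian_group "ground A" by (rule ab)
 note c0 = cx.V_closed[of _ 0]
 show ?thesis
 proof (intro left_dg_module.intro left_module.intro left_dg_module_axioms.intro left_module_axioms.intro ring ab)
  show "graded_by (ground A) (gr (ground A))"
   unfolding gr by (rule concentrated_graded[OF ab])
  show "a \<odot>\<^bsub>ground A\<^esub> x \<in>: (ground A)" if "a \<in>: A" "x \<in>: (ground A)" for a x
   using mult_gr[OF cx.comp_V[OF that(1), of 0], of x 0] that(2) by simp
  show "a \<odot>\<^bsub>ground A\<^esub> x \<in> gr (ground A) (i + j)" if a: "a \<in> gr A i" and x: "x \<in> gr (ground A) j" for a x i j
  proof (cases "i = 0 \<and> j = 0")
   case True
   thus ?thesis using mult_gr[OF a, of x 0] x cx.comp_same[OF a] by simp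
  next
   case False
   have xc: "x \<in>: A" using x c0 by (auto split: if_splits)
   have "cx.comp a 0 \<otimes>\<^sub>A x = \<zero>\<^sub>A"
    using False x xc cx.comp_V_eq[OF a, of 0] cx.comp_closed[OF cx.V_closed[OF a], of 0]
    by (auto split: if_splits)
   thus ?thesis by simp
  qed
  show "(a \<otimes>\<^sub>A b) \<odot>\<^bsub>ground A\<^esub> x = a \<odot>\<^bsub>ground A\<^esub> (b \<odot>\<^bsub>ground A\<^esub> x)"
   if "a \<in>: A" "b \<in>: A" "x \<in>: (ground A)" for a b x
   using that c0[of x] by (simp add: comp_mult_0 alg.m_assoc)
  show "dif (ground A) (a \<odot>\<^bsub>ground A\<^esub> x) = dif A a \<odot>\<^bsub>ground A\<^esub> x \<oplus>\<^bsub>ground A\<^esub>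
    sgn_pow (ground A) i (a \<odot>\<^bsub>ground A\<^esub> dif (ground A) x)"
   if a: "a \<in> gr A i" and x: "x \<in>: (ground A)" for a x i
  proof -
   have ac: "a \<in>: A" using cx.V_closed[OF a] .
   have z: "sgn_pow (ground A) i \<zero>\<^sub>A = \<zero>\<^sub>A" using G.sgn_zero by simp
   show ?thesis using x ac c0[of x] by (simp add: comp_dif_0 z)
  qed
 qed (use c0 in \<open>auto simp: cx.comp_add alg.l_distr alg.r_distr cx.comp_same[OF one_gr]\<close>)
qed

sublocale ground: left_dg_module A "ground A" by (rule ground_dg_module)

lemma pos_part_iff: "x \<in> pos_part A \<longleftrightarrow> x \<in>: A \<and> cx.comp x 0 = \<zero>\<^sub>A"
proof
 let ?H = "{x \<in> carrier A. cx.comp x 0 = \<zero>\<^sub>A}"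
 have sub: "subgroup ?H (add_monoid A)"
 proof (rule alg.add_subgroupI)
  fix a assume "a \<in> ?H"
  hence a: "a \<in>: A" "cx.comp a 0 = \<zero>\<^sub>A" by auto
  have "cx.comp (\<ominus>\<^sub>A a) 0 = \<ominus>\<^sub>A cx.comp a 0"
   by (rule additive_map_inv[OF alg.is_ab alg.is_ab cx.comp_additive a(1)])
  thus "\<ominus>\<^sub>A a \<in> ?H" using a by simp
 qed (auto simp: cx.comp_add)
 have gen: "(\<Union>n\<in>{1..}. gr A n) \<subseteq> ?H"
  using cx.V_closed cx.comp_V_eq by fastforce
 show "x \<in>: A \<and> cx.comp x 0 = \<zero>\<^sub>A" if "x \<in> pos_part A"
  using group.generate_subgroup_incl[OF alg.a_group gen sub] that unfolding pos_part_def by blast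
 assume x: "x \<in>: A \<and> cx.comp x 0 = \<zero>\<^sub>A"
 have gsub: "subgroup (pos_part A) (add_monoid A)"
  unfolding pos_part_def by (rule group.generate_is_subgroup[OF alg.a_group]) (use gen in auto)
 have zero: "\<zero>\<^sub>A \<in> pos_part A" using subgroup.one_closed[OF gsub] by simp
 have add: "u \<oplus>\<^sub>A v \<in> pos_part A" if "u \<in> pos_part A" "v \<in> pos_part A" for u v
  using subgroup.m_closed[OF gsub that] by simp
 have "cx.comp x n \<in> pos_part A" for n
 proof (cases "n \<ge> 1")
  case True
  have "cx.comp x n \<in> (\<Union>n\<in>{1..}. gr A n)"
   using True cx.comp_V[OF conjunct1[OF x], of n] by (intro UN_I[of n]) auto
  thus ?thesis unfolding pos_part_def by (rule generate.incl)
 next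
  case False
  hence "cx.comp x n = \<zero>\<^sub>A"
   using x gr_neg_zero[OF cx.comp_V, of x n] by (cases "n = 0") auto
  thus ?thesis using zero by simp
 qed
 hence "(\<Oplus>\<^sub>A n\<in>{n. cx.comp x n ~= \<zero>\<^sub>A}. cx.comp x n) \<in> pos_part A"
  by (intro cx.finsum_induct_closed[where P = "%y. y \<in> pos_part A"]) (use x zero add in auto)
 thus "x \<in> pos_part A" using cx.sum_comp x by simp
qed

lemma trivial_subquotient: "subquotient (regular A) (carrier A) (pos_part A)"
proof -
 interpret R: cochain_complex "regular A" by (rule regular_complex)
 show ?thesis
 proof (intro subquotient.intro subquotient_axioms.intro regular_complex)
  show "additive_subgroup (carrier A) (regular A)"
   by (rule additive_subgroupI, rule R.add_subgroupI) (use R.a_inv_closed in auto)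
  have inv: "cx.comp (\<ominus>\<^bsub>regular A\<^esub> a) 0 = \<zero>\<^sub>A" if "a \<in>: A" "cx.comp a 0 = \<zero>\<^sub>A" for a
   using additive_map_inv[OF R.is_ab R.is_ab R.comp_additive, of a 0] that
    R.inv_zero by (simp add: hcomp_regular)
  show "additive_subgroup (pos_part A) (regular A)"
   by (rule additive_subgroupI, rule R.add_subgroupI)
    (use R.a_inv_closed inv in \<open>auto simp: pos_part_iff cx.comp_add\<close>)
  show "R.comp x n \<in> pos_part A" if "x \<in> pos_part A" for x n
  proof -
   have x: "x \<in>: A" "cx.comp x 0 = \<zero>\<^sub>A" using that pos_part_iff by auto
   have "cx.comp (cx.comp x n) 0 = \<zero>\<^sub>A"
    using cx.comp_V_eq[OF cx.comp_V[OF x(1), of n], of 0] x(2) by auto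
   thus ?thesis using x by (simp add: pos_part_iff hcomp_regular)
  qed
 qed (auto simp: pos_part_iff comp_dif_0 hcomp_regular)
qed

text \<open>The trivial module consists of cosets of the positive part, and taking degree-\<open>0\<close>
 components of representatives identifies it with the ground module.\<close>

theorem ground_resolution_of_trivial:
 assumes P: "left_dg_module A P" and qi: "quasi_iso A P (trivial_module A) \<epsilon>"
 shows "\<exists>\<epsilon>'. ground_resolution A P \<epsilon>'"
proof -
 interpret P: left_dg_module A P by fact
 interpret T: subquotient "regular A" "carrier A" "pos_part A" by (rule trivial_subquotient)
 have T: "trivial_module A = T.SQ" by (simp add: trivial_module_def)
 interpret TC: cochain_complex "trivial_module A" unfolding T by (rule T.SQ_complex)
 have hom: "\<epsilon> \<in> hom_deg A P (trivial_module A) 0" and ed: "!!x. x \<in>: P ==> \<epsilon> (dif P x) = dif (trivial_module A) (\<epsilon> x)"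
  and bij: "bij_betw (cohom_map (trivial_module A) \<epsilon>) (carrier (cohom P)) (carrier (cohom (trivial_module A)))"
  using qi by (auto simp: quasi_iso_def)
 have car: "\<exists>a\<in>carrier A. y = T.cls a" if "y \<in>: (trivial_module A)" for y
  using that unfolding T T.SQ_carrier by blast
 have cls_eq: "T.cls a = T.cls b ==> cx.comp a 0 = cx.comp b 0" if a: "a \<in>: A" and b: "b \<in>: A" for a b
 proof -
  assume "T.cls a = T.cls b"
  hence "a \<ominus>\<^sub>A b \<in> pos_part A"
   using T.cls_eq_iff[of a b] a b a_minus_cong_structure[of "regular A" A] by simp
  hence "cx.comp a 0 \<ominus>\<^sub>A cx.comp b 0 = \<zero>\<^sub>A" using pos_part_iff cx.comp_minus[OF a b] by simp
  thus ?thesis using alg.minus_zero_iff a b by simp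
 qed
 have cls0: "T.cls a = \<zero>\<^bsub>trivial_module A\<^esub> \<longleftrightarrow> cx.comp a 0 = \<zero>\<^sub>A" if a: "a \<in>: A" for a
  unfolding T T.SQ_zero using T.cls_eq_zero_iff[of a] pos_part_iff a by simp
 have dT: "dif (trivial_module A) y = \<zero>\<^bsub>trivial_module A\<^esub>" if y: "y \<in>: (trivial_module A)" for y
 proof -
  obtain a where a: "a \<in>: A" "y = T.cls a" using car[OF y] by blast
  have "dif (trivial_module A) y = T.cls (dif A a)" unfolding a(2) T using T.SQ_dif[of a] a(1) by simp
  also have "... = \<zero>\<^bsub>trivial_module A\<^esub>" unfolding cls0[OF cx.dif_closed[OF a(1)]] by (rule comp_dif_0[OF a(1)])
  finally show ?thesis .
 qed
 have \<epsilon>gr: "\<epsilon> x \<in> gr (trivial_module A) n" if "x \<in> gr P n" for x n using hom_gr[OF hom that] by simp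
 have surj: "\<exists>x\<in>gr P n. dif P x = \<zero>\<^sub>P \<and> \<epsilon> x = y" if "y \<in> gr (trivial_module A) n" for y n
  by (rule quasi_iso_zero_dif_surj[OF P.cx.is_cpx TC.is_cpx
     hom_additive[OF hom] \<epsilon>gr ed dT bij that])
 have exact: "\<exists>y\<in>gr P (n - 1). dif P y = x"
  if "x \<in> gr P n" "dif P x = \<zero>\<^sub>P" "\<epsilon> x = \<zero>\<^bsub>trivial_module A\<^esub>" for x n
  by (rule quasi_iso_zero_dif_exact[OF P.cx.is_cpx TC.is_cpx
     hom_additive[OF hom] \<epsilon>gr ed dT bij that])
 define r where "r x = (SOME a. a \<in>: A \<and> \<epsilon> x = T.cls a)" for x
 have r: "r x \<in>: A" "\<epsilon> x = T.cls (r x)" if x: "x \<in>: P" for x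
 proof -
  have "\<exists>a. a \<in>: A \<and> \<epsilon> x = T.cls a" using car[OF hom_closed[OF hom x]] by blast
  from someI_ex[OF this] show "r x \<in>: A" "\<epsilon> x = T.cls (r x)" unfolding r_def by blast+
 qed
 define e where "e = (\<lambda>x\<in>carrier P. cx.comp (r x) 0)"
 have e: "e x = cx.comp a 0" if x: "x \<in>: P" and a: "a \<in>: A" "\<epsilon> x = T.cls a" for x a
  using cls_eq[OF r(1)[OF x] a(1)] r(2)[OF x] a(2) x by (simp add: e_def)
 have e0: "e x = \<zero>\<^sub>A \<longleftrightarrow> \<epsilon> x = \<zero>\<^bsub>trivial_module A\<^esub>" if x: "x \<in>: P" for x
  unfolding r(2)[OF x] cls0[OF r(1)[OF x]] using x by (simp add: e_def)
 show ?thesis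
 proof (intro exI[of _ e], unfold ground_resolution_def, intro conjI allI ballI impI)
  show "e \<in> hom_deg A P (ground A) 0"
  proof (rule hom_degI)
   show "e \<in> extensional (carrier P)" by (simp add: e_def)
   show "e x \<in>: (ground A)" if "x \<in>: P" for x
    using that cx.comp_V[OF r(1)[OF that], of 0] by (simp add: e_def)
   show "e (x \<oplus>\<^sub>P y) = e x \<oplus>\<^bsub>ground A\<^esub> e y" if x: "x \<in>: P" and y: "y \<in>: P" for x y
   proof -
    have "\<epsilon> (x \<oplus>\<^sub>P y) = T.cls (r x \<oplus>\<^sub>A r y)"
     unfolding hom_add[OF hom x y] r(2)[OF x] r(2)[OF y] T using T.SQ_add[of "r x" "r y"] r(1) x y by simp
    thus ?thesis using e[OF P.M.a_closed[OF x y], of "r x \<oplus>\<^sub>A r y"] r(1) x y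
     by (simp add: e_def cx.comp_add)
   qed
   show "e x \<in> gr (ground A) (i + 0)" if x: "x \<in> gr P i" for x i
   proof -
    obtain a where a: "a \<in> gr A i" "\<epsilon> x = T.cls a" using \<epsilon>gr[OF x] unfolding T T.SQ_gr by auto
    have "e x = cx.comp a 0" by (rule e[OF P.cx.V_closed[OF x] cx.V_closed[OF a(1)] a(2)])
    thus ?thesis using cx.comp_V_eq[OF a(1), of 0] a(1) by auto
   qed
   show "e (a \<odot>\<^sub>P x) = sgn_pow (ground A) (0 * i) (a \<odot>\<^bsub>ground A\<^esub> e x)"
    if a: "a \<in> gr A i" and x: "x \<in>: P" for i a x
   proof -
    have ac: "a \<in>: A" using cx.V_closed[OF a] .
    have "additive_map (regular A) (regular A) (%x. a \<odot>\<^bsub>regular A\<^esub> x)"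
     by (rule additive_mapI) (use ac in \<open>auto simp: alg.r_distr\<close>)
    moreover have "a \<odot>\<^bsub>regular A\<^esub> b \<in> pos_part A" if "b \<in> pos_part A" for b
     using that ac by (simp add: pos_part_iff comp_mult_0)
    ultimately have "a \<odot>\<^bsub>trivial_module A\<^esub> T.cls (r x) = T.cls (a \<otimes>\<^sub>A r x)"
     unfolding T using T.SQ_smult[of "r x" a] r(1)[OF x] by simp
    moreover have "\<epsilon> (a \<odot>\<^sub>P x) = a \<odot>\<^bsub>trivial_module A\<^esub> \<epsilon> x"
     using hom_smult[OF hom a x] by (simp add: sgn_pow_def)
    ultimately have "\<epsilon> (a \<odot>\<^sub>P x) = T.cls (a \<otimes>\<^sub>A r x)" using r(2)[OF x] by simp
    thus ?thesis using e[OF P.smult_closed[OF ac x], of "a \<otimes>\<^sub>A r x"] r(1)[OF x] ac x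
     by (simp add: e_def comp_mult_0 sgn_pow_def)
   qed
  qed
  show "e (dif P x) = \<zero>\<^sub>A" if x: "x \<in>: P" for x
   unfolding e0[OF P.cx.dif_closed[OF x]] ed[OF x] by (rule dT[OF hom_closed[OF hom x]])
  have "T.cls \<one>\<^sub>A \<in> gr (trivial_module A) 0" unfolding T T.SQ_gr using one_gr by simp
  from surj[OF this] obtain w where w: "w \<in> gr P 0" "dif P w = \<zero>\<^sub>P" "\<epsilon> w = T.cls \<one>\<^sub>A" by blast
  have "e w = \<one>\<^sub>A" using e[OF P.cx.V_closed[OF w(1)] one_closed w(3)] cx.comp_same[OF one_gr] by simp
  thus "\<exists>w\<in>gr P 0. dif P w = \<zero>\<^sub>P \<and> e w = \<one>\<^sub>A" using w by blast
  show "\<exists>y\<in>gr P (n - 1). dif P y = x" if x: "x \<in> gr P n" and d: "dif P x = \<zero>\<^sub>P \<and> e x = \<zero>\<^sub>A" for x n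
   using exact[OF x] d e0[OF P.cx.V_closed[OF x]] by simp
 qed
qed

end

section \<open>Lifting maps out of semifree modules\<close>

locale semifree_lifting = A: connected_dg_algebra K A + P: left_dg_module A P + M: left_dg_module A M
 for K :: "('k, 'c) ring_scheme" and A :: "('k, 'a) dg" and P :: "('a, 'p) dg" and M :: "('a, 'm) dg" +
 fixes Bn and \<epsilon>
 assumes semibasis: "semibasis A P Bn" and resolution: "ground_resolution A M \<epsilon>"
begin

sublocale Pf: free_dg_module K A P "\<Union>n. Bn n"
 by unfold_locales (use semibasis in \<open>auto simp: semibasis_def\<close>)

sublocale PM: hom_complex A P M by unfold_locales
sublocale PG: hom_complex A P "ground A" by unfold_locales

lemma eps: "\<epsilon> \<in> hom_deg A M (ground A) 0"
 and eps_dif: "x \<in>: M ==> \<epsilon> (dif M x) = \<zero>\<^sub>A"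
 and eps_unit: "\<exists>w\<in>gr M 0. dif M w = \<zero>\<^sub>M \<and> \<epsilon> w = \<one>\<^sub>A"
 and eps_exact: "x \<in> gr M n ==> dif M x = \<zero>\<^sub>M ==> \<epsilon> x = \<zero>\<^sub>A ==> \<exists>y\<in>gr M (n - 1). dif M y = x"
 using resolution by (auto simp: ground_resolution_def)

text \<open>A cocycle that the augmentation kills has a primitive with prescribed augmentation: the freedom
 lies in degree \<open>0\<close>, where multiples of the unit cocycle can be added.\<close>

lemma solve:
 assumes m: "m \<in> gr M j" "dif M m = \<zero>\<^sub>M" "\<epsilon> m = \<zero>\<^sub>A" and y: "y \<in> gr (ground A) (j - 1)"
 shows "\<exists>u\<in>gr M (j - 1). dif M u = m \<and> \<epsilon> u = y"
proof -
 obtain u where u: "u \<in> gr M (j - 1)" "dif M u = m" using eps_exact[OF m] by blast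
 show ?thesis
 proof (cases "j = 1")
  case False
  have "\<epsilon> u \<in> gr (ground A) (j - 1)" using hom_gr[OF eps u(1)] by simp
  hence "\<epsilon> u = y" using y False by simp
  with u show ?thesis by blast
 next
  case True
  obtain w where w: "w \<in> gr M 0" "dif M w = \<zero>\<^sub>M" "\<epsilon> w = \<one>\<^sub>A" using eps_unit by blast
  have uc: "u \<in>: M" "w \<in>: M" "m \<in>: M" using M.cx.V_closed u(1) w(1) m(1) by blast+
  have e: "\<epsilon> u \<in> gr A 0" "y \<in> gr A 0" using hom_closed[OF eps uc(1)] y True by auto
  define z where "z = y \<ominus>\<^sub>A \<epsilon> u"
  have z: "z \<in> gr A 0" using e by (simp add: z_def)
  have zc: "z \<in>: A" "\<epsilon> u \<in>: A" "y \<in>: A" using A.cx.V_closed z e by blast+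
  have dz: "dif A z = \<zero>\<^sub>A"
  proof -
   obtain c where c: "c \<in>: K" "z = A.scal c" using A.gr_0 z by (auto simp: bij_betw_def)
   show ?thesis unfolding c(2) A.dif_smult[OF c(1) A.one_closed] A.dif_one
    by (rule Module.module.smult_r_null[OF A.module c(1)])
  qed
  have zw: "z \<odot>\<^sub>M w \<in> gr M 0" using M.smult_gr[OF z w(1)] by simp
  hence zwc: "z \<odot>\<^sub>M w \<in>: M" by (rule M.cx.V_closed)
  have "dif M (z \<odot>\<^sub>M w) = \<zero>\<^sub>M"
   using M.leibniz[OF z uc(2)] w(2) dz uc zc by (simp add: M.smult_zero_left M.smult_zero_right)
  moreover have "\<epsilon> (z \<odot>\<^sub>M w) = z"
   using hom_smult[OF eps z uc(2)] w(3) zc A.cx.comp_same[OF z] by (simp add: sgn_pow_def)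
  ultimately show ?thesis
   using u zw zwc uc zc True hom_add[OF eps uc(1) zwc] A.alg.a_comm[of "\<epsilon> u" z] A.alg.minus_cancel[of y "\<epsilon> u"]
   by (intro bexI[of _ "u \<oplus>\<^sub>M z \<odot>\<^sub>M w"]) (auto simp: M.cx.dif_add z_def)
 qed
qed

text \<open>The cocycle \<open>\<theta>\<close> is killed by the homotopy \<open>\<alpha>\<close>, which is
 chosen on one layer of the semibasis after the other: once it is known on the earlier layers,
 the equation at a basis element asks for a primitive of a cocycle in the kernel of the
 augmentation.  The prescribed composition \<open>\<kappa>\<close> lets the same statement
 produce both lifts and homotopies.\<close>

theorem semifree_lift:
 assumes \<theta>: "\<theta> \<in> hom_deg A P M n" and D\<theta>: "!!x. x \<in>: P ==> hom_dif P M n \<theta> x = \<zero>\<^sub>M"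
  and \<kappa>: "\<kappa> \<in> hom_deg A P (ground A) (n - 1)"
  and compat: "!!x. x \<in>: P ==> \<epsilon> (\<theta> x) = hom_dif P (ground A) (n - 1) \<kappa> x"
 shows "\<exists>\<alpha>\<in>hom_deg A P M (n - 1). hom_dif P M (n - 1) \<alpha> = \<theta> \<and> (\<forall>x\<in>carrier P. \<epsilon> (\<alpha> x) = \<kappa> x)"
proof -
 let ?B = "\<Union>n. Bn n" and ?L = "%j. \<Union>i<j. Bn i"
 let ?e = "%s. Pf.ext M (n - 1) s"
 let ?good = "%s. \<forall>b\<in>?B. s b \<in> gr M (Pf.deg b + (n - 1))"
 let ?sol = "%s b. hom_dif P M (n - 1) (?e s) b = \<theta> b \<and> \<epsilon> (s b) = \<kappa> b"
 have BB: "b \<in> ?B" if "b \<in> Bn j" for b j using that by blast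
 have Bc: "b \<in>: P" if "b \<in> Bn j" for b j using Pf.B_closed[OF BB[OF that]] .
 have Lc: "?L j \<subseteq> carrier P" for j using Bc by blast
 have span: "dif P b \<in> lspan P (carrier A) (?L j)" if b: "b \<in> Bn j" for b j
 proof (cases "j = 0")
  case True
  hence "dif P b = \<zero>\<^sub>P" using semibasis b by (auto simp: semibasis_def)
  thus ?thesis unfolding lspan_def by (intro CollectI exI[of _ "{}"]) auto
 next
  case False
  thus ?thesis using semibasis b unfolding semibasis_def by blast
 qed
 have disj: "i = j" if "b \<in> Bn i" "b \<in> Bn j" for b i j
  using semibasis that unfolding semibasis_def by blast
 have eh: "?e s \<in> hom_deg A P M (n - 1)" if "?good s" for s
  by (rule Pf.ext_hom[OF M.is_dgm]) (use that in blast)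
 have eb: "?e s b = s b" if "?good s" "b \<in> ?B" for s b
  by (rule Pf.ext_basis[OF M.is_dgm]) (use that in blast)+
 have De: "hom_dif P M (n - 1) (?e s) \<in> hom_deg A P M n" if "?good s" for s
  using PM.D_V[OF eh[OF that]] by simp
 have LB: "x \<in> ?B" if "x \<in> ?L j" for x j using that by blast
 have agree: "?e s y = ?e s' y"
  if s: "?good s" and s': "?good s'" and eqL: "!!x. x \<in> ?L j ==> s x = s' x" and y: "y \<in> lspan P (carrier A) (?L j)"
  for s s' y j
 proof (rule Pf.hom_eq_on_span[OF M.is_dgm eh[OF s] eh[OF s'] Lc _ y])
  fix x assume x: "x \<in> ?L j"
  show "?e s x = ?e s' x" unfolding eb[OF s LB[OF x]] eb[OF s' LB[OF x]] by (rule eqL[OF x])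
 qed
 \<comment> \<open>the value at a basis element only involves earlier basis elements and the element itself\<close>
 have local: "?sol s b \<longleftrightarrow> ?sol s' b"
  if s: "?good s" and s': "?good s'" and b: "b \<in> Bn j" and eqL: "!!x. x \<in> ?L j ==> s x = s' x" and eqb: "s b = s' b"
  for s s' b j
 proof -
  have "?e s (dif P b) = ?e s' (dif P b)"
   by (rule agree[OF s s' eqL span[OF b]])
  hence "hom_dif P M (n - 1) (?e s) b = hom_dif P M (n - 1) (?e s') b"
   using eb[OF s BB[OF b]] eb[OF s' BB[OF b]] eqb Bc[OF b] by (simp add: PM.D_apply)
  thus ?thesis using eqb by simp
 qed
 let ?Q = "%j s. ?good s \<and> (\<forall>b\<in>?L j. ?sol s b)"
 have "\<exists>f. \<forall>j. ?Q j (f j) \<and> (\<forall>b. b \<notin> Bn j \<longrightarrow> f (Suc j) b = f j b)"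
 proof (rule dependent_nat_choice)
  show "\<exists>s. ?Q 0 s" by (rule exI[of _ "%_. \<zero>\<^sub>M"]) auto
  fix s j assume Q: "?Q j s"
  hence good: "?good s" and sol: "!!b. b \<in> ?L j ==> ?sol s b" by blast+
  have ex: "\<exists>u. u \<in> gr M (Pf.deg b + (n - 1)) \<and> dif M u = \<theta> b \<oplus>\<^sub>M sgn_pow M (n - 1) (?e s (dif P b)) \<and> \<epsilon> u = \<kappa> b"
   if b: "b \<in> Bn j" for b
  proof -
   let ?d = "Pf.deg b"
   have bc: "b \<in>: P" and bg: "b \<in> gr P ?d" using Bc[OF b] Pf.deg[OF BB[OF b]] .
   have dbc: "dif P b \<in>: P" using bc by simp
   note c = hom_closed[OF \<theta> bc] hom_closed[OF \<theta> dbc] hom_closed[OF eh[OF good] dbc]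
   let ?t = "\<theta> b \<oplus>\<^sub>M sgn_pow M (n - 1) (?e s (dif P b))"
   have t: "?t \<in> gr M (?d + n)"
   proof -
    have "?e s (dif P b) \<in> gr M (?d + n)"
     using hom_gr[OF eh[OF good] P.cx.dif_gr[OF bg]] by simp
    thus ?thesis using hom_gr[OF \<theta> bg] by simp
   qed
   have "hom_dif P M (n - 1) (?e s) (dif P b) = \<theta> (dif P b)"
    by (rule Pf.hom_eq_on_span[OF M.is_dgm De[OF good] \<theta> Lc _ span[OF b]]) (use sol in blast)
   hence de: "dif M (?e s (dif P b)) = \<theta> (dif P b)"
    using dbc c PM.hom_zero[OF eh[OF good]] by (simp add: PM.D_apply P.cx.dif_dif[OF bc] a_minus_def)
   have d\<theta>: "dif M (\<theta> b) = sgn_pow M n (\<theta> (dif P b))"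
    using D\<theta>[OF bc] M.M.minus_zero_iff c bc by (simp add: PM.D_apply)
   have dt: "dif M ?t = \<zero>\<^sub>M"
    using c by (cases "even n") (simp_all add: M.cx.dif_add M.cx.dif_sgn d\<theta> de M.M.sgn_odd M.M.r_neg M.M.l_neg M.cx.dif_inv)
   have "\<epsilon> (?e s (dif P b)) = \<kappa> (dif P b)"
   proof -
    have comp: "compose (carrier P) \<epsilon> (?e s) \<in> hom_deg A P (ground A) (n - 1)"
     using compose_V[OF P.is_dgm M.is_dgm A.ground.is_dgm
       A.cx.is_cpx eps eh[OF good]] by simp
    have "compose (carrier P) \<epsilon> (?e s) (dif P b) = \<kappa> (dif P b)"
    proof (rule Pf.hom_eq_on_span[OF A.ground.is_dgm comp \<kappa> Lc _ span[OF b]])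
     fix x assume x: "x \<in> ?L j"
     hence "x \<in> ?B" "x \<in>: P" using Lc by blast+
     thus "compose (carrier P) \<epsilon> (?e s) x = \<kappa> x" using sol[OF x] eb[OF good] by (simp add: compose_eq)
    qed
    thus ?thesis using dbc by (simp add: compose_eq)
   qed
   moreover have "\<epsilon> (\<theta> b) = \<ominus>\<^bsub>ground A\<^esub> sgn_pow (ground A) (n - 1) (\<kappa> (dif P b))"
    using compat[OF bc] A.ground.M.l_zero[OF A.ground.M.a_inv_closed[OF A.ground.M.sgn_closed[OF hom_closed[OF \<kappa> dbc]]], of "n - 1"] bc
    by (simp add: PG.D_apply a_minus_def)
   moreover have "\<epsilon> ?t = \<epsilon> (\<theta> b) \<oplus>\<^bsub>ground A\<^esub> sgn_pow (ground A) (n - 1) (\<epsilon> (?e s (dif P b)))"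
   proof -
    interpret MG: hom_complex A M "ground A" by unfold_locales
    show ?thesis using hom_add[OF eps c(1) M.M.sgn_closed[OF c(3)]] MG.hom_sgn[OF eps c(3)] by simp
   qed
   ultimately have et: "\<epsilon> ?t = \<zero>\<^sub>A"
    using A.ground.M.l_neg[OF A.ground.M.sgn_closed[OF hom_closed[OF \<kappa> dbc]], of "n - 1"] by simp
   have "\<kappa> b \<in> gr (ground A) (?d + n - 1)" using hom_gr[OF \<kappa> bg] by (simp add: algebra_simps)
   from solve[OF t dt et this] show ?thesis by (auto simp: algebra_simps)
  qed
  define g where "g b = (SOME u. u \<in> gr M (Pf.deg b + (n - 1)) \<and> dif M u = \<theta> b \<oplus>\<^sub>M sgn_pow M (n - 1) (?e s (dif P b)) \<and> \<epsilon> u = \<kappa> b)" for b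
  have g: "g b \<in> gr M (Pf.deg b + (n - 1)) \<and> dif M (g b) = \<theta> b \<oplus>\<^sub>M sgn_pow M (n - 1) (?e s (dif P b)) \<and> \<epsilon> (g b) = \<kappa> b"
   if "b \<in> Bn j" for b unfolding g_def by (rule someI_ex[OF ex[OF that]])
  define s' where "s' b = (if b \<in> Bn j then g b else s b)" for b
  have good': "?good s'" using good g by (auto simp: s'_def)
  have eqL: "s x = s' x" if x: "x \<in> ?L i" "i \<le> j" for x i
  proof -
   have "x \<notin> Bn j" using x disj by (metis UN_E lessThan_iff linorder_not_less)
   thus ?thesis by (simp add: s'_def)
  qed
  have sol': "?sol s' b" if b: "b \<in> ?L (Suc j)" for b
  proof (cases "b \<in> Bn j")
   case True
   have bc: "b \<in>: P" and dbc: "dif P b \<in>: P" using Bc[OF True] by auto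
   have s'b: "s' b = g b" using True by (simp add: s'_def)
   have "?e s' (dif P b) = ?e s (dif P b)"
    by (rule agree[OF good good' eqL[OF _ order_refl] span[OF True], symmetric])
   hence "hom_dif P M (n - 1) (?e s') b
     = (\<theta> b \<oplus>\<^sub>M sgn_pow M (n - 1) (?e s (dif P b))) \<ominus>\<^sub>M sgn_pow M (n - 1) (?e s (dif P b))"
    using bc eb[OF good' BB[OF True]] g[OF True] s'b by (simp add: PM.D_apply)
   also have "... = \<theta> b"
    by (rule M.M.add_minus_cancel) (use hom_closed[OF \<theta> bc] hom_closed[OF eh[OF good] dbc] in auto)
   finally show ?thesis using g[OF True] True by (simp add: s'_def)
  next
   case False
   then obtain i where i: "i < j" "b \<in> Bn i" using b by (auto simp: less_Suc_eq)
   hence bL: "b \<in> ?L j" by blast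
   show ?thesis using sol[OF bL] local[OF good good' i(2) eqL eqL[OF bL]] i(1) by simp
  qed
  have "?Q (Suc j) s'" by (rule conjI[OF good' ballI[OF sol']])
  moreover have "\<forall>b. b \<notin> Bn j \<longrightarrow> s' b = s b" by (simp add: s'_def)
  ultimately show "\<exists>s'. ?Q (Suc j) s' \<and> (\<forall>b. b \<notin> Bn j \<longrightarrow> s' b = s b)" by (rule exI[where x = s', OF conjI])
 qed
 then obtain f where f_all: "\<forall>j. ?Q j (f j) \<and> (\<forall>b. b \<notin> Bn j \<longrightarrow> f (Suc j) b = f j b)" by (elim exE)
 have f: "?Q j (f j)" for j by (rule conjunct1[OF spec[OF f_all]])
 have f_step: "f (Suc j) b = f j b" if "b \<notin> Bn j" for j b
  by (rule mp[OF spec[OF conjunct2[OF spec[OF f_all]]] that])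
 define lev where "lev b = (SOME j. b \<in> Bn j)" for b
 have lev: "lev b = j" if b: "b \<in> Bn j" for b j
 proof -
  have "b \<in> Bn (lev b)" unfolding lev_def using b by (rule someI)
  thus ?thesis using disj b by blast
 qed
 have f_const: "f (Suc j + k) b = f (Suc j) b" if b: "b \<in> Bn j" for b j k
 proof (induction k)
  case (Suc k)
  have "b \<notin> Bn (Suc j + k)" using disj[OF b] by force
  thus ?case using f_step[of b "Suc j + k"] Suc by simp
 qed simp
 define s where "s b = f (Suc (lev b)) b" for b
 have good: "?good s"
 proof
  fix b assume b: "b \<in> ?B"
  show "s b \<in> gr M (Pf.deg b + (n - 1))" unfolding s_def by (rule bspec[OF conjunct1[OF f] b])
 qed
 have s_eq: "s b = f i b" if "b \<in> Bn j" "j < i" for b i j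
  using f_const[OF that(1), of "i - Suc j"] that lev[OF that(1)] by (simp add: s_def)
 have sol: "?sol s b" if b: "b \<in> ?B" for b
 proof -
  obtain j where j: "b \<in> Bn j" using b by (elim UN_E)
  have fg: "?good (f (Suc j))" by (rule conjunct1[OF f])
  have fs: "?sol (f (Suc j)) b" by (rule bspec[OF conjunct2[OF f]]) (use j in blast)
  have "?sol (f (Suc j)) b \<longleftrightarrow> ?sol s b"
  proof (rule local[OF fg good j])
   show "f (Suc j) b = s b" using s_eq[OF j, of "Suc j"] by simp
   fix x assume "x \<in> ?L j"
   then obtain i where "i < j" "x \<in> Bn i" by blast
   thus "f (Suc j) x = s x" using s_eq[of x i "Suc j"] by simp
  qed
  thus ?thesis using fs by (rule iffD1)
 qed
 have "hom_dif P M (n - 1) (?e s) = \<theta>"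
  by (rule Pf.hom_eq_on_basis[OF M.is_dgm De[OF good] \<theta>]) (rule conjunct1[OF sol])
 moreover have "compose (carrier P) \<epsilon> (?e s) = \<kappa>"
 proof (rule Pf.hom_eq_on_basis[OF A.ground.is_dgm _ \<kappa>])
  show "compose (carrier P) \<epsilon> (?e s) \<in> hom_deg A P (ground A) (n - 1)"
   using compose_V[OF P.is_dgm M.is_dgm A.ground.is_dgm
       A.cx.is_cpx eps eh[OF good]] by simp
  show "compose (carrier P) \<epsilon> (?e s) b = \<kappa> b" if "b \<in> ?B" for b
   using sol[OF that] eb[OF good that] Pf.B_closed[OF that] by (simp add: compose_eq)
 qed
 hence "\<epsilon> (?e s x) = \<kappa> x" if "x \<in>: P" for x
  using compose_eq[OF that, of \<epsilon> "?e s"] by simp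
 ultimately show ?thesis using eh[OF good] by (intro bexI[of _ "?e s"] conjI ballI)
qed

end

section \<open>Minimal resolutions generated in degree zero\<close>

lemma (in hom_complex) hom_linear:
 assumes f: "f \<in> V 0" and a: "a \<in>: A" and x: "x \<in>: M"
 shows "f (a \<odot>\<^sub>M x) = a \<odot>\<^sub>N f x"
 using a
proof (induction rule: A.graded_induct)
 case (homogeneous i a)
 thus ?case using hom_smult[OF f homogeneous x] by (simp add: sgn_pow_def)
next
 case (add a b)
 thus ?case using x hom_closed[OF f x]
  by (simp add: M.smult_l_distr N.smult_l_distr M.smult_closed hom_add[OF f])
qed

locale koszul_resolution = A: connected_dg_algebra K A + L: left_dg_module A L
 for K :: "('k, 'c) ring_scheme" and A :: "('k, 'a) dg" and L :: "('a, 'r) dg" +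
 fixes Bn :: "nat => 'r set" and e :: "'r => 'a"
 assumes semibasis: "semibasis A L Bn" and Bn_gr: "Bn n \<subseteq> gr L 0"
  and minimal: "minimal_dg_module A L" and resolution: "ground_resolution A L e"
begin

abbreviation B where "B \<equiv> \<Union>n. Bn n"

sublocale LL: semifree_lifting K A L L Bn e
 by unfold_locales (use semibasis resolution in auto)

abbreviation coord where "coord \<equiv> LL.Pf.coord"

lemma one_neq_zero: "\<one>\<^sub>A ~= \<zero>\<^sub>A"
proof
 assume "\<one>\<^sub>A = \<zero>\<^sub>A"
 interpret K: field K by (rule A.field)
 have "A.scal \<one>\<^sub>K = A.scal \<zero>\<^sub>K"
  using Module.module.smult_l_null[OF A.module A.one_closed] A.scal_one \<open>\<one>\<^sub>A = \<zero>\<^sub>A\<close> by simp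
 thus False using A.gr_0 K.one_closed K.zero_closed K.zero_not_one unfolding bij_betw_def inj_on_def by metis
qed

lemma basis_gr: "b \<in> B ==> b \<in> gr L 0" using Bn_gr by blast

lemma basis_neq_zero: "b \<in> B ==> b ~= \<zero>\<^sub>L"
proof
 assume b: "b \<in> B" and "b = \<zero>\<^sub>L"
 hence "b \<oplus>\<^sub>L b = b" by simp
 hence "coord b b \<oplus>\<^sub>A coord b b = coord b b"
  using LL.Pf.coord_add[OF LL.Pf.B_closed[OF b] LL.Pf.B_closed[OF b] b] by simp
 thus False using LL.Pf.coord_basis[OF b b] one_neq_zero
  A.alg.add.r_cancel_one[of "\<one>\<^sub>A" "\<one>\<^sub>A"] by simp
qed

lemma deg_zero: "b \<in> B ==> LL.Pf.deg b = 0"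
 using L.cx.V_disjoint[OF basis_gr LL.Pf.deg] basis_neq_zero by metis

lemma coord_gr: "x \<in> gr L n ==> b \<in> B ==> coord x b \<in> gr A n"
 using LL.Pf.coord_gr[of x n b] deg_zero[of b] by simp

lemma gr_neg_zero:
 assumes x: "x \<in> gr L n" and "n < 0"
 shows "x = \<zero>\<^sub>L"
proof -
 have "coord x b = \<zero>\<^sub>A" if "b \<in> B" for b
  using A.gr_neg_zero[OF coord_gr[OF x that] \<open>n < 0\<close>] .
 hence "{b\<in>B. coord x b ~= \<zero>\<^sub>A} = {}" by auto
 thus ?thesis using LL.Pf.sum_coord[OF L.cx.V_closed[OF x], of "{}"] by simp
qed

lemma hom_zeroI:
 assumes N: "left_dg_module A N" and f: "f \<in> hom_deg A L N n" and N0: "gr N n = {\<zero>\<^sub>N}" and x: "x \<in>: L"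
 shows "f x = \<zero>\<^sub>N"
proof -
 interpret N: left_dg_module A N by fact
 interpret LN: hom_complex A L N by unfold_locales
 have "f = \<zero>\<^sub>LN.F"
 proof (rule LL.Pf.hom_eq_on_basis[OF N f LN.zero_V])
  fix b assume b: "b \<in> B"
  have "f b \<in> gr N n" using hom_gr[OF f basis_gr[OF b]] by simp
  thus "f b = \<zero>\<^sub>LN.F b" using N0 LL.Pf.B_closed[OF b] by (simp add: LN.F_eval_zero)
 qed
 thus ?thesis using x by (simp add: LN.F_eval_zero)
qed

lemma hom_neg_zero:
 assumes f: "f \<in> hom_deg A L L n" and n: "n < 0" and x: "x \<in>: L"
 shows "f x = \<zero>\<^sub>L"
proof (rule hom_zeroI[OF L.is_dgm f _ x])
 show "gr L n = {\<zero>\<^sub>L}" using gr_neg_zero n L.cx.V_zero[of n] by blast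
qed

text \<open>Minimality kills the differential of every complex of maps into a module on which the positive
 part of the algebra acts as zero.\<close>

lemma hom_dif_zero:
 assumes N: "left_dg_module A N" and k: "k \<in> hom_deg A L N 0"
  and triv: "!!a y. a \<in> pos_part A ==> y \<in>: N ==> a \<odot>\<^sub>N y = \<zero>\<^sub>N" and x: "x \<in>: L"
 shows "k (dif L x) = \<zero>\<^sub>N"
proof -
 interpret N: left_dg_module A N by fact
 interpret LN: hom_complex A L N by unfold_locales
 have "dif L x \<in> lspan L (pos_part A) (carrier L)"
  using minimal x unfolding minimal_dg_module_def by blast
 then obtain F c where F: "finite F" "F \<subseteq> carrier L" "c \<in> F \<rightarrow> pos_part A"
  and dx: "dif L x = (\<Oplus>\<^sub>L b\<in>F. c b \<odot>\<^sub>L b)" by (auto simp: lspan_def)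
 have cb: "c b \<in> pos_part A" "c b \<in>: A" "b \<in>: L" if "b \<in> F" for b
  using that F A.pos_part_iff by auto
 have "k (dif L x) = (\<Oplus>\<^sub>N b\<in>F. k (c b \<odot>\<^sub>L b))"
  unfolding dx by (rule LN.hom_finsum[OF k]) (use cb L.smult_closed in blast)
 also have "... = (\<Oplus>\<^sub>N b\<in>F. \<zero>\<^sub>N)"
 proof (rule N.M.finsum_cong'[OF refl])
  show "k (c b \<odot>\<^sub>L b) = \<zero>\<^sub>N" if "b \<in> F" for b
   unfolding LN.hom_linear[OF k cb(2,3)[OF that]] by (rule triv[OF cb(1)[OF that] hom_closed[OF k cb(3)[OF that]]])
 qed auto
 finally show ?thesis by simp
qed

lemma hom_dif_ground:
 assumes "k \<in> hom_deg A L (ground A) 0" and x: "x \<in>: L"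
 shows "hom_dif L (ground A) 0 k x = \<zero>\<^sub>A"
proof -
 have "k (dif L x) = \<zero>\<^sub>A"
  using hom_dif_zero[OF A.ground.is_dgm assms(1) _ x] A.pos_part_iff A.cx.V_closed by simp
 thus ?thesis using x A.ground.M.minus_zero_iff[of "\<zero>\<^sub>A" "\<zero>\<^sub>A"] by (simp add: LL.PG.D_apply)
qed

subsection \<open>Chain endomorphisms\<close>

definition E0 :: "('r => 'r) set" where
 "E0 = {f \<in> hom_deg A L L 0. \<forall>x\<in>carrier L. hom_dif L L 0 f x = \<zero>\<^sub>L}"

lemma E0_hom: "f \<in> E0 ==> f \<in> hom_deg A L L 0" by (simp add: E0_def)

lemma E0_iff: "f \<in> E0 \<longleftrightarrow> f \<in> hom_deg A L L 0 \<and> (\<forall>x\<in>carrier L. f (dif L x) = dif L (f x))"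
proof -
 have "hom_dif L L 0 f x = \<zero>\<^sub>L \<longleftrightarrow> f (dif L x) = dif L (f x)"
  if f: "f \<in> hom_deg A L L 0" and x: "x \<in>: L" for x
 proof -
  have c: "dif L (f x) \<in>: L" "f (dif L x) \<in>: L" using hom_closed[OF f] x by auto
  have "hom_dif L L 0 f x = dif L (f x) \<ominus>\<^sub>L f (dif L x)"
   using LL.PM.D_apply[OF x, of 0 f] by (simp add: sgn_pow_def)
  thus ?thesis using L.M.minus_zero_iff[OF c] by (simp only: eq_commute[of "dif L (f x)"])
 qed
 thus ?thesis by (auto simp: E0_def)
qed

lemma E0_dif: "f \<in> E0 ==> x \<in>: L ==> f (dif L x) = dif L (f x)"
 by (simp add: E0_iff)

lemma e_hom: "e \<in> hom_deg A L (ground A) 0" by (rule LL.eps)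

lemma e_closed: "x \<in>: L ==> e x \<in> gr A 0"
 using hom_closed[OF e_hom] by simp

text \<open>There are no nonzero maps of degree \<open>-1\<close>, so a chain endomorphism is determined by its
 composition with the augmentation, not merely up to homotopy.\<close>

lemma E0_eq_zero:
 assumes f: "f \<in> E0" and ef: "!!b. b \<in> B ==> e (f b) = \<zero>\<^sub>A" and x: "x \<in>: L"
 shows "f x = \<zero>\<^sub>L"
proof -
 note fh = E0_hom[OF f]
 have comp: "compose (carrier L) e f \<in> hom_deg A L (ground A) 0"
  using compose_V[OF L.is_dgm L.is_dgm A.ground.is_dgm
    A.cx.is_cpx e_hom fh] by simp
 have zg: "\<zero>\<^sub>LL.PG.F \<in> hom_deg A L (ground A) n" for n by (rule LL.PG.zero_V)
 have "compose (carrier L) e f = \<zero>\<^sub>LL.PG.F"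
  by (rule LL.Pf.hom_eq_on_basis[OF A.ground.is_dgm comp zg])
   (use ef LL.Pf.B_closed in \<open>auto simp: compose_eq LL.PG.F_eval_zero\<close>)
 hence ef0: "e (f y) = \<zero>\<^sub>A" if "y \<in>: L" for y
  using compose_eq[OF that, of e f] LL.PG.F_eval_zero[OF that] by simp
 have "\<exists>h\<in>hom_deg A L L (0 - 1). hom_dif L L (0 - 1) h = f \<and> (\<forall>y\<in>carrier L. e (h y) = \<zero>\<^sub>LL.PG.F y)"
 proof (rule LL.semifree_lift[OF fh _ zg])
  show "hom_dif L L 0 f y = \<zero>\<^sub>L" if "y \<in>: L" for y using f that by (simp add: E0_def)
  show "e (f y) = hom_dif L (ground A) (0 - 1) \<zero>\<^sub>LL.PG.F y" if "y \<in>: L" for y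
   unfolding LL.PG.D_zero ef0[OF that] using LL.PG.F_eval_zero[OF that] by simp
 qed
 then obtain h where h: "h \<in> hom_deg A L L (- 1)" "hom_dif L L (- 1) h = f" by auto
 have "h y = \<zero>\<^sub>L" if "y \<in>: L" for y by (rule hom_neg_zero[OF h(1) _ that]) simp
 hence "h = \<zero>\<^sub>LL.PM.F"
  by (intro hom_eqI[OF h(1) LL.PM.zero_V]) (simp add: LL.PM.F_eval_zero)
 thus ?thesis using h(2) LL.PM.D_zero LL.PM.F_eval_zero[OF x] by simp
qed

text \<open>A functional on the span of the basis kills the differential by minimality, so it lifts along
 the augmentation to a chain endomorphism.\<close>

lemma lift_functional:
 assumes \<phi>: "!!b. b \<in> B ==> \<phi> b \<in> gr A 0"
 shows "\<exists>f\<in>E0. \<forall>b\<in>B. e (f b) = \<phi> b"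
proof -
 let ?k = "LL.Pf.ext (ground A) 0 \<phi>"
 have s: "\<phi> b \<in> gr (ground A) (LL.Pf.deg b + 0)" if "b \<in> B" for b using \<phi>[OF that] deg_zero[OF that] by simp
 have k: "?k \<in> hom_deg A L (ground A) 0" by (rule LL.Pf.ext_hom[OF A.ground.is_dgm s])
 have kb: "?k b = \<phi> b" if "b \<in> B" for b by (rule LL.Pf.ext_basis[OF A.ground.is_dgm s that])
 have "\<exists>f\<in>hom_deg A L L (1 - 1). hom_dif L L (1 - 1) f = \<zero>\<^sub>LL.PM.F \<and> (\<forall>x\<in>carrier L. e (f x) = ?k x)"
 proof (rule LL.semifree_lift[OF LL.PM.zero_V])
  show "hom_dif L L 1 \<zero>\<^sub>LL.PM.F x = \<zero>\<^sub>L" if "x \<in>: L" for x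
   unfolding LL.PM.D_zero by (rule LL.PM.F_eval_zero[OF that])
  show "?k \<in> hom_deg A L (ground A) (1 - 1)" using k by simp
  show "e (\<zero>\<^sub>LL.PM.F x) = hom_dif L (ground A) (1 - 1) ?k x" if x: "x \<in>: L" for x
   using hom_dif_ground[OF k x] LL.PG.hom_zero[OF e_hom] LL.PM.F_eval_zero[OF x] by simp
 qed
 then obtain f where f: "f \<in> hom_deg A L L 0" "hom_dif L L 0 f = \<zero>\<^sub>LL.PM.F" "\<forall>x\<in>carrier L. e (f x) = ?k x" by auto
 thus ?thesis using kb LL.Pf.B_closed LL.PM.F_eval_zero by (intro bexI[of _ f]) (auto simp: E0_def)
qed

lemma cocycle_0_zero:
 assumes y: "y \<in> gr L 0" "dif L y = \<zero>\<^sub>L" "e y = \<zero>\<^sub>A"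
 shows "y = \<zero>\<^sub>L"
proof -
 obtain z where z: "z \<in> gr L (0 - 1)" "dif L z = y" using LL.eps_exact[OF y] by blast
 have "z = \<zero>\<^sub>L" by (rule gr_neg_zero[OF z(1)]) simp
 thus ?thesis using z(2) by simp
qed

definition w :: 'r where "w = (SOME w. w \<in> gr L 0 \<and> dif L w = \<zero>\<^sub>L \<and> e w = \<one>\<^sub>A)"

lemma w: "w \<in> gr L 0" "dif L w = \<zero>\<^sub>L" "e w = \<one>\<^sub>A"
proof -
 have "\<exists>w. w \<in> gr L 0 \<and> dif L w = \<zero>\<^sub>L \<and> e w = \<one>\<^sub>A" using LL.eps_unit by blast
 from someI_ex[OF this] show "w \<in> gr L 0" "dif L w = \<zero>\<^sub>L" "e w = \<one>\<^sub>A" unfolding w_def by blast+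
qed

lemma w_closed: "w \<in>: L" by (rule L.cx.V_closed[OF w(1)])

lemma dif_gr_0: "a \<in> gr A 0 ==> dif A a = \<zero>\<^sub>A"
proof -
 assume "a \<in> gr A 0"
 then obtain c where c: "c \<in>: K" "a = A.scal c" using A.gr_0 by (auto simp: bij_betw_def)
 show ?thesis unfolding c(2) A.dif_smult[OF c(1) A.one_closed] A.dif_one
  by (rule Module.module.smult_r_null[OF A.module c(1)])
qed

lemma e_smult_gr: "a \<in> gr A n ==> x \<in>: L ==> e (a \<odot>\<^sub>L x) = (if n = 0 then a \<otimes>\<^sub>A e x else \<zero>\<^sub>A)"
 using LL.PG.hom_linear[OF e_hom A.cx.V_closed] A.cx.comp_V_eq[of a n 0] A.cx.V_closed[OF e_closed] by simp

lemma dif_smult_w: "a \<in> gr A n ==> dif L (a \<odot>\<^sub>L w) = dif A a \<odot>\<^sub>L w"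
 using L.leibniz[of a n w] w w_closed A.cx.V_closed[of a n] by (simp add: L.smult_zero_right L.smult_closed)

lemma cocycle_0:
 assumes y: "y \<in> gr L 0" "dif L y = \<zero>\<^sub>L"
 shows "y = e y \<odot>\<^sub>L w"
proof -
 have yc: "y \<in>: L" by (rule L.cx.V_closed[OF y(1)])
 note ey = e_closed[OF yc]
 have eyc: "e y \<in>: A" by (rule A.cx.V_closed[OF ey])
 have ew: "e y \<odot>\<^sub>L w \<in> gr L 0" using L.smult_gr[OF ey w(1)] by simp
 have ewc: "e y \<odot>\<^sub>L w \<in>: L" by (rule L.cx.V_closed[OF ew])
 have "y \<ominus>\<^sub>L e y \<odot>\<^sub>L w = \<zero>\<^sub>L"
 proof (rule cocycle_0_zero)
  show "y \<ominus>\<^sub>L e y \<odot>\<^sub>L w \<in> gr L 0" using y(1) ew by simp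
  show "dif L (y \<ominus>\<^sub>L e y \<odot>\<^sub>L w) = \<zero>\<^sub>L"
   using y(2) dif_smult_w[OF ey] dif_gr_0[OF ey] w_closed L.M.minus_zero_iff[of "\<zero>\<^sub>L" "\<zero>\<^sub>L"]
   by (simp add: L.cx.dif_minus[OF yc ewc] L.smult_zero_left)
  have "e (e y \<odot>\<^sub>L w) = e y" using e_smult_gr[OF ey w_closed] w(3) eyc by simp
  thus "e (y \<ominus>\<^sub>L e y \<odot>\<^sub>L w) = \<zero>\<^sub>A"
   using LL.PG.hom_minus[OF e_hom yc ewc] A.ground.M.minus_zero_iff[of "e y" "e y"] ey by simp
 qed
 thus ?thesis using L.M.minus_zero_iff[OF yc ewc] by simp
qed

end

section \<open>Comparing resolutions\<close>

definition chain_map :: "('k, 'a) dg => ('a, 'm) dg => ('a, 'n) dg => ('m => 'n) => bool" where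
 "chain_map A M N f \<longleftrightarrow> f \<in> hom_deg A M N 0 \<and> (\<forall>x\<in>carrier M. f (dif M x) = dif N (f x))"

lemma chain_hom: "chain_map A M N f ==> f \<in> hom_deg A M N 0"
 and chain_dif: "chain_map A M N f ==> x \<in>: M ==> f (dif M x) = dif N (f x)"
 and chain_closed: "chain_map A M N f ==> x \<in>: M ==> f x \<in>: N"
 by (auto simp: chain_map_def hom_closed)

lemma chain_compose:
 assumes "left_dg_module A L" "left_dg_module A M" "left_dg_module A N" "cochain_complex A"
  and f: "chain_map A M N f" and g: "chain_map A L M g"
 shows "chain_map A L N (compose (carrier L) f g)"
proof -
 interpret L: left_dg_module A L by fact
 have "compose (carrier L) f g \<in> hom_deg A L N 0"
  using compose_V[OF assms(1-4) chain_hom[OF f] chain_hom[OF g]] by simp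
 thus ?thesis
  using chain_dif[OF f chain_closed[OF g]] chain_dif[OF g] by (simp add: chain_map_def compose_eq)
qed

lemma (in hom_complex) chain_iff: "f \<in> V 0 ==> chain_map A M N f \<longleftrightarrow> D 0 f = \<zero>\<^sub>F"
proof -
 assume f: "f \<in> V 0"
 have eq: "D 0 f x = \<zero>\<^sub>N \<longleftrightarrow> f (dif M x) = dif N (f x)" if x: "x \<in>: M" for x
 proof -
  have c: "dif N (f x) \<in>: N" "f (dif M x) \<in>: N" using hom_closed[OF f] x by auto
  have "D 0 f x = dif N (f x) \<ominus>\<^sub>N f (dif M x)" using D_apply[OF x, of 0 f] by (simp add: sgn_pow_def)
  thus ?thesis using N.M.minus_zero_iff[OF c] by (simp only: eq_commute[of "dif N (f x)"])
 qed
 have "D 0 f = \<zero>\<^sub>F \<longleftrightarrow> (\<forall>x\<in>carrier M. D 0 f x = \<zero>\<^sub>N)"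
 proof
  show "\<forall>x\<in>carrier M. D 0 f x = \<zero>\<^sub>N" if "D 0 f = \<zero>\<^sub>F" unfolding that by (simp add: F_eval_zero)
  show "D 0 f = \<zero>\<^sub>F" if "\<forall>x\<in>carrier M. D 0 f x = \<zero>\<^sub>N"
   by (rule hom_eqI[OF D_V[OF f] zero_V]) (simp add: that F_eval_zero)
 qed
 thus ?thesis using f eq by (simp add: chain_map_def)
qed

lemma (in hom_complex) chain_minus: "chain_map A M N f ==> chain_map A M N g ==> chain_map A M N (f \<ominus>\<^sub>F g)"
proof -
 assume f: "chain_map A M N f" and g: "chain_map A M N g"
 note fh = chain_hom[OF f] and gh = chain_hom[OF g]
 have "D 0 (f \<ominus>\<^sub>F g) = \<zero>\<^sub>F"
  using f g fh gh F.minus_zero_iff[OF F.zero_closed F.zero_closed] by (simp add: D_minus chain_iff)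
 thus ?thesis using chain_iff[OF minus_V[OF fh gh]] by simp
qed

lemma sandwich:
 assumes M': "left_dg_module A M'" and M: "left_dg_module A M" and N: "left_dg_module A N"
  and N': "left_dg_module A N'" and A: "cochain_complex A"
  and a: "chain_map A N N' a" and b: "chain_map A M' M b" and h: "h \<in> hom_deg A M N n"
 shows sandwich_hom: "compose (carrier M') a (compose (carrier M') h b) \<in> hom_deg A M' N' n"
  and sandwich_dif: "x \<in>: M' ==>
   hom_dif M' N' n (compose (carrier M') a (compose (carrier M') h b)) x = a (hom_dif M N n h (b x))"
proof -
 interpret A: cochain_complex A by fact
 interpret M': left_dg_module A M' by fact
 interpret M: left_dg_module A M by fact
 interpret N: left_dg_module A N by fact
 interpret N': left_dg_module A N' by fact
 interpret MN: hom_complex A M N by unfold_locales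
 interpret MN': hom_complex A M' N' by unfold_locales
 interpret NN': hom_complex A N N' by unfold_locales
 have hb: "compose (carrier M') h b \<in> hom_deg A M' N n"
  using compose_V[OF M' M N A h chain_hom[OF b]] by simp
 show "compose (carrier M') a (compose (carrier M') h b) \<in> hom_deg A M' N' n"
  using compose_V[OF M' N N' A chain_hom[OF a] hb] by simp
 show "hom_dif M' N' n (compose (carrier M') a (compose (carrier M') h b)) x = a (hom_dif M N n h (b x))"
  if x: "x \<in>: M'"
 proof -
  have bx: "b x \<in>: M" "b (dif M' x) = dif M (b x)" using chain_closed[OF b x] chain_dif[OF b x] .
  have hbx: "h (b x) \<in>: N" "h (dif M (b x)) \<in>: N" using hom_closed[OF h] bx by auto
  show ?thesis
   using x bx hbx NN'.hom_minus[OF chain_hom[OF a]] NN'.hom_sgn[OF chain_hom[OF a]] chain_dif[OF a]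
   by (simp add: MN'.D_apply MN.D_apply compose_eq)
 qed
qed

context semifree_lifting
begin

text \<open>The case \<open>\<theta> = 0\<close> of the lifting theorem.\<close>

lemma lift_chain:
 assumes k: "\<kappa> \<in> hom_deg A P (ground A) 0" and kd: "!!x. x \<in>: P ==> \<kappa> (dif P x) = \<zero>\<^sub>A"
 shows "\<exists>f. chain_map A P M f \<and> (\<forall>x\<in>carrier P. \<epsilon> (f x) = \<kappa> x)"
proof -
 have "\<exists>f\<in>hom_deg A P M (1 - 1). hom_dif P M (1 - 1) f = \<zero>\<^sub>PM.F \<and> (\<forall>x\<in>carrier P. \<epsilon> (f x) = \<kappa> x)"
 proof (rule semifree_lift[OF PM.zero_V])
  show "hom_dif P M 1 \<zero>\<^sub>PM.F x = \<zero>\<^sub>M" if "x \<in>: P" for x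
   unfolding PM.D_zero by (rule PM.F_eval_zero[OF that])
  show "\<kappa> \<in> hom_deg A P (ground A) (1 - 1)" using k by simp
  show "\<epsilon> (\<zero>\<^sub>PM.F x) = hom_dif P (ground A) (1 - 1) \<kappa> x" if x: "x \<in>: P" for x
  proof -
   interpret MG: hom_complex A M "ground A" by unfold_locales
   have "hom_dif P (ground A) 0 \<kappa> x = \<zero>\<^bsub>ground A\<^esub> \<ominus>\<^bsub>ground A\<^esub> \<zero>\<^bsub>ground A\<^esub>"
    using PG.D_apply[OF x, of 0 \<kappa>] kd[OF x] by (simp add: sgn_pow_def)
   thus ?thesis
    using MG.hom_zero[OF eps] PM.F_eval_zero[OF x] A.ground.M.minus_zero_iff[OF A.ground.M.zero_closed A.ground.M.zero_closed]
    by simp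
  qed
 qed
 thus ?thesis using PM.chain_iff by auto
qed

text \<open>The case \<open>\<kappa> = 0\<close> of the lifting theorem.\<close>

lemma null_homotopic:
 assumes f: "f \<in> hom_deg A P M n" and Df: "!!x. x \<in>: P ==> hom_dif P M n f x = \<zero>\<^sub>M"
  and ef: "!!x. x \<in>: P ==> \<epsilon> (f x) = \<zero>\<^sub>A"
 shows "\<exists>h\<in>hom_deg A P M (n - 1). hom_dif P M (n - 1) h = f"
proof -
 have "\<exists>h\<in>hom_deg A P M (n - 1). hom_dif P M (n - 1) h = f \<and> (\<forall>y\<in>carrier P. \<epsilon> (h y) = \<zero>\<^sub>PG.F y)"
  by (rule semifree_lift[OF f Df PG.zero_V]) (simp_all add: ef PG.D_zero PG.F_eval_zero)
 thus ?thesis by blast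
qed

end

locale koszul_transfer = koszul_resolution K A L Bn e + P: left_dg_module A P
 for K :: "('k, 'c) ring_scheme" and A :: "('k, 'a) dg" and L :: "('a, 'r) dg"
  and Bn :: "nat => 'r set" and e :: "'r => 'a" and P :: "('a, 'p) dg" +
 fixes Cn :: "nat => 'p set" and \<epsilon> :: "'p => 'a"
 assumes semibasis_P: "semibasis A P Cn" and resolution_P: "ground_resolution A P \<epsilon>"
begin

sublocale PP: semifree_lifting K A P P Cn \<epsilon>
 by unfold_locales (use semibasis_P resolution_P in auto)
sublocale LP: semifree_lifting K A L P Bn \<epsilon>
 by unfold_locales (use semibasis resolution_P in auto)
sublocale PL: semifree_lifting K A P L Cn e
 by unfold_locales (use semibasis_P resolution in auto)

definition u :: "'r => 'p" where
 "u = (SOME u. chain_map A L P u \<and> (\<forall>x\<in>carrier L. \<epsilon> (u x) = e x))"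

definition v :: "'p => 'r" where
 "v = (SOME v. chain_map A P L v \<and> (\<forall>x\<in>carrier P. e (v x) = \<epsilon> x))"

lemma u: "chain_map A L P u" "x \<in>: L ==> \<epsilon> (u x) = e x"
proof -
 have "\<exists>u. chain_map A L P u \<and> (\<forall>x\<in>carrier L. \<epsilon> (u x) = e x)"
  by (rule LP.lift_chain[OF e_hom LL.eps_dif])
 from someI_ex[OF this] have "chain_map A L P u \<and> (\<forall>x\<in>carrier L. \<epsilon> (u x) = e x)" unfolding u_def .
 thus "chain_map A L P u" "x \<in>: L ==> \<epsilon> (u x) = e x" by blast+
qed

lemma v: "chain_map A P L v" "x \<in>: P ==> e (v x) = \<epsilon> x"
proof -
 have "\<exists>v. chain_map A P L v \<and> (\<forall>x\<in>carrier P. e (v x) = \<epsilon> x)"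
  by (rule PL.lift_chain[OF PP.eps PP.eps_dif])
 from someI_ex[OF this] have "chain_map A P L v \<and> (\<forall>x\<in>carrier P. e (v x) = \<epsilon> x)" unfolding v_def .
 thus "chain_map A P L v" "x \<in>: P ==> e (v x) = \<epsilon> x" by blast+
qed

lemmas u_closed = chain_closed[OF u(1)] and v_closed = chain_closed[OF v(1)]
lemmas modules = L.is_dgm P.is_dgm

lemma E0_chain: "f \<in> E0 \<longleftrightarrow> chain_map A L L f"
 by (simp add: E0_iff chain_map_def)

lemma null_L_zero:
 assumes h: "h \<in> hom_deg A L L (- 1)" and x: "x \<in>: L"
 shows "hom_dif L L (- 1) h x = \<zero>\<^sub>L"
proof -
 have h0: "h y = \<zero>\<^sub>L" if "y \<in>: L" for y by (rule hom_neg_zero[OF h _ that]) simp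
 show ?thesis using x L.M.minus_zero_iff[OF L.M.zero_closed L.M.zero_closed] by (simp add: LL.PM.D_apply h0)
qed

text \<open>The comparison maps \<open>u\<close> and \<open>v\<close> are mutually inverse up to homotopy;
 on the minimal resolution the homotopy has degree \<open>-1\<close> and therefore vanishes.\<close>

lemma vu:
 assumes x: "x \<in>: L"
 shows "v (u x) = x"
proof -
 let ?i = "\<lambda>x\<in>carrier L. x"
 have i: "chain_map A L L ?i"
  unfolding chain_map_def by (auto intro!: hom_degI simp: L.smult_closed sgn_pow_def dest: L.cx.V_closed A.cx.V_closed)
 have vu: "chain_map A L L (compose (carrier L) v u)"
  by (rule chain_compose[OF modules(1,2,1) A.cx.is_cpx v(1) u(1)])
 define d where "d = compose (carrier L) v u \<ominus>\<^sub>LL.PM.F ?i"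
 have d: "d \<in> E0"
  unfolding E0_chain d_def by (rule LL.PM.chain_minus[OF vu i])
 have ev: "d y = v (u y) \<ominus>\<^sub>L y" if y: "y \<in>: L" for y
  using LL.PM.F_eval_minus[OF LL.PM.V_F[OF chain_hom[OF vu]] LL.PM.V_F[OF chain_hom[OF i]] y] y
  by (simp add: compose_eq d_def)
 have "e (d b) = \<zero>\<^sub>A" if b: "b \<in> B" for b
 proof -
  have y: "b \<in>: L" by (rule LL.Pf.B_closed[OF b])
  have "e (v (u b)) = e b" using v(2)[OF u_closed[OF y]] u(2)[OF y] by simp
  thus ?thesis unfolding ev[OF y] using LL.PG.hom_minus[OF e_hom v_closed[OF u_closed[OF y]] y] e_closed[OF y]
    A.ground.M.minus_zero_iff[of "e b" "e b"] by simp
 qed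
 from E0_eq_zero[OF d this x] have "d x = \<zero>\<^sub>L" .
 thus ?thesis using ev[OF x] L.M.minus_zero_iff[OF v_closed[OF u_closed[OF x]] x] by simp
qed

lemma uv_homotopy: "\<exists>h\<in>hom_deg A P P (- 1). \<forall>x\<in>carrier P. hom_dif P P (- 1) h x = u (v x) \<ominus>\<^sub>P x"
proof -
 let ?i = "\<lambda>x\<in>carrier P. x"
 let ?f = "compose (carrier P) u v \<ominus>\<^sub>PP.PM.F ?i"
 have i: "chain_map A P P ?i"
  unfolding chain_map_def by (auto intro!: hom_degI simp: P.smult_closed sgn_pow_def dest: P.cx.V_closed A.cx.V_closed)
 have uv: "chain_map A P P (compose (carrier P) u v)"
  by (rule chain_compose[OF modules(2,1,2) A.cx.is_cpx u(1) v(1)])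
 have f: "chain_map A P P ?f" by (rule PP.PM.chain_minus[OF uv i])
 have ev: "?f y = u (v y) \<ominus>\<^sub>P y" if y: "y \<in>: P" for y
  using PP.PM.F_eval_minus[OF PP.PM.V_F[OF chain_hom[OF uv]] PP.PM.V_F[OF chain_hom[OF i]] y] y
  by (simp add: compose_eq)
 have "\<exists>h\<in>hom_deg A P P (0 - 1). hom_dif P P (0 - 1) h = ?f"
 proof (rule PP.null_homotopic[OF chain_hom[OF f]])
  show "hom_dif P P 0 ?f x = \<zero>\<^sub>P" if "x \<in>: P" for x
   using f PP.PM.chain_iff[OF chain_hom[OF f]] PP.PM.F_eval_zero[OF that] by simp
  show "\<epsilon> (?f y) = \<zero>\<^sub>A" if y: "y \<in>: P" for y
  proof -
   have "\<epsilon> (u (v y)) = \<epsilon> y" using u(2)[OF v_closed[OF y]] v(2)[OF y] by simp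
   moreover have "\<epsilon> y \<in>: (ground A)" by (rule hom_closed[OF PP.eps y])
   ultimately show ?thesis unfolding ev[OF y] using PP.PG.hom_minus[OF PP.eps u_closed[OF v_closed[OF y]] y]
    A.ground.M.minus_zero_iff[of "\<epsilon> y" "\<epsilon> y"] by simp
  qed
 qed
 then obtain h where "h \<in> hom_deg A P P (- 1)" "hom_dif P P (- 1) h = ?f" by auto
 thus ?thesis using ev by (intro bexI[of _ h]) auto
qed

subsection \<open>The Ext-algebra acts on the minimal resolution\<close>

sublocale X: dg_end K A P by unfold_locales
sublocale XE: dg_algebra K "end_dg A P" by (rule X.E_dg_algebra)

lemma chain_cocycle: "f \<in> hom_deg A P P 0 ==> f \<in> cocycles (end_dg A P) \<longleftrightarrow> chain_map A P P f"
 using PP.PM.H_cocycle_iff[of f 0] PP.PM.chain_iff[of f]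
 by (simp add: cocycles_def X.E_simps)

lemma chain_cocycleI: "chain_map A P P f ==> f \<in> cocycles (end_dg A P)"
 using chain_cocycle[OF chain_hom] by blast

lemma coboundary_iff: "f \<in> hom_deg A P P n ==>
  f \<in> coboundaries (end_dg A P) \<longleftrightarrow> (\<exists>h\<in>hom_deg A P P (n - 1). hom_dif P P (n - 1) h = f)"
 using PP.PM.H_coboundary_iff[of f n] by (simp add: coboundaries_def X.E_simps)

lemma cls_sandwich_uv:
 assumes f: "f \<in> hom_deg A P P n" "f \<in> cocycles (end_dg A P)"
 shows "XE.HA.cls f = XE.HA.cls (compose (carrier P) u (compose (carrier P)
  (compose (carrier L) v (compose (carrier L) f u)) v))"
proof -
 let ?uv = "compose (carrier P) u v"
 have uv: "chain_map A P P ?uv"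
  by (rule chain_compose[OF modules(2,1,2) A.cx.is_cpx u(1) v(1)])
 note uvz = chain_cocycleI[OF uv]
 have one: "XE.HA.cls ?uv = \<one>\<^bsub>cohom (end_dg A P)\<^esub>"
 proof -
  obtain h where h: "h \<in> hom_deg A P P (- 1)" "\<forall>x\<in>carrier P. hom_dif P P (- 1) h x = u (v x) \<ominus>\<^sub>P x"
   using uv_homotopy by blast
  have c: "?uv \<in>: (end_dg A P)" "\<one>\<^bsub>end_dg A P\<^esub> \<in>: (end_dg A P)"
   using X.gr_E[OF chain_hom[OF uv]] by auto
  have cF: "?uv \<in>: PP.PM.H" "\<one>\<^bsub>end_dg A P\<^esub> \<in>: PP.PM.H" using c by (auto simp: X.E_simps)
  have "?uv \<ominus>\<^bsub>end_dg A P\<^esub> \<one>\<^bsub>end_dg A P\<^esub> = ?uv \<ominus>\<^sub>PP.PM.F \<one>\<^bsub>end_dg A P\<^esub>"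
   using PP.PM.H_minus[OF cF] a_minus_cong_structure[of "end_dg A P" PP.PM.H] by (simp add: X.E_simps(1-3))
  also have "... = hom_dif P P (- 1) h"
  proof (rule hom_eqI[of _ A P P 0 _ 0])
   show "?uv \<ominus>\<^sub>PP.PM.F \<one>\<^bsub>end_dg A P\<^esub> \<in> hom_deg A P P 0"
    by (rule PP.PM.minus_V[OF chain_hom[OF uv] X.E_one_gr])
   show "hom_dif P P (- 1) h \<in> hom_deg A P P 0" using PP.PM.D_V[OF h(1)] by simp
   show "(?uv \<ominus>\<^sub>PP.PM.F \<one>\<^bsub>end_dg A P\<^esub>) x = hom_dif P P (- 1) h x" if x: "x \<in>: P" for x
    using PP.PM.F_eval_minus[OF PP.PM.H_F[OF cF(1)] PP.PM.H_F[OF cF(2)] x] h(2) x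
    by (simp add: compose_eq X.E_simps(7))
  qed
  finally have eq: "?uv \<ominus>\<^bsub>end_dg A P\<^esub> \<one>\<^bsub>end_dg A P\<^esub> = hom_dif P P (- 1) h" .
  have "hom_dif P P (- 1) h \<in> coboundaries (end_dg A P)"
  proof -
   have "hom_dif P P (- 1) h \<in> hom_deg A P P 0" using PP.PM.D_V[OF h(1)] by simp
   from coboundary_iff[OF this] h(1) show ?thesis by auto
  qed
  thus ?thesis unfolding XE.cohom_one XE.HA.cls_eq_iff[OF c] eq .
 qed
 have fE: "f \<in>: (end_dg A P)" by (rule X.gr_E[OF f(1)])
 interpret C: dg_algebra K "cohom (end_dg A P)" by (rule XE.cohom_dg_algebra)
 have cf: "XE.HA.cls f \<in> carrier (cohom (end_dg A P))"
  unfolding XE.cohom_carrier by (rule imageI[OF f(2)])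
 have "XE.HA.cls f = (XE.HA.cls ?uv \<otimes>\<^bsub>cohom (end_dg A P)\<^esub> XE.HA.cls f) \<otimes>\<^bsub>cohom (end_dg A P)\<^esub> XE.HA.cls ?uv"
  unfolding one C.alg.l_one[OF cf] C.alg.r_one[OF cf] ..
 also have "... = XE.HA.cls ((?uv \<otimes>\<^bsub>end_dg A P\<^esub> f) \<otimes>\<^bsub>end_dg A P\<^esub> ?uv)"
  unfolding XE.cohom_mult[OF uvz f(2)] XE.cohom_mult[OF XE.mult_cocycles[OF uvz f(2)] uvz] ..
 also have "(?uv \<otimes>\<^bsub>end_dg A P\<^esub> f) \<otimes>\<^bsub>end_dg A P\<^esub> ?uv =
   compose (carrier P) u (compose (carrier P) (compose (carrier L) v (compose (carrier L) f u)) v)"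
  using v_closed u_closed hom_closed[OF f(1)] by (auto simp: X.E_simps(6) compose_def fun_eq_iff)
 finally show ?thesis .
qed

lemma sandwich_null:
 assumes f: "f \<in> hom_deg A P P n" "f \<in> cocycles (end_dg A P)"
  and k: "k \<in> hom_deg A L L (n - 1)" "!!x. x \<in>: L ==> hom_dif L L (n - 1) k x = v (f (u x))"
 shows "f \<in> coboundaries (end_dg A P)"
proof -
 let ?g = "compose (carrier P) u (compose (carrier P) k v)"
 let ?f = "compose (carrier P) u (compose (carrier P) (compose (carrier L) v (compose (carrier L) f u)) v)"
 note A = A.cx.is_cpx
 have g: "?g \<in> hom_deg A P P (n - 1)" by (rule sandwich_hom[OF modules(2,1,1,2) A u(1) v(1) k(1)])
 have vfu: "compose (carrier L) v (compose (carrier L) f u) \<in> hom_deg A L L n"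
  by (rule sandwich_hom[OF modules(1,2,2,1) A v(1) u(1) f(1)])
 have fh: "?f \<in> hom_deg A P P n" by (rule sandwich_hom[OF modules(2,1,1,2) A u(1) v(1) vfu])
 have "hom_dif P P (n - 1) ?g = ?f"
 proof (rule hom_eqI[OF _ fh])
  show "hom_dif P P (n - 1) ?g \<in> hom_deg A P P n" using PP.PM.D_V[OF g] by simp
  show "hom_dif P P (n - 1) ?g x = ?f x" if x: "x \<in>: P" for x
   unfolding sandwich_dif[OF modules(2,1,1,2) A u(1) v(1) k(1) x] k(2)[OF v_closed[OF x]]
   using x v_closed[OF x] by (simp add: compose_eq)
 qed
 hence "?f \<in> coboundaries (end_dg A P)" using coboundary_iff[OF fh] g by blast
 hence "XE.HA.cls ?f = coboundaries (end_dg A P)" by (rule XE.HA.cls_zero)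
 hence "XE.HA.cls f = coboundaries (end_dg A P)" using cls_sandwich_uv[OF f] by simp
 thus ?thesis using XE.HA.cls_eq_zero_iff[OF X.gr_E[OF f(1)]] by simp
qed

text \<open>The Ext-algebra is concentrated in degree \<open>0\<close>: after transport to the minimal
 resolution, a cocycle of another degree composes to zero with the augmentation.\<close>

lemma cocycle_off_zero:
 assumes f: "f \<in> hom_deg A P P n" "f \<in> cocycles (end_dg A P)" and n: "n ~= 0"
 shows "f \<in> coboundaries (end_dg A P)"
proof -
 note A = A.cx.is_cpx
 let ?g = "compose (carrier L) v (compose (carrier L) f u)"
 have g: "?g \<in> hom_deg A L L n" by (rule sandwich_hom[OF modules(1,2,2,1) A v(1) u(1) f(1)])
 have eg: "compose (carrier L) e ?g \<in> hom_deg A L (ground A) n"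
  using compose_V[OF modules(1,1) A.ground.is_dgm A e_hom g] by simp
 have Df: "hom_dif P P n f = \<zero>\<^sub>PP.PM.F"
  using PP.PM.H_cocycle_iff[OF f(1)] f(2) by (simp add: cocycles_def X.E_simps)
 have "\<exists>k\<in>hom_deg A L L (n - 1). hom_dif L L (n - 1) k = ?g"
 proof (rule LL.null_homotopic[OF g])
  show "hom_dif L L n ?g x = \<zero>\<^sub>L" if x: "x \<in>: L" for x
   unfolding sandwich_dif[OF modules(1,2,2,1) A v(1) u(1) f(1) x] Df
   using PL.PM.hom_zero[OF chain_hom[OF v(1)]] PP.PM.F_eval_zero[OF u_closed[OF x]] by simp
  show "e (?g x) = \<zero>\<^sub>A" if x: "x \<in>: L" for x
   using hom_zeroI[OF A.ground.is_dgm eg _ x] n x by (simp add: compose_eq)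
 qed
 then obtain k where "k \<in> hom_deg A L L (n - 1)" "hom_dif L L (n - 1) k = ?g" by blast
 thus ?thesis by (intro sandwich_null[OF f]) (auto simp: compose_eq)
qed

lemma ex_chain_rep:
 assumes "U \<in> carrier (cohom (end_dg A P))"
 shows "\<exists>g. chain_map A P P g \<and> U = XE.HA.cls g"
proof -
 obtain z where z: "z \<in> cocycles (end_dg A P)" "U = XE.HA.cls z"
  using assms unfolding XE.cohom_carrier by (elim imageE) (simp only:)
 note zc = cocyclesD(1)[OF z(1)]
 have zn: "X.Ex.comp z n \<in> hom_deg A P P n" for n using X.Ex.comp_V[OF zc, of n] by (simp add: X.E_simps)
 let ?d = "z \<ominus>\<^bsub>end_dg A P\<^esub> X.Ex.comp z 0"
 have dc: "?d \<in>: (end_dg A P)" using zc by simp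
 have "X.Ex.comp ?d n \<in> coboundaries (end_dg A P)" for n
 proof (cases "n = 0")
  case True
  have "X.Ex.comp ?d 0 = X.Ex.comp z 0 \<ominus>\<^bsub>end_dg A P\<^esub> X.Ex.comp z 0"
   unfolding X.Ex.comp_minus[OF zc X.Ex.comp_closed[OF zc]] X.Ex.comp_same[OF X.Ex.comp_V[OF zc]] ..
  thus ?thesis using True XE.HA.B.zero_closed X.Ex.minus_zero_iff[of "X.Ex.comp z 0" "X.Ex.comp z 0"] zc by simp
 next
  case False
  have "X.Ex.comp (X.Ex.comp z 0) n = \<zero>\<^bsub>end_dg A P\<^esub>"
   using X.Ex.comp_V_eq[OF X.Ex.comp_V[OF zc, of 0], of n] False by simp
  hence "X.Ex.comp ?d n = X.Ex.comp z n"
   unfolding X.Ex.comp_minus[OF zc X.Ex.comp_closed[OF zc]] using zc by (simp add: a_minus_def)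
  thus ?thesis using cocycle_off_zero[OF zn X.Ex.comp_cocycle[OF z(1)] False] by simp
 qed
 hence "?d \<in> coboundaries (end_dg A P)" using X.Ex.coboundary_comp_iff[OF dc] by blast
 hence "U = XE.HA.cls (X.Ex.comp z 0)"
  unfolding z(2) XE.HA.cls_eq_iff[OF zc X.Ex.comp_closed[OF zc]] .
 moreover have "chain_map A P P (X.Ex.comp z 0)"
  using chain_cocycle[OF zn] X.Ex.comp_cocycle[OF z(1)] by blast
 ultimately show ?thesis by blast
qed

lemma vnu_zero:
 assumes h: "h \<in> hom_deg A P P (- 1)" and a: "chain_map A P L a" and b: "chain_map A L P b" and x: "x \<in>: L"
 shows "a (hom_dif P P (- 1) h (b x)) = \<zero>\<^sub>L"
 using null_L_zero[OF sandwich_hom[OF modules(1,2,2,1) A.cx.is_cpx a b h] x]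
  sandwich_dif[OF modules(1,2,2,1) A.cx.is_cpx a b h x] by simp

lemma cls_zero_iff:
 assumes g: "chain_map A P P g"
 shows "g \<in> coboundaries (end_dg A P) \<longleftrightarrow> (\<forall>x\<in>carrier L. v (g (u x)) = \<zero>\<^sub>L)"
proof
 assume "g \<in> coboundaries (end_dg A P)"
 then obtain h where h: "h \<in> hom_deg A P P (- 1)" "hom_dif P P (- 1) h = g"
  using coboundary_iff[OF chain_hom[OF g]] by auto
 show "\<forall>x\<in>carrier L. v (g (u x)) = \<zero>\<^sub>L" using vnu_zero[OF h(1) v(1) u(1)] h(2) by simp
next
 assume z: "\<forall>x\<in>carrier L. v (g (u x)) = \<zero>\<^sub>L"
 show "g \<in> coboundaries (end_dg A P)"
 proof (rule sandwich_null[OF chain_hom[OF g] chain_cocycleI[OF g] LL.PM.zero_V])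
  show "hom_dif L L (0 - 1) \<zero>\<^sub>LL.PM.F x = v (g (u x))" if "x \<in>: L" for x
   unfolding LL.PM.D_zero using z that by (simp add: LL.PM.F_eval_zero)
 qed
qed

text \<open>A class acts through any of its representatives, transported along \<open>u\<close> and
 \<open>v\<close>; two representatives differ by a boundary, whose transport is zero.\<close>

definition act :: "('p => 'p) set => 'r => 'r" where
 "act U x = v ((SOME g. chain_map A P P g \<and> U = XE.HA.cls g) (u x))"

lemma act_cls:
 assumes g: "chain_map A P P g" and x: "x \<in>: L"
 shows "act (XE.HA.cls g) x = v (g (u x))"
proof -
 define g' where "g' = (SOME g'. chain_map A P P g' \<and> XE.HA.cls g = XE.HA.cls g')"
 have "chain_map A P P g' \<and> XE.HA.cls g = XE.HA.cls g'"
  unfolding g'_def by (rule someI[of _ g]) (simp add: g)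
 hence g': "chain_map A P P g'" "XE.HA.cls g = XE.HA.cls g'" by blast+
 note gH = PP.PM.V_H[OF chain_hom[OF g]] and g'H = PP.PM.V_H[OF chain_hom[OF g'(1)]]
 have "g \<ominus>\<^bsub>end_dg A P\<^esub> g' = g \<ominus>\<^sub>PP.PM.F g'"
  using PP.PM.H_minus[OF gH g'H] a_minus_cong_structure[of "end_dg A P" PP.PM.H] by (simp add: X.E_simps(1-3))
 moreover have "g \<ominus>\<^bsub>end_dg A P\<^esub> g' \<in> coboundaries (end_dg A P)"
  using XE.HA.cls_eq_iff[OF X.gr_E[OF chain_hom[OF g]] X.gr_E[OF chain_hom[OF g'(1)]]] g'(2) by (rule iffD1)
 ultimately have "v ((g \<ominus>\<^sub>PP.PM.F g') (u x)) = \<zero>\<^sub>L"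
  using cls_zero_iff[OF PP.PM.chain_minus[OF g g'(1)]] x by simp
 moreover have "(g \<ominus>\<^sub>PP.PM.F g') (u x) = g (u x) \<ominus>\<^sub>P g' (u x)"
  by (rule PP.PM.F_eval_minus[OF PP.PM.H_F[OF gH] PP.PM.H_F[OF g'H] u_closed[OF x]])
 moreover have "v (g (u x) \<ominus>\<^sub>P g' (u x)) = v (g (u x)) \<ominus>\<^sub>L v (g' (u x))"
  by (rule PL.PM.hom_minus[OF chain_hom[OF v(1)] chain_closed[OF g u_closed[OF x]] chain_closed[OF g'(1) u_closed[OF x]]])
 ultimately have "v (g (u x)) = v (g' (u x))"
  using L.M.minus_zero_iff[OF v_closed[OF chain_closed[OF g u_closed[OF x]]] v_closed[OF chain_closed[OF g'(1) u_closed[OF x]]]] by simp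
 thus ?thesis unfolding act_def g'_def[symmetric] by simp
qed

abbreviation E where "E \<equiv> cohom (end_dg A P)"

lemma act_E0:
 assumes "U \<in>: E"
 shows "(\<lambda>x\<in>carrier L. act U x) \<in> E0"
proof -
 obtain g where g: "chain_map A P P g" "U = XE.HA.cls g" using ex_chain_rep[OF assms] by (elim exE conjE)
 note A = A.cx.is_cpx
 have "chain_map A L L (compose (carrier L) v (compose (carrier L) g u))"
  by (rule chain_compose[OF modules(1,2,1) A v(1) chain_compose[OF modules(1,2,2) A g(1) u(1)]])
 moreover have "(\<lambda>x\<in>carrier L. act U x) = compose (carrier L) v (compose (carrier L) g u)"
  unfolding g(2) by (rule ext) (simp add: act_cls[OF g(1)] compose_def)
 ultimately show ?thesis unfolding E0_chain by simp
qed

lemma act_add: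
 assumes "U \<in>: E" "W \<in>: E" and x: "x \<in>: L"
 shows "act (U \<oplus>\<^sub>E W) x = act U x \<oplus>\<^sub>L act W x"
proof -
 obtain g where g: "chain_map A P P g" "U = XE.HA.cls g" using ex_chain_rep[OF assms(1)] by (elim exE conjE)
 obtain k where k: "chain_map A P P k" "W = XE.HA.cls k" using ex_chain_rep[OF assms(2)] by (elim exE conjE)
 have gk: "g \<oplus>\<^bsub>end_dg A P\<^esub> k = g \<oplus>\<^sub>PP.PM.F k" by (simp add: X.E_simps PP.PM.H_add)
 have ch: "chain_map A P P (g \<oplus>\<^sub>PP.PM.F k)"
  unfolding chain_map_def
  using PP.PM.add_V[OF chain_hom[OF g(1)] chain_hom[OF k(1)]] chain_dif[OF g(1)] chain_dif[OF k(1)]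
   chain_closed[OF g(1)] chain_closed[OF k(1)] by (simp add: PP.PM.F_eval_add P.cx.dif_add)
 have "act (U \<oplus>\<^sub>E W) x = v ((g \<oplus>\<^sub>PP.PM.F k) (u x))"
  unfolding g(2) k(2) XE.cohom_add[OF chain_cocycleI[OF g(1)] chain_cocycleI[OF k(1)]] gk
  by (rule act_cls[OF ch x])
 also have "... = v (g (u x)) \<oplus>\<^sub>L v (k (u x))"
  unfolding PP.PM.F_eval_add[OF u_closed[OF x]]
  by (rule hom_add[OF chain_hom[OF v(1)] chain_closed[OF g(1) u_closed[OF x]] chain_closed[OF k(1) u_closed[OF x]]])
 finally show ?thesis unfolding g(2) k(2) act_cls[OF g(1) x] act_cls[OF k(1) x] .
qed

lemma act_mult:
 assumes "U \<in>: E" "W \<in>: E" and x: "x \<in>: L"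
 shows "act (U \<otimes>\<^sub>E W) x = act U (act W x)"
proof -
 obtain g where g: "chain_map A P P g" "U = XE.HA.cls g" using ex_chain_rep[OF assms(1)] by (elim exE conjE)
 obtain k where k: "chain_map A P P k" "W = XE.HA.cls k" using ex_chain_rep[OF assms(2)] by (elim exE conjE)
 note A = A.cx.is_cpx
 have gk: "g \<otimes>\<^bsub>end_dg A P\<^esub> k = compose (carrier P) g k" by (simp add: X.E_simps)
 have ch: "chain_map A P P (compose (carrier P) g k)"
  by (rule chain_compose[OF modules(2,2,2) A g(1) k(1)])
 have 1: "act (U \<otimes>\<^sub>E W) x = v (g (k (u x)))"
  unfolding g(2) k(2) XE.cohom_mult[OF chain_cocycleI[OF g(1)] chain_cocycleI[OF k(1)]] gk
  using act_cls[OF ch x] u_closed[OF x] by (simp add: compose_eq)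
 define y where "y = k (u x)"
 have y: "y \<in>: P" unfolding y_def by (rule chain_closed[OF k(1) u_closed[OF x]])
 have 2: "act U (act W x) = v (g (u (v y)))"
  unfolding g(2) k(2) act_cls[OF k(1) x] y_def[symmetric] by (rule act_cls[OF g(1) v_closed[OF y]])
 obtain h where h: "h \<in> hom_deg A P P (- 1)" "\<forall>x\<in>carrier P. hom_dif P P (- 1) h x = u (v x) \<ominus>\<^sub>P x"
  using uv_homotopy by blast
 have "compose (carrier P) v g (hom_dif P P (- 1) h (compose (carrier L) k u x)) = \<zero>\<^sub>L"
  by (rule vnu_zero[OF h(1) chain_compose[OF modules(2,2,1) A v(1) g(1)] chain_compose[OF modules(1,2,2) A k(1) u(1)] x])
 hence "v (g (u (v y) \<ominus>\<^sub>P y)) = \<zero>\<^sub>L"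
  using x y h(2) u_closed[OF v_closed[OF y]] by (simp add: compose_eq y_def)
 moreover have "v (g (u (v y) \<ominus>\<^sub>P y)) = v (g (u (v y))) \<ominus>\<^sub>L v (g y)"
  unfolding PP.PM.hom_minus[OF chain_hom[OF g(1)] u_closed[OF v_closed[OF y]] y]
  by (rule PL.PM.hom_minus[OF chain_hom[OF v(1)] chain_closed[OF g(1) u_closed[OF v_closed[OF y]]] chain_closed[OF g(1) y]])
 ultimately have "v (g (u (v y))) = v (g y)"
  using L.M.minus_zero_iff v_closed chain_closed[OF g(1)] y u_closed by metis
 thus ?thesis unfolding 1 2 y_def by simp
qed

lemma act_one:
 assumes x: "x \<in>: L"
 shows "act \<one>\<^sub>E x = x"
proof -
 have ch: "chain_map A P P \<one>\<^bsub>end_dg A P\<^esub>"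
  using chain_cocycle[OF X.E_one_gr] XE.one_cocycle by blast
 show ?thesis unfolding XE.cohom_one act_cls[OF ch x] using vu[OF x] u_closed[OF x] by (simp add: X.E_simps)
qed

lemma act_smult:
 assumes c: "c \<in>: K" and "U \<in>: E" and x: "x \<in>: L"
 shows "act (c \<odot>\<^sub>E U) x = A.scal c \<odot>\<^sub>L act U x"
proof -
 obtain g where g: "chain_map A P P g" "U = XE.HA.cls g" using ex_chain_rep[OF assms(2)] by (elim exE conjE)
 have cgh: "c \<odot>\<^bsub>end_dg A P\<^esub> g \<in> hom_deg A P P 0" by (rule X.E_smult_gr[OF chain_hom[OF g(1)] c])
 have ch: "chain_map A P P (c \<odot>\<^bsub>end_dg A P\<^esub> g)"
  using chain_cocycle[OF cgh] XE.smult_cocycles[OF c chain_cocycleI[OF g(1)]] by blast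
 have cc: "A.scal c \<in>: A" using c by simp
 have "act (c \<odot>\<^sub>E U) x = v (A.scal c \<odot>\<^sub>P g (u x))"
  unfolding g(2) XE.cohom_smult[OF c chain_cocycleI[OF g(1)]] act_cls[OF ch x]
  using u_closed[OF x] by (simp add: X.E_smult)
 also have "... = A.scal c \<odot>\<^sub>L v (g (u x))"
  by (rule PL.PM.hom_linear[OF chain_hom[OF v(1)] cc chain_closed[OF g(1) u_closed[OF x]]])
 finally show ?thesis unfolding g(2) act_cls[OF g(1) x] .
qed

lemma act_full:
 assumes "f \<in> E0"
 shows "\<exists>U\<in>carrier E. \<forall>x\<in>carrier L. act U x = f x"
proof -
 note A = A.cx.is_cpx
 have f: "chain_map A L L f" using assms by (simp add: E0_chain)
 let ?g = "compose (carrier P) u (compose (carrier P) f v)"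
 have g: "chain_map A P P ?g"
  by (rule chain_compose[OF modules(2,1,2) A u(1) chain_compose[OF modules(2,1,1) A f v(1)]])
 have "act (XE.HA.cls ?g) x = f x" if x: "x \<in>: L" for x
  unfolding act_cls[OF g x] using u_closed[OF x] vu[OF x] vu[OF chain_closed[OF f x]] by (simp add: compose_eq)
 moreover have "XE.HA.cls ?g \<in>: E" unfolding XE.cohom_carrier by (rule imageI[OF chain_cocycleI[OF g]])
 ultimately show ?thesis by blast
qed

lemma act_faithful:
 assumes "U \<in>: E" and zero: "!!x. x \<in>: L ==> act U x = \<zero>\<^sub>L"
 shows "U = \<zero>\<^sub>E"
proof -
 obtain g where g: "chain_map A P P g" "U = XE.HA.cls g" using ex_chain_rep[OF assms(1)] by (elim exE conjE)
 have "g \<in> coboundaries (end_dg A P)" unfolding cls_zero_iff[OF g(1)]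
  using zero act_cls[OF g(1)] by (simp add: g(2))
 thus ?thesis unfolding g(2) XE.cohom_zero by (rule XE.HA.cls_zero)
qed

end

section \<open>Compactness and finite bases\<close>

lemma (in connected_dg_algebra) concentrated_dg_module:
 assumes N: "abelian_group N" and gr: "gr N = (%n. if n = 0 then carrier N else {\<zero>\<^sub>N})"
  and dif: "!!x. dif N x = \<zero>\<^sub>N"
  and closed: "!!a x. a \<in>: A ==> x \<in>: N ==> a \<odot>\<^sub>N x \<in>: N"
  and l_distr: "!!a b x. a \<in>: A ==> b \<in>: A ==> x \<in>: N
   ==> (a \<oplus>\<^sub>A b) \<odot>\<^sub>N x = a \<odot>\<^sub>N x \<oplus>\<^sub>N b \<odot>\<^sub>N x"
  and r_distr: "!!a x y. a \<in>: A ==> x \<in>: N ==> y \<in>: N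
   ==> a \<odot>\<^sub>N (x \<oplus>\<^sub>N y) = a \<odot>\<^sub>N x \<oplus>\<^sub>N a \<odot>\<^sub>N y"
  and assoc: "!!a b x. a \<in>: A ==> b \<in>: A ==> x \<in>: N
   ==> (a \<otimes>\<^sub>A b) \<odot>\<^sub>N x = a \<odot>\<^sub>N (b \<odot>\<^sub>N x)"
  and one: "!!x. x \<in>: N ==> \<one>\<^sub>A \<odot>\<^sub>N x = x"
  and triv: "!!a x. a \<in> pos_part A ==> x \<in>: N ==> a \<odot>\<^sub>N x = \<zero>\<^sub>N"
 shows "left_dg_module A N"
proof -
 interpret N: abelian_group N by (rule N)
 have lm: "left_module A N"
  by (intro left_module.intro left_module_axioms.intro ring N closed l_distr r_distr assoc one)
 interpret LN: left_module A N by (rule lm)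
 show ?thesis
 proof (intro left_dg_module.intro left_dg_module_axioms.intro lm)
  show "graded_by N (gr N)" unfolding gr by (rule concentrated_graded[OF N])
  show "a \<odot>\<^sub>N x \<in> gr N (i + j)" if a: "a \<in> gr A i" and x: "x \<in> gr N j" for a x i j
  proof (cases "j = 0")
   case True
   hence xc: "x \<in>: N" using x gr by simp
   show ?thesis
   proof (cases "i = 0")
    case True
    thus ?thesis using \<open>j = 0\<close> closed[OF cx.V_closed[OF a] xc] gr by simp
   next
    case False
    hence "a \<in> pos_part A" using pos_part_iff cx.comp_V_eq[OF a, of 0] cx.V_closed[OF a] by simp
    thus ?thesis using triv[OF _ xc] gr by simp
   qed
  next
   case False
   hence "x = \<zero>\<^sub>N" using x gr by simp
   thus ?thesis using LN.smult_zero_right[OF cx.V_closed[OF a]] gr by simp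
  qed
  show "dif N (a \<odot>\<^sub>N x) = dif A a \<odot>\<^sub>N x \<oplus>\<^sub>N sgn_pow N i (a \<odot>\<^sub>N dif N x)"
   if a: "a \<in> gr A i" and x: "x \<in>: N" for a x i
  proof -
   have ac: "a \<in>: A" by (rule cx.V_closed[OF a])
   have "dif A a \<in> pos_part A" using pos_part_iff comp_dif_0[OF ac] cx.dif_closed[OF ac] by simp
   thus ?thesis unfolding dif using triv[OF _ x] LN.smult_zero_right[OF ac] by simp
  qed
 qed (simp_all add: dif gr)
qed

text \<open>The test modules for compactness live in a function type, hence the ground module is realised by
 constant functions.\<close>

definition const_ground :: "('k, 'a) dg => ('a, 'u => 'a) dg" where
 "const_ground A =
  \<lparr>carrier = (%x _. x) ` gr A 0, mult = undefined, one = undefined, zero = (%_. \<zero>\<^sub>A),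
   add = (%f g i. f i \<oplus>\<^sub>A g i), smult = (%a f i. hcomp A (gr A) a 0 \<otimes>\<^sub>A f i),
   gr = (%n. if n = 0 then (%x _. x) ` gr A 0 else {%_. \<zero>\<^sub>A}), dif = (%_ _. \<zero>\<^sub>A)\<rparr>"

lemma const_ground_simps:
 "carrier (const_ground A) = (%x _. x) ` gr A 0" "\<zero>\<^bsub>const_ground A\<^esub> = (%_. \<zero>\<^sub>A)"
 "f \<oplus>\<^bsub>const_ground A\<^esub> g = (%i. f i \<oplus>\<^sub>A g i)"
 "a \<odot>\<^bsub>const_ground A\<^esub> f = (%i. hcomp A (gr A) a 0 \<otimes>\<^sub>A f i)"
 "gr (const_ground A) = (%n. if n = 0 then (%x _. x) ` gr A 0 else {%_. \<zero>\<^sub>A})"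
 "dif (const_ground A) x = (%_. \<zero>\<^sub>A)"
 by (simp_all add: const_ground_def)

context connected_dg_algebra
begin

lemma const_ground_triv: "a \<in> pos_part A ==> x \<in>: (const_ground A) ==> a \<odot>\<^bsub>const_ground A\<^esub> x = \<zero>\<^bsub>const_ground A\<^esub>"
 using cx.V_closed[of _ 0] by (auto simp: const_ground_simps pos_part_iff)

lemma const_ground_dg_module: "left_dg_module A (const_ground A :: ('c, 'u => 'c) dg)"
proof -
 let ?W = "const_ground A :: ('c, 'u => 'c) dg"
 note c0 = cx.V_closed[of _ 0]
 have ex: "\<exists>r\<in>gr A 0. x = (%_. r)" if "x \<in>: ?W" for x using that by (auto simp: const_ground_simps)
 have mem: "(%_. r) \<in>: ?W" if "r \<in> gr A 0" for r using that by (auto simp: const_ground_simps)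
 have ab: "abelian_group ?W"
 proof (rule abelian_groupI)
  show "\<exists>y\<in>carrier ?W. y \<oplus>\<^bsub>?W\<^esub> x = \<zero>\<^bsub>?W\<^esub>" if x: "x \<in>: ?W" for x
  proof -
   obtain r where r: "r \<in> gr A 0" "x = (%_. r)" using ex[OF x] by blast
   show ?thesis
    by (rule bexI[OF _ mem[of "\<ominus>\<^sub>A r"]]) (use r c0 in \<open>auto simp: const_ground_simps alg.l_neg\<close>)
  qed
 qed (use c0 in \<open>auto simp: const_ground_simps alg.a_ac fun_eq_iff intro!: image_eqI\<close>)
 show ?thesis
 proof (rule concentrated_dg_module[OF ab _ _ _ _ _ _ _ const_ground_triv])
  show "a \<odot>\<^bsub>?W\<^esub> x \<in>: ?W" if "a \<in>: A" and x: "x \<in>: ?W" for a x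
  proof -
   obtain r where r: "r \<in> gr A 0" "x = (%_. r)" using ex[OF x] by blast
   have "cx.comp a 0 \<otimes>\<^sub>A r \<in> gr A 0" using mult_gr[OF cx.comp_V[OF that(1), of 0] r(1)] by simp
   from mem[OF this] show ?thesis by (simp add: const_ground_simps r(2))
  qed
 qed (use c0 in \<open>auto simp: const_ground_simps fun_eq_iff cx.comp_add comp_mult_0 alg.l_distr alg.r_distr alg.m_assoc
    cx.comp_same[OF one_gr]\<close>)
qed

end

lemma dsum_simps:
 fixes W :: "('a, 'm) dg"
 defines "S \<equiv> dsum (UNIV :: 'u set) (%_. W)"
 shows "carrier S = {x. (\<forall>i. x i \<in>: W) \<and> finite {i. x i ~= \<zero>\<^sub>W}}"
  "\<zero>\<^sub>S = (%_. \<zero>\<^sub>W)" "x \<oplus>\<^sub>S y = (%i. x i \<oplus>\<^sub>W y i)" "a \<odot>\<^sub>S x = (%i. a \<odot>\<^sub>W x i)"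
  "gr S n = {x \<in> carrier S. \<forall>i. x i \<in> gr W n}" "dif S x = (%i. dif W (x i))"
 by (simp_all add: S_def dsum_def Let_def PiE_UNIV_domain Pi_iff restrict_def)

locale concentrated_dsum = A: connected_dg_algebra K A + W: left_dg_module A W
 for K :: "('k, 'c) ring_scheme" and A :: "('k, 'a) dg" and W :: "('a, 'm) dg" +
 assumes gr_W: "gr W = (%n. if n = 0 then carrier W else {\<zero>\<^sub>W})"
  and dif_W: "dif W x = \<zero>\<^sub>W"
  and triv_W: "a \<in> pos_part A ==> x \<in>: W ==> a \<odot>\<^sub>W x = \<zero>\<^sub>W"
begin

abbreviation S :: "('a, 'u => 'm) dg" where "S \<equiv> dsum UNIV (%_. W)"

lemma S_abelian: "abelian_group (S :: ('a, 'u => 'm) dg)"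
proof (rule abelian_groupI)
 fix x y :: "'u => 'm"
 assume x: "x \<in>: S"
 thus "\<exists>y\<in>carrier S. y \<oplus>\<^sub>S x = \<zero>\<^sub>S"
 proof (intro bexI[of _ "%i. \<ominus>\<^sub>W x i"])
  have "{i. \<ominus>\<^sub>W x i ~= \<zero>\<^sub>W} \<subseteq> {i. x i ~= \<zero>\<^sub>W}" by auto
  thus "(%i. \<ominus>\<^sub>W x i) \<in>: S" using x finite_subset by (auto simp: dsum_simps)
 qed (auto simp: dsum_simps W.M.l_neg)
 assume y: "y \<in>: S"
 have "{i. x i \<oplus>\<^sub>W y i ~= \<zero>\<^sub>W} \<subseteq> {i. x i ~= \<zero>\<^sub>W} \<union> {i. y i ~= \<zero>\<^sub>W}" by auto
 from finite_subset[OF this] show "x \<oplus>\<^sub>S y \<in>: S" using x y by (auto simp: dsum_simps)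
qed (auto simp: dsum_simps fun_eq_iff W.M.a_ac)

lemma S_dg_module: "left_dg_module A (S :: ('a, 'u => 'm) dg)"
proof (rule A.concentrated_dg_module[OF S_abelian])
 show "gr (S :: ('a, 'u => 'm) dg) = (%n. if n = 0 then carrier S else {\<zero>\<^sub>S})"
  by (rule ext) (auto simp: dsum_simps gr_W fun_eq_iff)
 show "a \<odot>\<^sub>S x \<in>: S" if a: "a \<in>: A" and x: "x \<in>: S" for a and x :: "'u => 'm"
 proof -
  have "{i. a \<odot>\<^sub>W x i ~= \<zero>\<^sub>W} \<subseteq> {i. x i ~= \<zero>\<^sub>W}" using W.smult_zero_right[OF a] by auto
  from finite_subset[OF this] show ?thesis using a x W.smult_closed by (auto simp: dsum_simps)
 qed
qed (auto simp: dsum_simps fun_eq_iff dif_W W.smult_l_distr W.smult_r_distr W.smult_assoc W.smult_one triv_W)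

lemma inj_chain: "chain_map A W S (\<lambda>x\<in>carrier W. (%j. if j = (i :: 'u) then x else \<zero>\<^sub>W))"
proof -
 have fin: "finite {j. (if j = i then x else \<zero>\<^sub>W) ~= \<zero>\<^sub>W}" for x
  by (rule finite_subset[of _ "{i}"]) auto
 have "(\<lambda>x\<in>carrier W. (%j. if j = i then x else \<zero>\<^sub>W)) \<in> hom_deg A W S 0"
  by (rule hom_degI)
   (use fin W.smult_zero_right in \<open>auto simp: dsum_simps fun_eq_iff gr_W W.smult_closed sgn_pow_def
     dest: A.cx.V_closed\<close>)
 thus ?thesis by (auto simp: chain_map_def dsum_simps dif_W)
qed

end

context koszul_transfer
begin

context
 fixes W :: "('a, 'm) dg"
 assumes W: "concentrated_dsum K A W"
begin

interpretation W: concentrated_dsum K A W by (rule W)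
interpretation S: left_dg_module A "W.S :: ('a, 'u => 'm) dg" by (rule W.S_dg_module)
interpretation PW: hom_complex A P W by unfold_locales
interpretation PS: hom_complex A P "W.S :: ('a, 'u => 'm) dg" by unfold_locales
interpretation HW: subquotient PW.H "cocycles PW.H" "coboundaries PW.H" by (rule PW.Hx.subquotient_cohom)
interpretation HS: subquotient "PS.H :: ('k, 'p => 'u => 'm) dg" "cocycles PS.H" "coboundaries PS.H"
 by (rule PS.Hx.subquotient_cohom)

text \<open>An element of the \<open>i\<close>-th summand is represented in the direct sum by a map that
 vanishes outside the component \<open>i\<close>.\<close>

lemma ext_component:
 fixes i :: 'u
 assumes X: "X \<in> gr (ext_dg A P W) 0"
 shows "\<exists>t. t \<in> hom_deg A P W.S 0 \<and> t \<in> cocycles PS.H \<and>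
  cohom_map PS.H (compose (carrier P) (dsum_inj UNIV (%_. W) i)) X = HS.cls t \<and>
  (\<forall>p\<in>carrier P. \<forall>j. j ~= i \<longrightarrow> t p j = \<zero>\<^sub>W)"
proof -
 let ?j = "\<lambda>x\<in>carrier W. (%j. if j = i then x else \<zero>\<^sub>W)"
 let ?i = "%f. compose (carrier P) (dsum_inj UNIV (%_. W) i) f"
 have ij: "?i f = compose (carrier P) ?j f" if "f \<in>: PW.H" for f
  using PW.H_F[OF that] by (auto simp: compose_def dsum_inj_def PW.F_carrier fun_eq_iff)
 obtain g where g: "g \<in> cocycles PW.H" "g \<in> hom_deg A P W 0" "X = HW.cls g"
  using X unfolding ext_dg_def cohom_def HW.SQ_gr PW.H_gr by (elim imageE IntE) (simp only:)
 have A: "cochain_complex A" by (rule A.cx.is_cpx)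
 have hom: "compose (carrier P) ?j f \<in> hom_deg A P W.S n" if "f \<in> hom_deg A P W n" for f n
  using compose_V[OF P.is_dgm W.W.is_dgm S.is_dgm A
    chain_hom[OF W.inj_chain] that] by simp
 interpret WS: hom_complex A W "W.S :: ('a, 'u => 'm) dg" by unfold_locales
 have hom_dif: "dif PS.H (compose (carrier P) ?j f) = compose (carrier P) ?j (dif PW.H f)" if f: "f \<in> hom_deg A P W n" for f n
 proof (rule hom_eqI)
  show "dif PS.H (compose (carrier P) ?j f) \<in> hom_deg A P W.S (n + 1)"
   unfolding PS.H_dif[OF hom[OF f]] by (rule PS.D_V[OF hom[OF f]])
  show "compose (carrier P) ?j (dif PW.H f) \<in> hom_deg A P W.S (n + 1)"
   unfolding PW.H_dif[OF f] by (rule hom[OF PW.D_V[OF f]])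
  fix x assume x: "x \<in>: P"
  have c: "f x \<in>: W" "f (dif P x) \<in>: W" using hom_closed[OF f] x by auto
  note jh = chain_hom[OF W.inj_chain[of i]]
  have "?j (hom_dif P W n f x) = ?j (dif W (f x)) \<ominus>\<^sub>W.S sgn_pow W.S n (?j (f (dif P x)))"
   unfolding PW.D_apply[OF x]
   using WS.hom_minus[OF jh W.W.cx.dif_closed[OF c(1)] W.W.M.sgn_closed[OF c(2)]] WS.hom_sgn[OF jh c(2)] by (simp only:)
  thus "dif PS.H (compose (carrier P) ?j f) x = compose (carrier P) ?j (dif PW.H f) x"
   unfolding PS.H_dif[OF hom[OF f]] PW.H_dif[OF f] PS.D_apply[OF x]
    compose_eq[OF x] compose_eq[OF P.cx.dif_closed[OF x]] chain_dif[OF W.inj_chain[of i] c(1), symmetric] by (simp only:)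
 qed
 have iH: "?i f \<in>: PS.H \<and> dif PS.H (?i f) = ?i (dif PW.H f)" if "f \<in>: PW.H" for f
  using that
 proof (induction rule: PW.Hg.graded_induct)
  case (homogeneous n f)
  show ?case using PS.V_H[OF hom[OF homogeneous]] hom_dif[OF homogeneous]
    ij[OF PW.V_H[OF homogeneous]] ij[OF PW.Hx.dif_closed[OF PW.V_H[OF homogeneous]]] by simp
 next
  case (add f k)
  have plus: "?i (f \<oplus>\<^sub>PW.H k) = ?i f \<oplus>\<^sub>PS.H ?i k" for f k
   by (rule ext) (auto simp: PW.H_add PS.H_add PW.F_add PS.F_add compose_def dsum_inj_def dsum_simps)
  show ?case using add by (simp add: plus PW.Hx.dif_add PS.Hx.dif_add)
 qed
 have plus: "?i (f \<oplus>\<^sub>PW.H k) = ?i f \<oplus>\<^sub>PS.H ?i k" for f k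
  by (rule ext) (auto simp: PW.H_add PS.H_add PW.F_add PS.F_add compose_def dsum_inj_def dsum_simps)
 have add: "additive_map PW.H PS.H ?i"
  by (rule additive_mapI) (use iH plus in auto)
 note gc = cocyclesD[OF g(1)]
 have "cohom_map PS.H ?i X = HS.cls (?i g)"
  unfolding cohom_map_def g(3)
 proof (rule HW.UN_cls[OF gc(1)])
  fix f assume f: "f \<in> HW.cls g"
  have fc: "f \<in>: PW.H" "HW.cls f = HW.cls g" using HW.cls_memD[OF f gc(1)] by blast+
  then obtain h where h: "h \<in>: PW.H" "f \<ominus>\<^sub>PW.H g = dif PW.H h"
   using HW.cls_eq_iff[OF fc(1) gc(1)] by (auto simp: coboundaries_def)
  have "?i f \<ominus>\<^sub>PS.H ?i g = dif PS.H (?i h)"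
   using additive_map_minus[OF PW.H.is_ab PS.H.is_ab add fc(1) gc(1)] h iH by simp
  hence "?i f \<ominus>\<^sub>PS.H ?i g \<in> coboundaries PS.H" unfolding coboundaries_def using iH[OF h(1)] by blast
  thus "HS.cls (?i f) = HS.cls (?i g)" using HS.cls_eq_iff iH fc(1) gc(1) by blast
 qed
 moreover have "?i g \<in> hom_deg A P W.S 0" unfolding ij[OF gc(1)] by (rule hom[OF g(2)])
 moreover have "?i g \<in> cocycles PS.H"
 proof (rule cocyclesI)
  show "?i g \<in>: PS.H" using iH[OF gc(1)] by blast
  have "dif PS.H (?i g) = ?i \<zero>\<^sub>PW.H" using iH[OF gc(1)] gc(2) by simp
  also have "... = \<zero>\<^sub>PS.H" by (rule additive_map_zero[OF PW.H.is_ab PS.H.is_ab add])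
  finally show "dif PS.H (?i g) = \<zero>\<^sub>PS.H" .
 qed
 moreover have "\<forall>p\<in>carrier P. \<forall>j. j ~= i \<longrightarrow> ?i g p j = \<zero>\<^sub>W" by (simp add: compose_eq dsum_inj_def)
 ultimately show ?thesis by blast
qed

text \<open>By compactness the class of a chain map is a finite sum of classes supported in single
 components.  On the minimal resolution homotopic maps into a module with trivial action are
 equal, so the map itself has finite support.\<close>

lemma finite_support_of_ext:
 assumes compact: "bij_betw (ext_dsum_map A P (UNIV :: 'u set) (%_. W))
   (gr (dsum UNIV (%_. ext_dg A P W)) 0) (gr (ext_dg A P W.S) 0)"
  and F: "chain_map A L W.S F"
 shows "\<exists>T :: 'u set. finite T \<and> (\<forall>x\<in>carrier L. \<forall>j. j \<notin> T \<longrightarrow> F x j = \<zero>\<^sub>W)"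
proof -
 note A = A.cx.is_cpx
 let ?G = "compose (carrier P) F v"
 have G: "chain_map A P W.S ?G"
  by (rule chain_compose[OF modules(2,1) S.is_dgm A F v(1)])
 have Gz: "?G \<in> cocycles PS.H"
  using PS.H_cocycle_iff[OF chain_hom[OF G]] PS.chain_iff[OF chain_hom[OF G]] G by blast
 note Gc = cocyclesD(1)[OF Gz]
 have "HS.cls ?G \<in> gr (ext_dg A P W.S) 0"
  unfolding ext_dg_def cohom_def HS.SQ_gr PS.H_gr by (intro imageI IntI Gz chain_hom[OF G])
 hence "HS.cls ?G \<in> ext_dsum_map A P UNIV (%_. W) ` gr (dsum UNIV (%_. ext_dg A P W)) 0"
  using compact unfolding bij_betw_def by (elim conjE) (simp only:)
 then obtain \<phi> where \<phi>: "\<phi> \<in> gr (dsum UNIV (%_. ext_dg A P W)) 0"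
  and eq: "HS.cls ?G = ext_dsum_map A P UNIV (%_. W) \<phi>" by (elim imageE)
 let ?T = "{i. \<phi> i ~= \<zero>\<^bsub>ext_dg A P W\<^esub>}"
 have T: "finite ?T" and \<phi>i: "\<phi> i \<in> gr (ext_dg A P W) 0" for i
  using \<phi> by (auto simp: dsum_simps)
 have "\<forall>i. \<exists>t. t \<in> hom_deg A P W.S 0 \<and> t \<in> cocycles PS.H \<and>
   cohom_map PS.H (compose (carrier P) (dsum_inj UNIV (%_. W) i)) (\<phi> i) = HS.cls t \<and>
   (\<forall>p\<in>carrier P. \<forall>j. j ~= i \<longrightarrow> t p j = \<zero>\<^sub>W)"
  by (rule allI) (rule ext_component[OF \<phi>i])
 from choice[OF this] obtain t where tt:
  "\<forall>i. t i \<in> hom_deg A P W.S 0 \<and> t i \<in> cocycles PS.H \<and>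
   cohom_map PS.H (compose (carrier P) (dsum_inj UNIV (%_. W) i)) (\<phi> i) = HS.cls (t i) \<and>
   (\<forall>p\<in>carrier P. \<forall>j. j ~= i \<longrightarrow> t i p j = \<zero>\<^sub>W)" by (elim exE)
 have t: "!!i. t i \<in> hom_deg A P W.S 0"
  "!!i. t i \<in> cocycles PS.H"
  "!!i. cohom_map PS.H (compose (carrier P) (dsum_inj UNIV (%_. W) i)) (\<phi> i) = HS.cls (t i)"
  "!!i p j. p \<in>: P ==> j ~= i ==> t i p j = \<zero>\<^sub>W"
  using spec[OF tt] by simp_all
 define s where "s = (\<Oplus>\<^sub>PS.H i\<in>?T. t i)"
 have tH: "t i \<in>: PS.H" for i by (rule PS.V_H[OF t(1)])
 have sV: "s \<in> hom_deg A P W.S 0" unfolding s_def by (rule PS.Hg.V_finsum) (rule t(1))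
 have "HS.cls ?G = (\<Oplus>\<^sub>HS.SQ i\<in>?T. HS.cls (t i))"
  unfolding eq ext_dsum_map_def ext_dg_def cohom_def by (simp add: t(3))
 also have "... = HS.cls s" unfolding s_def by (rule HS.SQ_finsum) (rule t(2))
 finally have "?G \<ominus>\<^sub>PS.H s \<in> coboundaries PS.H"
  using HS.cls_eq_iff[OF Gc PS.V_H[OF sV]] by blast
 hence "?G \<ominus>\<^sub>PS.F s \<in> coboundaries PS.H" unfolding PS.H_minus[OF Gc PS.V_H[OF sV]] .
 then obtain h where h: "h \<in> hom_deg A P W.S (- 1)" "hom_dif P W.S (- 1) h = ?G \<ominus>\<^sub>PS.F s"
  using PS.H_coboundary_iff[OF PS.minus_V[OF chain_hom[OF G] sV]] by auto
 have Fs: "F x = s (u x)" if x: "x \<in>: L" for x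
 proof -
  interpret LS: hom_complex A L "W.S :: ('a, 'u => 'm) dg" by unfold_locales
  have hu: "compose (carrier L) h u \<in> hom_deg A L W.S (- 1)"
   using compose_V[OF modules(1,2) S.is_dgm A h(1) chain_hom[OF u(1)]] by simp
  have gr: "gr (W.S :: ('a, 'u => 'm) dg) (- 1) = {\<zero>\<^sub>W.S}"
   by (auto simp: dsum_simps W.gr_W fun_eq_iff)
  have hu0: "h (u y) = \<zero>\<^sub>W.S" if "y \<in>: L" for y
   using hom_zeroI[OF S.is_dgm hu gr that] that by (simp add: compose_eq)
  have "hom_dif P W.S (- 1) h (u x) = \<zero>\<^sub>W.S"
   unfolding PS.D_apply[OF u_closed[OF x]] chain_dif[OF u(1) x, symmetric] hu0[OF x] hu0[OF L.cx.dif_closed[OF x]]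
   using S.M.minus_zero_iff[OF S.M.zero_closed S.M.zero_closed] by simp
  hence "?G (u x) \<ominus>\<^sub>W.S s (u x) = \<zero>\<^sub>W.S"
   unfolding h(2) PS.F_eval_minus[OF PS.V_F[OF chain_hom[OF G]] PS.V_F[OF sV] u_closed[OF x]] .
  hence "?G (u x) = s (u x)"
   using S.M.minus_zero_iff[OF chain_closed[OF G u_closed[OF x]] hom_closed[OF sV u_closed[OF x]]] by simp
  thus ?thesis using vu[OF x] u_closed[OF x] by (simp add: compose_eq)
 qed
 have "s p j = \<zero>\<^sub>W" if p: "p \<in>: P" and j: "j \<notin> ?T" for p j
 proof -
  have "additive_map PS.H W (%f. f p j)"
   by (rule additive_mapI)
    (use PS.H_F p in \<open>auto simp: PS.H_add PS.F_add dsum_simps PS.F_carrier PiE_iff\<close>)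
  from additive_map_finsum[OF PS.H.is_ab W.W.M.is_ab this, of ?T t]
  have "s p j = (\<Oplus>\<^sub>W i\<in>?T. t i p j)" unfolding s_def using tH by simp
  also have "... = (\<Oplus>\<^sub>W i\<in>?T. \<zero>\<^sub>W)"
  proof (rule W.W.M.finsum_cong'[OF refl])
   show "t i p j = \<zero>\<^sub>W" if "i \<in> ?T" for i
    using t(4)[OF p, of j i] that j by blast
  qed auto
  finally show ?thesis by simp
 qed
 thus ?thesis using T Fs u_closed by (intro exI[of _ ?T]) simp
qed

end

text \<open>An infinite basis would allow a chain map that sends infinitely many basis elements to nonzero
 elements of distinct summands.\<close>

theorem finite_basis:
 assumes compact: "!!(I :: 'u::infinite set) (M :: 'u => ('a, 'u => 'a) dg). (\<forall>i\<in>I. left_dg_module A (M i)) ==>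
   bij_betw (ext_dsum_map A P I M) (gr (dsum I (%i. ext_dg A P (M i))) 0) (gr (ext_dg A P (dsum I M)) 0)"
 shows "finite B"
proof (rule ccontr)
 assume inf: "infinite B"
 let ?W = "const_ground A :: ('a, 'u => 'a) dg"
 have W: "concentrated_dsum K A ?W"
  by (intro concentrated_dsum.intro concentrated_dsum_axioms.intro A.connected_dg_algebra_axioms
    A.const_ground_dg_module A.const_ground_triv) (unfold const_ground_simps, auto)
 interpret W: concentrated_dsum K A ?W by (rule W)
 interpret S: left_dg_module A "W.S :: ('a, 'u => 'u => 'a) dg" by (rule W.S_dg_module)
 have inf_u: "infinite (UNIV :: 'u set)" by (rule infinite_UNIV)
 obtain \<beta> :: "nat => 'r" where \<beta>: "inj \<beta>" "range \<beta> \<subseteq> B"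
  using infinite_countable_subset[OF inf] by blast
 obtain \<alpha> :: "nat => 'u" where \<alpha>: "inj \<alpha>"
  using infinite_countable_subset[OF inf_u] by blast
 \<comment> \<open>the map sending infinitely many basis elements to units in distinct summands\<close>
 define s where "s b = (%i. if \<exists>j. b = \<beta> j \<and> i = \<alpha> j then (%_. \<one>\<^sub>A) else \<zero>\<^bsub>?W\<^esub>)" for b
 have sc: "s b \<in>: W.S" for b
 proof -
  have "{i. s b i ~= \<zero>\<^bsub>?W\<^esub>} \<subseteq> \<alpha> ` (\<beta> -` {b})" by (auto simp: s_def)
  moreover have "finite (\<beta> -` {b})" using finite_vimageI[OF _ \<beta>(1)] by simp
  ultimately have "finite {i. s b i ~= \<zero>\<^bsub>?W\<^esub>}" using finite_subset by blast
  moreover have "s b i \<in>: ?W" for i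
   using A.one_gr A.cx.V_zero[of 0] by (auto simp: s_def const_ground_simps)
  ultimately show ?thesis by (simp add: dsum_simps)
 qed
 have s: "s b \<in> gr W.S (LL.Pf.deg b + 0)" if "b \<in> B" for b
  using sc[of b] deg_zero[OF that] by (simp add: dsum_simps W.gr_W)
 let ?F = "LL.Pf.ext W.S 0 s"
 have F: "?F \<in> hom_deg A L W.S 0" by (rule LL.Pf.ext_hom[OF S.is_dgm s])
 have Fb: "?F b = s b" if "b \<in> B" for b by (rule LL.Pf.ext_basis[OF S.is_dgm s that])
 have "?F (dif L x) = dif W.S (?F x)" if x: "x \<in>: L" for x
 proof -
  have "?F (dif L x) = \<zero>\<^sub>W.S"
  proof (rule hom_dif_zero[OF S.is_dgm F _ x])
   show "a \<odot>\<^sub>W.S y = \<zero>\<^sub>W.S" if "a \<in> pos_part A" "y \<in>: W.S" for a and y :: "'u => 'u => 'a"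
    using that W.triv_W by (simp add: dsum_simps)
  qed
  thus ?thesis by (simp add: dsum_simps W.dif_W)
 qed
 hence ch: "chain_map A L W.S ?F" using F by (simp add: chain_map_def)
 have "bij_betw (ext_dsum_map A P (UNIV :: 'u set) (%_. ?W))
   (gr (dsum UNIV (%_. ext_dg A P ?W)) 0) (gr (ext_dg A P W.S) 0)"
  by (rule compact) (simp add: A.const_ground_dg_module)
 from finite_support_of_ext[OF W this ch]
 obtain T :: "'u set" where T: "finite T" "!!x j. x \<in>: L ==> j \<notin> T ==> ?F x j = \<zero>\<^bsub>?W\<^esub>" by blast
 have "infinite (range \<alpha>)" using \<alpha> by (simp add: finite_image_iff)
 then obtain j where j: "\<alpha> j \<notin> T" using T(1) by (meson finite_subset image_subsetI)
 have b: "\<beta> j \<in> B" using \<beta>(2) by blast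
 have "?F (\<beta> j) (\<alpha> j) = (%_. \<one>\<^sub>A)" unfolding Fb[OF b] by (auto simp: s_def)
 hence "(%_ :: 'u. \<one>\<^sub>A) = (%_. \<zero>\<^sub>A)" using T(2)[OF LL.Pf.B_closed[OF b] j] by (simp add: const_ground_simps)
 thus False using one_neq_zero by (simp add: fun_eq_iff)
qed

end

section \<open>Linear extension over a field\<close>

text \<open>Zorn's lemma on the graphs of partial linear maps: a maximal one is defined everywhere, because
 a vector outside its domain could be sent to zero.\<close>

lemma linear_extension:
 assumes K: "field K" and X: "Module.module K X" and N: "Module.module K N"
  and U: "additive_subgroup U X" and U_smult: "!!c x. c \<in>: K ==> x \<in> U ==> c \<odot>\<^sub>X x \<in> U"
  and f: "!!x. x \<in> U ==> f x \<in>: N"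
  and f_add: "!!x y. x \<in> U ==> y \<in> U ==> f (x \<oplus>\<^sub>X y) = f x \<oplus>\<^sub>N f y"
  and f_smult: "!!c x. c \<in>: K ==> x \<in> U ==> f (c \<odot>\<^sub>X x) = c \<odot>\<^sub>N f x"
 shows "\<exists>g. additive_map X N g \<and> (\<forall>c\<in>carrier K. \<forall>x\<in>carrier X. g (c \<odot>\<^sub>X x) = c \<odot>\<^sub>N g x) \<and> (\<forall>x\<in>U. g x = f x)"
proof -
 interpret K: field K by fact
 interpret X: Module.module K X by fact
 interpret N: Module.module K N by fact
 interpret U: additive_subgroup U X by fact
 define lg where "lg G \<longleftrightarrow> G \<subseteq> carrier X \<times> carrier N \<and> (\<zero>\<^sub>X, \<zero>\<^sub>N) \<in> G \<and>
   (\<forall>x n y m. (x, n) \<in> G \<longrightarrow> (y, m) \<in> G \<longrightarrow> (x \<oplus>\<^sub>X y, n \<oplus>\<^sub>N m) \<in> G) \<and>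
   (\<forall>c x n. c \<in>: K \<longrightarrow> (x, n) \<in> G \<longrightarrow> (c \<odot>\<^sub>X x, c \<odot>\<^sub>N n) \<in> G) \<and>
   (\<forall>n. (\<zero>\<^sub>X, n) \<in> G \<longrightarrow> n = \<zero>\<^sub>N)" for G
 have lg_sub: "x \<in>: X" "n \<in>: N" if "lg G" "(x, n) \<in> G" for G x n
  using that by (auto simp: lg_def)
 have lg_zero: "(\<zero>\<^sub>X, \<zero>\<^sub>N) \<in> G" if "lg G" for G using that by (simp add: lg_def)
 have lg_add: "(x \<oplus>\<^sub>X y, n \<oplus>\<^sub>N m) \<in> G" if "lg G" "(x, n) \<in> G" "(y, m) \<in> G" for G x n y m
  using that unfolding lg_def by blast
 have lg_smult: "(c \<odot>\<^sub>X x, c \<odot>\<^sub>N n) \<in> G" if "lg G" "c \<in>: K" "(x, n) \<in> G" for G c x n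
  using that unfolding lg_def by blast
 have lg_fun0: "n = \<zero>\<^sub>N" if "lg G" "(\<zero>\<^sub>X, n) \<in> G" for G n
  using that unfolding lg_def by blast
 have m1: "\<ominus>\<^sub>K \<one>\<^sub>K \<in>: K" by simp
 have negX: "(\<ominus>\<^sub>K \<one>\<^sub>K) \<odot>\<^sub>X x = \<ominus>\<^sub>X x" if "x \<in>: X" for x
  using X.smult_l_minus[OF K.one_closed that] X.smult_one[OF that] by simp
 have negN: "(\<ominus>\<^sub>K \<one>\<^sub>K) \<odot>\<^sub>N x = \<ominus>\<^sub>N x" if "x \<in>: N" for x
  using N.smult_l_minus[OF K.one_closed that] N.smult_one[OF that] by simp
 have lg_fun: "n = m" if G: "lg G" and x: "(x, n) \<in> G" and y: "(x, m) \<in> G" for G x n m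
 proof -
  note c = lg_sub[OF G x] lg_sub[OF G y]
  have "(\<ominus>\<^sub>X x, \<ominus>\<^sub>N m) \<in> G" using lg_smult[OF G m1 y] c negX negN by simp
  from lg_add[OF G x this] have "(\<zero>\<^sub>X, n \<ominus>\<^sub>N m) \<in> G" using c by (simp add: X.M.r_neg a_minus_def)
  from lg_fun0[OF G this] show ?thesis using N.M.minus_zero_iff[of n m] c by simp
 qed
 let ?G0 = "(%x. (x, f x)) ` U"
 have f0: "f \<zero>\<^sub>X = \<zero>\<^sub>N"
  using f_smult[OF K.zero_closed U.zero_closed] f[OF U.zero_closed] by simp
 have G0_iff: "(x, n) \<in> ?G0 \<longleftrightarrow> x \<in> U \<and> n = f x" for x n by blast
 have G0: "lg ?G0"
  unfolding lg_def G0_iff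
 proof (intro conjI allI impI)
  show "?G0 \<subseteq> carrier X \<times> carrier N" using f U.a_Hcarr by blast
  show "\<zero>\<^sub>X \<in> U" by (rule U.zero_closed)
  show "\<zero>\<^sub>N = f \<zero>\<^sub>X" by (rule f0[symmetric])
  show "x \<oplus>\<^sub>X y \<in> U" "n \<oplus>\<^sub>N m = f (x \<oplus>\<^sub>X y)" if "x \<in> U \<and> n = f x" "y \<in> U \<and> m = f y" for x n y m
   using that U.a_closed[of x y] f_add[of x y] by simp_all
  show "c \<odot>\<^sub>X x \<in> U" "c \<odot>\<^sub>N n = f (c \<odot>\<^sub>X x)" if "c \<in>: K" "x \<in> U \<and> n = f x" for c x n
   using that U_smult[of c x] f_smult[of c x] by simp_all
  show "n = \<zero>\<^sub>N" if "\<zero>\<^sub>X \<in> U \<and> n = f \<zero>\<^sub>X" for n using that f0 by simp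
 qed
 let ?\<A> = "{G. lg G \<and> ?G0 \<subseteq> G}"
 have "\<exists>M\<in>?\<A>. \<forall>G\<in>?\<A>. M \<subseteq> G \<longrightarrow> G = M"
 proof (rule subset_Zorn_nonempty)
  have "?G0 \<in> ?\<A>" using G0 by simp
  thus "?\<A> ~= {}" by (metis empty_iff)
  fix \<C> assume ne: "\<C> ~= {}" and ch: "subset.chain ?\<A> \<C>"
  have ch1: "\<C> \<subseteq> ?\<A>" using ch unfolding subset.chain_def by (rule conjunct1)
  have ch2: "\<forall>G\<in>\<C>. \<forall>G'\<in>\<C>. G \<subseteq> G' \<or> G' \<subseteq> G" using ch unfolding subset_chain_def by (rule conjunct2)
  have lgC: "lg G" "?G0 \<subseteq> G" if "G \<in> \<C>" for G using subsetD[OF ch1 that] by simp_all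
  have two: "\<exists>G\<in>\<C>. p \<in> G \<and> q \<in> G" if pq: "p \<in> \<Union>\<C>" "q \<in> \<Union>\<C>" for p q
  proof -
   obtain G where G: "G \<in> \<C>" "p \<in> G" using pq(1) by blast
   obtain G' where G': "G' \<in> \<C>" "q \<in> G'" using pq(2) by blast
   have "G \<subseteq> G' \<or> G' \<subseteq> G" using ch2 G(1) G'(1) by blast
   thus ?thesis using G G' by blast
  qed
  obtain G1 where G1: "G1 \<in> \<C>" using ne by blast
  have "lg (\<Union>\<C>)"
   unfolding lg_def
  proof (intro conjI allI impI)
   show "\<Union>\<C> \<subseteq> carrier X \<times> carrier N" using lgC(1) lg_sub by fast
   show "(\<zero>\<^sub>X, \<zero>\<^sub>N) \<in> \<Union>\<C>" using lg_zero[OF lgC(1)[OF G1]] G1 by blast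
   show "(x \<oplus>\<^sub>X y, n \<oplus>\<^sub>N m) \<in> \<Union>\<C>" if xy: "(x, n) \<in> \<Union>\<C>" "(y, m) \<in> \<Union>\<C>" for x n y m
   proof -
    obtain G where G: "G \<in> \<C>" "(x, n) \<in> G" "(y, m) \<in> G" using two[OF xy] by blast
    show ?thesis using lg_add[OF lgC(1)[OF G(1)] G(2,3)] G(1) by blast
   qed
   show "(c \<odot>\<^sub>X x, c \<odot>\<^sub>N n) \<in> \<Union>\<C>" if c: "c \<in>: K" and x: "(x, n) \<in> \<Union>\<C>" for c x n
   proof -
    obtain G where G: "G \<in> \<C>" "(x, n) \<in> G" using x by blast
    show ?thesis using lg_smult[OF lgC(1)[OF G(1)] c G(2)] G(1) by blast
   qed
   show "n = \<zero>\<^sub>N" if n: "(\<zero>\<^sub>X, n) \<in> \<Union>\<C>" for n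
   proof -
    obtain G where G: "G \<in> \<C>" "(\<zero>\<^sub>X, n) \<in> G" using n by blast
    show ?thesis by (rule lg_fun0[OF lgC(1)[OF G(1)] G(2)])
   qed
  qed
  moreover have "?G0 \<subseteq> \<Union>\<C>" using lgC(2)[OF G1] G1 by blast
  ultimately show "\<Union>\<C> \<in> ?\<A>" by simp
 qed
 then obtain M where M1: "M \<in> ?\<A>" and M2: "\<forall>G\<in>?\<A>. M \<subseteq> G \<longrightarrow> G = M" by (elim bexE)
 have M: "lg M" "?G0 \<subseteq> M" using M1 by simp_all
 have max: "G = M" if "lg G" "?G0 \<subseteq> G" "M \<subseteq> G" for G
  using bspec[OF M2, of G] that by simp
 have total: "\<exists>n. (x, n) \<in> M" if x: "x \<in>: X" for x
 proof (rule ccontr)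
  assume notin: "\<nexists>n. (x, n) \<in> M"
  let ?M' = "{(y \<oplus>\<^sub>X c \<odot>\<^sub>X x, n) | y c n. (y, n) \<in> M \<and> c \<in>: K}"
  have mem: "(y \<oplus>\<^sub>X c \<odot>\<^sub>X x, n) \<in> ?M'" if "(y, n) \<in> M" "c \<in>: K" for y c n
   using that by blast
  have sub: "M \<subseteq> ?M'"
  proof
   fix p assume "p \<in> M"
   then obtain y n where p: "p = (y, n)" "(y, n) \<in> M" by (cases p) auto
   have "y \<oplus>\<^sub>X \<zero>\<^sub>K \<odot>\<^sub>X x = y" using lg_sub[OF M(1) p(2)] x by simp
   thus "p \<in> ?M'" using mem[OF p(2) K.zero_closed] p(1) by simp
  qed
  have "lg ?M'"
   unfolding lg_def
  proof (intro conjI allI impI)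
   show "?M' \<subseteq> carrier X \<times> carrier N" using lg_sub[OF M(1)] x by auto
   show "(\<zero>\<^sub>X, \<zero>\<^sub>N) \<in> ?M'" using lg_zero[OF M(1)] sub by blast
   show "(a \<oplus>\<^sub>X b, n \<oplus>\<^sub>N m) \<in> ?M'" if a: "(a, n) \<in> ?M'" and b: "(b, m) \<in> ?M'" for a n b m
   proof -
    obtain y c where y: "a = y \<oplus>\<^sub>X c \<odot>\<^sub>X x" "(y, n) \<in> M" "c \<in>: K" using a by blast
    obtain z d where z: "b = z \<oplus>\<^sub>X d \<odot>\<^sub>X x" "(z, m) \<in> M" "d \<in>: K" using b by blast
    note c = lg_sub[OF M(1) y(2)] lg_sub[OF M(1) z(2)]
    have "a \<oplus>\<^sub>X b = (y \<oplus>\<^sub>X z) \<oplus>\<^sub>X (c \<oplus>\<^sub>K d) \<odot>\<^sub>X x"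
     unfolding y(1) z(1) using c x y(3) z(3) by (simp add: X.smult_l_distr X.M.a_ac)
    thus ?thesis using mem[OF lg_add[OF M(1) y(2) z(2)] K.a_closed[OF y(3) z(3)]] by simp
   qed
   show "(k \<odot>\<^sub>X a, k \<odot>\<^sub>N n) \<in> ?M'" if k: "k \<in>: K" and a: "(a, n) \<in> ?M'" for k a n
   proof -
    obtain y c where y: "a = y \<oplus>\<^sub>X c \<odot>\<^sub>X x" "(y, n) \<in> M" "c \<in>: K" using a by blast
    have "k \<odot>\<^sub>X a = (k \<odot>\<^sub>X y) \<oplus>\<^sub>X (k \<otimes>\<^sub>K c) \<odot>\<^sub>X x"
     unfolding y(1) using lg_sub[OF M(1) y(2)] x y(3) k by (simp add: X.smult_r_distr X.smult_assoc1)
    thus ?thesis using mem[OF lg_smult[OF M(1) k y(2)] K.m_closed[OF k y(3)]] by simp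
   qed
   show "n = \<zero>\<^sub>N" if n: "(\<zero>\<^sub>X, n) \<in> ?M'" for n
   proof -
    obtain y c where y: "\<zero>\<^sub>X = y \<oplus>\<^sub>X c \<odot>\<^sub>X x" "(y, n) \<in> M" "c \<in>: K" using n by blast
    note yc = lg_sub[OF M(1) y(2)]
    show ?thesis
    proof (cases "c = \<zero>\<^sub>K")
     case True
     thus ?thesis using y yc x lg_fun0[OF M(1), of n] by simp
    next
     case False
     hence cu: "c \<in> Units K" using y(3) K.field_Units by blast
     let ?i = "\<ominus>\<^sub>K (inv\<^bsub>K\<^esub> c)"
     have ic: "?i \<in>: K" "inv\<^bsub>K\<^esub> c \<in>: K" using cu by simp_all
     have cx: "c \<odot>\<^sub>X x \<in>: X" using y(3) x by simp
     have "y = \<ominus>\<^sub>X (c \<odot>\<^sub>X x)" using X.M.minus_equality[OF y(1)[symmetric] cx yc(1)] by simp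
     hence "?i \<odot>\<^sub>X y = (inv\<^bsub>K\<^esub> c \<otimes>\<^sub>K c) \<odot>\<^sub>X x"
      using cx ic y(3) x X.smult_l_minus[OF ic(2)] X.smult_r_minus[OF ic(2)]
      by (simp add: X.smult_assoc1)
     hence "?i \<odot>\<^sub>X y = x" using cu x by simp
     thus ?thesis using lg_smult[OF M(1) ic(1) y(2)] notin by auto
    qed
   qed
  qed
  from max[OF this subset_trans[OF M(2) sub] sub] have "?M' = M" .
  moreover have "(x, \<zero>\<^sub>N) \<in> ?M'" using mem[OF lg_zero[OF M(1)] K.one_closed] x by simp
  ultimately show False using notin by auto
 qed
 define g where "g x = (SOME n. (x, n) \<in> M)" for x
 have g: "(x, g x) \<in> M" if "x \<in>: X" for x unfolding g_def by (rule someI_ex[OF total[OF that]])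
 have geq: "g x = n" if "(x, n) \<in> M" for x n
  using lg_fun[OF M(1) g[OF lg_sub(1)[OF M(1) that]] that] .
 show ?thesis
 proof (intro exI[of _ g] conjI ballI)
  show "additive_map X N g"
   by (rule additive_mapI) (use lg_sub(2)[OF M(1) g] geq[OF lg_add[OF M(1) g g]] in auto)
  show "g (c \<odot>\<^sub>X x) = c \<odot>\<^sub>N g x" if "c \<in>: K" "x \<in>: X" for c x
   by (rule geq[OF lg_smult[OF M(1) that(1) g[OF that(2)]]])
  show "g x = f x" if "x \<in> U" for x by (rule geq) (use M(2) that in blast)
 qed
qed

section \<open>The minimal resolution as a complex of injective modules\<close>

text \<open>The Ext-algebra as a ring \<open>R\<close> in degree \<open>0\<close>, together with its identification with the
 chain endomorphisms of the minimal resolution.\<close>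

locale koszul_dual = koszul_resolution K A L Bn e + R: dg_algebra K R
 for K :: "('k, 'c) ring_scheme" and A :: "('k, 'a) dg" and L :: "('a, 'r) dg"
  and Bn :: "nat => 'r set" and e :: "'r => 'a" and R :: "('k, 'e) dg" +
 fixes act :: "'e => 'r => 'r"
 assumes finite_B: "finite B"
  and R_gr: "gr R n = (if n = 0 then carrier R else {\<zero>\<^sub>R})" and R_dif: "dif R U = \<zero>\<^sub>R"
  and act_E0: "U \<in>: R ==> (\<lambda>x\<in>carrier L. act U x) \<in> E0"
  and act_add: "U \<in>: R ==> W \<in>: R ==> x \<in>: L ==> act (U \<oplus>\<^sub>R W) x = act U x \<oplus>\<^sub>L act W x"
  and act_mult: "U \<in>: R ==> W \<in>: R ==> x \<in>: L ==> act (U \<otimes>\<^sub>R W) x = act U (act W x)"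
  and act_one: "x \<in>: L ==> act \<one>\<^sub>R x = x"
  and act_scalar: "c \<in>: K ==> U \<in>: R ==> x \<in>: L ==> act (c \<odot>\<^sub>R U) x = A.scal c \<odot>\<^sub>L act U x"
  and act_full: "f \<in> E0 ==> \<exists>U\<in>carrier R. \<forall>x\<in>carrier L. act U x = f x"
  and act_faithful: "U \<in>: R ==> (!!x. x \<in>: L ==> act U x = \<zero>\<^sub>L) ==> U = \<zero>\<^sub>R"
begin

lemma
 assumes U: "U \<in>: R"
 shows act_closed: "x \<in>: L ==> act U x \<in>: L"
  and act_plus: "x \<in>: L ==> y \<in>: L ==> act U (x \<oplus>\<^sub>L y) = act U x \<oplus>\<^sub>L act U y"
  and act_smult: "a \<in>: A ==> x \<in>: L ==> act U (a \<odot>\<^sub>L x) = a \<odot>\<^sub>L act U x"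
  and act_gr: "x \<in> gr L n ==> act U x \<in> gr L n"
  and act_dif: "x \<in>: L ==> act U (dif L x) = dif L (act U x)"
proof -
 note f = act_E0[OF U] E0_hom[OF act_E0[OF U]]
 show "x \<in>: L ==> act U x \<in>: L" using hom_closed[OF f(2)] by simp
 show "x \<in>: L ==> y \<in>: L ==> act U (x \<oplus>\<^sub>L y) = act U x \<oplus>\<^sub>L act U y"
  using hom_add[OF f(2), of x y] by simp
 show "a \<in>: A ==> x \<in>: L ==> act U (a \<odot>\<^sub>L x) = a \<odot>\<^sub>L act U x"
  using LL.PM.hom_linear[OF f(2), of a x] L.smult_closed[of a x] by simp
 show "x \<in> gr L n ==> act U x \<in> gr L n" using hom_gr[OF f(2), of x n] L.cx.V_closed[of x n] by simp
 show "x \<in>: L ==> act U (dif L x) = dif L (act U x)" using E0_dif[OF f(1), of x] by simp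
qed

text \<open>The minimal resolution with \<open>R\<close> instead of the algebra as its ring of scalars.\<close>

definition LR :: "('e, 'r) dg" where
 "LR = \<lparr>carrier = carrier L, mult = mult L, one = one L, zero = zero L, add = add L,
  smult = act, gr = gr L, dif = dif L\<rparr>"

lemma LR_simps [simp]:
 "carrier LR = carrier L" "zero LR = zero L" "add LR = add L" "smult LR = act" "gr LR = gr L" "dif LR = dif L"
 by (simp_all add: LR_def)

lemma sgn_LR [simp]: "sgn_pow LR n x = sgn_pow L n x"
 by (rule sgn_cong_structure) simp_all

lemma act_zero: "U \<in>: R ==> act U \<zero>\<^sub>L = \<zero>\<^sub>L"
 by (rule additive_map_zero[OF L.M.is_ab L.M.is_ab])
  (auto intro!: additive_mapI act_closed act_plus)

lemma act_zero_left: "x \<in>: L ==> act \<zero>\<^sub>R x = \<zero>\<^sub>L"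
 using additive_map_zero[OF R.alg.is_ab L.M.is_ab, of "%U. act U x"]
 by (auto intro!: additive_mapI act_closed act_add)

lemma act_minus_left:
 "U \<in>: R ==> W \<in>: R ==> x \<in>: L ==> act (U \<ominus>\<^sub>R W) x = act U x \<ominus>\<^sub>L act W x"
 using additive_map_minus[OF R.alg.is_ab L.M.is_ab, of "%U. act U x"]
 by (auto intro!: additive_mapI act_closed act_add)

lemma LR_dg_module: "left_dg_module R LR"
proof -
 have ab: "abelian_group LR"
  by (rule abelian_group_cong_structure[OF L.M.is_ab]) simp_all
 have cx: "cochain_complex LR"
  by (rule cochain_complex_cong_structure[OF L.cx.is_cpx]) simp_all
 interpret C: cochain_complex LR by (rule cx)
 show ?thesis
 proof (intro left_dg_module.intro left_module.intro left_dg_module_axioms.intro left_module_axioms.intro R.ring ab)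
  show "graded_by LR (gr LR)" by (rule C.graded)
  show "U \<odot>\<^sub>LR x \<in> gr LR (i + j)" if U: "U \<in> gr R i" and x: "x \<in> gr LR j" for U x i j
  proof (cases "i = 0")
   case True
   thus ?thesis using U x act_gr by (simp add: R_gr)
  next
   case False
   hence "U = \<zero>\<^sub>R" using U by (simp add: R_gr)
   thus ?thesis using act_zero_left[OF L.cx.V_closed[of x j]] x by simp
  qed
  show "dif LR (U \<odot>\<^sub>LR x) = dif R U \<odot>\<^sub>LR x \<oplus>\<^sub>LR sgn_pow LR i (U \<odot>\<^sub>LR dif LR x)"
   if U: "U \<in> gr R i" and x: "x \<in>: LR" for U x i
  proof -
   have xc: "x \<in>: L" "dif L x \<in>: L" using x by simp_all
   show ?thesis
   proof (cases "i = 0")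
    case True
    thus ?thesis using U xc act_zero_left[OF xc(1)] act_dif[of U x] act_closed[of U x] act_closed[of U "dif L x"]
     by (simp add: R_gr R_dif sgn_pow_def)
   next
    case False
    hence "U = \<zero>\<^sub>R" using U by (simp add: R_gr)
    thus ?thesis using xc act_zero_left by (simp add: R_dif)
   qed
  qed
 qed (simp_all add: act_closed act_plus act_add act_mult act_one L.cx.dif_gr L.cx.dif_add L.cx.dif_dif)
qed

sublocale LR: left_dg_module R LR by (rule LR_dg_module)

subsection \<open>The radical\<close>

lemma aug_w: "U \<in>: R ==> act U w = e (act U w) \<odot>\<^sub>L w"
 using act_gr[OF _ w(1)] act_dif[OF _ w_closed] w(2) act_zero by (intro cocycle_0) auto

lemma e_plus: "x \<in>: L ==> y \<in>: L ==> e (x \<oplus>\<^sub>L y) = e x \<oplus>\<^sub>A e y"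
 using hom_add[OF e_hom] by simp

lemma e_minus: "x \<in>: L ==> y \<in>: L ==> e (x \<ominus>\<^sub>L y) = e x \<ominus>\<^sub>A e y"
proof -
 have "additive_map L A e"
  by (rule additive_mapI) (auto simp: e_plus A.cx.V_closed[OF e_closed])
 thus "x \<in>: L ==> y \<in>: L ==> e (x \<ominus>\<^sub>L y) = e x \<ominus>\<^sub>A e y"
  by (rule additive_map_minus[OF L.M.is_ab A.alg.is_ab])
qed

text \<open>The annihilator of \<open>w\<close>; the action on the line through \<open>w\<close> identifies
 the quotient with the ground field.\<close>

definition J :: "'e set" where "J = {U \<in> carrier R. act U w = \<zero>\<^sub>L}"

lemma J_iff: "U \<in>: R ==> U \<in> J \<longleftrightarrow> e (act U w) = \<zero>\<^sub>A"
proof -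
 assume U: "U \<in>: R"
 have "e (act U w) = \<zero>\<^sub>A ==> act U w = \<zero>\<^sub>L" using aug_w[OF U] L.smult_zero_left[OF w_closed] by simp
 moreover have "e \<zero>\<^sub>L = \<zero>\<^sub>A" using LL.PG.hom_zero[OF e_hom] by simp
 ultimately show ?thesis using U by (auto simp: J_def)
qed

lemma gr_A_0: "a \<in> gr A 0 ==> \<exists>c\<in>carrier K. a = A.scal c"
 using A.gr_0 by (auto simp: bij_betw_def)

lemma J_left_ideal: "left_ideal J R"
 unfolding left_ideal_def
proof
 have "\<ominus>\<^sub>R a \<in> J" if a: "a \<in> J" for a
 proof -
  have ac: "a \<in>: R" "act a w = \<zero>\<^sub>L" using a by (auto simp: J_def)
  have "act (\<zero>\<^sub>R \<ominus>\<^sub>R a) w = \<zero>\<^sub>L"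
   using act_minus_left[OF R.alg.zero_closed ac(1) w_closed] act_zero_left[OF w_closed] ac(2)
    L.M.minus_zero_iff[OF L.M.zero_closed L.M.zero_closed] by simp
  thus ?thesis using ac by (simp add: J_def a_minus_def)
 qed
 thus "additive_subgroup J R"
  by (intro additive_subgroupI R.alg.add_subgroupI)
   (auto simp: J_def act_add act_zero_left w_closed)
 show "\<forall>r\<in>carrier R. \<forall>x\<in>J. r \<otimes>\<^sub>R x \<in> J"
  by (auto simp: J_def act_mult w_closed act_zero)
qed

lemma one_notin_J: "\<one>\<^sub>R \<notin> J"
 using act_one[OF w_closed] w(3) J_iff[OF R.alg.one_closed] one_neq_zero by simp

lemma left_ideal_one:
 assumes I: "left_ideal I R" and "\<one>\<^sub>R \<in> I"
 shows "I = carrier R"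
proof
 show "I \<subseteq> carrier R" using I unfolding left_ideal_def by (simp add: additive_subgroup.a_subset)
 show "carrier R \<subseteq> I"
 proof
  fix r assume r: "r \<in>: R"
  hence "r \<otimes>\<^sub>R \<one>\<^sub>R \<in> I" using assms unfolding left_ideal_def by blast
  thus "r \<in> I" using r by simp
 qed
qed

lemma act_eqI:
 assumes U: "U \<in>: R" and W: "W \<in>: R" and eq: "!!b. b \<in> B ==> e (act U b) = e (act W b)"
 shows "U = W"
proof -
 have Uc: "U \<ominus>\<^sub>R W \<in>: R" using U W by simp
 have "act (U \<ominus>\<^sub>R W) x = \<zero>\<^sub>L" if x: "x \<in>: L" for x
 proof -
  have "(\<lambda>x\<in>carrier L. act (U \<ominus>\<^sub>R W) x) x = \<zero>\<^sub>L"
  proof (rule E0_eq_zero[OF act_E0[OF Uc] _ x])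
   fix b assume b: "b \<in> B"
   note bc = LL.Pf.B_closed[OF b]
   show "e ((\<lambda>x\<in>carrier L. act (U \<ominus>\<^sub>R W) x) b) = \<zero>\<^sub>A"
    using eq[OF b] bc act_minus_left[OF U W bc] e_minus[OF act_closed[OF U bc] act_closed[OF W bc]]
     A.alg.minus_zero_iff[of "e (act W b)" "e (act W b)"] A.cx.V_closed[OF e_closed[OF act_closed[OF W bc]]] by simp
  qed
  thus ?thesis using x by simp
 qed
 from act_faithful[OF Uc this] show ?thesis using R.alg.minus_zero_iff[OF U W] by simp
qed

text \<open>Composing the augmentation with a chain endomorphism that fixes \<open>w\<close> gives another augmentation
 with the same exactness property, and lifting the original augmentation along it gives the inverse.\<close>

lemma right_inverse:
 assumes U: "U \<in>: R" and Uw: "act U w = w"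
 shows "\<exists>W\<in>carrier R. U \<otimes>\<^sub>R W = \<one>\<^sub>R \<and> act W w = w"
proof -
 let ?f = "\<lambda>x\<in>carrier L. act U x" and ?e = "\<lambda>x\<in>carrier L. e (act U x)"
 have "compose (carrier L) e ?f = ?e" by (rule ext) (simp add: compose_def)
 hence eh: "?e \<in> hom_deg A L (ground A) 0"
  using compose_V[OF L.is_dgm L.is_dgm A.ground.is_dgm
    A.cx.is_cpx e_hom E0_hom[OF act_E0[OF U]]] by simp
 have res: "ground_resolution A L ?e"
  unfolding ground_resolution_def
 proof (intro conjI allI ballI impI eh)
  show "?e (dif L x) = \<zero>\<^sub>A" if "x \<in>: L" for x
   using that act_dif[OF U that] LL.eps_dif[OF act_closed[OF U that]] by simp
  show "\<exists>w\<in>gr L 0. dif L w = \<zero>\<^sub>L \<and> ?e w = \<one>\<^sub>A"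
   by (rule bexI[OF _ w(1)]) (use w Uw w_closed in simp)
  fix n x assume x: "x \<in> gr L n" and "dif L x = \<zero>\<^sub>L \<and> ?e x = \<zero>\<^sub>A"
  note xc = L.cx.V_closed[OF x]
  have dx: "dif L x = \<zero>\<^sub>L" and ex: "e (act U x) = \<zero>\<^sub>A" using \<open>_ \<and> _\<close> xc by simp_all
  have "e x = \<zero>\<^sub>A"
  proof (cases "n = 0")
   case True
   have xw: "x = e x \<odot>\<^sub>L w" using cocycle_0[of x] x dx True by simp
   have "act U x = e x \<odot>\<^sub>L w"
    using act_smult[OF U A.cx.V_closed[OF e_closed[OF xc]] w_closed] Uw arg_cong[OF xw, of "act U"] by simp
   thus ?thesis using ex xw by simp
  next
   case False
   thus ?thesis using hom_gr[OF e_hom x] by simp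
  qed
  from LL.eps_exact[OF x dx this] show "\<exists>y\<in>gr L (n - 1). dif L y = x" .
 qed
 interpret U: semifree_lifting K A L L Bn ?e
  by unfold_locales (use semibasis res in auto)
 obtain v where v: "chain_map A L L v" and ev: "\<forall>x\<in>carrier L. ?e (v x) = e x"
  using U.lift_chain[OF e_hom LL.eps_dif] by blast
 have "v \<in> E0" using v by (simp add: E0_iff chain_map_def)
 then obtain W where W: "W \<in>: R" and Wv: "\<forall>x\<in>carrier L. act W x = v x" using act_full by blast
 have UW: "U \<otimes>\<^sub>R W = \<one>\<^sub>R"
 proof (rule act_eqI)
  fix b assume "b \<in> B"
  hence b: "b \<in>: L" by (rule LL.Pf.B_closed)
  have "e (act U (act W b)) = e b" using bspec[OF ev b] bspec[OF Wv b] act_closed[OF W b] by simp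
  thus "e (act (U \<otimes>\<^sub>R W) b) = e (act \<one>\<^sub>R b)" using act_mult[OF U W b] act_one[OF b] by simp
 qed (use U W in simp_all)
 have c: "e (act W w) \<in>: A" by (rule A.cx.V_closed[OF e_closed[OF act_closed[OF W w_closed]]])
 have "act W w = act U (act W w)"
  using act_smult[OF U c w_closed] Uw aug_w[OF W] by simp
 also have "... = w" using act_mult[OF U W w_closed] UW act_one[OF w_closed] by simp
 finally show ?thesis using W UW by blast
qed

text \<open>For \<open>g\<close> in \<open>J\<close> the element \<open>1 - g\<close> fixes
 \<open>w\<close>, so it is invertible and lies in no maximal left ideal.\<close>

lemma J_mem_maximal:
 assumes I: "maximal_left_ideal I R" and f: "f \<in> J"
 shows "f \<in> I"
proof (rule ccontr)
 assume notin: "f \<notin> I"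
 have Il: "left_ideal I R" and Ine: "I ~= carrier R"
  and Imax: "!!I'. left_ideal I' R ==> I \<subseteq> I' ==> I' = I \<or> I' = carrier R"
  using I by (auto simp: maximal_left_ideal_def)
 interpret I: additive_subgroup I R using Il by (simp add: left_ideal_def)
 have Imul: "r \<otimes>\<^sub>R x \<in> I" if "r \<in>: R" "x \<in> I" for r x using Il that by (simp add: left_ideal_def)
 have Ic: "x \<in>: R" if "x \<in> I" for x by (rule I.a_Hcarr[OF that])
 have fc: "f \<in>: R" using f by (simp add: J_def)
 let ?I = "{i \<oplus>\<^sub>R r \<otimes>\<^sub>R f | i r. i \<in> I \<and> r \<in>: R}"
 have mem: "i \<oplus>\<^sub>R r \<otimes>\<^sub>R f \<in> ?I" if "i \<in> I" "r \<in>: R" for i r using that by blast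
 have "left_ideal ?I R"
  unfolding left_ideal_def
 proof (intro conjI ballI additive_subgroupI R.alg.add_subgroupI)
  show "?I \<subseteq> carrier R" using fc Ic by auto
  show "\<zero>\<^sub>R \<in> ?I" using mem[OF I.zero_closed R.alg.zero_closed] fc by simp
  fix a assume "a \<in> ?I"
  then obtain i r where a: "a = i \<oplus>\<^sub>R r \<otimes>\<^sub>R f" "i \<in> I" "r \<in>: R" by blast
  have "\<ominus>\<^sub>R a = (\<ominus>\<^sub>R i) \<oplus>\<^sub>R (\<ominus>\<^sub>R r) \<otimes>\<^sub>R f"
   unfolding a(1) using a(3) Ic[OF a(2)] fc by (simp add: R.alg.minus_add R.alg.l_minus)
  thus "\<ominus>\<^sub>R a \<in> ?I" using mem[OF I.a_inv_closed[OF a(2)] R.alg.a_inv_closed[OF a(3)]] by simp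
  {
   fix b assume "b \<in> ?I"
   then obtain j s where b: "b = j \<oplus>\<^sub>R s \<otimes>\<^sub>R f" "j \<in> I" "s \<in>: R" by blast
   have "a \<oplus>\<^sub>R b = (i \<oplus>\<^sub>R j) \<oplus>\<^sub>R (r \<oplus>\<^sub>R s) \<otimes>\<^sub>R f"
    unfolding a(1) b(1) using a(3) b(3) Ic[OF a(2)] Ic[OF b(2)] fc by (simp add: R.alg.l_distr R.alg.a_ac)
   thus "a \<oplus>\<^sub>R b \<in> ?I" using mem[OF I.a_closed[OF a(2) b(2)] R.alg.a_closed[OF a(3) b(3)]] by simp
  }
  fix t assume t: "t \<in>: R"
  have "t \<otimes>\<^sub>R a = (t \<otimes>\<^sub>R i) \<oplus>\<^sub>R (t \<otimes>\<^sub>R r) \<otimes>\<^sub>R f"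
   unfolding a(1) using a(3) Ic[OF a(2)] fc t by (simp add: R.alg.r_distr R.alg.m_assoc)
  thus "t \<otimes>\<^sub>R a \<in> ?I" using mem[OF Imul[OF t a(2)] R.alg.m_closed[OF t a(3)]] by simp
 qed
 moreover have "I \<subseteq> ?I"
 proof
  fix i assume i: "i \<in> I"
  thus "i \<in> ?I" using mem[OF i R.alg.zero_closed] Ic[OF i] fc by simp
 qed
 moreover have "f \<in> ?I" using mem[OF I.zero_closed R.alg.one_closed] fc by simp
 ultimately have "?I = carrier R" using Imax[of ?I] notin by blast
 hence "\<one>\<^sub>R \<in> ?I" by simp
 then obtain i r where ir: "\<one>\<^sub>R = i \<oplus>\<^sub>R r \<otimes>\<^sub>R f" "i \<in> I" "r \<in>: R" by blast
 define g where "g = r \<otimes>\<^sub>R f"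
 have gJ: "g \<in> J" using J_left_ideal f ir(3) by (simp add: left_ideal_def g_def)
 hence gc: "g \<in>: R" by (simp add: J_def)
 have ig: "\<one>\<^sub>R \<ominus>\<^sub>R g \<in> I"
  using ir(1,2) R.alg.add_minus_cancel[OF Ic[OF ir(2)] gc] by (simp add: g_def)
 let ?u = "\<one>\<^sub>R \<ominus>\<^sub>R g"
 have uc: "?u \<in>: R" using gc by simp
 have "act ?u w = w"
  using act_minus_left[OF R.one_closed gc w_closed] act_one[OF w_closed] gJ w_closed by (simp add: J_def a_minus_def)
 from right_inverse[OF uc this] obtain W where W: "W \<in>: R" "?u \<otimes>\<^sub>R W = \<one>\<^sub>R" "act W w = w" by blast
 from right_inverse[OF W(1,3)] obtain T where T: "T \<in>: R" "W \<otimes>\<^sub>R T = \<one>\<^sub>R" by blast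
 have "?u = ?u \<otimes>\<^sub>R (W \<otimes>\<^sub>R T)" using T uc by simp
 also have "... = T" using W(2) R.alg.m_assoc[OF uc W(1) T(1)] T(1) by simp
 finally have "\<one>\<^sub>R \<in> I" using Imul[OF W(1) ig] T(2) by simp
 thus False using left_ideal_one[OF Il] Ine by simp
qed

lemma J_maximal: "maximal_left_ideal J R"
 unfolding maximal_left_ideal_def
proof (intro conjI allI impI J_left_ideal)
 show "J ~= carrier R" using one_notin_J R.alg.one_closed by blast
 fix I assume I: "left_ideal I R \<and> J \<subseteq> I"
 interpret I: additive_subgroup I R using I by (simp add: left_ideal_def)
 show "I = J \<or> I = carrier R"
 proof (cases "I \<subseteq> J")
  case True
  thus ?thesis using I by blast
 next
  case False
  then obtain f where f: "f \<in> I" "f \<notin> J" by blast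
  have fc: "f \<in>: R" by (rule I.a_Hcarr[OF f(1)])
  interpret KF: field K by (rule A.field)
  obtain c where c: "c \<in>: K" "e (act f w) = A.scal c"
   using gr_A_0[OF e_closed[OF act_closed[OF fc w_closed]]] by blast
  have "c ~= \<zero>\<^sub>K" using J_iff[OF fc] f(2) c Module.module.smult_l_null[OF A.module A.one_closed] by auto
  hence cu: "c \<in> Units K" using c(1) KF.field_Units by blast
  hence ic: "inv\<^bsub>K\<^esub> c \<in>: K" by simp
  let ?g = "inv\<^bsub>K\<^esub> c \<odot>\<^sub>R f"
  have gc: "?g \<in>: R" using ic fc by simp
  have gI: "?g \<in> I" using I f(1) R.smult_conv_left[OF ic fc] ic R.smult_closed[OF ic R.one_closed]
   by (simp add: left_ideal_def)
  have "act ?g w = (A.scal (inv\<^bsub>K\<^esub> c) \<otimes>\<^sub>A A.scal c) \<odot>\<^sub>L w"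
   using act_scalar[OF ic fc w_closed] aug_w[OF fc] c ic w_closed L.smult_assoc by simp
  also have "... = w"
   using A.scal_mult[OF ic c(1)] cu A.scal_one L.smult_one[OF w_closed] by simp
  finally have "act (\<one>\<^sub>R \<ominus>\<^sub>R ?g) w = \<zero>\<^sub>L"
   using act_minus_left[OF R.one_closed gc w_closed] act_one[OF w_closed] L.M.minus_zero_iff[OF w_closed w_closed] by simp
  hence "\<one>\<^sub>R \<ominus>\<^sub>R ?g \<in> I" using I gc by (auto simp: J_def)
  from I.a_closed[OF this gI] have "\<one>\<^sub>R \<in> I" using R.alg.minus_cancel[OF R.one_closed gc] by simp
  thus ?thesis using left_ideal_one I by blast
 qed
qed

theorem jacobson_radical_eq: "jacobson_radical R = J"
proof
 show "jacobson_radical R \<subseteq> J" using J_maximal by (auto simp: jacobson_radical_def)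
 show "J \<subseteq> jacobson_radical R" using J_mem_maximal by (auto simp: jacobson_radical_def J_def)
qed

subsection \<open>Injectivity\<close>

text \<open>The extension of the augmentation from the basis to a map into the algebra that is linear over
 the algebra.\<close>

definition pi :: "'r => 'a" where "pi y = (\<Oplus>\<^sub>A b\<in>B. coord y b \<otimes>\<^sub>A e b)"

lemma eb: "b \<in> B ==> e b \<in> gr A 0" "b \<in> B ==> e b \<in>: A"
 by (rule e_closed[OF LL.Pf.B_closed], assumption) (rule A.cx.V_closed[OF e_closed[OF LL.Pf.B_closed]], assumption)

lemma pi_gr: "y \<in> gr L n ==> pi y \<in> gr A n"
 unfolding pi_def
 by (rule A.cx.V_finsum) (use A.mult_gr[OF coord_gr eb(1), of y n] in auto)

lemma pi_additive: "additive_map L A pi"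
proof (rule additive_mapI)
 show "pi y \<in>: A" if "y \<in>: L" for y
  unfolding pi_def by (rule A.alg.finsum_closed) (use LL.Pf.coord_closed[OF that] eb in auto)
 fix x y assume x: "x \<in>: L" and y: "y \<in>: L"
 have "pi (x \<oplus>\<^sub>L y) = (\<Oplus>\<^sub>A b\<in>B. coord x b \<otimes>\<^sub>A e b \<oplus>\<^sub>A coord y b \<otimes>\<^sub>A e b)"
  unfolding pi_def
  by (rule A.alg.finsum_cong'[OF refl])
   (use LL.Pf.coord_closed[OF x] LL.Pf.coord_closed[OF y] eb LL.Pf.coord_add[OF x y] in \<open>auto simp: A.alg.l_distr\<close>)
 also have "... = pi x \<oplus>\<^sub>A pi y" unfolding pi_def
  by (rule A.alg.finsum_addf) (use LL.Pf.coord_closed[OF x] LL.Pf.coord_closed[OF y] eb in auto)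
 finally show "pi (x \<oplus>\<^sub>L y) = pi x \<oplus>\<^sub>A pi y" .
qed

lemmas pi_closed = additive_map_closed[OF pi_additive] and pi_plus = additive_map_add[OF pi_additive]

lemma pi_smult:
 assumes a: "a \<in>: A" and y: "y \<in>: L"
 shows "pi (a \<odot>\<^sub>L y) = a \<otimes>\<^sub>A pi y"
proof -
 have "pi (a \<odot>\<^sub>L y) = (\<Oplus>\<^sub>A b\<in>B. a \<otimes>\<^sub>A (coord y b \<otimes>\<^sub>A e b))"
  unfolding pi_def
  by (rule A.alg.finsum_cong'[OF refl])
   (use LL.Pf.coord_closed[OF y] eb a LL.Pf.coord_smult[OF a y] in \<open>auto simp: A.alg.m_assoc\<close>)
 also have "... = a \<otimes>\<^sub>A pi y" unfolding pi_def
  by (rule A.alg.finsum_rdistr[symmetric]) (use finite_B a LL.Pf.coord_closed[OF y] eb in auto)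
 finally show ?thesis .
qed

lemma sum_basis: "y \<in>: L ==> (\<Oplus>\<^sub>L b\<in>B. coord y b \<odot>\<^sub>L b) = y"
 by (rule LL.Pf.sum_coord) (use finite_B in auto)

lemma pi_e:
 assumes y: "y \<in> gr L 0"
 shows "pi y = e y"
proof -
 have yc: "y \<in>: L" by (rule L.cx.V_closed[OF y])
 have ea: "additive_map L A e" by (rule additive_mapI) (auto simp: e_plus A.cx.V_closed[OF e_closed])
 have t: "coord y b \<odot>\<^sub>L b \<in>: L" if "b \<in> B" for b
  using L.smult_closed LL.Pf.coord_closed[OF yc that] LL.Pf.B_closed[OF that] by blast
 have "e y = e (\<Oplus>\<^sub>L b\<in>B. coord y b \<odot>\<^sub>L b)" using sum_basis[OF yc] by simp
 also have "... = (\<Oplus>\<^sub>A b\<in>B. e (coord y b \<odot>\<^sub>L b))"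
  by (rule additive_map_finsum[OF L.M.is_ab A.alg.is_ab ea t])
 also have "... = pi y" unfolding pi_def
  by (rule A.alg.finsum_cong'[OF refl])
   (use e_smult_gr[OF coord_gr[OF y]] LL.Pf.B_closed eb LL.Pf.coord_closed[OF yc] in auto)
 finally show ?thesis by simp
qed

lemma pi_w: "pi w = \<one>\<^sub>A" using pi_e[OF w(1)] w(3) by simp

lemma pi_smult_w: "a \<in>: A ==> pi (a \<odot>\<^sub>L w) = a"
 using pi_smult[OF _ w_closed] pi_w by simp

text \<open>The chain endomorphisms that the augmentation turns into the dual basis.\<close>

definition db :: "'r => 'e" where
 "db b = (SOME U. U \<in>: R \<and> (\<forall>b'\<in>B. e (act U b') = (if b' = b then \<one>\<^sub>A else \<zero>\<^sub>A)))"

lemma db: "db b \<in>: R" "b' \<in> B ==> e (act (db b) b') = (if b' = b then \<one>\<^sub>A else \<zero>\<^sub>A)"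
proof -
 have "\<exists>f\<in>E0. \<forall>b'\<in>B. e (f b') = (if b' = b then \<one>\<^sub>A else \<zero>\<^sub>A)"
  by (rule lift_functional) (auto simp: A.one_gr)
 then obtain f where f: "f \<in> E0" "\<forall>b'\<in>B. e (f b') = (if b' = b then \<one>\<^sub>A else \<zero>\<^sub>A)" by blast
 obtain U where U: "U \<in>: R" "\<forall>x\<in>carrier L. act U x = f x" using act_full[OF f(1)] by blast
 have "\<exists>U. U \<in>: R \<and> (\<forall>b'\<in>B. e (act U b') = (if b' = b then \<one>\<^sub>A else \<zero>\<^sub>A))"
  using U f(2) LL.Pf.B_closed by (intro exI[of _ U]) auto
 from someI_ex[OF this] have *: "db b \<in>: R \<and> (\<forall>b'\<in>B. e (act (db b) b') = (if b' = b then \<one>\<^sub>A else \<zero>\<^sub>A))"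
  unfolding db_def .
 thus "db b \<in>: R" "b' \<in> B ==> e (act (db b) b') = (if b' = b then \<one>\<^sub>A else \<zero>\<^sub>A)" by blast+
qed

lemma pi_act:
 assumes U: "U \<in>: R" and y: "y \<in>: L"
 shows "pi (act U y) = (\<Oplus>\<^sub>A b\<in>B. coord y b \<otimes>\<^sub>A e (act U b))"
proof -
 have f: "additive_map L A (%y. pi (act U y))"
  by (rule additive_mapI) (auto simp: act_closed[OF U] act_plus[OF U] pi_closed pi_plus)
 have t: "coord y b \<odot>\<^sub>L b \<in>: L" if "b \<in> B" for b
  using L.smult_closed LL.Pf.coord_closed[OF y that] LL.Pf.B_closed[OF that] by blast
 have "pi (act U y) = pi (act U (\<Oplus>\<^sub>L b\<in>B. coord y b \<odot>\<^sub>L b))" using sum_basis[OF y] by simp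
 also have "... = (\<Oplus>\<^sub>A b\<in>B. pi (act U (coord y b \<odot>\<^sub>L b)))"
  by (rule additive_map_finsum[OF L.M.is_ab A.alg.is_ab f t])
 also have "... = (\<Oplus>\<^sub>A b\<in>B. coord y b \<otimes>\<^sub>A e (act U b))"
 proof (rule A.alg.finsum_cong'[OF refl])
  fix b assume b: "b \<in> B"
  note bc = LL.Pf.B_closed[OF b] and cc = LL.Pf.coord_closed[OF y b]
  show "pi (act U (coord y b \<odot>\<^sub>L b)) = coord y b \<otimes>\<^sub>A e (act U b)"
   unfolding act_smult[OF U cc bc] pi_smult[OF cc act_closed[OF U bc]] pi_e[OF act_gr[OF U basis_gr[OF b]]] ..
 qed (use LL.Pf.coord_closed[OF y] A.cx.V_closed[OF e_closed[OF act_closed[OF U LL.Pf.B_closed]]] in auto)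
 finally show ?thesis .
qed

lemma coord_db:
 assumes y: "y \<in>: L" and b: "b \<in> B"
 shows "pi (act (db b) y) = coord y b"
proof -
 have "pi (act (db b) y) = (\<Oplus>\<^sub>A b'\<in>B. if b' = b then coord y b else \<zero>\<^sub>A)"
  unfolding pi_act[OF db(1) y]
  by (rule A.alg.finsum_cong'[OF refl]) (use LL.Pf.coord_closed[OF y] b in \<open>auto simp: db(2)\<close>)
 also have "... = coord y b"
  using A.alg.finsum_delta[OF finite_B LL.Pf.coord_closed[OF y b], of b] b by simp
 finally show ?thesis .
qed

lemma coord_eqI:
 assumes "x \<in>: L" "y \<in>: L" "!!b. b \<in> B ==> coord x b = coord y b"
 shows "x = y"
proof -
 have "x = (\<Oplus>\<^sub>L b\<in>B. coord x b \<odot>\<^sub>L b)" by (rule sum_basis[OF assms(1), symmetric])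
 also have "... = (\<Oplus>\<^sub>L b\<in>B. coord y b \<odot>\<^sub>L b)"
  by (rule L.M.finsum_cong'[OF refl])
   (use assms(3) L.smult_closed LL.Pf.coord_closed[OF assms(2)] LL.Pf.B_closed in auto)
 also have "... = y" by (rule sum_basis[OF assms(2)])
 finally show ?thesis .
qed

definition coef :: "'e => 'r => 'k" where
 "coef U b = (SOME c. c \<in>: K \<and> e (act U b) = A.scal c)"

lemma coef:
 assumes "U \<in>: R" "b \<in> B"
 shows "coef U b \<in>: K" "A.scal (coef U b) = e (act U b)"
proof -
 have "\<exists>c. c \<in>: K \<and> e (act U b) = A.scal c"
  using gr_A_0[OF e_closed[OF act_closed[OF assms(1) LL.Pf.B_closed[OF assms(2)]]]] by blast
 from someI_ex[OF this] show "coef U b \<in>: K" "A.scal (coef U b) = e (act U b)" unfolding coef_def by auto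
qed

text \<open>An endomorphism is determined by the augmented values on the basis, so that expanding these values
 in the dual basis expands the endomorphism.\<close>

lemma expand:
 assumes U: "U \<in>: R"
 shows "U = (\<Oplus>\<^sub>R b\<in>B. coef U b \<odot>\<^sub>R db b)"
proof -
 let ?S = "\<Oplus>\<^sub>R b\<in>B. coef U b \<odot>\<^sub>R db b"
 have t: "coef U b \<odot>\<^sub>R db b \<in>: R" if "b \<in> B" for b using R.smult_closed[OF coef(1)[OF U that] db(1)] .
 have Sc: "?S \<in>: R" by (rule R.alg.finsum_closed) (use t in auto)
 have "e (act ?S b') = e (act U b')" if b': "b' \<in> B" for b'
 proof -
  have b'c: "b' \<in>: L" by (rule LL.Pf.B_closed[OF b'])
  have f: "additive_map R A (%U. e (act U b'))"
   by (rule additive_mapI) (auto simp: act_add act_closed b'c e_plus A.cx.V_closed[OF e_closed])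
  have "e (act ?S b') = (\<Oplus>\<^sub>A b\<in>B. e (act (coef U b \<odot>\<^sub>R db b) b'))"
   by (rule additive_map_finsum[OF R.alg.is_ab A.alg.is_ab f t])
  also have "... = (\<Oplus>\<^sub>A b\<in>B. if b = b' then e (act U b') else \<zero>\<^sub>A)"
  proof (rule A.alg.finsum_cong'[OF refl])
   fix b assume b: "b \<in> B"
   have ec: "e (act U b) \<in> gr A 0" "e (act U b) \<in>: A"
    using e_closed[OF act_closed[OF U LL.Pf.B_closed[OF b]]] A.cx.V_closed by auto
   have "e (act (coef U b \<odot>\<^sub>R db b) b') = e (e (act U b) \<odot>\<^sub>L act (db b) b')"
    unfolding act_scalar[OF coef(1)[OF U b] db(1) b'c] coef(2)[OF U b] ..
   also have "... = e (act U b) \<otimes>\<^sub>A e (act (db b) b')"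
    using e_smult_gr[OF ec(1) act_closed[OF db(1) b'c]] by simp
   also have "... = (if b = b' then e (act U b') else \<zero>\<^sub>A)" unfolding db(2)[OF b'] using ec by auto
   finally show "e (act (coef U b \<odot>\<^sub>R db b) b') = (if b = b' then e (act U b') else \<zero>\<^sub>A)" .
  qed (use A.cx.V_closed[OF e_closed[OF act_closed[OF U b'c]]] in auto)
  also have "... = e (act U b')"
   using A.alg.finsum_delta[OF finite_B A.cx.V_closed[OF e_closed[OF act_closed[OF U b'c]]], of b'] b' by simp
  finally show ?thesis .
 qed
 from act_eqI[OF U Sc this[symmetric]] show ?thesis .
qed

text \<open>Linear maps over the Ext-algebra into the minimal resolution correspond to linear maps over the
 ground field into the algebra, by composition with \<open>pi\<close>; so they extend from submodules.\<close>

theorem injective_extension: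
 fixes X :: "('e, 'x) dg"
 assumes X: "left_module R X" and U: "additive_subgroup U X"
  and U_smult: "!!r x. r \<in>: R ==> x \<in> U ==> r \<odot>\<^sub>X x \<in> U"
  and f: "!!x. x \<in> U ==> f x \<in> gr L j"
  and f_add: "!!x y. x \<in> U ==> y \<in> U ==> f (x \<oplus>\<^sub>X y) = f x \<oplus>\<^sub>L f y"
  and f_smult: "!!r x. r \<in>: R ==> x \<in> U ==> f (r \<odot>\<^sub>X x) = act r (f x)"
 shows "\<exists>g. (\<forall>x\<in>carrier X. g x \<in> gr L j) \<and> (\<forall>x\<in>carrier X. \<forall>y\<in>carrier X. g (x \<oplus>\<^sub>X y) = g x \<oplus>\<^sub>L g y) \<and>
  (\<forall>r\<in>carrier R. \<forall>x\<in>carrier X. g (r \<odot>\<^sub>X x) = act r (g x)) \<and> (\<forall>x\<in>U. g x = f x)"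
proof -
 interpret X: left_module R X by fact
 interpret U: additive_subgroup U X by fact
 interpret KF: field K by (rule A.field)
 define XK :: "('k, 'x) module" where
  "XK = \<lparr>carrier = carrier X, mult = undefined, one = undefined, zero = zero X, add = add X,
   smult = (%c x. R.scal c \<odot>\<^sub>X x)\<rparr>"
 have XK [simp]: "carrier XK = carrier X" "zero XK = zero X" "add XK = add X" "c \<odot>\<^sub>XK x = R.scal c \<odot>\<^sub>X x" for c x
  by (simp_all add: XK_def)
 have XKm: "Module.module K XK"
 proof (rule moduleI[OF R.K_cring])
  show "abelian_group XK" by (rule abelian_group_cong_structure[OF X.M.is_ab]) simp_all
 qed (simp_all add: X.smult_closed R.scal_add X.smult_l_distr X.smult_r_distr R.scal_mult X.smult_assoc R.scal_one X.smult_one)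
 have Uc: "x \<in>: X" if "x \<in> U" for x using U.a_Hcarr[OF that] .
 have fc: "f x \<in>: L" if "x \<in> U" for x by (rule L.cx.V_closed[OF f[OF that]])
 have UK: "additive_subgroup U XK"
  using U unfolding additive_subgroup_def subgroup_def by (simp add: m_inv_def)
 have "\<exists>g. additive_map XK A g \<and> (\<forall>c\<in>carrier K. \<forall>x\<in>carrier XK. g (c \<odot>\<^sub>XK x) = c \<odot>\<^sub>A g x) \<and> (\<forall>x\<in>U. g x = pi (f x))"
 proof (rule linear_extension[OF A.field XKm A.module UK])
  show "pi (f (c \<odot>\<^sub>XK x)) = c \<odot>\<^sub>A pi (f x)" if c: "c \<in>: K" and x: "x \<in> U" for c x
  proof -
   have sc: "R.scal c \<in>: R" "A.scal c \<in>: A" using c by simp_all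
   have "f (R.scal c \<odot>\<^sub>X x) = A.scal c \<odot>\<^sub>L f x"
    using f_smult[OF sc(1) x] act_scalar[OF c R.one_closed fc[OF x]] act_one[OF fc[OF x]] by simp
   thus ?thesis using pi_smult[OF sc(2) fc[OF x]] A.smult_conv_left[OF c pi_closed[OF fc[OF x]]] by simp
  qed
 qed (simp_all add: U_smult fc f_add pi_closed pi_plus)
 then obtain g0 where g0: "additive_map XK A g0"
  and g0_smult: "!!c x. c \<in>: K ==> x \<in>: X ==> g0 (R.scal c \<odot>\<^sub>X x) = c \<odot>\<^sub>A g0 x"
  and g0_U: "!!x. x \<in> U ==> g0 x = pi (f x)" by auto
 define \<psi> where "\<psi> x = A.cx.comp (g0 x) j" for x
 have g0c: "g0 x \<in>: A" if "x \<in>: X" for x using additive_map_closed[OF g0] that by simp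
 have \<psi>_gr: "\<psi> x \<in> gr A j" if "x \<in>: X" for x unfolding \<psi>_def by (rule A.cx.comp_V[OF g0c[OF that]])
 have \<psi>c: "\<psi> x \<in>: A" if "x \<in>: X" for x by (rule A.cx.V_closed[OF \<psi>_gr[OF that]])
 have \<psi>_add: "\<psi> (x \<oplus>\<^sub>X y) = \<psi> x \<oplus>\<^sub>A \<psi> y" if "x \<in>: X" "y \<in>: X" for x y
  unfolding \<psi>_def using additive_map_add[OF g0, of x y] that A.cx.comp_add[OF g0c[OF that(1)] g0c[OF that(2)]] by simp
 have \<psi>_smult: "\<psi> (R.scal c \<odot>\<^sub>X x) = A.scal c \<otimes>\<^sub>A \<psi> x" if c: "c \<in>: K" and x: "x \<in>: X" for c x
 proof -
  have "A.cx.comp (c \<odot>\<^sub>A g0 x) (j + 0) = c \<odot>\<^sub>A A.cx.comp (g0 x) j"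
   by (rule comp_additive_map[OF A.cx.graded_group_axioms A.cx.graded_group_axioms A.smult_additive[OF c] _ g0c[OF x]])
    (use A.smult_gr[OF c] in simp)
  thus ?thesis unfolding \<psi>_def g0_smult[OF c x]
   using A.smult_conv_left[OF c A.cx.comp_closed[OF g0c[OF x]]] by simp
 qed
 have \<psi>_U: "\<psi> x = pi (f x)" if "x \<in> U" for x
  unfolding \<psi>_def g0_U[OF that] by (rule A.cx.comp_same[OF pi_gr[OF f[OF that]]])
 define g where "g x = (\<Oplus>\<^sub>L b\<in>B. \<psi> (db b \<odot>\<^sub>X x) \<odot>\<^sub>L b)" for x
 have dx: "db b \<odot>\<^sub>X x \<in>: X" if "x \<in>: X" for b x by (rule X.smult_closed[OF db(1) that])
 have tc: "\<psi> (db b \<odot>\<^sub>X x) \<odot>\<^sub>L b \<in> gr L j" if "x \<in>: X" "b \<in> B" for b x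
  using L.smult_gr[OF \<psi>_gr[OF dx[OF that(1)]] basis_gr[OF that(2)]] by simp
 have g_gr: "g x \<in> gr L j" if "x \<in>: X" for x
  unfolding g_def by (rule L.cx.V_finsum) (rule tc[OF that])
 have gc: "g x \<in>: L" if "x \<in>: X" for x by (rule L.cx.V_closed[OF g_gr[OF that]])
 have g_coord: "coord (g x) b = \<psi> (db b \<odot>\<^sub>X x)" if x: "x \<in>: X" and b: "b \<in> B" for x b
  by (rule LL.Pf.coord_eqI[OF finite_B order_refl _ _ g_def b]) (use \<psi>c[OF dx[OF x]] in auto)
 \<comment> \<open>the functional attached to \<open>g x\<close> takes the value \<open>\<psi> (r x)\<close> at every \<open>r\<close>, not only at the dual basis\<close>
 have key: "pi (act r (g x)) = \<psi> (r \<odot>\<^sub>X x)" if r: "r \<in>: R" and x: "x \<in>: X" for r x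
 proof -
  have h: "additive_map R A (%r. \<psi> (r \<odot>\<^sub>X x))"
   by (rule additive_mapI) (auto simp: X.smult_closed x \<psi>c X.smult_l_distr \<psi>_add)
  have t: "coef r b \<odot>\<^sub>R db b \<in>: R" if "b \<in> B" for b using R.smult_closed[OF coef(1)[OF r that] db(1)] .
  have "\<psi> (r \<odot>\<^sub>X x) = \<psi> ((\<Oplus>\<^sub>R b\<in>B. coef r b \<odot>\<^sub>R db b) \<odot>\<^sub>X x)" using expand[OF r] by simp
  also have "... = (\<Oplus>\<^sub>A b\<in>B. \<psi> ((coef r b \<odot>\<^sub>R db b) \<odot>\<^sub>X x))"
   by (rule additive_map_finsum[OF R.alg.is_ab A.alg.is_ab h t])
  also have "... = (\<Oplus>\<^sub>A b\<in>B. coord (g x) b \<otimes>\<^sub>A e (act r b))"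
  proof (rule A.alg.finsum_cong'[OF refl])
   fix b assume b: "b \<in> B"
   note c = coef[OF r b]
   have sc: "R.scal (coef r b) \<in>: R" using c(1) by simp
   have "\<psi> ((coef r b \<odot>\<^sub>R db b) \<odot>\<^sub>X x) = \<psi> (R.scal (coef r b) \<odot>\<^sub>X (db b \<odot>\<^sub>X x))"
    unfolding R.smult_conv_left[OF c(1) db(1)] X.smult_assoc[OF sc db(1) x] ..
   also have "... = A.scal (coef r b) \<otimes>\<^sub>A \<psi> (db b \<odot>\<^sub>X x)" by (rule \<psi>_smult[OF c(1) dx[OF x]])
   also have "... = \<psi> (db b \<odot>\<^sub>X x) \<otimes>\<^sub>A A.scal (coef r b)"
    using A.smult_conv_left[OF c(1) \<psi>c[OF dx[OF x]]] A.smult_conv_right[OF c(1) \<psi>c[OF dx[OF x]]] by simp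
   finally show "\<psi> ((coef r b \<odot>\<^sub>R db b) \<odot>\<^sub>X x) = coord (g x) b \<otimes>\<^sub>A e (act r b)"
    unfolding c(2) g_coord[OF x b] .
  qed (use LL.Pf.coord_closed[OF gc[OF x]] A.cx.V_closed[OF e_closed[OF act_closed[OF r LL.Pf.B_closed]]] in auto)
  also have "... = pi (act r (g x))" by (rule pi_act[OF r gc[OF x], symmetric])
  finally show ?thesis by simp
 qed
 show ?thesis
 proof (intro exI[of _ g] conjI ballI)
  show "g x \<in> gr L j" if "x \<in>: X" for x by (rule g_gr[OF that])
  show "g (x \<oplus>\<^sub>X y) = g x \<oplus>\<^sub>L g y" if x: "x \<in>: X" and y: "y \<in>: X" for x y
  proof (rule coord_eqI)
   show "coord (g (x \<oplus>\<^sub>X y)) b = coord (g x \<oplus>\<^sub>L g y) b" if b: "b \<in> B" for b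
    unfolding LL.Pf.coord_add[OF gc[OF x] gc[OF y] b] g_coord[OF x b] g_coord[OF y b]
     g_coord[OF X.M.a_closed[OF x y] b] X.smult_r_distr[OF db(1) x y] by (rule \<psi>_add[OF dx[OF x] dx[OF y]])
  qed (use gc x y X.M.a_closed[OF x y] in auto)
  show "g (r \<odot>\<^sub>X x) = act r (g x)" if r: "r \<in>: R" and x: "x \<in>: X" for r x
  proof (rule coord_eqI)
   note rx = X.smult_closed[OF r x]
   show "g (r \<odot>\<^sub>X x) \<in>: L" "act r (g x) \<in>: L" using gc[OF rx] act_closed[OF r gc[OF x]] .
   show "coord (g (r \<odot>\<^sub>X x)) b = coord (act r (g x)) b" if b: "b \<in> B" for b
    unfolding g_coord[OF rx b] coord_db[OF act_closed[OF r gc[OF x]] b, symmetric]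
     act_mult[OF db(1) r gc[OF x], symmetric] key[OF R.alg.m_closed[OF db(1) r] x]
     X.smult_assoc[OF db(1) r x] ..
  qed
  show "g x = f x" if x: "x \<in> U" for x
  proof (rule coord_eqI[OF gc[OF Uc[OF x]] fc[OF x]])
   show "coord (g x) b = coord (f x) b" if b: "b \<in> B" for b
    unfolding g_coord[OF Uc[OF x] b] \<psi>_U[OF U_smult[OF db(1) x]] f_smult[OF db(1) x]
    by (rule coord_db[OF fc[OF x] b])
  qed
 qed
qed

end

section \<open>Complexes of modules over an algebra in degree zero\<close>

abbreviation part :: "('a, 'm) dg => int => ('a, 'm) dg" where
 "part X n \<equiv> X\<lparr>carrier := gr X n\<rparr>"

lemma linear_mapsI:
 assumes "!!x. x \<in>: M ==> f x \<in>: N"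
  and "!!x y. x \<in>: M ==> y \<in>: M ==> f (x \<oplus>\<^sub>M y) = f x \<oplus>\<^sub>N f y"
  and "!!a x. a \<in>: R ==> x \<in>: M ==> f (a \<odot>\<^sub>M x) = a \<odot>\<^sub>N f x"
 shows "f \<in> linear_maps R M N"
 using assms by (simp add: linear_maps_def)

lemma linear_mapsD:
 assumes "f \<in> linear_maps R M N"
 shows lin_closed: "x \<in>: M ==> f x \<in>: N"
  and lin_add: "x \<in>: M ==> y \<in>: M ==> f (x \<oplus>\<^sub>M y) = f x \<oplus>\<^sub>N f y"
  and lin_smult: "a \<in>: R ==> x \<in>: M ==> f (a \<odot>\<^sub>M x) = a \<odot>\<^sub>N f x"
 using assms by (auto simp: linear_maps_def)

lemma lin_additive: "f \<in> linear_maps R M N ==> additive_map M N f"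
 by (rule additive_mapI) (auto simp: lin_closed lin_add)

text \<open>A direct summand of a free module inherits the lifting property; on the free module the lift is
 chosen on the standard basis.\<close>

lemma projective_lift:
 fixes X :: "('e, 'x) dg"
 assumes R: "ring R" and X: "projective_module R X" and Xm: "left_module R X" and Y: "left_module R Y" and Z: "left_module R Z"
  and d: "d \<in> linear_maps R Y Z" and f: "f \<in> linear_maps R X Z"
  and onto: "!!x. x \<in>: X ==> \<exists>y\<in>carrier Y. d y = f x"
 shows "\<exists>g\<in>linear_maps R X Y. \<forall>x\<in>carrier X. d (g x) = f x"
proof -
 interpret R: ring R by fact
 interpret X: left_module R X by fact
 interpret Y: left_module R Y by fact
 interpret Z: left_module R Z by fact
 obtain S :: "'x set" and s r where s: "s \<in> linear_maps R X (dsum S (%_. regular R))"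
  and r: "r \<in> linear_maps R (dsum S (%_. regular R)) X" and rs: "\<forall>x\<in>carrier X. r (s x) = x"
  using X unfolding projective_module_def by (elim exE conjE)
 let ?F = "dsum S (%_. regular R)"
 have F: "v \<in>: ?F \<longleftrightarrow> v \<in> extensional S \<and> (\<forall>t\<in>S. v t \<in>: R) \<and> finite {t\<in>S. v t ~= \<zero>\<^sub>R}" for v
  by (auto simp: dsum_def Let_def regular_def PiE_iff)
 have Fadd: "v \<oplus>\<^bsub>?F\<^esub> v' = (\<lambda>t\<in>S. v t \<oplus>\<^sub>R v' t)" and Fsmult: "a \<odot>\<^bsub>?F\<^esub> v = (\<lambda>t\<in>S. a \<otimes>\<^sub>R v t)" for v v' a
  by (simp_all add: dsum_def Let_def regular_def)
 define \<delta> where "\<delta> t = (\<lambda>i\<in>S. if i = t then \<one>\<^sub>R else \<zero>\<^sub>R)" for t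
 have \<delta>: "\<delta> t \<in>: ?F" for t
 proof -
  have "{i\<in>S. \<delta> t i ~= \<zero>\<^sub>R} \<subseteq> {t}" by (auto simp: \<delta>_def)
  from finite_subset[OF this] show ?thesis by (auto simp: F \<delta>_def)
 qed
 define fr where "fr v = f (r v)" for v
 have frc: "fr v \<in>: Z" if "v \<in>: ?F" for v
  unfolding fr_def by (rule lin_closed[OF f lin_closed[OF r that]])
 have fr_add: "fr (v \<oplus>\<^bsub>?F\<^esub> v') = fr v \<oplus>\<^sub>Z fr v'" if "v \<in>: ?F" "v' \<in>: ?F" for v v'
  unfolding fr_def lin_add[OF r that] by (rule lin_add[OF f lin_closed[OF r that(1)] lin_closed[OF r that(2)]])
 have fr_smult: "fr (a \<odot>\<^bsub>?F\<^esub> v) = a \<odot>\<^sub>Z fr v" if "a \<in>: R" "v \<in>: ?F" for a v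
  unfolding fr_def lin_smult[OF r that] by (rule lin_smult[OF f that(1) lin_closed[OF r that(2)]])
 have "\<exists>y. y \<in>: Y \<and> d y = fr (\<delta> t)" for t
  using onto[OF lin_closed[OF r \<delta>[of t]]] unfolding fr_def by blast
 then obtain y where y: "!!t. y t \<in>: Y \<and> d (y t) = fr (\<delta> t)" by metis
 have yc: "y t \<in>: Y" and dy: "d (y t) = fr (\<delta> t)" for t using y by auto
 define G where "G v = (\<Oplus>\<^sub>Y t\<in>{t\<in>S. v t ~= \<zero>\<^sub>R}. v t \<odot>\<^sub>Y y t)" for v
 have tc: "v t \<odot>\<^sub>Y y t \<in>: Y" if "v \<in>: ?F" "t \<in> S" for v t
  using Y.smult_closed[OF _ yc] that by (simp add: F)
 have G: "G v = (\<Oplus>\<^sub>Y t\<in>T. v t \<odot>\<^sub>Y y t)"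
  if v: "v \<in>: ?F" and T: "finite T" "{t\<in>S. v t ~= \<zero>\<^sub>R} \<subseteq> T" "T \<subseteq> S" for v T
  unfolding G_def
 proof (rule Y.M.finsum_superset[OF T(1,2)])
  show "v t \<odot>\<^sub>Y y t \<in>: Y" if "t \<in> T" for t using tc[OF v] T(3) that by blast
  show "v t \<odot>\<^sub>Y y t = \<zero>\<^sub>Y" if "t \<in> T - {t\<in>S. v t ~= \<zero>\<^sub>R}" for t
   using that T(3) Y.smult_zero_left[OF yc] by auto
 qed
 have supp: "finite {t\<in>S. v t ~= \<zero>\<^sub>R}" if "v \<in>: ?F" for v using that by (simp add: F)
 have Gc: "G v \<in>: Y" if v: "v \<in>: ?F" for v
  unfolding G_def by (rule Y.M.finsum_closed) (use tc[OF v] in auto)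
 have G_add: "G (v \<oplus>\<^bsub>?F\<^esub> v') = G v \<oplus>\<^sub>Y G v'" if v: "v \<in>: ?F" "v' \<in>: ?F" for v v'
 proof -
  let ?T = "{t\<in>S. v t ~= \<zero>\<^sub>R} \<union> {t\<in>S. v' t ~= \<zero>\<^sub>R}"
  have T: "finite ?T" using supp v by simp
  have TS: "?T \<subseteq> S" by auto
  have sub: "{t\<in>S. (v \<oplus>\<^bsub>?F\<^esub> v') t ~= \<zero>\<^sub>R} \<subseteq> ?T" by (auto simp: Fadd)
  have vv: "v \<oplus>\<^bsub>?F\<^esub> v' \<in>: ?F"
   using finite_subset[OF sub T] v by (auto simp: F Fadd)
  have "G (v \<oplus>\<^bsub>?F\<^esub> v') = (\<Oplus>\<^sub>Y t\<in>?T. v t \<odot>\<^sub>Y y t \<oplus>\<^sub>Y v' t \<odot>\<^sub>Y y t)"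
   unfolding G[OF vv T sub TS]
   by (rule Y.M.finsum_cong'[OF refl]) (use v tc[OF v(1)] tc[OF v(2)] yc in \<open>auto simp: Fadd F Y.smult_l_distr\<close>)
  also have "... = G v \<oplus>\<^sub>Y G v'"
   using G[OF v(1) T _ TS] G[OF v(2) T _ TS] tc[OF v(1)] tc[OF v(2)] by (subst Y.M.finsum_addf) auto
  finally show ?thesis .
 qed
 have G_smult: "G (a \<odot>\<^bsub>?F\<^esub> v) = a \<odot>\<^sub>Y G v" if a: "a \<in>: R" and v: "v \<in>: ?F" for a v
 proof -
  let ?T = "{t\<in>S. v t ~= \<zero>\<^sub>R}"
  have sub: "{t\<in>S. (a \<odot>\<^bsub>?F\<^esub> v) t ~= \<zero>\<^sub>R} \<subseteq> ?T" using a by (auto simp: Fsmult)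
  have av: "a \<odot>\<^bsub>?F\<^esub> v \<in>: ?F"
   using finite_subset[OF sub supp[OF v]] v a by (auto simp: F Fsmult)
  have "G (a \<odot>\<^bsub>?F\<^esub> v) = (\<Oplus>\<^sub>Y t\<in>?T. a \<odot>\<^sub>Y (v t \<odot>\<^sub>Y y t))"
   unfolding G[OF av supp[OF v] sub, OF Collect_restrict]
   by (rule Y.M.finsum_cong'[OF refl])
    (use v a tc[OF v] yc in \<open>auto simp: Fsmult F Y.smult_assoc Y.smult_closed\<close>)
  also have "... = a \<odot>\<^sub>Y G v" unfolding G_def by (rule Y.smult_finsum_right[OF a, symmetric]) (use tc[OF v] in auto)
  finally show ?thesis .
 qed
 have dG: "\<forall>v\<in>carrier ?F. {t\<in>S. v t ~= \<zero>\<^sub>R} \<subseteq> T \<longrightarrow> fr v = (\<Oplus>\<^sub>Z t\<in>T. v t \<odot>\<^sub>Z fr (\<delta> t))"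
  if "finite T" "T \<subseteq> S" for T
  using that
 proof (induction T rule: finite_induct)
  case empty
  show ?case
  proof (intro ballI impI)
   fix v assume v: "v \<in>: ?F" and "{t\<in>S. v t ~= \<zero>\<^sub>R} \<subseteq> {}"
   hence "v = \<zero>\<^sub>R \<odot>\<^bsub>?F\<^esub> v" by (auto simp: F Fsmult fun_eq_iff extensional_def)
   hence "fr v = \<zero>\<^sub>R \<odot>\<^sub>Z fr v" using fr_smult[OF R.zero_closed v] by simp
   thus "fr v = (\<Oplus>\<^sub>Z t\<in>{}. v t \<odot>\<^sub>Z fr (\<delta> t))" using Z.smult_zero_left[OF frc[OF v]] by simp
  qed
 next
  case (insert t T)
  show ?case
  proof (intro ballI impI)
   fix v assume v: "v \<in>: ?F" and sub: "{t\<in>S. v t ~= \<zero>\<^sub>R} \<subseteq> insert t T"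
   let ?v = "v(t := \<zero>\<^sub>R)"
   have tS: "t \<in> S" and TS: "T \<subseteq> S" using insert.prems by auto
   have vt: "v t' \<in>: R" if "t' \<in> S" for t' using v that by (simp add: F)
   have "{i\<in>S. ?v i ~= \<zero>\<^sub>R} \<subseteq> {t\<in>S. v t ~= \<zero>\<^sub>R}" by auto
   from finite_subset[OF this supp[OF v]] have v': "?v \<in>: ?F" using v tS by (auto simp: F extensional_def)
   have sub': "{i\<in>S. ?v i ~= \<zero>\<^sub>R} \<subseteq> T" using sub by auto
   have "{i\<in>S. (v t \<odot>\<^bsub>?F\<^esub> \<delta> t) i ~= \<zero>\<^sub>R} \<subseteq> {t}" using vt[OF tS] by (auto simp: \<delta>_def Fsmult)
   from finite_subset[OF this] have d': "v t \<odot>\<^bsub>?F\<^esub> \<delta> t \<in>: ?F" using vt[OF tS] by (auto simp: F Fsmult \<delta>_def)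
   have zc: "v i \<odot>\<^sub>Z fr (\<delta> i) \<in>: Z" if "i \<in> insert t T" for i
    by (rule Z.smult_closed[OF vt frc[OF \<delta>]]) (use that tS TS in blast)
   have "v = ?v \<oplus>\<^bsub>?F\<^esub> v t \<odot>\<^bsub>?F\<^esub> \<delta> t"
    using v vt tS by (auto simp: fun_eq_iff Fadd Fsmult \<delta>_def F extensional_def)
   hence "fr v = fr ?v \<oplus>\<^sub>Z v t \<odot>\<^sub>Z fr (\<delta> t)"
    using fr_add[OF v' d'] fr_smult[OF vt[OF tS] \<delta>] by simp
   also have "fr ?v = (\<Oplus>\<^sub>Z i\<in>T. ?v i \<odot>\<^sub>Z fr (\<delta> i))" using insert.IH[OF TS] v' sub' by blast
   also have "... = (\<Oplus>\<^sub>Z i\<in>T. v i \<odot>\<^sub>Z fr (\<delta> i))"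
    by (rule Z.M.finsum_cong'[OF refl]) (use zc insert.hyps(2) in auto)
   also have "... \<oplus>\<^sub>Z v t \<odot>\<^sub>Z fr (\<delta> t) = (\<Oplus>\<^sub>Z i\<in>insert t T. v i \<odot>\<^sub>Z fr (\<delta> i))"
    using insert.hyps zc by (subst Z.M.finsum_insert) (auto simp: Z.M.a_comm)
   finally show "fr v = (\<Oplus>\<^sub>Z i\<in>insert t T. v i \<odot>\<^sub>Z fr (\<delta> i))" .
  qed
 qed
 have dGv: "d (G v) = fr v" if v: "v \<in>: ?F" for v
 proof -
  have "d (G v) = (\<Oplus>\<^sub>Z t\<in>{t\<in>S. v t ~= \<zero>\<^sub>R}. d (v t \<odot>\<^sub>Y y t))"
   unfolding G_def
   by (rule additive_map_finsum[OF Y.M.is_ab Z.M.is_ab lin_additive[OF d]]) (use tc[OF v] in auto)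
  also have "... = (\<Oplus>\<^sub>Z t\<in>{t\<in>S. v t ~= \<zero>\<^sub>R}. v t \<odot>\<^sub>Z fr (\<delta> t))"
   by (rule Z.M.finsum_cong'[OF refl])
    (use v Z.smult_closed[OF _ frc[OF \<delta>]] lin_smult[OF d _ yc] dy in \<open>auto simp: F\<close>)
  also have "... = fr v" using dG[OF supp[OF v], OF Collect_restrict] v by simp
  finally show ?thesis .
 qed
 show ?thesis
 proof (intro bexI[of _ "%x. G (s x)"] ballI linear_mapsI)
  note sc = lin_closed[OF s]
  show "d (G (s x)) = f x" if "x \<in>: X" for x using dGv[OF sc[OF that]] rs that by (simp add: fr_def)
  show "G (s x) \<in>: Y" if "x \<in>: X" for x by (rule Gc[OF sc[OF that]])
  show "G (s (x \<oplus>\<^sub>X x')) = G (s x) \<oplus>\<^sub>Y G (s x')" if "x \<in>: X" "x' \<in>: X" for x x'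
   unfolding lin_add[OF s that] by (rule G_add[OF sc[OF that(1)] sc[OF that(2)]])
  show "G (s (a \<odot>\<^sub>X x)) = a \<odot>\<^sub>Y G (s x)" if "a \<in>: R" "x \<in>: X" for a x
   unfolding lin_smult[OF s that] by (rule G_smult[OF that(1) sc[OF that(2)]])
 qed
qed

locale concentrated_algebra = R: dg_algebra K R
 for K :: "('k, 'c) ring_scheme" and R :: "('k, 'e) dg" +
 assumes R_gr: "gr R n = (if n = 0 then carrier R else {\<zero>\<^sub>R})" and R_dif: "dif R U = \<zero>\<^sub>R"
begin

lemma part_module:
 assumes "left_dg_module R X"
 shows "left_module R (part X n)"
proof -
 interpret X: left_dg_module R X by fact
 have sm: "a \<odot>\<^sub>X x \<in> gr X n" if "a \<in>: R" "x \<in> gr X n" for a x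
  using X.smult_gr[of a 0 x n] that by (simp add: R_gr)
 have ab: "abelian_group (part X n)"
 proof (rule abelian_groupI)
  show "\<exists>y\<in>carrier (part X n). y \<oplus>\<^bsub>part X n\<^esub> x = \<zero>\<^bsub>part X n\<^esub>" if "x \<in>: (part X n)" for x
   using that X.cx.V_closed[of x n] by (intro bexI[of _ "\<ominus>\<^sub>X x"]) (auto simp: X.M.l_neg)
 qed (use X.cx.V_closed[of _ n] in \<open>auto simp: X.M.a_ac\<close>)
 show ?thesis
  by (intro left_module.intro left_module_axioms.intro R.ring ab)
   (use sm X.cx.V_closed[of _ n] in \<open>auto simp: X.smult_l_distr X.smult_r_distr X.smult_assoc X.smult_one\<close>)
qed

lemma smult_part:
 assumes "left_dg_module R X" "a \<in>: R" "x \<in> gr X n"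
 shows "a \<odot>\<^sub>X x \<in> gr X n"
 using left_module.smult_closed[OF part_module[OF assms(1)], of a x] assms by simp

lemma dif_linear:
 assumes "left_dg_module R X" "a \<in>: R" "x \<in>: X"
 shows "dif X (a \<odot>\<^sub>X x) = a \<odot>\<^sub>X dif X x"
proof -
 interpret X: left_dg_module R X by fact
 show ?thesis
  using X.leibniz[of a 0 x] assms X.smult_zero_left[OF assms(3)] X.smult_closed[OF assms(2) X.cx.dif_closed[OF assms(3)]]
  by (simp add: R_gr R_dif sgn_pow_def)
qed

lemma dif_part:
 assumes "left_dg_module R X"
 shows "dif X \<in> linear_maps R (part X n) (part X (n + 1))"
proof -
 interpret X: left_dg_module R X by fact
 show ?thesis
  by (rule linear_mapsI) (use X.cx.V_closed[of _ n] in \<open>auto simp: dif_linear[OF assms] X.dif_gr X.cx.dif_add\<close>)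
qed

lemma hom_act:
 "f \<in> hom_deg R X Y n ==> a \<in>: R ==> x \<in>: X ==> f (a \<odot>\<^sub>X x) = a \<odot>\<^sub>Y f x"
 using hom_smult[of f R X Y n a 0 x] by (simp add: R_gr sgn_pow_def)

lemma hom_part:
 assumes "left_dg_module R X" "f \<in> hom_deg R X Y n"
 shows "f \<in> linear_maps R (part X i) (part Y (i + n))"
proof -
 interpret X: left_dg_module R X by fact
 show ?thesis
  by (rule linear_mapsI)
   (use X.cx.V_closed[of _ i] in \<open>auto simp: hom_act[OF assms(2)] hom_gr[OF assms(2)] hom_add[OF assms(2)]\<close>)
qed

lemma hom_degI_linear:
 assumes X: "left_dg_module R X" and Y: "left_dg_module R Y"
  and ext: "f \<in> extensional (carrier X)" and add: "additive_map X Y f"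
  and deg: "!!i x. x \<in> gr X i ==> f x \<in> gr Y (i + n)"
  and lin: "!!a x. a \<in>: R ==> x \<in>: X ==> f (a \<odot>\<^sub>X x) = a \<odot>\<^sub>Y f x"
 shows "f \<in> hom_deg R X Y n"
proof (rule hom_degI[OF ext additive_map_closed[OF add] additive_map_add[OF add] deg])
 interpret X: left_dg_module R X by fact
 interpret Y: left_dg_module R Y by fact
 fix i a x assume a: "a \<in> gr R i" and x: "x \<in>: X"
 note fx = additive_map_closed[OF add x]
 show "f (a \<odot>\<^sub>X x) = sgn_pow Y (n * i) (a \<odot>\<^sub>Y f x)"
 proof (cases "i = 0")
  case True
  thus ?thesis using a lin[OF _ x] by (simp add: R_gr sgn_pow_def)
 next
  case False
  hence "a = \<zero>\<^sub>R" using a by (simp add: R_gr)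
  thus ?thesis using lin[OF R.alg.zero_closed x] Y.smult_zero_left[OF fx] by simp
 qed
qed

lemma hom_glue:
 assumes X: "left_dg_module R X" and Y: "left_dg_module R Y"
  and k: "!!i. k i \<in> linear_maps R (part X i) (part Y (i + n))"
 shows "\<exists>f\<in>hom_deg R X Y n. \<forall>i. \<forall>x\<in>gr X i. f x = k i x"
proof -
 interpret X: left_dg_module R X by fact
 interpret Y: left_dg_module R Y by fact
 have kg: "k i x \<in> gr Y (i + n)" if "x \<in> gr X i" for i x using lin_closed[OF k] that by simp
 have kc: "k i x \<in>: Y" if "x \<in> gr X i" for i x by (rule Y.cx.V_closed[OF kg[OF that]])
 have "\<exists>f. additive_map X Y f \<and> (\<forall>i. \<forall>x\<in>gr X i. f x = k i x)"
 proof (rule X.cx.glue[OF Y.M.is_ab kc])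
  show "k i (x \<oplus>\<^sub>X y) = k i x \<oplus>\<^sub>Y k i y" if "x \<in> gr X i" "y \<in> gr X i" for i x y
   using lin_add[OF k[of i], of x y] that by simp
 qed
 then obtain f where f: "additive_map X Y f" and fk: "!!i x. x \<in> gr X i ==> f x = k i x" by blast
 have lin: "f (a \<odot>\<^sub>X x) = a \<odot>\<^sub>Y f x" if a: "a \<in>: R" and "x \<in>: X" for a x
  using that(2)
 proof (induction rule: X.cx.graded_induct)
  case (homogeneous i x)
  show ?case unfolding fk[OF homogeneous] fk[OF smult_part[OF X a homogeneous]]
   using lin_smult[OF k a, of x] homogeneous by simp
 next
  case (add x y)
  thus ?case
   using a additive_map_closed[OF f] X.smult_closed[OF a]
   by (simp add: X.smult_r_distr Y.smult_r_distr additive_map_add[OF f])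
 qed
 let ?f = "\<lambda>x\<in>carrier X. f x"
 have fk': "?f x = k i x" if "x \<in> gr X i" for i x using fk[OF that] X.cx.V_closed[OF that] by simp
 have "?f \<in> hom_deg R X Y n"
 proof (rule hom_degI_linear[OF X Y])
  show "additive_map X Y ?f"
   by (rule additive_mapI) (auto simp: additive_map_closed[OF f] additive_map_add[OF f])
 qed (use fk' kg lin X.smult_closed in auto)
 thus ?thesis using fk' by blast
qed

lemma zero_linear: "left_dg_module R Y ==> (%_. \<zero>\<^sub>Y) \<in> linear_maps R (part X i) (part Y j)"
proof -
 assume "left_dg_module R Y"
 then interpret Y: left_dg_module R Y .
 show ?thesis by (rule linear_mapsI) (auto simp: Y.smult_zero_right)
qed

lemma sgn_linear:
 assumes X: "left_dg_module R X" and f: "f \<in> linear_maps R M (part X j)"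
 shows "(%x. sgn_pow X n (f x)) \<in> linear_maps R M (part X j)"
proof -
 interpret X: left_dg_module R X by fact
 have fg: "f x \<in> gr X j" if "x \<in>: M" for x using lin_closed[OF f that] by simp
 note fc = X.cx.V_closed[OF fg]
 show ?thesis
  by (rule linear_mapsI)
   (use fg fc lin_add[OF f] lin_smult[OF f] in \<open>auto simp: X.cx.V_sgn X.M.sgn_add X.smult_sgn_right\<close>)
qed

lemma add_linear:
 assumes X: "left_dg_module R X" and f: "f \<in> linear_maps R M (part X j)" and g: "g \<in> linear_maps R M (part X j)"
 shows "(%x. f x \<oplus>\<^sub>X g x) \<in> linear_maps R M (part X j)"
proof -
 interpret X: left_dg_module R X by fact
 have fg: "f x \<in> gr X j" "g x \<in> gr X j" if "x \<in>: M" for x using lin_closed[OF f that] lin_closed[OF g that] by simp_all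
 note c = X.cx.V_closed[OF fg(1)] X.cx.V_closed[OF fg(2)]
 show ?thesis
  by (rule linear_mapsI)
   (use fg c lin_add[OF f] lin_smult[OF f] lin_add[OF g] lin_smult[OF g] in \<open>auto simp: X.M.a_ac X.smult_r_distr\<close>)
qed

lemma comp_linear:
 "g \<in> linear_maps R M N ==> f \<in> linear_maps R N T ==> (%x. f (g x)) \<in> linear_maps R M T"
 by (rule linear_mapsI) (auto simp: lin_closed lin_add lin_smult)

text \<open>The induction starts in degree \<open>0\<close> and descends: projectivity lifts one degree at a time.\<close>

theorem hom_acyclic:
 fixes Q :: "('e, 'q) dg" and C :: "('e, 'y) dg"
 assumes Q: "left_dg_module R Q" and Q_pos: "!!i. i > 0 ==> gr Q i = {\<zero>\<^sub>Q}"
  and Q_proj: "!!i. projective_module R (part Q i)"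
  and C: "left_dg_module R C"
  and acyclic: "!!j y. y \<in> gr C j ==> dif C y = \<zero>\<^sub>C ==> \<exists>z\<in>gr C (j - 1). dif C z = y"
  and \<phi>: "\<phi> \<in> hom_deg R Q C n" and D\<phi>: "!!x. x \<in>: Q ==> hom_dif Q C n \<phi> x = \<zero>\<^sub>C"
 shows "\<exists>k\<in>hom_deg R Q C (n - 1). \<forall>x\<in>carrier Q. hom_dif Q C (n - 1) k x = \<phi> x"
proof -
 interpret Q: left_dg_module R Q by fact
 interpret C: left_dg_module R C by fact
 interpret QC: hom_complex R Q C by unfold_locales
 have \<phi>_dif: "dif C (\<phi> x) = sgn_pow C n (\<phi> (dif Q x))" if x: "x \<in>: Q" for x
  using D\<phi>[OF x] C.M.minus_zero_iff[of "dif C (\<phi> x)" "sgn_pow C n (\<phi> (dif Q x))"] x hom_closed[OF \<phi>]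
  by (simp add: QC.D_apply)
 define ok where "ok t k \<longleftrightarrow> k \<in> linear_maps R (part Q (1 - int t)) (part C (n - int t)) \<and>
   (\<forall>x\<in>gr Q (1 - int t). dif Q x = \<zero>\<^sub>Q \<longrightarrow> dif C (k x) = \<phi> x)" for t k
 define ext where "ext t k k' \<longleftrightarrow> (\<forall>x\<in>gr Q (- int t). dif C (k' x) = \<phi> x \<oplus>\<^sub>C sgn_pow C (n - 1) (k (dif Q x)))"
  for t :: nat and k k' :: "'q => 'y"
 have "\<exists>k. \<forall>t. ok t (k t) \<and> ext t (k t) (k (Suc t))"
 proof (rule dependent_nat_choice)
  have "ok 0 (%_. \<zero>\<^sub>C)"
   unfolding ok_def using zero_linear[OF C, of Q 1 n] Q_pos[of 1] QC.hom_zero[OF \<phi>] by simp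
  thus "\<exists>k. ok 0 k" by blast
  fix k t assume k: "ok t k"
  have kl: "k \<in> linear_maps R (part Q (- int t + 1)) (part C (n - int t))" using k by (simp add: ok_def add.commute)
  have kd: "dif C (k x) = \<phi> x" if "x \<in> gr Q (- int t + 1)" "dif Q x = \<zero>\<^sub>Q" for x
   using k that by (simp add: ok_def add.commute)
  let ?f = "%x. \<phi> x \<oplus>\<^sub>C sgn_pow C (n - 1) (k (dif Q x))"
  have fl: "?f \<in> linear_maps R (part Q (- int t)) (part C (n - int t))"
   using add_linear[OF C hom_part[OF Q \<phi>, of "- int t"]
     sgn_linear[OF C comp_linear[OF dif_part[OF Q, of "- int t"]], of k "- int t + n" "n - 1"]] kl
   by (simp add: add.commute)
  have "\<exists>k'\<in>linear_maps R (part Q (- int t)) (part C (n - int t - 1)). \<forall>x\<in>carrier (part Q (- int t)). dif C (k' x) = ?f x"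
  proof (rule projective_lift[OF R.ring Q_proj part_module[OF Q] part_module[OF C] part_module[OF C] _ fl])
   show "dif C \<in> linear_maps R (part C (n - int t - 1)) (part C (n - int t))"
    using dif_part[OF C, of "n - int t - 1"] by simp
   fix x assume "x \<in> carrier (part Q (- int t))"
   hence x: "x \<in> gr Q (- int t)" by simp
   note xc = Q.cx.V_closed[OF x] and dx = Q.dif_gr[OF x]
   have c: "\<phi> x \<in>: C" "\<phi> (dif Q x) \<in>: C" "k (dif Q x) \<in>: C"
    using hom_closed[OF \<phi>] xc C.cx.V_closed[of "k (dif Q x)" "n - int t"] lin_closed[OF kl, of "dif Q x"] dx by simp_all
   have "dif C (?f x) = sgn_pow C n (\<phi> (dif Q x)) \<oplus>\<^sub>C sgn_pow C (n - 1) (\<phi> (dif Q x))"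
    using c \<phi>_dif[OF xc] kd[OF dx Q.dif_dif[OF xc]] by (simp add: C.cx.dif_add C.cx.dif_sgn)
   also have "... = \<zero>\<^sub>C" using c by (simp add: sgn_pow_def C.M.r_neg C.M.l_neg)
   finally have "dif C (?f x) = \<zero>\<^sub>C" .
   from acyclic[OF _ this] show "\<exists>y\<in>carrier (part C (n - int t - 1)). dif C y = ?f x"
    using lin_closed[OF fl, of x] x by simp
  qed
  then obtain k' where k': "k' \<in> linear_maps R (part Q (- int t)) (part C (n - int t - 1))"
   and dk': "!!x. x \<in> gr Q (- int t) ==> dif C (k' x) = ?f x" by auto
  have k0: "k \<zero>\<^sub>Q = \<zero>\<^sub>C"
   using additive_map_zero[OF left_module.axioms(2)[OF part_module[OF Q]] left_module.axioms(2)[OF part_module[OF C]]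
     lin_additive[OF kl]] by simp
  have "dif C (k' x) = \<phi> x" if x: "x \<in> gr Q (- int t)" and dx: "dif Q x = \<zero>\<^sub>Q" for x
   using dk'[OF x] dx k0 hom_closed[OF \<phi> Q.cx.V_closed[OF x]] by simp
  hence "ok (Suc t) k'" unfolding ok_def using k' by (simp add: algebra_simps)
  moreover have "ext t k k'" unfolding ext_def using dk' by blast
  ultimately show "\<exists>k'. ok (Suc t) k' \<and> ext t k k'" by blast
 qed
 then obtain k where ok: "!!t. ok t (k t)" and ext: "!!t. ext t (k t) (k (Suc t))" by blast
 define \<kappa> where "\<kappa> i = (if i \<le> 1 then k (nat (1 - i)) else (%_. \<zero>\<^sub>C))" for i
 have \<kappa>: "\<kappa> i \<in> linear_maps R (part Q i) (part C (i + (n - 1)))" for i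
 proof (cases "i \<le> 1")
  case True
  hence e: "1 - int (nat (1 - i)) = i" "n - int (nat (1 - i)) = i + (n - 1)" by simp_all
  have "k (nat (1 - i)) \<in> linear_maps R (part Q i) (part C (i + (n - 1)))"
   using ok[of "nat (1 - i)"] unfolding ok_def e by (rule conjunct1)
  thus ?thesis using True by (simp add: \<kappa>_def)
 next
  case False
  thus ?thesis using zero_linear[OF C] by (simp add: \<kappa>_def)
 qed
 obtain h where h: "h \<in> hom_deg R Q C (n - 1)" and hk: "\<forall>i. \<forall>x\<in>gr Q i. h x = \<kappa> i x"
  using hom_glue[OF Q C \<kappa>] by blast
 have "hom_dif Q C (n - 1) h = \<phi>"
 proof (rule QC.hom_eq_homogeneous[OF QC.D_V[OF h] \<phi>])
  fix i x assume x: "x \<in> gr Q i"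
  note xc = Q.cx.V_closed[OF x] and dx = Q.dif_gr[OF x]
  show "hom_dif Q C (n - 1) h x = \<phi> x"
  proof (cases "i > 0")
   case True
   hence "x = \<zero>\<^sub>Q" using Q_pos x by simp
   thus ?thesis using QC.hom_zero[OF \<phi>] QC.hom_zero[OF QC.D_V[OF h]] by simp
  next
   case False
   define t where "t = nat (- i)"
   have i: "i = - int t" using False by (simp add: t_def)
   have "h x = k (Suc t) x" "h (dif Q x) = k t (dif Q x)"
    using hk x dx i by (simp_all add: \<kappa>_def nat_add_distrib)
   moreover have "dif C (k (Suc t) x) = \<phi> x \<oplus>\<^sub>C sgn_pow C (n - 1) (k t (dif Q x))"
    using ext[of t] x i by (simp add: ext_def)
   ultimately show ?thesis
    using xc hom_closed[OF \<phi> xc] hom_closed[OF h, of "dif Q x"] C.M.sgn_closed[of "h (dif Q x)" "n - 1"]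
    by (simp add: QC.D_apply a_minus_def C.M.a_assoc C.M.r_neg)
  qed
 qed
 thus ?thesis using h by blast
qed

end

section \<open>Mapping cones\<close>

text \<open>The sign in the first component makes the differential square to zero.\<close>

definition cone :: "('a, 'm) dg => ('a, 'n) dg => ('m => 'n) => ('a, 'm \<times> 'n) dg" where
 "cone M N f =
  \<lparr>carrier = carrier M \<times> carrier N, mult = undefined, one = undefined, zero = (\<zero>\<^sub>M, \<zero>\<^sub>N),
   add = (%x y. (fst x \<oplus>\<^sub>M fst y, snd x \<oplus>\<^sub>N snd y)),
   smult = (%a x. (a \<odot>\<^sub>M fst x, a \<odot>\<^sub>N snd x)),
   gr = (%n. gr M (n + 1) \<times> gr N n),
   dif = (%x. (\<ominus>\<^sub>M dif M (fst x), f (fst x) \<oplus>\<^sub>N dif N (snd x)))\<rparr>"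

lemma cone_simps:
 "carrier (cone M N f) = carrier M \<times> carrier N" "\<zero>\<^bsub>cone M N f\<^esub> = (\<zero>\<^sub>M, \<zero>\<^sub>N)"
 "x \<oplus>\<^bsub>cone M N f\<^esub> y = (fst x \<oplus>\<^sub>M fst y, snd x \<oplus>\<^sub>N snd y)"
 "a \<odot>\<^bsub>cone M N f\<^esub> x = (a \<odot>\<^sub>M fst x, a \<odot>\<^sub>N snd x)"
 "gr (cone M N f) n = gr M (n + 1) \<times> gr N n"
 "dif (cone M N f) x = (\<ominus>\<^sub>M dif M (fst x), f (fst x) \<oplus>\<^sub>N dif N (snd x))"
 by (simp_all add: cone_def)

context concentrated_algebra
begin

lemma cone_dg_module:
 assumes M: "left_dg_module R M" and N: "left_dg_module R N" and f: "chain_map R M N f"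
 shows "left_dg_module R (cone M N f)"
proof -
 interpret M: left_dg_module R M by fact
 interpret N: left_dg_module R N by fact
 let ?C = "cone M N f"
 note fh = chain_hom[OF f]
 note fc = hom_closed[OF fh]
 have ab: "abelian_group ?C"
 proof (rule abelian_groupI)
  show "\<exists>y\<in>carrier ?C. y \<oplus>\<^bsub>?C\<^esub> x = \<zero>\<^bsub>?C\<^esub>" if "x \<in>: ?C" for x
   using that by (intro bexI[of _ "(\<ominus>\<^sub>M fst x, \<ominus>\<^sub>N snd x)"]) (auto simp: cone_simps M.M.l_neg N.M.l_neg)
 qed (auto simp: cone_simps M.M.a_ac N.M.a_ac)
 interpret C: abelian_group ?C by (rule ab)
 have inv: "\<ominus>\<^bsub>?C\<^esub> x = (\<ominus>\<^sub>M fst x, \<ominus>\<^sub>N snd x)" if "x \<in>: ?C" for x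
  by (rule C.minus_equality) (use that in \<open>auto simp: cone_simps M.M.l_neg N.M.l_neg\<close>)
 have fst: "additive_map ?C M fst" and snd: "additive_map ?C N snd"
  by (rule additive_mapI; auto simp: cone_simps)+
 have graded: "graded_by ?C (gr ?C)"
 proof (rule graded_byI[OF ab, where p = "%n x. (M.cx.comp (fst x) (n + 1), N.cx.comp (snd x) n)"])
  show "subgroup (gr ?C n) (add_monoid ?C)" for n
   by (rule C.add_subgroupI)
    (auto simp: cone_simps inv M.cx.V_closed N.cx.V_closed)
  show "additive_map ?C ?C (%x. (M.cx.comp (fst x) (n + 1), N.cx.comp (snd x) n))" for n
   by (rule additive_mapI) (auto simp: cone_simps M.cx.comp_add N.cx.comp_add)
  show "(M.cx.comp (fst x) (n + 1), N.cx.comp (snd x) n) = (if n = m then x else \<zero>\<^bsub>?C\<^esub>)" if "x \<in> gr ?C m" for m n x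
   using that M.cx.comp_V_eq[of "fst x" "m + 1" "n + 1"] N.cx.comp_V_eq[of "snd x" m n]
   by (auto simp: cone_simps)
  show "\<exists>c. is_decomp ?C (gr ?C) x c" if x: "x \<in>: ?C" for x
  proof -
   have xc: "fst x \<in>: M" "snd x \<in>: N" using x by (auto simp: cone_simps)
   let ?A = "{n. M.cx.comp (fst x) n ~= \<zero>\<^sub>M}" and ?B = "{n. N.cx.comp (snd x) n ~= \<zero>\<^sub>N}"
   let ?S = "(%n. n - 1) ` ?A \<union> ?B"
   let ?c = "%n. (M.cx.comp (fst x) (n + 1), N.cx.comp (snd x) n)"
   have S: "finite ?S" using M.cx.finite_comp[OF xc(1)] N.cx.finite_comp[OF xc(2)] by simp
   have AS: "?A \<subseteq> (%n. n + 1) ` ?S"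
   proof
    fix n assume "n \<in> ?A"
    hence "n - 1 \<in> ?S" by blast
    thus "n \<in> (%n. n + 1) ` ?S" by (rule rev_image_eqI) simp
   qed
   have cc: "?c n \<in>: ?C" for n using xc by (simp add: cone_simps)
   have "fst (\<Oplus>\<^bsub>?C\<^esub>n\<in>?S. ?c n) = (\<Oplus>\<^sub>M n\<in>?S. M.cx.comp (fst x) (n + 1))"
    using additive_map_finsum[OF ab M.M.is_ab fst, of ?S ?c] cc by simp
   also have "... = (\<Oplus>\<^sub>M n\<in>(%n. n + 1) ` ?S. M.cx.comp (fst x) n)"
    by (rule M.M.finsum_reindex[symmetric]) (use xc in \<open>auto simp: inj_on_def\<close>)
   also have "... = fst x" by (rule M.cx.sum_comp_superset[OF xc(1) finite_imageI[OF S] AS])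
   finally have 1: "fst (\<Oplus>\<^bsub>?C\<^esub>n\<in>?S. ?c n) = fst x" .
   have "snd (\<Oplus>\<^bsub>?C\<^esub>n\<in>?S. ?c n) = (\<Oplus>\<^sub>N n\<in>?S. N.cx.comp (snd x) n)"
    using additive_map_finsum[OF ab N.M.is_ab snd, of ?S ?c] cc by simp
   also have "... = snd x" by (rule N.cx.sum_comp_superset[OF xc(2) S]) blast
   finally have "x = (\<Oplus>\<^bsub>?C\<^esub>n\<in>?S. ?c n)" using 1 by (simp add: prod_eq_iff)
   moreover have "{n. ?c n ~= \<zero>\<^bsub>?C\<^esub>} \<subseteq> ?S"
   proof
    fix n assume "n \<in> {n. ?c n ~= \<zero>\<^bsub>?C\<^esub>}"
    hence "n + 1 \<in> ?A \<or> n \<in> ?B" by (auto simp: cone_simps)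
    thus "n \<in> ?S" using image_eqI[of n "%n. n - 1" "n + 1" ?A] by auto
   qed
   moreover have "(\<Oplus>\<^bsub>?C\<^esub>n\<in>{n. ?c n ~= \<zero>\<^bsub>?C\<^esub>}. ?c n) = (\<Oplus>\<^bsub>?C\<^esub>n\<in>?S. ?c n)"
    by (rule C.finsum_superset[OF S calculation(2)]) (use cc in auto)
   ultimately show ?thesis
    using finite_subset[OF _ S] xc by (intro exI[of _ ?c]) (simp add: is_decomp_def cone_simps(5))
  qed
 qed
 have lm: "left_module R ?C"
  by (intro left_module.intro left_module_axioms.intro R.ring ab)
   (auto simp: cone_simps M.smult_closed N.smult_closed M.smult_l_distr N.smult_l_distr
     M.smult_r_distr N.smult_r_distr M.smult_assoc N.smult_assoc M.smult_one N.smult_one)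
 interpret LC: left_module R ?C by (rule lm)
 have dc: "dif ?C x \<in>: ?C" if "x \<in>: ?C" for x
  using that fc by (auto simp: cone_simps)
 show ?thesis
 proof (intro left_dg_module.intro left_dg_module_axioms.intro lm graded)
  show "a \<odot>\<^bsub>?C\<^esub> x \<in> gr ?C (i + j)" if "a \<in> gr R i" "x \<in> gr ?C j" for a x i j
   using that M.smult_gr[of a i "fst x" "j + 1"] N.smult_gr[of a i "snd x" j] by (auto simp: cone_simps add.assoc)
  show "dif ?C x \<in> gr ?C (n + 1)" if "x \<in> gr ?C n" for x n
   using that M.dif_gr[of "fst x" "n + 1"] N.dif_gr[of "snd x" n] hom_gr[OF fh, of "fst x" "n + 1"]
   by (auto simp: cone_simps)
  show "dif ?C (x \<oplus>\<^bsub>?C\<^esub> y) = dif ?C x \<oplus>\<^bsub>?C\<^esub> dif ?C y" if "x \<in>: ?C" "y \<in>: ?C" for x y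
   using that fc hom_add[OF fh]
   by (auto simp: cone_simps M.cx.dif_add N.cx.dif_add M.M.minus_add N.M.a_ac)
  show "dif ?C (dif ?C x) = \<zero>\<^bsub>?C\<^esub>" if "x \<in>: ?C" for x
  proof -
   have xc: "fst x \<in>: M" "snd x \<in>: N" using that by (auto simp: cone_simps)
   have "f (\<ominus>\<^sub>M dif M (fst x)) = \<ominus>\<^sub>N dif N (f (fst x))"
    using additive_map_inv[OF M.M.is_ab N.M.is_ab hom_additive[OF fh], of "dif M (fst x)"]
     chain_dif[OF f xc(1)] xc by simp
   thus ?thesis using xc fc
    by (simp add: cone_simps M.cx.dif_inv M.dif_dif N.cx.dif_add N.dif_dif N.M.l_neg)
  qed
  show "dif ?C (a \<odot>\<^bsub>?C\<^esub> x) = dif R a \<odot>\<^bsub>?C\<^esub> x \<oplus>\<^bsub>?C\<^esub> sgn_pow ?C i (a \<odot>\<^bsub>?C\<^esub> dif ?C x)"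
   if a: "a \<in> gr R i" and x: "x \<in>: ?C" for a x i
  proof -
   have xc: "fst x \<in>: M" "snd x \<in>: N" using x by (auto simp: cone_simps)
   have ac: "a \<in>: R" by (rule R.cx.V_closed[OF a])
   have "a = \<zero>\<^sub>R" if "i ~= 0" using a that by (simp add: R_gr)
   hence "sgn_pow ?C i (a \<odot>\<^bsub>?C\<^esub> dif ?C x) = a \<odot>\<^bsub>?C\<^esub> dif ?C x"
    using LC.smult_zero_left[OF dc[OF x]] C.sgn_zero by (cases "i = 0") (auto simp: sgn_pow_def)
   moreover have "dif R a \<odot>\<^bsub>?C\<^esub> x = \<zero>\<^bsub>?C\<^esub>" unfolding R_dif by (rule LC.smult_zero_left[OF x])
   moreover have "dif ?C (a \<odot>\<^bsub>?C\<^esub> x) = a \<odot>\<^bsub>?C\<^esub> dif ?C x"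
    using xc ac fc M.smult_inv_right[OF ac, of "dif M (fst x)"]
    by (simp add: cone_simps dif_linear[OF M] dif_linear[OF N] hom_act[OF fh] N.smult_r_distr)
   ultimately show ?thesis using LC.smult_closed[OF ac dc[OF x]] by simp
  qed
 qed
qed

text \<open>Maps out of a bounded above complex of projectives do not distinguish the two ends of a
 quasi-isomorphism up to homotopy; applied to the cone, the vanishing above gives surjectivity and
 injectivity alike.\<close>

theorem hom_quasi_iso:
 fixes Q :: "('e, 'q) dg" and M :: "('e, 'm) dg" and N :: "('e, 'n) dg"
 assumes Q: "left_dg_module R Q" and Q_pos: "!!i. i > 0 ==> gr Q i = {\<zero>\<^sub>Q}"
  and Q_proj: "!!i. projective_module R (part Q i)"
  and M: "left_dg_module R M" and N: "left_dg_module R N" and f: "chain_map R M N f"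
  and exact: "!!n x y. x \<in> gr M (n + 1) ==> y \<in> gr N n ==> dif M x = \<zero>\<^sub>M ==> f x \<oplus>\<^sub>N dif N y = \<zero>\<^sub>N ==>
   \<exists>p\<in>gr M n. \<exists>q\<in>gr N (n - 1). dif M p = \<ominus>\<^sub>M x \<and> f p \<oplus>\<^sub>N dif N q = y"
 shows hom_quasi_iso_surj: "!!\<phi> m. \<phi> \<in> hom_deg R Q N m ==> (!!x. x \<in>: Q ==> hom_dif Q N m \<phi> x = \<zero>\<^sub>N) ==>
   \<exists>g\<in>hom_deg R Q M m. \<exists>h\<in>hom_deg R Q N (m - 1).
    \<forall>x\<in>carrier Q. hom_dif Q M m g x = \<zero>\<^sub>M \<and> f (g x) \<oplus>\<^sub>N hom_dif Q N (m - 1) h x = \<phi> x"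
  and hom_quasi_iso_inj: "!!g h m. g \<in> hom_deg R Q M m ==> h \<in> hom_deg R Q N (m - 1) ==>
   (!!x. x \<in>: Q ==> hom_dif Q M m g x = \<zero>\<^sub>M) ==>
   (!!x. x \<in>: Q ==> f (g x) = hom_dif Q N (m - 1) h x) ==>
   \<exists>p\<in>hom_deg R Q M (m - 1). \<forall>x\<in>carrier Q. hom_dif Q M (m - 1) p x = g x"
proof -
 let ?C = "cone M N f"
 note fh = chain_hom[OF f]
 have C: "left_dg_module R ?C" by (rule cone_dg_module[OF M N f])
 interpret Q: left_dg_module R Q by fact
 interpret M: left_dg_module R M by fact
 interpret N: left_dg_module R N by fact
 interpret C: left_dg_module R ?C by (rule C)
 interpret QM: hom_complex R Q M by unfold_locales
 interpret QN: hom_complex R Q N by unfold_locales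
 interpret QC: hom_complex R Q ?C by unfold_locales
 have fst: "additive_map ?C M fst" and snd: "additive_map ?C N snd"
  by (rule additive_mapI; auto simp: cone_simps)+
 note sgn_fst = additive_map_sgn[OF C.M.is_ab M.M.is_ab fst]
  and sgn_snd = additive_map_sgn[OF C.M.is_ab N.M.is_ab snd]
  and minus_fst = additive_map_minus[OF C.M.is_ab M.M.is_ab fst]
  and minus_snd = additive_map_minus[OF C.M.is_ab N.M.is_ab snd]
 have acyclic: "\<exists>z\<in>gr ?C (j - 1). dif ?C z = y" if y: "y \<in> gr ?C j" "dif ?C y = \<zero>\<^bsub>?C\<^esub>" for j y
 proof -
  have c: "fst y \<in> gr M (j + 1)" "snd y \<in> gr N j" "\<ominus>\<^sub>M dif M (fst y) = \<zero>\<^sub>M" "f (fst y) \<oplus>\<^sub>N dif N (snd y) = \<zero>\<^sub>N"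
   using y by (auto simp: cone_simps)
  have fyc: "fst y \<in>: M" by (rule M.cx.V_closed[OF c(1)])
  have "dif M (fst y) = \<zero>\<^sub>M" using c(3) fyc M.M.minus_minus[of "dif M (fst y)"] by simp
  from exact[OF c(1,2) this c(4)] obtain p q where
   pq: "p \<in> gr M j" "q \<in> gr N (j - 1)" "dif M p = \<ominus>\<^sub>M fst y" "f p \<oplus>\<^sub>N dif N q = snd y" by blast
  thus ?thesis using fyc by (intro bexI[of _ "(p, q)"]) (simp_all add: cone_simps prod_eq_iff)
 qed
 have build: "(\<lambda>x\<in>carrier Q. (g x, h x)) \<in> hom_deg R Q ?C n"
  if g: "g \<in> hom_deg R Q M (n + 1)" and h: "h \<in> hom_deg R Q N n" for g h n
 proof (rule hom_degI_linear[OF Q C])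
  show "additive_map Q ?C (\<lambda>x\<in>carrier Q. (g x, h x))"
   by (rule additive_mapI) (auto simp: cone_simps hom_closed[OF g] hom_closed[OF h] hom_add[OF g] hom_add[OF h])
 qed (use Q.smult_closed Q.cx.V_closed hom_gr[OF g] hom_gr[OF h] in \<open>auto simp: cone_simps hom_act[OF g] hom_act[OF h] add.assoc\<close>)
 have fstV: "(\<lambda>x\<in>carrier Q. fst (k x)) \<in> hom_deg R Q M (n + 1)" and sndV: "(\<lambda>x\<in>carrier Q. snd (k x)) \<in> hom_deg R Q N n"
  if k: "k \<in> hom_deg R Q ?C n" for k n
 proof -
  have kc: "k x \<in> carrier M \<times> carrier N" if "x \<in>: Q" for x using hom_closed[OF k that] by (simp add: cone_simps)
  have kg: "k x \<in> gr M (i + (n + 1)) \<times> gr N (i + n)" if "x \<in> gr Q i" for x i using hom_gr[OF k that] by (simp add: cone_simps add.assoc)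
  show "(\<lambda>x\<in>carrier Q. fst (k x)) \<in> hom_deg R Q M (n + 1)"
  proof (rule hom_degI_linear[OF Q M])
   show "additive_map Q M (\<lambda>x\<in>carrier Q. fst (k x))"
    by (rule additive_mapI) (use kc in \<open>auto simp: hom_add[OF k] cone_simps(3) mem_Times_iff\<close>)
  qed (use Q.smult_closed Q.cx.V_closed kg in \<open>auto simp: hom_act[OF k] cone_simps(4) mem_Times_iff\<close>)
  show "(\<lambda>x\<in>carrier Q. snd (k x)) \<in> hom_deg R Q N n"
  proof (rule hom_degI_linear[OF Q N])
   show "additive_map Q N (\<lambda>x\<in>carrier Q. snd (k x))"
    by (rule additive_mapI) (use kc in \<open>auto simp: hom_add[OF k] cone_simps(3) mem_Times_iff\<close>)
  qed (use Q.smult_closed Q.cx.V_closed kg in \<open>auto simp: hom_act[OF k] cone_simps(4) mem_Times_iff\<close>)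
 qed
 have D_fst: "fst (hom_dif Q ?C n k x) = \<ominus>\<^sub>M hom_dif Q M (n + 1) (\<lambda>x\<in>carrier Q. fst (k x)) x"
  and D_snd: "snd (hom_dif Q ?C n k x) = f (fst (k x)) \<oplus>\<^sub>N hom_dif Q N n (\<lambda>x\<in>carrier Q. snd (k x)) x"
  if k: "k \<in> hom_deg R Q ?C n" and x: "x \<in>: Q" for k n x
 proof -
  have kc: "k x \<in>: ?C" "k (dif Q x) \<in>: ?C" using hom_closed[OF k] x by simp_all
  have c: "fst (k x) \<in>: M" "snd (k x) \<in>: N" "fst (k (dif Q x)) \<in>: M" "snd (k (dif Q x)) \<in>: N"
   using kc by (auto simp: cone_simps)
  note sg = C.M.sgn_closed[OF kc(2), of n]
  have "fst (hom_dif Q ?C n k x) = \<ominus>\<^sub>M dif M (fst (k x)) \<ominus>\<^sub>M sgn_pow M n (fst (k (dif Q x)))"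
   unfolding QC.D_apply[OF x] minus_fst[OF C.cx.dif_closed[OF kc(1)] sg] sgn_fst[OF kc(2)] by (simp add: cone_simps)
  thus "fst (hom_dif Q ?C n k x) = \<ominus>\<^sub>M hom_dif Q M (n + 1) (\<lambda>x\<in>carrier Q. fst (k x)) x"
   using x c by (cases "even n") (simp_all add: QM.D_apply sgn_pow_def a_minus_def M.M.minus_add)
  have "snd (hom_dif Q ?C n k x) = (f (fst (k x)) \<oplus>\<^sub>N dif N (snd (k x))) \<ominus>\<^sub>N sgn_pow N n (snd (k (dif Q x)))"
   unfolding QC.D_apply[OF x] minus_snd[OF C.cx.dif_closed[OF kc(1)] sg] sgn_snd[OF kc(2)] by (simp add: cone_simps)
  thus "snd (hom_dif Q ?C n k x) = f (fst (k x)) \<oplus>\<^sub>N hom_dif Q N n (\<lambda>x\<in>carrier Q. snd (k x)) x"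
   using x c hom_closed[OF fh] N.M.sgn_closed[OF c(4)] by (simp add: QN.D_apply a_minus_def N.M.a_assoc)
 qed
 have pair: "(\<lambda>x\<in>carrier Q. fst ((\<lambda>x\<in>carrier Q. (g x, h x)) x)) = g"
  "(\<lambda>x\<in>carrier Q. snd ((\<lambda>x\<in>carrier Q. (g x, h x)) x)) = h"
  if "g \<in> hom_deg R Q M i" "h \<in> hom_deg R Q N j" for g h i j
  using hom_ext[OF that(1)] hom_ext[OF that(2)] by (auto simp: fun_eq_iff restrict_def extensional_def)
 {
  fix \<phi> m
  assume \<phi>: "\<phi> \<in> hom_deg R Q N m" and D\<phi>: "!!x. x \<in>: Q ==> hom_dif Q N m \<phi> x = \<zero>\<^sub>N"
  let ?k = "\<lambda>x\<in>carrier Q. (\<zero>\<^sub>QM.F x, \<phi> x)"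
  note k = build[OF QM.zero_V \<phi>]
  note k_parts = pair[OF QM.zero_V[of m] \<phi>]
  have "hom_dif Q ?C m ?k x = \<zero>\<^bsub>?C\<^esub>" if x: "x \<in>: Q" for x
   using k_parts D_fst[OF k x] D_snd[OF k x] D\<phi>[OF x] QM.D_zero[of "m + 1"] QM.F_eval_zero[OF x] x
    additive_map_zero[OF M.M.is_ab N.M.is_ab hom_additive[OF fh]]
   by (simp add: cone_simps prod_eq_iff)
  from hom_acyclic[OF Q Q_pos Q_proj C acyclic k this]
  obtain l where l: "l \<in> hom_deg R Q ?C (m - 1)" and Dl: "\<forall>x\<in>carrier Q. hom_dif Q ?C (m - 1) l x = ?k x" by blast
  show "\<exists>g\<in>hom_deg R Q M m. \<exists>h\<in>hom_deg R Q N (m - 1).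
    \<forall>x\<in>carrier Q. hom_dif Q M m g x = \<zero>\<^sub>M \<and> f (g x) \<oplus>\<^sub>N hom_dif Q N (m - 1) h x = \<phi> x"
  proof (intro bexI ballI conjI)
   show g: "(\<lambda>x\<in>carrier Q. fst (l x)) \<in> hom_deg R Q M m" using fstV[OF l] by simp
   show h: "(\<lambda>x\<in>carrier Q. snd (l x)) \<in> hom_deg R Q N (m - 1)" by (rule sndV[OF l])
   fix x assume x: "x \<in>: Q"
   have "\<ominus>\<^sub>M hom_dif Q M m (\<lambda>x\<in>carrier Q. fst (l x)) x = \<zero>\<^sub>M"
    using D_fst[OF l x] Dl x QM.F_eval_zero[OF x] by simp
   thus "hom_dif Q M m (\<lambda>x\<in>carrier Q. fst (l x)) x = \<zero>\<^sub>M"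
    using M.M.minus_minus[OF hom_closed[OF QM.D_V[OF g] x]] by simp
   show "f ((\<lambda>x\<in>carrier Q. fst (l x)) x) \<oplus>\<^sub>N hom_dif Q N (m - 1) (\<lambda>x\<in>carrier Q. snd (l x)) x = \<phi> x"
    using D_snd[OF l x] Dl x by simp
  qed
 next
  fix g h m
  assume g: "g \<in> hom_deg R Q M m" and h: "h \<in> hom_deg R Q N (m - 1)"
   and Dg: "!!x. x \<in>: Q ==> hom_dif Q M m g x = \<zero>\<^sub>M"
   and fg: "!!x. x \<in>: Q ==> f (g x) = hom_dif Q N (m - 1) h x"
  let ?h = "\<ominus>\<^sub>QN.F h" and ?k = "\<lambda>x\<in>carrier Q. (g x, (\<ominus>\<^sub>QN.F h) x)"
  have g': "g \<in> hom_deg R Q M (m - 1 + 1)" using g by simp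
  note h' = QN.inv_V[OF h]
  note k = build[OF g' h']
  note k_parts = pair[OF g h']
  have "hom_dif Q ?C (m - 1) ?k x = \<zero>\<^bsub>?C\<^esub>" if x: "x \<in>: Q" for x
   using k_parts D_fst[OF k x] D_snd[OF k x] Dg[OF x] fg[OF x] x QN.D_inv[OF h]
    QN.F_eval_inv[OF QN.V_F[OF QN.D_V[OF h]] x] hom_closed[OF QN.D_V[OF h] x]
   by (simp add: cone_simps prod_eq_iff N.M.r_neg)
  from hom_acyclic[OF Q Q_pos Q_proj C acyclic k this]
  obtain l where l: "l \<in> hom_deg R Q ?C (m - 1 - 1)" and Dl: "\<forall>x\<in>carrier Q. hom_dif Q ?C (m - 1 - 1) l x = ?k x" by blast
  have p: "(\<lambda>x\<in>carrier Q. fst (l x)) \<in> hom_deg R Q M (m - 1)" using fstV[OF l] by simp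
  show "\<exists>p\<in>hom_deg R Q M (m - 1). \<forall>x\<in>carrier Q. hom_dif Q M (m - 1) p x = g x"
  proof (intro bexI ballI)
   show "\<ominus>\<^sub>QM.F (\<lambda>x\<in>carrier Q. fst (l x)) \<in> hom_deg R Q M (m - 1)" by (rule QM.inv_V[OF p])
   fix x assume x: "x \<in>: Q"
   have "\<ominus>\<^sub>M hom_dif Q M (m - 1) (\<lambda>x\<in>carrier Q. fst (l x)) x = g x"
    using D_fst[OF l x] Dl x by simp
   thus "hom_dif Q M (m - 1) (\<ominus>\<^sub>QM.F (\<lambda>x\<in>carrier Q. fst (l x))) x = g x"
    unfolding QM.D_inv[OF p] QM.F_eval_inv[OF QM.V_F[OF QM.D_V[OF p]] x] .
  qed
 }
qed

end

section \<open>Comparison of the two Hom complexes\<close>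

sublocale koszul_dual \<subseteq> RC: concentrated_algebra K R
 by unfold_locales (rule R_gr R_dif)+

context koszul_dual
begin

lemma act_scal: "c \<in>: K ==> x \<in>: L ==> act (R.scal c) x = A.scal c \<odot>\<^sub>L x"
 using act_scalar[OF _ R.one_closed] act_one by simp

text \<open>Modulo the radical every ring element is a scalar, so an element that the radical annihilates is
 acted on by scalars only; its coordinates are then those of a multiple of \<open>w\<close>.\<close>

lemma socle:
 assumes y: "y \<in>: L" and J0: "!!U. U \<in> J ==> act U y = \<zero>\<^sub>L"
 shows "y = pi y \<odot>\<^sub>L w"
proof (rule coord_eqI[OF y])
 note py = pi_closed[OF y]
 show pyw: "pi y \<odot>\<^sub>L w \<in>: L" by (rule L.smult_closed[OF py w_closed])
 fix b assume b: "b \<in> B"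
 note V = db(1)[of b]
 obtain c where c: "c \<in>: K" "e (act (db b) w) = A.scal c"
  using gr_A_0[OF e_closed[OF act_closed[OF V w_closed]]] by blast
 have sc: "R.scal c \<in>: R" "A.scal c \<in>: A" using c(1) by simp_all
 have Vw: "act (db b) w = A.scal c \<odot>\<^sub>L w" using aug_w[OF V] c(2) by simp
 have "act (db b \<ominus>\<^sub>R R.scal c) w = \<zero>\<^sub>L"
  unfolding act_minus_left[OF V sc(1) w_closed] act_scal[OF c(1) w_closed] Vw
  using L.M.minus_zero_iff[of "A.scal c \<odot>\<^sub>L w" "A.scal c \<odot>\<^sub>L w"] L.smult_closed[OF sc(2) w_closed] by simp
 hence "db b \<ominus>\<^sub>R R.scal c \<in> J" using V sc(1) by (simp add: J_def)
 from J0[OF this] have Vy: "act (db b) y = A.scal c \<odot>\<^sub>L y"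
  unfolding act_minus_left[OF V sc(1) y] act_scal[OF c(1) y]
  using L.M.minus_zero_iff act_closed[OF V y] L.smult_closed[OF sc(2) y] by simp
 have "coord y b = A.scal c \<otimes>\<^sub>A pi y"
  using coord_db[OF y b] pi_smult[OF sc(2) y] unfolding Vy by simp
 also have "... = pi y \<otimes>\<^sub>A A.scal c"
  using A.smult_conv_left[OF c(1) py] A.smult_conv_right[OF c(1) py] by simp
 also have "... = coord (pi y \<odot>\<^sub>L w) b"
  unfolding coord_db[OF pyw b, symmetric] act_smult[OF V py w_closed] Vw
   pi_smult[OF py L.smult_closed[OF sc(2) w_closed]] pi_smult_w[OF sc(2)] ..
 finally show "coord y b = coord (pi y \<odot>\<^sub>L w) b" .
qed

lemma residue_subquotient: "subquotient (regular R) (carrier R) J"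
proof -
 interpret X: cochain_complex "regular R" by (rule R.regular_complex)
 have J: "additive_subgroup J R" using J_left_ideal by (simp add: left_ideal_def)
 interpret J: additive_subgroup J R by (rule J)
 have inv: "\<ominus>\<^bsub>regular R\<^esub> a = \<ominus>\<^sub>R a" for a by (simp add: a_inv_def m_inv_def)
 have comp: "X.comp x n = (if n = 0 then x else \<zero>\<^sub>R)" if "x \<in>: R" for x n
  using R.cx.comp_V_eq[of x 0 n] that by (simp add: R.hcomp_regular R_gr)
 show ?thesis
 proof (intro subquotient.intro subquotient_axioms.intro R.regular_complex)
  show "additive_subgroup (carrier R) (regular R)"
   by (rule additive_subgroupI, rule X.add_subgroupI) (auto simp: inv)
  show "additive_subgroup J (regular R)"
   by (rule additive_subgroupI, rule X.add_subgroupI) (auto simp: inv J.a_Hcarr J.zero_closed J.a_inv_closed J.a_closed)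
  show "X.comp x n \<in> J" if "x \<in> J" for x n
   using that comp[OF J.a_Hcarr[OF that]] J.zero_closed by simp
  show "X.comp x n \<in>: R" if "x \<in>: R" for x n using that comp[OF that] by simp
 qed (auto simp: R_dif J.a_Hcarr J.zero_closed)
qed

end

locale koszul_dual_resolution = koszul_dual K A L Bn e R act + Q: left_dg_module R Q
 for K :: "('k, 'c) ring_scheme" and A :: "('k, 'a) dg" and L :: "('a, 'r) dg"
  and Bn :: "nat => 'r set" and e :: "'r => 'a" and R :: "('k, 'e) dg" and act
  and Q :: "('e, 'q) dg" +
 fixes \<eta> :: "'q => 'e set"
 assumes resolution_Q: "projective_resolution R (residue_module R) Q \<eta>"
begin

sublocale T: subquotient "regular R" "carrier R" J by (rule residue_subquotient)

lemma residue: "residue_module R = T.SQ"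
 by (simp add: residue_module_def jacobson_radical_eq)

lemma Q_pos: "i > 0 ==> gr Q i = {\<zero>\<^sub>Q}" and Q_proj: "projective_module R (part Q i)"
 and \<eta>_hom: "\<eta> \<in> hom_deg R Q T.SQ 0" and \<eta>_dif: "x \<in>: Q ==> \<eta> (dif Q x) = dif T.SQ (\<eta> x)"
 and \<eta>_bij: "bij_betw (cohom_map T.SQ \<eta>) (carrier (cohom Q)) (carrier (cohom T.SQ))"
 using resolution_Q unfolding projective_resolution_def quasi_iso_def residue by auto

lemma \<eta>_cls: "x \<in>: Q ==> \<exists>U. U \<in>: R \<and> \<eta> x = T.cls U"
 using hom_closed[OF \<eta>_hom, of x] unfolding T.SQ_carrier by blast

lemma cls_act: "U \<in>: R ==> W \<in>: R ==> T.cls U = T.cls W \<longleftrightarrow> act U w = act W w"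
proof -
 assume UW: "U \<in>: R" "W \<in>: R"
 have "U \<ominus>\<^bsub>regular R\<^esub> W = U \<ominus>\<^sub>R W" by (simp add: a_minus_def a_inv_def m_inv_def)
 hence "T.cls U = T.cls W \<longleftrightarrow> U \<ominus>\<^sub>R W \<in> J" using T.cls_eq_iff[of U W] UW by simp
 thus ?thesis
  using UW act_minus_left[OF UW w_closed] L.M.minus_zero_iff[OF act_closed[OF UW(1) w_closed] act_closed[OF UW(2) w_closed]]
  by (simp add: J_def)
qed

text \<open>The augmentation followed by the embedding of the residue module as the line spanned by \<open>w\<close>.\<close>

definition aug :: "'q => 'r" where
 "aug = (\<lambda>x\<in>carrier Q. act (SOME U. U \<in>: R \<and> \<eta> x = T.cls U) w)"

lemma aug_eq:
 assumes x: "x \<in>: Q" and U: "U \<in>: R" "\<eta> x = T.cls U"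
 shows "aug x = act U w"
proof -
 define W where "W = (SOME W. W \<in>: R \<and> \<eta> x = T.cls W)"
 have W: "W \<in>: R \<and> \<eta> x = T.cls W" unfolding W_def by (rule someI_ex[OF \<eta>_cls[OF x]])
 have "aug x = act W w" using x by (simp add: aug_def W_def)
 moreover have "T.cls W = T.cls U" using W U(2) by simp
 ultimately show ?thesis using cls_act[OF conjunct1[OF W] U(1)] by simp
qed

lemma SQ_smult: "a \<in>: R ==> U \<in>: R ==> a \<odot>\<^sub>T.SQ T.cls U = T.cls (a \<otimes>\<^sub>R U)"
proof -
 assume a: "a \<in>: R" and U: "U \<in>: R"
 have "a \<odot>\<^sub>T.SQ T.cls U = T.cls (a \<odot>\<^bsub>regular R\<^esub> U)"
 proof (rule T.SQ_smult)
  show "additive_map (regular R) (regular R) (%x. a \<odot>\<^bsub>regular R\<^esub> x)"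
   by (rule additive_mapI) (use a in \<open>auto simp: R.alg.r_distr\<close>)
  show "a \<odot>\<^bsub>regular R\<^esub> b \<in> J" if "b \<in> J" for b using J_left_ideal a that by (simp add: left_ideal_def)
 qed (use U in simp)
 thus ?thesis by simp
qed

lemma aug_dif: "x \<in>: Q ==> aug (dif Q x) = \<zero>\<^sub>L"
proof -
 assume x: "x \<in>: Q"
 obtain U where U: "U \<in>: R" "\<eta> x = T.cls U" using \<eta>_cls[OF x] by blast
 have "\<eta> (dif Q x) = T.cls \<zero>\<^sub>R" using \<eta>_dif[OF x] T.SQ_dif[of U] U by (simp add: R_dif)
 thus ?thesis using aug_eq[of "dif Q x" "\<zero>\<^sub>R"] x act_zero_left[OF w_closed] by simp
qed

lemma dif_aug: "x \<in>: Q ==> dif L (aug x) = \<zero>\<^sub>L"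
proof -
 assume x: "x \<in>: Q"
 obtain U where U: "U \<in>: R" "\<eta> x = T.cls U" using \<eta>_cls[OF x] by blast
 show ?thesis using aug_eq[OF x U] act_dif[OF U(1) w_closed] act_zero[OF U(1)] w(2) by simp
qed

lemma aug_gr: "x \<in> gr Q i ==> aug x \<in> gr L i" and aug_zero: "x \<in> gr Q i ==> i ~= 0 ==> aug x = \<zero>\<^sub>L"
proof -
 assume x: "x \<in> gr Q i"
 note xc = Q.cx.V_closed[OF x]
 have "\<eta> x \<in> gr T.SQ i" using hom_gr[OF \<eta>_hom x] by simp
 then obtain U where U: "U \<in> gr R i" "U \<in>: R" "\<eta> x = T.cls U" unfolding T.SQ_gr by auto
 show z: "aug x = \<zero>\<^sub>L" if "i ~= 0"
  using aug_eq[OF xc U(2,3)] U(1) that act_zero_left[OF w_closed] by (simp add: R_gr)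
 show "aug x \<in> gr L i"
  using aug_eq[OF xc U(2,3)] act_gr[OF U(2) w(1)] z L.cx.V_zero by (cases "i = 0") auto
qed

lemma aug_hom: "aug \<in> hom_deg R Q LR 0"
proof (rule RC.hom_degI_linear[OF Q.is_dgm LR_dg_module])
 show "additive_map Q LR aug"
 proof (rule additive_mapI)
  fix x assume x: "x \<in>: Q"
  obtain U where U: "U \<in>: R" "\<eta> x = T.cls U" using \<eta>_cls[OF x] by blast
  show "aug x \<in>: LR" using aug_eq[OF x U] act_closed[OF U(1) w_closed] by simp
  fix y assume y: "y \<in>: Q"
  obtain W where W: "W \<in>: R" "\<eta> y = T.cls W" using \<eta>_cls[OF y] by blast
  have "\<eta> (x \<oplus>\<^sub>Q y) = T.cls (U \<oplus>\<^sub>R W)"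
   using hom_add[OF \<eta>_hom x y] T.SQ_add[of U W] U W by simp
  thus "aug (x \<oplus>\<^sub>Q y) = aug x \<oplus>\<^sub>LR aug y"
   using aug_eq[of "x \<oplus>\<^sub>Q y" "U \<oplus>\<^sub>R W"] x y U(1) W(1) aug_eq[OF x U] aug_eq[OF y W] act_add[OF _ _ w_closed] by simp
 qed
 show "aug (a \<odot>\<^sub>Q x) = a \<odot>\<^sub>LR aug x" if a: "a \<in>: R" and x: "x \<in>: Q" for a x
 proof -
  obtain U where U: "U \<in>: R" "\<eta> x = T.cls U" using \<eta>_cls[OF x] by blast
  have "\<eta> (a \<odot>\<^sub>Q x) = T.cls (a \<otimes>\<^sub>R U)"
   using RC.hom_act[OF \<eta>_hom a x] SQ_smult[OF a U(1)] U(2) by simp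
  thus ?thesis
   using aug_eq[OF Q.smult_closed[OF a x], of "a \<otimes>\<^sub>R U"] a U(1) aug_eq[OF x U] act_mult[OF a U(1) w_closed] by simp
 qed
qed (use aug_gr in \<open>auto simp: aug_def\<close>)

lemma aug_closed: "x \<in>: Q ==> aug x \<in>: L"
 using hom_closed[OF aug_hom] by simp

lemma aug_plus: "x \<in>: Q ==> y \<in>: Q ==> aug (x \<oplus>\<^sub>Q y) = aug x \<oplus>\<^sub>L aug y"
 using hom_add[OF aug_hom] by simp

lemma aug_act: "a \<in>: R ==> x \<in>: Q ==> aug (a \<odot>\<^sub>Q x) = act a (aug x)"
 using RC.hom_act[OF aug_hom] by simp

lemma aug_chain: "chain_map R Q LR aug"
 unfolding chain_map_def using aug_hom aug_dif dif_aug by simp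

lemma
 shows \<eta>_surj: "y \<in> gr T.SQ n ==> \<exists>x\<in>gr Q n. dif Q x = \<zero>\<^sub>Q \<and> \<eta> x = y"
  and \<eta>_exact: "x \<in> gr Q n ==> dif Q x = \<zero>\<^sub>Q ==> \<eta> x = \<zero>\<^sub>T.SQ ==> \<exists>y\<in>gr Q (n - 1). dif Q y = x"
proof -
 have d: "dif T.SQ y = \<zero>\<^sub>T.SQ" if y: "y \<in>: T.SQ" for y
 proof -
  obtain U where U: "U \<in>: R" "y = T.cls U" using y unfolding T.SQ_carrier by blast
  have Uc: "U \<in>: (regular R)" using U(1) by simp
  have "dif T.SQ y = T.cls (dif (regular R) U)" unfolding U(2) by (rule T.SQ_dif[OF Uc])
  also have "dif (regular R) U = \<zero>\<^bsub>regular R\<^esub>" by (simp add: R_dif)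
  also have "T.cls \<zero>\<^bsub>regular R\<^esub> = J" by (rule T.cls_zero[OF T.B.zero_closed])
  finally show ?thesis unfolding T.SQ_zero .
 qed
 have deg: "\<eta> x \<in> gr T.SQ n" if "x \<in> gr Q n" for x n using hom_gr[OF \<eta>_hom that] by simp
 note q = Q.cx.is_cpx T.SQ_complex hom_additive[OF \<eta>_hom] deg \<eta>_dif d \<eta>_bij
 show "y \<in> gr T.SQ n ==> \<exists>x\<in>gr Q n. dif Q x = \<zero>\<^sub>Q \<and> \<eta> x = y"
  by (rule quasi_iso_zero_dif_surj[OF q])
 show "x \<in> gr Q n ==> dif Q x = \<zero>\<^sub>Q ==> \<eta> x = \<zero>\<^sub>T.SQ ==> \<exists>y\<in>gr Q (n - 1). dif Q y = x"
  by (rule quasi_iso_zero_dif_exact[OF q])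
qed

lemma exact_Q:
 assumes x: "x \<in> gr Q n" "dif Q x = \<zero>\<^sub>Q" "aug x = \<zero>\<^sub>L"
 shows "\<exists>y\<in>gr Q (n - 1). dif Q y = x"
proof (rule \<eta>_exact[OF x(1,2)])
 note xc = Q.cx.V_closed[OF x(1)]
 obtain U where U: "U \<in>: R" "\<eta> x = T.cls U" using \<eta>_cls[OF xc] by blast
 have "U \<in> J" using aug_eq[OF xc U] x(3) U(1) by (simp add: J_def)
 thus "\<eta> x = \<zero>\<^sub>T.SQ" using U(2) T.cls_zero T.SQ_zero by simp
qed

lemma ex_generator: "\<exists>q\<in>gr Q 0. dif Q q = \<zero>\<^sub>Q \<and> aug q = w"
proof -
 have "T.cls \<one>\<^sub>R \<in> gr T.SQ 0" unfolding T.SQ_gr using R.one_closed by (simp add: R_gr)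
 then obtain x where x: "x \<in> gr Q 0" "dif Q x = \<zero>\<^sub>Q" "\<eta> x = T.cls \<one>\<^sub>R" using \<eta>_surj by blast
 have "aug x = w" using aug_eq[OF Q.cx.V_closed[OF x(1)] R.one_closed x(3)] act_one[OF w_closed] by simp
 with x show ?thesis by blast
qed

definition q0 :: 'q where "q0 = (SOME q. q \<in> gr Q 0 \<and> dif Q q = \<zero>\<^sub>Q \<and> aug q = w)"

lemma q0: "q0 \<in> gr Q 0" "dif Q q0 = \<zero>\<^sub>Q" "aug q0 = w"
proof -
 have "\<exists>q. q \<in> gr Q 0 \<and> dif Q q = \<zero>\<^sub>Q \<and> aug q = w" using ex_generator by blast
 from someI_ex[OF this] show "q0 \<in> gr Q 0" "dif Q q0 = \<zero>\<^sub>Q" "aug q0 = w" unfolding q0_def by blast+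
qed

lemma q0_closed: "q0 \<in>: Q" by (rule Q.cx.V_closed[OF q0(1)])

lemma Hom_dual_complex: "hom_complex R Q LR" by unfold_locales
lemma End_algebra: "dg_end K R Q" by unfold_locales

sublocale QL: hom_complex R Q LR by (rule Hom_dual_complex)
sublocale QQ: dg_end K R Q by (rule End_algebra)

text \<open>The cone of \<open>aug\<close> is acyclic: both complexes have cohomology only in degree
 \<open>0\<close>, where \<open>aug\<close> maps the generator to \<open>w\<close>.\<close>

lemma cone_exact:
 assumes x: "x \<in> gr Q (n + 1)" and y: "y \<in> gr LR n" and dx: "dif Q x = \<zero>\<^sub>Q"
  and xy: "aug x \<oplus>\<^sub>LR dif LR y = \<zero>\<^sub>LR"
 shows "\<exists>p\<in>gr Q n. \<exists>q\<in>gr LR (n - 1). dif Q p = \<ominus>\<^sub>Q x \<and> aug p \<oplus>\<^sub>LR dif LR q = y"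
proof -
 note xc = Q.cx.V_closed[OF x]
 have y': "y \<in> gr L n" using y by simp
 note yc = L.cx.V_closed[OF y']
 consider "n < 0" | "n = 0" | "n > 0" by linarith
 thus ?thesis
 proof cases
  case 1
  have y0: "y = \<zero>\<^sub>L" by (rule gr_neg_zero[OF y' 1])
  hence a0: "aug x = \<zero>\<^sub>L" using xy aug_closed[OF xc] by simp
  obtain p where p: "p \<in> gr Q n" "dif Q p = x" using exact_Q[OF x dx a0] by auto
  have "aug (\<ominus>\<^sub>Q p) = \<zero>\<^sub>L" by (rule aug_zero[of _ n]) (use p 1 in auto)
  thus ?thesis using p y0 Q.cx.V_closed[OF p(1)] L.cx.V_zero
   by (intro bexI[of _ "\<ominus>\<^sub>Q p"] bexI[of _ "\<zero>\<^sub>L"]) (auto simp: Q.cx.dif_inv)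
 next
  case 2
  have x0: "x = \<zero>\<^sub>Q" using x Q_pos[of 1] 2 by simp
  have "aug \<zero>\<^sub>Q = \<zero>\<^sub>L" using QL.hom_zero[OF aug_hom] by simp
  hence "dif L y = \<zero>\<^sub>L" using xy yc x0 by simp
  hence yw: "y = e y \<odot>\<^sub>L w" using cocycle_0[of y] y' 2 by simp
  obtain c where c: "c \<in>: K" "e y = A.scal c" using gr_A_0[OF e_closed[OF yc]] by blast
  have sc: "R.scal c \<in>: R" using c(1) by simp
  have "aug (R.scal c \<odot>\<^sub>Q q0) = y" using aug_act[OF sc q0_closed] q0(3) act_scal[OF c(1) w_closed] yw c(2) by simp
  moreover have "dif Q (R.scal c \<odot>\<^sub>Q q0) = \<zero>\<^sub>Q"
   using RC.dif_linear[OF Q.is_dgm sc q0_closed] q0(2) Q.smult_zero_right[OF sc] by simp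
  moreover have "R.scal c \<odot>\<^sub>Q q0 \<in> gr Q n" using RC.smult_part[OF Q.is_dgm sc q0(1)] 2 by simp
  ultimately show ?thesis using x0 yc L.cx.V_zero
   by (intro bexI[of _ "R.scal c \<odot>\<^sub>Q q0"] bexI[of _ "\<zero>\<^sub>L"]) auto
 next
  case 3
  have x0: "x = \<zero>\<^sub>Q" using x Q_pos[of "n + 1"] 3 by simp
  have a0: "aug \<zero>\<^sub>Q = \<zero>\<^sub>L" using QL.hom_zero[OF aug_hom] by simp
  hence dy: "dif L y = \<zero>\<^sub>L" using xy yc x0 by simp
  have "e y \<in> gr (ground A) n" using hom_gr[OF e_hom y'] by simp
  hence "e y = \<zero>\<^sub>A" using 3 by simp
  from LL.eps_exact[OF y' dy this] obtain q where q: "q \<in> gr L (n - 1)" "dif L q = y" by blast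
  thus ?thesis using x0 a0 yc Q.cx.V_zero
   by (intro bexI[of _ "\<zero>\<^sub>Q"] bexI[of _ q]) auto
 qed
qed

subsection \<open>Maps into the minimal resolution\<close>

text \<open>A map that vanishes on cocycles factors through the differential, and the factor extends from
 the boundaries to the next degree by injectivity.\<close>

lemma factor_through_dif:
 assumes v: "v \<in> linear_maps R (part Q i) (part LR j)"
  and ker: "!!x. x \<in> gr Q i ==> dif Q x = \<zero>\<^sub>Q ==> v x = \<zero>\<^sub>L"
 shows "\<exists>g\<in>linear_maps R (part Q (i + 1)) (part LR j). \<forall>x\<in>gr Q i. g (dif Q x) = v x"
proof -
 note Qm = RC.part_module[OF Q.is_dgm]
 interpret P0: left_module R "part Q i" by (rule Qm)
 interpret P1: left_module R "part Q (i + 1)" by (rule Qm)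
 note vd = lin_closed[OF v] lin_add[OF v] lin_smult[OF v]
 define f where "f u = v (SOME x. x \<in> gr Q i \<and> dif Q x = u)" for u
 have f: "f (dif Q x) = v x" if x: "x \<in> gr Q i" for x
 proof -
  define x' where "x' = (SOME x'. x' \<in> gr Q i \<and> dif Q x' = dif Q x)"
  have "x' \<in> gr Q i \<and> dif Q x' = dif Q x" unfolding x'_def by (rule someI[of _ x]) (simp add: x)
  hence x': "x' \<in> gr Q i" "dif Q x' = dif Q x" by blast+
  note c = Q.cx.V_closed[OF x] Q.cx.V_closed[OF x'(1)]
  have d: "x \<ominus>\<^sub>Q x' \<in> gr Q i" using x x'(1) by (simp add: a_minus_def)
  have "dif Q (x \<ominus>\<^sub>Q x') = \<zero>\<^sub>Q"
   using c x'(2) Q.M.minus_zero_iff[of "dif Q x" "dif Q x"] by (simp add: Q.cx.dif_minus)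
  from ker[OF d this] have "v (x' \<oplus>\<^sub>Q (x \<ominus>\<^sub>Q x')) = v x'"
   using vd(2)[of x' "x \<ominus>\<^sub>Q x'"] vd(1)[of x'] x'(1) d L.cx.V_closed[of "v x'" j] by simp
  moreover have "x' \<oplus>\<^sub>Q (x \<ominus>\<^sub>Q x') = x" using c by (simp add: a_minus_def Q.M.cancel_simps)
  ultimately show ?thesis by (simp add: f_def x'_def[symmetric])
 qed
 let ?U = "dif Q ` gr Q i"
 have U: "additive_subgroup ?U (part Q (i + 1))"
 proof (rule additive_subgroupI, rule P1.M.add_subgroupI)
  fix a b assume a: "a \<in> ?U"
  then obtain x where x: "x \<in> gr Q i" "a = dif Q x" by blast
  have "dif Q (\<ominus>\<^bsub>part Q i\<^esub> x) = \<ominus>\<^bsub>part Q (i + 1)\<^esub> dif Q x"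
   by (rule additive_map_inv[OF P0.M.is_ab P1.M.is_ab
      lin_additive[OF RC.dif_part[OF Q.is_dgm]]]) (simp add: x)
  moreover have "\<ominus>\<^bsub>part Q i\<^esub> x \<in> gr Q i" using P0.M.a_inv_closed[of x] x(1) by simp
  ultimately show "\<ominus>\<^bsub>part Q (i + 1)\<^esub> a \<in> ?U" using x(2) by (metis imageI)
  assume "b \<in> ?U"
  then obtain y where y: "y \<in> gr Q i" "b = dif Q y" by blast
  show "a \<oplus>\<^bsub>part Q (i + 1)\<^esub> b \<in> ?U"
   using x y Q.cx.V_closed[OF x(1)] Q.cx.V_closed[OF y(1)]
   by (intro image_eqI[of _ _ "x \<oplus>\<^sub>Q y"]) (auto simp: Q.cx.dif_add)
 next
  show "\<zero>\<^bsub>part Q (i + 1)\<^esub> \<in> ?U" using Q.cx.V_zero[of i] by (intro image_eqI[of _ _ "\<zero>\<^sub>Q"]) auto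
 qed (auto simp: Q.dif_gr)
 have "\<exists>g. (\<forall>x\<in>carrier (part Q (i + 1)). g x \<in> gr L j) \<and>
   (\<forall>x\<in>carrier (part Q (i + 1)). \<forall>y\<in>carrier (part Q (i + 1)). g (x \<oplus>\<^bsub>part Q (i + 1)\<^esub> y) = g x \<oplus>\<^sub>L g y) \<and>
   (\<forall>r\<in>carrier R. \<forall>x\<in>carrier (part Q (i + 1)). g (r \<odot>\<^bsub>part Q (i + 1)\<^esub> x) = act r (g x)) \<and> (\<forall>x\<in>?U. g x = f x)"
 proof (rule injective_extension[OF Qm U])
  fix u assume "u \<in> ?U"
  then obtain x where x: "x \<in> gr Q i" "u = dif Q x" by blast
  note xc = Q.cx.V_closed[OF x(1)]
  show "f u \<in> gr L j" using f[OF x(1)] vd(1)[of x] x by simp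
  {
   fix u' assume "u' \<in> ?U"
   then obtain y where y: "y \<in> gr Q i" "u' = dif Q y" by blast
   show "f (u \<oplus>\<^bsub>part Q (i + 1)\<^esub> u') = f u \<oplus>\<^sub>L f u'"
    using f[of "x \<oplus>\<^sub>Q y"] f[OF x(1)] f[OF y(1)] x y xc Q.cx.V_closed[OF y(1)] vd(2)[of x y]
    by (simp add: Q.cx.dif_add)
  }
  fix r assume r: "r \<in>: R"
  note rx = RC.smult_part[OF Q.is_dgm r x(1)] and dr = RC.dif_linear[OF Q.is_dgm r xc]
  show "r \<odot>\<^bsub>part Q (i + 1)\<^esub> u \<in> ?U" using rx dr x(2) by (intro image_eqI[of _ _ "r \<odot>\<^sub>Q x"]) auto
  show "f (r \<odot>\<^bsub>part Q (i + 1)\<^esub> u) = act r (f u)"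
   using f[OF rx] f[OF x(1)] dr x(2) vd(3)[OF r, of x] x(1) by simp
 qed
 then obtain g where g: "\<forall>x\<in>gr Q (i + 1). g x \<in> gr L j"
   "\<forall>x\<in>gr Q (i + 1). \<forall>y\<in>gr Q (i + 1). g (x \<oplus>\<^sub>Q y) = g x \<oplus>\<^sub>L g y"
   "\<forall>r\<in>carrier R. \<forall>x\<in>gr Q (i + 1). g (r \<odot>\<^sub>Q x) = act r (g x)" and gf: "\<forall>x\<in>?U. g x = f x" by auto
 have "g \<in> linear_maps R (part Q (i + 1)) (part LR j)" by (rule linear_mapsI) (use g in auto)
 moreover have "\<forall>x\<in>gr Q i. g (dif Q x) = v x" using gf f by auto
 ultimately show ?thesis by blast
qed

text \<open>The action of the algebra on the minimal resolution commutes with the Ext-algebra, so it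
 operates on the Hom complex.\<close>

lemma mult_hom:
 assumes a: "a \<in> gr A i" and h: "h \<in> QL.V n"
 shows "(\<lambda>x\<in>carrier Q. a \<odot>\<^sub>L h x) \<in> QL.V (i + n)"
  and "x \<in>: Q ==> QL.D (i + n) (\<lambda>x\<in>carrier Q. a \<odot>\<^sub>L h x) x =
   dif A a \<odot>\<^sub>L h x \<oplus>\<^sub>L sgn_pow L i (a \<odot>\<^sub>L QL.D n h x)"
proof -
 have ac: "a \<in>: A" by (rule A.cx.V_closed[OF a])
 have hc: "h x \<in>: L" if "x \<in>: Q" for x using hom_closed[OF h that] by simp
 show "(\<lambda>x\<in>carrier Q. a \<odot>\<^sub>L h x) \<in> QL.V (i + n)"
 proof (rule RC.hom_degI_linear[OF Q.is_dgm LR_dg_module])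
  show "additive_map Q LR (\<lambda>x\<in>carrier Q. a \<odot>\<^sub>L h x)"
   by (rule additive_mapI) (use hom_add[OF h] in \<open>auto simp: L.smult_closed ac hc L.smult_r_distr\<close>)
  show "(\<lambda>x\<in>carrier Q. a \<odot>\<^sub>L h x) x \<in> gr LR (j + (i + n))" if "x \<in> gr Q j" for j x
   using L.smult_gr[OF a, of "h x" "j + n"] hom_gr[OF h that] Q.cx.V_closed[OF that] by (simp add: add.left_commute)
  show "(\<lambda>x\<in>carrier Q. a \<odot>\<^sub>L h x) (r \<odot>\<^sub>Q x) = r \<odot>\<^sub>LR (\<lambda>x\<in>carrier Q. a \<odot>\<^sub>L h x) x"
   if r: "r \<in>: R" and x: "x \<in>: Q" for r x
   using RC.hom_act[OF h r x] act_smult[OF r ac hc[OF x]] r x Q.smult_closed[OF r x] by simp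
 qed simp
 assume x: "x \<in>: Q"
 have c: "dif L (h x) \<in>: L" "h (dif Q x) \<in>: L" using hc x by simp_all
 note sm = L.smult_closed[OF ac c(1)] L.smult_closed[OF ac c(2)] L.smult_closed[OF A.cx.dif_closed[OF ac] hc[OF x]]
 note minus = L.smult_minus_right[OF ac c(1)] L.smult_inv_right[OF ac c(2)]
 have D: "QL.D n h x = dif L (h x) \<ominus>\<^sub>L sgn_pow L n (h (dif Q x))"
  using QL.D_apply[OF x, of n h] by (simp add: a_minus_def a_inv_def m_inv_def)
 have sg: "sgn_pow L n (h (dif Q x)) \<in>: L" using c by simp
 have "QL.D (i + n) (\<lambda>x\<in>carrier Q. a \<odot>\<^sub>L h x) x = dif L (a \<odot>\<^sub>L h x) \<ominus>\<^sub>L sgn_pow L (i + n) (a \<odot>\<^sub>L h (dif Q x))"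
  using QL.D_apply[OF x, of "i + n" "\<lambda>x\<in>carrier Q. a \<odot>\<^sub>L h x"] x by (simp add: a_minus_def a_inv_def m_inv_def)
 also have "... = dif A a \<odot>\<^sub>L h x \<oplus>\<^sub>L sgn_pow L i (a \<odot>\<^sub>L QL.D n h x)"
  unfolding D L.leibniz[OF a hc[OF x]] L.smult_minus_right[OF ac c(1) sg] L.smult_sgn_right[OF ac c(2)]
  using sm by (cases "even i"; cases "even n") (simp_all add: sgn_pow_def a_minus_def L.M.minus_add L.M.a_ac)
 finally show "QL.D (i + n) (\<lambda>x\<in>carrier Q. a \<odot>\<^sub>L h x) x =
   dif A a \<odot>\<^sub>L h x \<oplus>\<^sub>L sgn_pow L i (a \<odot>\<^sub>L QL.D n h x)" .
qed

lemma D_aug: "x \<in>: Q ==> QL.D 0 aug x = \<zero>\<^sub>L"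
 using QL.D_apply[of x 0 aug] aug_dif[of x] dif_aug[of x] LR.M.minus_zero_iff[of "\<zero>\<^sub>L" "\<zero>\<^sub>L"] by (simp add: sgn_pow_def)

abbreviation mul :: "'a => 'q => 'r" where "mul a \<equiv> \<lambda>x\<in>carrier Q. a \<odot>\<^sub>L aug x"

lemma mul:
 assumes a: "a \<in> gr A m"
 shows "mul a \<in> QL.V m" and "x \<in>: Q ==> QL.D m (mul a) x = dif A a \<odot>\<^sub>L aug x"
 using mult_hom(1)[OF a aug_hom] mult_hom(2)[OF a aug_hom, of x] D_aug[of x] L.smult_zero_right[OF A.cx.V_closed[OF a]] aug_closed[of x]
  L.smult_closed[OF A.cx.dif_closed[OF A.cx.V_closed[OF a]] aug_closed, of x] by simp_all

end

context koszul_dual_resolution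
begin

text \<open>Injectivity of the minimal resolution extends a null-homotopy from one degree to the next, upwards
 from the degree where the target starts.  What cannot be contracted is concentrated in the last
 degree \<open>0\<close>, factors through the residue module and so lands in the socle.\<close>

theorem hom_into_dual:
 assumes \<phi>: "\<phi> \<in> QL.V m" and D\<phi>: "!!i x. i < 0 ==> x \<in> gr Q i ==> QL.D m \<phi> x = \<zero>\<^sub>L"
 shows "\<exists>a\<in>gr A m. \<exists>k\<in>QL.V (m - 1). \<forall>x\<in>carrier Q. \<phi> x = a \<odot>\<^sub>L aug x \<oplus>\<^sub>L QL.D (m - 1) k x"
proof -
 note Qm = Q.is_dgm
 have inv: "x \<ominus>\<^sub>LR y = x \<ominus>\<^sub>L y" for x y by (simp add: a_minus_def a_inv_def m_inv_def)
 have \<phi>c: "\<phi> x \<in>: L" if "x \<in>: Q" for x using hom_closed[OF \<phi> that] by simp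
 have \<phi>_gr: "\<phi> x \<in> gr L (i + m)" if "x \<in> gr Q i" for x i using hom_gr[OF \<phi> that] by simp
 have V_dif: "dif L (\<psi> x) = sgn_pow L n (\<psi> (dif Q x))"
  if "\<psi> \<in> QL.V n" "x \<in>: Q" "QL.D n \<psi> x = \<zero>\<^sub>L" for \<psi> n x
  using that(3) L.M.minus_zero_iff[of "dif L (\<psi> x)" "sgn_pow L n (\<psi> (dif Q x))"] that(2) hom_closed[OF that(1)]
  by (simp add: QL.D_apply[OF that(2)] inv)
 have \<phi>_dif: "dif L (\<phi> x) = sgn_pow L m (\<phi> (dif Q x))" if "x \<in> gr Q i" "i < 0" for x i
  by (rule V_dif[OF \<phi> Q.cx.V_closed[OF that(1)] D\<phi>[OF that(2,1)]])
 define ok where "ok t k \<longleftrightarrow> k \<in> linear_maps R (part Q (int t - m)) (part LR (int t - 1)) \<and>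
   (int t - m < 0 \<longrightarrow> (\<forall>x\<in>gr Q (int t - m). dif Q x = \<zero>\<^sub>Q \<longrightarrow> dif L (k x) = \<phi> x))" for t k
 define ext where "ext t k k' \<longleftrightarrow> (int t - m < 0 \<longrightarrow> (\<forall>x\<in>gr Q (int t - m).
   k' (dif Q x) = sgn_pow L (m - 1) (dif L (k x)) \<oplus>\<^sub>L sgn_pow L m (\<phi> x)))" for t :: nat and k k' :: "'q => 'r"
 have preimage: "\<exists>y\<in>gr Q (i - 1). dif Q y = x" if "x \<in> gr Q i" "i < 0" "dif Q x = \<zero>\<^sub>Q" for x i
  by (rule exact_Q[OF that(1,3) aug_zero[OF that(1)]]) (use that(2) in simp)
 have "\<exists>k. \<forall>t. ok t (k t) \<and> ext t (k t) (k (Suc t))"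
 proof (rule dependent_nat_choice)
  have "\<phi> x = \<zero>\<^sub>L" if x: "x \<in> gr Q (- m)" "- m < 0" "dif Q x = \<zero>\<^sub>Q" for x
  proof -
   obtain y where y: "y \<in> gr Q (- m - 1)" "dif Q y = x" using preimage[OF x] by blast
   have "\<phi> y = \<zero>\<^sub>L" by (rule gr_neg_zero[OF \<phi>_gr[OF y(1)]]) simp
   hence "sgn_pow L m (\<phi> x) = \<zero>\<^sub>L" using \<phi>_dif[OF y(1)] y(2) x(2) by simp
   hence "sgn_pow L m (sgn_pow L m (\<phi> x)) = \<zero>\<^sub>L" by simp
   thus ?thesis using \<phi>c[OF Q.cx.V_closed[OF x(1)]] by simp
  qed
  hence "ok 0 (%_. \<zero>\<^sub>L)"
   unfolding ok_def using RC.zero_linear[OF LR_dg_module, of Q "int 0 - m" "int 0 - 1"] by auto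
  thus "\<exists>k. ok 0 k" by blast
  fix k t assume k: "ok t k"
  have kl: "k \<in> linear_maps R (part Q (int t - m)) (part LR (int t - 1))" using k by (simp add: ok_def)
  have kg: "k x \<in> gr L (int t - 1)" if "x \<in> gr Q (int t - m)" for x using lin_closed[OF kl] that by simp
  show "\<exists>k'. ok (Suc t) k' \<and> ext t k k'"
  proof (cases "int t - m < 0")
   case False
   thus ?thesis
    using RC.zero_linear[OF LR_dg_module, of Q "int (Suc t) - m" "int (Suc t) - 1"]
    by (intro exI[of _ "%_. \<zero>\<^sub>L"]) (simp add: ok_def ext_def)
  next
   case True
   let ?v = "%x. sgn_pow L (m - 1) (dif L (k x)) \<oplus>\<^sub>L sgn_pow L m (\<phi> x)"
   have kd: "dif L (k x) = \<phi> x" if "x \<in> gr Q (int t - m)" "dif Q x = \<zero>\<^sub>Q" for x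
    using k that True by (simp add: ok_def)
   have 1: "dif LR \<in> linear_maps R (part LR (int t - 1)) (part LR (int t))"
    using RC.dif_part[OF LR_dg_module, of "int t - 1"] by simp
   have 2: "\<phi> \<in> linear_maps R (part Q (int t - m)) (part LR (int t))"
    using RC.hom_part[OF Qm \<phi>, of "int t - m"] by simp
   have v: "?v \<in> linear_maps R (part Q (int t - m)) (part LR (int t))"
    using RC.add_linear[OF LR_dg_module RC.sgn_linear[OF LR_dg_module RC.comp_linear[OF kl 1], of "m - 1"]
      RC.sgn_linear[OF LR_dg_module 2, of m]] by simp
   have "\<exists>k'\<in>linear_maps R (part Q (int t - m + 1)) (part LR (int t)). \<forall>x\<in>gr Q (int t - m). k' (dif Q x) = ?v x"
   proof (rule factor_through_dif[OF v])
    fix x assume x: "x \<in> gr Q (int t - m)" "dif Q x = \<zero>\<^sub>Q"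
    show "?v x = \<zero>\<^sub>L"
     unfolding kd[OF x] using \<phi>c[OF Q.cx.V_closed[OF x(1)]] by (simp add: sgn_pow_def L.M.r_neg L.M.l_neg)
   qed
   then obtain k' where k': "k' \<in> linear_maps R (part Q (int t - m + 1)) (part LR (int t))"
    and k'd: "\<forall>x\<in>gr Q (int t - m). k' (dif Q x) = ?v x" by blast
   have idx: "int (Suc t) - m = int t - m + 1" "int (Suc t) - 1 = int t" by simp_all
   have "dif L (k' x) = \<phi> x" if neg: "int t - m + 1 < 0" and x: "x \<in> gr Q (int t - m + 1)" and dx: "dif Q x = \<zero>\<^sub>Q" for x
   proof -
    obtain y where y: "y \<in> gr Q (int t - m)" "dif Q y = x" using preimage[OF x neg dx] by auto
    note kc = L.cx.V_closed[OF kg[OF y(1)]] and yc = \<phi>c[OF Q.cx.V_closed[OF y(1)]]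
    have "k' x = ?v y" using k'd y by blast
    hence "dif L (k' x) = sgn_pow L (m - 1) \<zero>\<^sub>L \<oplus>\<^sub>L sgn_pow L m (sgn_pow L m (\<phi> x))"
     using kc yc \<phi>_dif[OF y(1) True] y(2) by (simp add: L.cx.dif_add L.cx.dif_sgn L.cx.dif_dif)
    thus ?thesis using \<phi>c[OF Q.cx.V_closed[OF x]] by simp
   qed
   hence "ok (Suc t) k'" unfolding ok_def idx using k' by blast
   moreover have "ext t k k'" unfolding ext_def using k'd by blast
   ultimately show ?thesis by blast
  qed
 qed
 then obtain k where ok: "!!t. ok t (k t)" and ext: "!!t. ext t (k t) (k (Suc t))" by blast
 define \<kappa> where "\<kappa> i = (if i \<ge> - m then k (nat (i + m)) else (%_. \<zero>\<^sub>L))" for i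
 have \<kappa>: "\<kappa> i \<in> linear_maps R (part Q i) (part LR (i + (m - 1)))" for i
 proof (cases "i \<ge> - m")
  case True
  hence e: "int (nat (i + m)) - m = i" "int (nat (i + m)) - 1 = i + (m - 1)" by simp_all
  have "k (nat (i + m)) \<in> linear_maps R (part Q i) (part LR (i + (m - 1)))"
   using ok[of "nat (i + m)"] unfolding ok_def e by (rule conjunct1)
  thus ?thesis using True by (simp add: \<kappa>_def)
 next
  case False
  thus ?thesis using RC.zero_linear[OF LR_dg_module] by (simp add: \<kappa>_def)
 qed
 obtain h where h: "h \<in> QL.V (m - 1)" and hk: "\<forall>i. \<forall>x\<in>gr Q i. h x = \<kappa> i x"
  using RC.hom_glue[OF Qm LR_dg_module \<kappa>] by blast
 have hc: "h x \<in>: L" if "x \<in>: Q" for x using hom_closed[OF h that] by simp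
 have Dh: "QL.D (m - 1) h x = \<phi> x" if x: "x \<in> gr Q i" and i: "i < 0" for x i
 proof -
  note xc = Q.cx.V_closed[OF x] and dx = Q.dif_gr[OF x]
  have D: "QL.D (m - 1) h x = dif L (h x) \<ominus>\<^sub>L sgn_pow L (m - 1) (h (dif Q x))"
   using QL.D_apply[OF xc, of "m - 1" h] by (simp add: inv)
  show ?thesis
  proof (cases "i \<ge> - m")
   case True
   define t where "t = nat (i + m)"
   have t: "i = int t - m" using True by (simp add: t_def)
   have "h x = k t x" "h (dif Q x) = k (Suc t) (dif Q x)"
    using hk x dx by (simp_all add: \<kappa>_def t nat_add_distrib)
   moreover have "k (Suc t) (dif Q x) = sgn_pow L (m - 1) (dif L (k t x)) \<oplus>\<^sub>L sgn_pow L m (\<phi> x)"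
    using ext[of t] x i t by (simp add: ext_def)
   ultimately have "h (dif Q x) = sgn_pow L (m - 1) (dif L (h x)) \<oplus>\<^sub>L sgn_pow L m (\<phi> x)" by simp
   thus ?thesis unfolding D using L.cx.dif_closed[OF hc[OF xc]] \<phi>c[OF xc]
    by (cases "even m") (simp_all add: sgn_pow_def a_minus_def L.M.minus_add L.M.r_neg L.M.cancel_simps L.M.r_neg2 L.M.r_neg1)
  next
   case False
   have "h x = \<zero>\<^sub>L" by (rule gr_neg_zero[of _ "i + (m - 1)"]) (use hom_gr[OF h x] False in auto)
   moreover have "h (dif Q x) = \<zero>\<^sub>L" by (rule gr_neg_zero[of _ "i + 1 + (m - 1)"]) (use hom_gr[OF h dx] False in auto)
   moreover have "\<phi> x = \<zero>\<^sub>L" by (rule gr_neg_zero[OF \<phi>_gr[OF x]]) (use False in auto)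
   ultimately show ?thesis unfolding D using L.M.minus_zero_iff[of "\<zero>\<^sub>L" "\<zero>\<^sub>L"] by simp
  qed
 qed
 define \<psi> where "\<psi> = \<phi> \<ominus>\<^sub>QL.F QL.D (m - 1) h"
 have DhV: "QL.D (m - 1) h \<in> QL.V m" using QL.D_V[OF h] by simp
 have \<psi>V: "\<psi> \<in> QL.V m" unfolding \<psi>_def by (rule QL.minus_V[OF \<phi> DhV])
 have \<psi>: "\<psi> x = \<phi> x \<ominus>\<^sub>L QL.D (m - 1) h x" if "x \<in>: Q" for x
  unfolding \<psi>_def using QL.F_eval_minus[OF QL.V_F[OF \<phi>] QL.V_F[OF DhV] that] by (simp add: inv)
 have Dhc: "QL.D (m - 1) h x \<in>: L" if "x \<in>: Q" for x using hom_closed[OF DhV that] by simp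
 have \<psi>_neg: "\<psi> x = \<zero>\<^sub>L" if "x \<in> gr Q i" "i < 0" for x i
  using \<psi>[OF Q.cx.V_closed[OF that(1)]] Dh[OF that] L.M.minus_zero_iff \<phi>c[OF Q.cx.V_closed[OF that(1)]] by simp
 have \<psi>_cob: "\<psi> (dif Q y) = \<zero>\<^sub>L" if y: "y \<in> gr Q (- 1)" for y
 proof -
  note yc = Q.cx.V_closed[OF y]
  have "QL.D m \<psi> = QL.D m \<phi> \<ominus>\<^sub>QL.F \<zero>\<^sub>QL.F"
   unfolding \<psi>_def QL.D_minus[OF \<phi> DhV] using QL.D_D[OF h] by simp
  hence "QL.D m \<psi> y = QL.D m \<phi> y \<ominus>\<^sub>LR \<zero>\<^sub>LR"
   using QL.F_eval_minus[OF QL.V_F[OF QL.D_V[OF \<phi>]] QL.V_F[OF QL.zero_V[of 0]] yc] QL.F_eval_zero[OF yc] by simp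
  hence "QL.D m \<psi> y = \<zero>\<^sub>L" using D\<phi>[OF _ y] L.M.minus_zero_iff[of "\<zero>\<^sub>L" "\<zero>\<^sub>L"] by (simp add: inv)
  from V_dif[OF \<psi>V yc this] have "sgn_pow L m (\<psi> (dif Q y)) = \<zero>\<^sub>L" using \<psi>_neg[OF y] by simp
  hence "sgn_pow L m (sgn_pow L m (\<psi> (dif Q y))) = \<zero>\<^sub>L" by simp
  thus ?thesis using hom_closed[OF \<psi>V Q.cx.dif_closed[OF yc]] by simp
 qed
 have \<psi>_ker: "\<psi> x = \<zero>\<^sub>L" if x: "x \<in> gr Q 0" "aug x = \<zero>\<^sub>L" for x
 proof -
  have "dif Q x = \<zero>\<^sub>Q" using Q.dif_gr[OF x(1)] Q_pos[of 1] by simp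
  from exact_Q[OF x(1) this x(2)] obtain y where y: "y \<in> gr Q (- 1)" "dif Q y = x" by auto
  show ?thesis using \<psi>_cob[OF y(1)] y(2) by simp
 qed
 have \<psi>_act: "\<psi> (U \<odot>\<^sub>Q x) = act U (\<psi> x)" if "U \<in>: R" "x \<in>: Q" for U x
  using RC.hom_act[OF \<psi>V that] by simp
 have y0: "\<psi> q0 \<in> gr L m" using hom_gr[OF \<psi>V q0(1)] by simp
 note y0c = L.cx.V_closed[OF y0]
 define a where "a = pi (\<psi> q0)"
 have a: "a \<in> gr A m" "a \<in>: A" unfolding a_def using pi_gr[OF y0] pi_closed[OF y0c] .
 have soc: "\<psi> q0 = a \<odot>\<^sub>L w"
  unfolding a_def
 proof (rule socle[OF y0c])
  fix U assume U: "U \<in> J"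
  hence Uc: "U \<in>: R" "act U w = \<zero>\<^sub>L" by (auto simp: J_def)
  have "\<psi> (U \<odot>\<^sub>Q q0) = \<zero>\<^sub>L"
   by (rule \<psi>_ker[OF RC.smult_part[OF Qm Uc(1) q0(1)]]) (use aug_act[OF Uc(1) q0_closed] q0(3) Uc(2) in simp)
  thus "act U (\<psi> q0) = \<zero>\<^sub>L" using \<psi>_act[OF Uc(1) q0_closed] by simp
 qed
 have \<psi>_eq: "\<psi> x = a \<odot>\<^sub>L aug x" if x: "x \<in> gr Q i" for i x
 proof (cases "i = 0")
  case False
  have "\<psi> x = \<zero>\<^sub>L"
  proof (cases "i < 0")
   case True
   thus ?thesis by (rule \<psi>_neg[OF x])
  next
   case f: False
   hence "x = \<zero>\<^sub>Q" using x Q_pos[of i] False by simp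
   thus ?thesis using QL.hom_zero[OF \<psi>V] by simp
  qed
  thus ?thesis using aug_zero[OF x False] L.smult_zero_right[OF a(2)] by simp
 next
  case True
  note xc = Q.cx.V_closed[OF x]
  have x0: "x \<in> gr Q 0" using x True by simp
  obtain U where U: "U \<in>: R" "\<eta> x = T.cls U" using \<eta>_cls[OF xc] by blast
  have aU: "aug x = act U w" by (rule aug_eq[OF xc U])
  have Uq: "U \<odot>\<^sub>Q q0 \<in> gr Q 0" by (rule RC.smult_part[OF Qm U(1) q0(1)])
  note Uqc = Q.cx.V_closed[OF Uq]
  have "aug (x \<ominus>\<^sub>Q U \<odot>\<^sub>Q q0) = aug x \<ominus>\<^sub>L act U w"
   using QL.hom_minus[OF aug_hom xc Uqc] aug_act[OF U(1) q0_closed] q0(3) by (simp add: inv)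
  also have "... = \<zero>\<^sub>L" using aU L.M.minus_zero_iff act_closed[OF U(1) w_closed] by simp
  finally have z: "aug (x \<ominus>\<^sub>Q U \<odot>\<^sub>Q q0) = \<zero>\<^sub>L" .
  have "x \<ominus>\<^sub>Q U \<odot>\<^sub>Q q0 \<in> gr Q 0" using x0 Uq by (simp add: a_minus_def)
  from \<psi>_ker[OF this z] have "\<psi> x \<ominus>\<^sub>L \<psi> (U \<odot>\<^sub>Q q0) = \<zero>\<^sub>L"
   using QL.hom_minus[OF \<psi>V xc Uqc] by (simp add: inv)
  hence "\<psi> x = \<psi> (U \<odot>\<^sub>Q q0)"
   using L.M.minus_zero_iff hom_closed[OF \<psi>V xc] hom_closed[OF \<psi>V Uqc] by simp
  also have "... = a \<odot>\<^sub>L act U w"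
   unfolding \<psi>_act[OF U(1) q0_closed] soc by (rule act_smult[OF U(1) a(2) w_closed])
  finally show ?thesis using aU by simp
 qed
 have \<psi>_mul: "\<psi> = mul a"
 proof (rule QL.hom_eq_homogeneous[OF \<psi>V mul(1)[OF a(1)]])
  show "\<psi> x = mul a x" if "x \<in> gr Q i" for i x using \<psi>_eq[OF that] Q.cx.V_closed[OF that] by simp
 qed
 have "\<phi> x = a \<odot>\<^sub>L aug x \<oplus>\<^sub>L QL.D (m - 1) h x" if x: "x \<in>: Q" for x
 proof -
  have "a \<odot>\<^sub>L aug x = \<phi> x \<ominus>\<^sub>L QL.D (m - 1) h x"
   using \<psi>[OF x] fun_cong[OF \<psi>_mul, of x] x by simp
  thus ?thesis using \<phi>c[OF x] Dhc[OF x] by (simp add: a_minus_def L.M.a_assoc L.M.l_neg)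
 qed
 thus ?thesis using a(1) h by blast
qed

lemma aug_surj:
 assumes \<phi>: "\<phi> \<in> QL.V m" and D: "!!x. x \<in>: Q ==> QL.D m \<phi> x = \<zero>\<^sub>L"
 shows "\<exists>g\<in>QQ.hc.V m. \<exists>h\<in>QL.V (m - 1).
  \<forall>x\<in>carrier Q. QQ.hc.D m g x = \<zero>\<^sub>Q \<and> aug (g x) \<oplus>\<^sub>LR QL.D (m - 1) h x = \<phi> x"
proof (rule RC.hom_quasi_iso_surj[OF Q.is_dgm _ Q_proj Q.is_dgm LR_dg_module aug_chain _ \<phi>])
 show "gr Q i = {\<zero>\<^sub>Q}" if "i > 0" for i by (rule Q_pos[OF that])
 show "\<exists>p\<in>gr Q n. \<exists>q\<in>gr LR (n - 1). dif Q p = \<ominus>\<^sub>Q x \<and> aug p \<oplus>\<^sub>LR dif LR q = y"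
  if "x \<in> gr Q (n + 1)" "y \<in> gr LR n" "dif Q x = \<zero>\<^sub>Q" "aug x \<oplus>\<^sub>LR dif LR y = \<zero>\<^sub>LR" for n x y
  by (rule cone_exact[OF that])
qed (use D in simp_all)

lemma aug_inj:
 assumes g: "g \<in> QQ.hc.V m" and h: "h \<in> QL.V (m - 1)"
  and D: "!!x. x \<in>: Q ==> QQ.hc.D m g x = \<zero>\<^sub>Q"
  and eq: "!!x. x \<in>: Q ==> aug (g x) = QL.D (m - 1) h x"
 shows "\<exists>p\<in>QQ.hc.V (m - 1). \<forall>x\<in>carrier Q. QQ.hc.D (m - 1) p x = g x"
proof (rule RC.hom_quasi_iso_inj[OF Q.is_dgm _ Q_proj Q.is_dgm LR_dg_module aug_chain _ g h])
 show "gr Q i = {\<zero>\<^sub>Q}" if "i > 0" for i by (rule Q_pos[OF that])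
 show "\<exists>p\<in>gr Q n. \<exists>q\<in>gr LR (n - 1). dif Q p = \<ominus>\<^sub>Q x \<and> aug p \<oplus>\<^sub>LR dif LR q = y"
  if "x \<in> gr Q (n + 1)" "y \<in> gr LR n" "dif Q x = \<zero>\<^sub>Q" "aug x \<oplus>\<^sub>LR dif LR y = \<zero>\<^sub>LR" for n x y
  by (rule cone_exact[OF that])
qed (use D eq in simp_all)

subsection \<open>The correspondence\<close>

text \<open>An endomorphism \<open>g\<close> of the projective resolution and an element \<open>a\<close> of
 the algebra correspond if \<open>aug \<circ> g\<close> and \<open>a \<cdot> aug\<close> are
 homotopic.\<close>

definition rel :: "int => ('q => 'q) => 'a => bool" where
 "rel m g a \<longleftrightarrow> g \<in> QQ.hc.V m \<and> (\<forall>x\<in>carrier Q. QQ.hc.D m g x = \<zero>\<^sub>Q) \<and> a \<in> gr A m \<and> dif A a = \<zero>\<^sub>A \<and>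
  (\<exists>h\<in>QL.V (m - 1). \<forall>x\<in>carrier Q. aug (g x) \<oplus>\<^sub>L QL.D (m - 1) h x = a \<odot>\<^sub>L aug x)"

lemma relI:
 assumes "g \<in> QQ.hc.V m" "!!x. x \<in>: Q ==> QQ.hc.D m g x = \<zero>\<^sub>Q" "a \<in> gr A m" "dif A a = \<zero>\<^sub>A"
  "h \<in> QL.V (m - 1)" "!!x. x \<in>: Q ==> aug (g x) \<oplus>\<^sub>L QL.D (m - 1) h x = a \<odot>\<^sub>L aug x"
 shows "rel m g a"
 using assms unfolding rel_def by blast

lemma relE:
 assumes "rel m g a"
 obtains h where "g \<in> QQ.hc.V m" "\<forall>x\<in>carrier Q. QQ.hc.D m g x = \<zero>\<^sub>Q" "a \<in> gr A m" "dif A a = \<zero>\<^sub>A"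
  "h \<in> QL.V (m - 1)" "\<forall>x\<in>carrier Q. aug (g x) \<oplus>\<^sub>L QL.D (m - 1) h x = a \<odot>\<^sub>L aug x"
 using assms unfolding rel_def by blast

lemma End_cocycle_iff:
 assumes g: "g \<in> QQ.hc.V m"
 shows "dif QQ.E g = \<zero>\<^sub>QQ.E \<longleftrightarrow> (\<forall>x\<in>carrier Q. QQ.hc.D m g x = \<zero>\<^sub>Q)"
proof
 assume "dif QQ.E g = \<zero>\<^sub>QQ.E"
 hence "QQ.hc.D m g = \<zero>\<^sub>QQ.hc.F" unfolding QQ.E_dif[OF g] by (simp add: QQ.E_simps QQ.hc.H_zero)
 thus "\<forall>x\<in>carrier Q. QQ.hc.D m g x = \<zero>\<^sub>Q" using QQ.hc.F_eval_zero by simp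
next
 assume "\<forall>x\<in>carrier Q. QQ.hc.D m g x = \<zero>\<^sub>Q"
 hence "QQ.hc.D m g = \<zero>\<^sub>QQ.hc.F"
  by (intro hom_eqI[OF QQ.hc.D_V[OF g] QQ.hc.zero_V]) (simp add: QQ.hc.F_eval_zero)
 thus "dif QQ.E g = \<zero>\<^sub>QQ.E" unfolding QQ.E_dif[OF g] by (simp add: QQ.E_simps QQ.hc.H_zero)
qed

lemma End_coboundary_iff: "g \<in> QQ.hc.V n ==>
  g \<in> coboundaries QQ.E \<longleftrightarrow> (\<exists>p\<in>QQ.hc.V (n - 1). QQ.hc.D (n - 1) p = g)"
 using QQ.hc.H_coboundary_iff[of g n] by (simp add: coboundaries_def QQ.E_simps)

lemma D_L_closed: "h \<in> QL.V n ==> x \<in>: Q ==> QL.D n h x \<in>: L"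
 using hom_closed[OF QL.D_V] by simp

lemma smult_w_inj: "a \<in>: A ==> b \<in>: A ==> a \<odot>\<^sub>L w = b \<odot>\<^sub>L w ==> a = b"
 using pi_smult_w by metis

text \<open>A boundary does not contribute to the differential, and the differential of multiplication by \<open>b\<close> is
 multiplication by the differential of \<open>b\<close>, as \<open>aug\<close> is a chain map.\<close>

lemma dif_of_homotopy:
 assumes b: "b \<in> gr A m" and \<phi>: "\<phi> \<in> QL.V m" and k: "k \<in> QL.V (m - 1)"
  and eq: "!!x. x \<in>: Q ==> \<phi> x = b \<odot>\<^sub>L aug x \<oplus>\<^sub>L QL.D (m - 1) k x"
  and x: "x \<in>: Q"
 shows "QL.D m \<phi> x = dif A b \<odot>\<^sub>L aug x"
proof -
 have DkV: "QL.D (m - 1) k \<in> QL.V m" using QL.D_V[OF k] by simp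
 have "\<phi> = mul b \<oplus>\<^sub>QL.F QL.D (m - 1) k"
  by (rule hom_eqI[OF \<phi> QL.add_V[OF mul(1)[OF b] DkV]]) (use eq in \<open>simp add: QL.F_eval_add\<close>)
 hence "QL.D m \<phi> = QL.D m (mul b) \<oplus>\<^sub>QL.F \<zero>\<^sub>QL.F"
  using QL.D_add[OF mul(1)[OF b] DkV, of m] QL.D_D[OF k] by simp
 thus ?thesis
  using x mul(2)[OF b x] QL.F_eval_zero[OF x] L.smult_closed[OF A.cx.dif_closed[OF A.cx.V_closed[OF b]] aug_closed[OF x]]
  by (simp add: QL.F_eval_add)
qed

text \<open>The homotopies compose because multiplication by \<open>a\<close> is a map of complexes of
 modules over the Ext-algebra; the sign makes up for the degree by which \<open>a\<close> passes
 the differential.\<close>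

lemma rel_compose:
 assumes "rel m g a" and "rel n g' a'"
 shows "rel (m + n) (compose (carrier Q) g g') (a \<otimes>\<^sub>A a')"
proof -
 obtain h where g: "g \<in> QQ.hc.V m" and Dg: "\<forall>x\<in>carrier Q. QQ.hc.D m g x = \<zero>\<^sub>Q" and a: "a \<in> gr A m" and da: "dif A a = \<zero>\<^sub>A"
  and h: "h \<in> QL.V (m - 1)" and eq: "\<forall>x\<in>carrier Q. aug (g x) \<oplus>\<^sub>L QL.D (m - 1) h x = a \<odot>\<^sub>L aug x"
  using assms(1) by (rule relE)
 obtain h' where g': "g' \<in> QQ.hc.V n" and Dg': "\<forall>x\<in>carrier Q. QQ.hc.D n g' x = \<zero>\<^sub>Q" and a': "a' \<in> gr A n" and da': "dif A a' = \<zero>\<^sub>A"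
  and h': "h' \<in> QL.V (n - 1)" and eq': "\<forall>x\<in>carrier Q. aug (g' x) \<oplus>\<^sub>L QL.D (n - 1) h' x = a' \<odot>\<^sub>L aug x"
  using assms(2) by (rule relE)
 note Qm = Q.is_dgm and Rx = R.cx.is_cpx
 have ac: "a \<in>: A" "a' \<in>: A" using A.cx.V_closed a a' by blast+
 let ?s = "sgn_pow A m a"
 have s: "?s \<in> gr A m" "dif A ?s = \<zero>\<^sub>A" using a da ac by (simp_all add: A.cx.dif_sgn)
 let ?h1 = "\<lambda>x\<in>carrier Q. ?s \<odot>\<^sub>L h' x" and ?h2 = "compose (carrier Q) h g'"
 have h1: "?h1 \<in> QL.V (m + n - 1)" using mult_hom(1)[OF s(1) h'] by (simp add: algebra_simps)
 have h2: "?h2 \<in> QL.V (m + n - 1)" using compose_V[OF Qm Qm LR_dg_module Rx h g'] by (simp add: algebra_simps)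
 show ?thesis
 proof (rule relI[where h = "?h1 \<oplus>\<^sub>QL.F ?h2"])
  show "compose (carrier Q) g g' \<in> QQ.hc.V (m + n)" by (rule compose_V[OF Qm Qm Qm Rx g g'])
  show "a \<otimes>\<^sub>A a' \<in> gr A (m + n)" by (rule A.mult_gr[OF a a'])
  show "dif A (a \<otimes>\<^sub>A a') = \<zero>\<^sub>A" using A.leibniz[OF a ac(2)] da da' ac by simp
  show "?h1 \<oplus>\<^sub>QL.F ?h2 \<in> QL.V (m + n - 1)" by (rule QL.add_V[OF h1 h2])
  fix x assume x: "x \<in>: Q"
  have g'x: "g' x \<in>: Q" by (rule hom_closed[OF g' x])
  show "QQ.hc.D (m + n) (compose (carrier Q) g g') x = \<zero>\<^sub>Q"
   using compose_D[OF Qm Qm Qm Rx g g' x] Dg Dg' x g'x QQ.hc.hom_zero[OF g] by simp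
  note c = D_L_closed[OF h' x] D_L_closed[OF h g'x] aug_closed[OF x] aug_closed[OF hom_closed[OF g g'x]] aug_closed[OF g'x]
  note ss = L.smult_closed[OF ac(1) c(1)]
  have "QL.D (m + n - 1) ?h1 x = sgn_pow L m (?s \<odot>\<^sub>L QL.D (n - 1) h' x)"
   using mult_hom(2)[OF s(1) h' x] s(2) hom_closed[OF h' x] ac(1) c(1)
   by (simp add: algebra_simps L.smult_zero_left L.smult_closed)
  also have "... = a \<odot>\<^sub>L QL.D (n - 1) h' x"
   using L.smult_inv_left[OF ac(1) c(1)] ss by (simp add: sgn_pow_def)
  finally have D1: "QL.D (m + n - 1) ?h1 x = a \<odot>\<^sub>L QL.D (n - 1) h' x" .
  have D2: "QL.D (m + n - 1) ?h2 x = QL.D (m - 1) h (g' x)"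
   using compose_D[OF Qm Qm LR_dg_module Rx h g' x] Dg' x c(2) QL.hom_zero[OF h] by (simp add: algebra_simps)
  have "QL.D (m + n - 1) (?h1 \<oplus>\<^sub>QL.F ?h2) x = a \<odot>\<^sub>L QL.D (n - 1) h' x \<oplus>\<^sub>L QL.D (m - 1) h (g' x)"
   unfolding QL.D_add[OF h1 h2] QL.F_eval_add[OF x] D1 D2 by simp
  hence "aug (compose (carrier Q) g g' x) \<oplus>\<^sub>L QL.D (m + n - 1) (?h1 \<oplus>\<^sub>QL.F ?h2) x =
    (aug (g (g' x)) \<oplus>\<^sub>L QL.D (m - 1) h (g' x)) \<oplus>\<^sub>L a \<odot>\<^sub>L QL.D (n - 1) h' x"
   using x c ss by (simp add: compose_def L.M.a_ac)
  also have "... = a \<odot>\<^sub>L (aug (g' x) \<oplus>\<^sub>L QL.D (n - 1) h' x)"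
   using eq g'x L.smult_r_distr[OF ac(1) c(5,1)] by simp
  also have "... = (a \<otimes>\<^sub>A a') \<odot>\<^sub>L aug x" using eq' x L.smult_assoc[OF ac c(3)] by simp
  finally show "aug (compose (carrier Q) g g' x) \<oplus>\<^sub>L QL.D (m + n - 1) (?h1 \<oplus>\<^sub>QL.F ?h2) x = (a \<otimes>\<^sub>A a') \<odot>\<^sub>L aug x" .
 qed
qed

lemma rel_add:
 assumes "rel m g a" and "rel m g' a'"
 shows "rel m (g \<oplus>\<^sub>QQ.E g') (a \<oplus>\<^sub>A a')"
proof -
 obtain h where g: "g \<in> QQ.hc.V m" and Dg: "\<forall>x\<in>carrier Q. QQ.hc.D m g x = \<zero>\<^sub>Q" and a: "a \<in> gr A m" and da: "dif A a = \<zero>\<^sub>A"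
  and h: "h \<in> QL.V (m - 1)" and eq: "\<forall>x\<in>carrier Q. aug (g x) \<oplus>\<^sub>L QL.D (m - 1) h x = a \<odot>\<^sub>L aug x"
  using assms(1) by (rule relE)
 obtain h' where g': "g' \<in> QQ.hc.V m" and Dg': "\<forall>x\<in>carrier Q. QQ.hc.D m g' x = \<zero>\<^sub>Q" and a': "a' \<in> gr A m" and da': "dif A a' = \<zero>\<^sub>A"
  and h': "h' \<in> QL.V (m - 1)" and eq': "\<forall>x\<in>carrier Q. aug (g' x) \<oplus>\<^sub>L QL.D (m - 1) h' x = a' \<odot>\<^sub>L aug x"
  using assms(2) by (rule relE)
 have ac: "a \<in>: A" "a' \<in>: A" using A.cx.V_closed a a' by blast+
 have gg: "g \<oplus>\<^sub>QQ.E g' = g \<oplus>\<^sub>QQ.hc.F g'" by (simp add: QQ.E_simps QQ.hc.H_add)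
 show ?thesis
  unfolding gg
 proof (rule relI[OF QQ.hc.add_V[OF g g'] _ _ _ QL.add_V[OF h h']])
  show "a \<oplus>\<^sub>A a' \<in> gr A m" "dif A (a \<oplus>\<^sub>A a') = \<zero>\<^sub>A" using a a' da da' ac by (simp_all add: A.cx.dif_add)
  fix x assume x: "x \<in>: Q"
  show "QQ.hc.D m (g \<oplus>\<^sub>QQ.hc.F g') x = \<zero>\<^sub>Q"
   unfolding QQ.hc.D_add[OF g g'] QQ.hc.F_eval_add[OF x] using Dg Dg' x by simp
  note c = D_L_closed[OF h x] D_L_closed[OF h' x] aug_closed[OF hom_closed[OF g x]] aug_closed[OF hom_closed[OF g' x]]
  have "aug ((g \<oplus>\<^sub>QQ.hc.F g') x) \<oplus>\<^sub>L QL.D (m - 1) (h \<oplus>\<^sub>QL.F h') x =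
    (aug (g x) \<oplus>\<^sub>L QL.D (m - 1) h x) \<oplus>\<^sub>L (aug (g' x) \<oplus>\<^sub>L QL.D (m - 1) h' x)"
   unfolding QL.D_add[OF h h'] QL.F_eval_add[OF x] QQ.hc.F_eval_add[OF x] aug_plus[OF hom_closed[OF g x] hom_closed[OF g' x]]
   using c by (simp add: L.M.a_ac)
  also have "... = (a \<oplus>\<^sub>A a') \<odot>\<^sub>L aug x" using eq eq' x L.smult_l_distr[OF ac aug_closed[OF x]] by simp
  finally show "aug ((g \<oplus>\<^sub>QQ.hc.F g') x) \<oplus>\<^sub>L QL.D (m - 1) (h \<oplus>\<^sub>QL.F h') x = (a \<oplus>\<^sub>A a') \<odot>\<^sub>L aug x" .
 qed
qed

lemma rel_scalar:
 assumes c: "c \<in>: K" and "rel m g a"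
 shows "rel m (c \<odot>\<^sub>QQ.E g) (c \<odot>\<^sub>A a)"
proof -
 obtain h where g: "g \<in> QQ.hc.V m" and Dg: "\<forall>x\<in>carrier Q. QQ.hc.D m g x = \<zero>\<^sub>Q" and a: "a \<in> gr A m" and da: "dif A a = \<zero>\<^sub>A"
  and h: "h \<in> QL.V (m - 1)" and eq: "\<forall>x\<in>carrier Q. aug (g x) \<oplus>\<^sub>L QL.D (m - 1) h x = a \<odot>\<^sub>L aug x"
  using assms(2) by (rule relE)
 have ac: "a \<in>: A" by (rule A.cx.V_closed[OF a])
 have sc: "A.scal c \<in> gr A 0" "A.scal c \<in>: A" "R.scal c \<in>: R" using c by simp_all
 interpret QE: dg_algebra K "QQ.E" by (rule QQ.E_dg_algebra)
 have cg: "c \<odot>\<^sub>QQ.E g \<in> QQ.hc.V m" by (rule QQ.E_smult_gr[OF g c])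
 have "dif QQ.E (c \<odot>\<^sub>QQ.E g) = c \<odot>\<^sub>QQ.E \<zero>\<^sub>QQ.E"
  using QE.dif_smult[OF c QQ.gr_E[OF g]] End_cocycle_iff[OF g] Dg by simp
 hence Dcg: "\<forall>x\<in>carrier Q. QQ.hc.D m (c \<odot>\<^sub>QQ.E g) x = \<zero>\<^sub>Q"
  using Module.module.smult_r_null[OF QE.module c] End_cocycle_iff[OF cg] by simp
 have h': "(\<lambda>x\<in>carrier Q. A.scal c \<odot>\<^sub>L h x) \<in> QL.V (m - 1)" using mult_hom(1)[OF sc(1) h] by simp
 show ?thesis
 proof (rule relI[OF cg _ A.smult_gr[OF c a] _ h'])
  show "dif A (c \<odot>\<^sub>A a) = \<zero>\<^sub>A" using A.dif_smult[OF c ac] da Module.module.smult_r_null[OF A.module c] by simp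
  fix x assume x: "x \<in>: Q"
  show "QQ.hc.D m (c \<odot>\<^sub>QQ.E g) x = \<zero>\<^sub>Q" using Dcg x by blast
  note gx = hom_closed[OF g x] and Dh = D_L_closed[OF h x]
  have D: "QL.D (m - 1) (\<lambda>x\<in>carrier Q. A.scal c \<odot>\<^sub>L h x) x = A.scal c \<odot>\<^sub>L QL.D (m - 1) h x"
   using mult_hom(2)[OF sc(1) h x] dif_gr_0[OF sc(1)] hom_closed[OF h x] sc Dh
   by (simp add: sgn_pow_def L.smult_zero_left L.smult_closed)
  have "aug ((c \<odot>\<^sub>QQ.E g) x) = A.scal c \<odot>\<^sub>L aug (g x)"
   using QQ.E_smult[of c g] x aug_act[OF sc(3) gx] act_scal[OF c aug_closed[OF gx]] by simp
  hence "aug ((c \<odot>\<^sub>QQ.E g) x) \<oplus>\<^sub>L QL.D (m - 1) (\<lambda>x\<in>carrier Q. A.scal c \<odot>\<^sub>L h x) x =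
    A.scal c \<odot>\<^sub>L (aug (g x) \<oplus>\<^sub>L QL.D (m - 1) h x)"
   unfolding D using L.smult_r_distr[OF sc(2) aug_closed[OF gx] Dh] by simp
  also have "... = (c \<odot>\<^sub>A a) \<odot>\<^sub>L aug x"
   using eq x L.smult_assoc[OF sc(2) ac aug_closed[OF x]] A.smult_conv_left[OF c ac] by simp
  finally show "aug ((c \<odot>\<^sub>QQ.E g) x) \<oplus>\<^sub>L QL.D (m - 1) (\<lambda>x\<in>carrier Q. A.scal c \<odot>\<^sub>L h x) x = (c \<odot>\<^sub>A a) \<odot>\<^sub>L aug x" .
 qed
qed

text \<open>Forwards, a primitive of \<open>a\<close> is found by comparing the homotopy with multiplication
 by an element of the algebra one degree lower; backwards, \<open>aug \<circ> g\<close> is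
 null-homotopic and hence so is \<open>g\<close>.\<close>

lemma rel_coboundary:
 assumes "rel m g a"
 shows "g \<in> coboundaries QQ.E \<longleftrightarrow> a \<in> coboundaries A"
proof
 obtain h where g: "g \<in> QQ.hc.V m" and Dg: "\<forall>x\<in>carrier Q. QQ.hc.D m g x = \<zero>\<^sub>Q" and a: "a \<in> gr A m"
  and h: "h \<in> QL.V (m - 1)" and eq: "\<forall>x\<in>carrier Q. aug (g x) \<oplus>\<^sub>L QL.D (m - 1) h x = a \<odot>\<^sub>L aug x"
  using assms by (rule relE)
 note Qm = Q.is_dgm and Rx = R.cx.is_cpx
 have ac: "a \<in>: A" by (rule A.cx.V_closed[OF a])
 {
  assume "g \<in> coboundaries QQ.E"
  then obtain p where p: "p \<in> QQ.hc.V (m - 1)" "QQ.hc.D (m - 1) p = g" using End_coboundary_iff[OF g] by blast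
  let ?p = "compose (carrier Q) aug p"
  have ap: "?p \<in> QL.V (m - 1)" using compose_V[OF Qm Qm LR_dg_module Rx aug_hom p(1)] by simp
  have Dap: "QL.D (m - 1) ?p x = aug (g x)" if x: "x \<in>: Q" for x
   using compose_D[OF Qm Qm LR_dg_module Rx aug_hom p(1) x] D_aug[OF hom_closed[OF p(1) x]] p(2)
    aug_closed[OF hom_closed[OF g x]] by (simp add: sgn_pow_def)
  define \<phi> where "\<phi> = ?p \<oplus>\<^sub>QL.F h"
  have \<phi>: "\<phi> \<in> QL.V (m - 1)" unfolding \<phi>_def by (rule QL.add_V[OF ap h])
  have D\<phi>: "QL.D (m - 1) \<phi> x = a \<odot>\<^sub>L aug x" if x: "x \<in>: Q" for x
   unfolding \<phi>_def QL.D_add[OF ap h] QL.F_eval_add[OF x] using Dap[OF x] eq x by simp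
  have D0: "QL.D (m - 1) \<phi> x = \<zero>\<^sub>L" if "i < 0" "x \<in> gr Q i" for i x
   using D\<phi>[OF Q.cx.V_closed[OF that(2)]] aug_zero[OF that(2)] that(1) L.smult_zero_right[OF ac] by simp
  have "\<exists>b\<in>gr A (m - 1). \<exists>k\<in>QL.V (m - 1 - 1). \<forall>x\<in>carrier Q. \<phi> x = b \<odot>\<^sub>L aug x \<oplus>\<^sub>L QL.D (m - 1 - 1) k x"
   by (rule hom_into_dual[OF \<phi>]) (rule D0)
  then obtain b k where b: "b \<in> gr A (m - 1)" and k: "k \<in> QL.V (m - 1 - 1)"
   and bk: "\<forall>x\<in>carrier Q. \<phi> x = b \<odot>\<^sub>L aug x \<oplus>\<^sub>L QL.D (m - 1 - 1) k x" by blast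
  have "QL.D (m - 1) \<phi> q0 = dif A b \<odot>\<^sub>L aug q0"
   by (rule dif_of_homotopy[OF b \<phi> k _ q0_closed]) (use bk in blast)
  hence "a \<odot>\<^sub>L w = dif A b \<odot>\<^sub>L w" using D\<phi>[OF q0_closed] q0(3) by simp
  hence "a = dif A b" by (rule smult_w_inj[OF ac A.cx.dif_closed[OF A.cx.V_closed[OF b]]])
  thus "a \<in> coboundaries A" using A.cx.V_closed[OF b] by (simp add: coboundaries_def)
 next
  assume "a \<in> coboundaries A"
  then obtain b where b: "b \<in> gr A (m - 1)" "dif A b = a" using A.cx.homogeneous_coboundary[OF _ a] by blast
  note mV = mul(1)[OF b(1)]
  let ?h = "mul b \<ominus>\<^sub>QL.F h"
  have "aug (g x) = QL.D (m - 1) ?h x" if x: "x \<in>: Q" for x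
  proof -
   note c = D_L_closed[OF h x] aug_closed[OF hom_closed[OF g x]]
   have "QL.D (m - 1) ?h x = a \<odot>\<^sub>L aug x \<ominus>\<^sub>LR QL.D (m - 1) h x"
    unfolding QL.D_minus[OF mV h] QL.F_eval_minus[OF QL.V_F[OF QL.D_V[OF mV]] QL.V_F[OF QL.D_V[OF h]] x]
     mul(2)[OF b(1) x] b(2) ..
   also have "... = (aug (g x) \<oplus>\<^sub>L QL.D (m - 1) h x) \<ominus>\<^sub>L QL.D (m - 1) h x"
    using eq x by (simp add: a_minus_def a_inv_def m_inv_def)
   also have "... = aug (g x)" using c by (simp add: a_minus_def L.M.a_assoc L.M.r_neg)
   finally show ?thesis by simp
  qed
  note fg = this
  have "\<exists>p\<in>QQ.hc.V (m - 1). \<forall>x\<in>carrier Q. QQ.hc.D (m - 1) p x = g x"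
   by (rule aug_inj[OF g QL.minus_V[OF mV h]]) (use Dg fg in blast)+
  then obtain p where p: "p \<in> QQ.hc.V (m - 1)" "\<forall>x\<in>carrier Q. QQ.hc.D (m - 1) p x = g x" by blast
  have "QQ.hc.D (m - 1) p = g"
   by (rule hom_eqI[OF QQ.hc.D_V[OF p(1)] g]) (use p(2) in blast)
  thus "g \<in> coboundaries QQ.E" using End_coboundary_iff[OF g] p(1) by blast
 }
qed

lemma rel_total:
 assumes g: "g \<in> QQ.hc.V m" and Dg: "\<forall>x\<in>carrier Q. QQ.hc.D m g x = \<zero>\<^sub>Q"
 shows "\<exists>a. rel m g a"
proof -
 note Qm = Q.is_dgm and Rx = R.cx.is_cpx
 let ?g = "compose (carrier Q) aug g"
 have ag: "?g \<in> QL.V m" using compose_V[OF Qm Qm LR_dg_module Rx aug_hom g] by simp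
 have Dag: "QL.D m ?g x = \<zero>\<^sub>L" if x: "x \<in>: Q" for x
  using compose_D[OF Qm Qm LR_dg_module Rx aug_hom g x] D_aug[OF hom_closed[OF g x]] Dg x QL.hom_zero[OF aug_hom]
  by (simp add: sgn_pow_def)
 have "\<exists>a\<in>gr A m. \<exists>k\<in>QL.V (m - 1). \<forall>x\<in>carrier Q. ?g x = a \<odot>\<^sub>L aug x \<oplus>\<^sub>L QL.D (m - 1) k x"
  by (rule hom_into_dual[OF ag]) (rule Dag, rule Q.cx.V_closed)
 then obtain a k where a: "a \<in> gr A m" and k: "k \<in> QL.V (m - 1)"
  and ak: "\<forall>x\<in>carrier Q. ?g x = a \<odot>\<^sub>L aug x \<oplus>\<^sub>L QL.D (m - 1) k x" by blast
 have ac: "a \<in>: A" by (rule A.cx.V_closed[OF a])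
 have "QL.D m ?g q0 = dif A a \<odot>\<^sub>L aug q0"
  by (rule dif_of_homotopy[OF a ag k _ q0_closed]) (use ak in blast)
 hence "dif A a \<odot>\<^sub>L w = \<zero>\<^sub>A \<odot>\<^sub>L w" using Dag[OF q0_closed] q0(3) L.smult_zero_left[OF w_closed] by simp
 hence da: "dif A a = \<zero>\<^sub>A" by (rule smult_w_inj[OF A.cx.dif_closed[OF ac] A.alg.zero_closed])
 have "rel m g a"
 proof (rule relI[OF g _ a da QL.inv_V[OF k]])
  fix x assume x: "x \<in>: Q"
  show "QQ.hc.D m g x = \<zero>\<^sub>Q" using Dg x by blast
  note c = D_L_closed[OF k x] L.smult_closed[OF ac aug_closed[OF x]]
  have "QL.D (m - 1) (\<ominus>\<^sub>QL.F k) x = \<ominus>\<^sub>LR QL.D (m - 1) k x"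
   unfolding QL.D_inv[OF k] by (rule QL.F_eval_inv[OF QL.V_F[OF QL.D_V[OF k]] x])
  also have "... = \<ominus>\<^sub>L QL.D (m - 1) k x" by (simp add: a_inv_def m_inv_def)
  finally show "aug (g x) \<oplus>\<^sub>L QL.D (m - 1) (\<ominus>\<^sub>QL.F k) x = a \<odot>\<^sub>L aug x"
   using ak x c by (simp add: compose_def L.M.a_assoc L.M.r_neg)
 qed
 thus ?thesis by blast
qed

lemma rel_onto:
 assumes a: "a \<in> gr A m" and da: "dif A a = \<zero>\<^sub>A"
 shows "\<exists>g. rel m g a"
proof -
 have D: "QL.D m (mul a) x = \<zero>\<^sub>L" if "x \<in>: Q" for x
  using mul(2)[OF a that] da L.smult_zero_left[OF aug_closed[OF that]] by simp
 from aug_surj[OF mul(1)[OF a] D]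
 obtain g h where g: "g \<in> QQ.hc.V m" and h: "h \<in> QL.V (m - 1)"
  and eq: "\<forall>x\<in>carrier Q. QQ.hc.D m g x = \<zero>\<^sub>Q \<and> aug (g x) \<oplus>\<^sub>LR QL.D (m - 1) h x = mul a x" by auto
 have "rel m g a" by (rule relI[OF g _ a da h]) (use eq in auto)
 thus ?thesis by blast
qed

lemma rel_zero: "rel m \<zero>\<^sub>QQ.E \<zero>\<^sub>A"
proof -
 have z: "\<zero>\<^sub>QQ.E = \<zero>\<^sub>QQ.hc.F" by (simp add: QQ.E_simps QQ.hc.H_zero)
 show ?thesis
  unfolding z
 proof (rule relI[OF QQ.hc.zero_V _ A.cx.V_zero _ QL.zero_V])
  fix x assume x: "x \<in>: Q"
  show "QQ.hc.D m \<zero>\<^sub>QQ.hc.F x = \<zero>\<^sub>Q" unfolding QQ.hc.D_zero by (rule QQ.hc.F_eval_zero[OF x])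
  show "aug (\<zero>\<^sub>QQ.hc.F x) \<oplus>\<^sub>L QL.D (m - 1) \<zero>\<^sub>QL.F x = \<zero>\<^sub>A \<odot>\<^sub>L aug x"
   unfolding QL.D_zero QL.F_eval_zero[OF x] QQ.hc.F_eval_zero[OF x]
   using QL.hom_zero[OF aug_hom] L.smult_zero_left[OF aug_closed[OF x]] by simp
 qed simp
qed

lemma rel_one: "rel 0 \<one>\<^sub>QQ.E \<one>\<^sub>A"
proof (rule relI[OF QQ.E_one_gr _ A.one_gr A.dif_one QL.zero_V])
 fix x assume x: "x \<in>: Q"
 show "QQ.hc.D 0 \<one>\<^sub>QQ.E x = \<zero>\<^sub>Q"
  using QQ.hc.D_apply[OF x, of 0 "\<one>\<^sub>QQ.E"] Q.M.minus_zero_iff x by (simp add: QQ.E_simps sgn_pow_def)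
 show "aug (\<one>\<^sub>QQ.E x) \<oplus>\<^sub>L QL.D (0 - 1) \<zero>\<^sub>QL.F x = \<one>\<^sub>A \<odot>\<^sub>L aug x"
  unfolding QL.D_zero QL.F_eval_zero[OF x] using x aug_closed[OF x] L.smult_one by (simp add: QQ.E_simps)
qed

theorem yoneda_algebra_isomorphic: "graded_algebra_isomorphic K (cohom QQ.E) (cohom A)"
proof -
 interpret QE: dg_algebra K "QQ.E" by (rule QQ.E_dg_algebra)
 interpret KF: field K by (rule A.field)
 have m1: "\<ominus>\<^sub>K \<one>\<^sub>K \<in>: K" by simp
 have neg: "(\<ominus>\<^sub>K \<one>\<^sub>K) \<odot>\<^sub>X x = \<ominus>\<^sub>X x" if X: "Module.module K X" and x: "x \<in>: X"
  for X :: "('k, 't) dg" and x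
  using Module.module.smult_l_minus[OF X KF.one_closed x] Module.module.smult_one[OF X x] by simp
 interpret GC: graded_correspondence K "QQ.E" A rel
 proof unfold_locales
  show "x \<in> gr QQ.E n" if "rel n x y" for n x y using that by (auto simp: rel_def QQ.E_simps)
  show "dif QQ.E x = \<zero>\<^sub>QQ.E" if "rel n x y" for n x y
   using that End_cocycle_iff[of x n] by (simp add: rel_def)
  show "y \<in> gr A n" "dif A y = \<zero>\<^sub>A" if "rel n x y" for n x y using that by (simp_all add: rel_def)
  show "rel n \<zero>\<^sub>QQ.E \<zero>\<^sub>A" for n by (rule rel_zero)
  show "rel n (x \<oplus>\<^sub>QQ.E x') (y \<oplus>\<^sub>A y')" if "rel n x y" "rel n x' y'" for n x y x' y' by (rule rel_add[OF that])
  show "rel n (x \<ominus>\<^sub>QQ.E x') (y \<ominus>\<^sub>A y')" if xy: "rel n x y" "rel n x' y'" for n x y x' y'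
  proof -
   have c: "x' \<in>: QQ.E" "y' \<in>: A"
    using xy(2) QQ.gr_E A.cx.V_closed[of y' n] by (auto simp: rel_def)
   show ?thesis
    using rel_add[OF xy(1) rel_scalar[OF m1 xy(2)]] neg[OF QE.module c(1)] neg[OF A.module c(2)] by (simp add: a_minus_def)
  qed
  show "rel n (c \<odot>\<^sub>QQ.E x) (c \<odot>\<^sub>A y)" if "c \<in>: K" "rel n x y" for c n x y by (rule rel_scalar[OF that])
  show "rel (m + n) (x \<otimes>\<^sub>QQ.E x') (y \<otimes>\<^sub>A y')" if "rel m x y" "rel n x' y'" for m n x y x' y'
   using rel_compose[OF that] by (simp add: QQ.E_simps)
  show "rel 0 \<one>\<^sub>QQ.E \<one>\<^sub>A" by (rule rel_one)
  show "\<exists>y. rel n x y" if "x \<in> gr QQ.E n" "dif QQ.E x = \<zero>\<^sub>QQ.E" for n x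
   using that rel_total[of x n] End_cocycle_iff[of x n] by (simp add: QQ.E_simps(4))
  show "\<exists>x. rel n x y" if "y \<in> gr A n" "dif A y = \<zero>\<^sub>A" for n y by (rule rel_onto[OF that])
  show "(x \<in> coboundaries QQ.E) = (y \<in> coboundaries A)" if "rel n x y" for n x y by (rule rel_coboundary[OF that])
 qed
 show ?thesis by (rule GC.cohomology_isomorphic)
qed

end

theorem theorem3p8:
  fixes K :: "'k ring"
    and A :: "('k, 'a) dg"
    and P :: "('a, 'p) dg" and \<epsilon> :: "'p \<Rightarrow> 'a set"
    and E :: "('k, ('p \<Rightarrow> 'p) set) dg"
    and Q :: "(('p \<Rightarrow> 'p) set, 'q) dg" and \<eta> :: "'q \<Rightarrow> ('p \<Rightarrow> 'p) set set"
  assumes "koszul_dg_algebra TYPE('r) K A"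
    and "semifree_resolution A (trivial_module A) P \<epsilon>"
    and "E = ext_algebra A P"
    and "compact_object TYPE('u::infinite) TYPE('s) A (trivial_module A)"
    and "projective_resolution (ungraded E) (residue_module (ungraded E)) Q \<eta>"
  shows "graded_algebra_isomorphic K (ext_algebra (ungraded E) Q) (cohom A)"
proof -
 obtain L :: "('a, 'r) dg" and e0 Bn where conn: "connected_dg_algebra K A"
  and L: "semifree_resolution A (trivial_module A) L e0" "minimal_dg_module A L" "semibasis A L Bn" "\<forall>n. Bn n \<subseteq> gr L 0"
  using assms(1) unfolding koszul_dg_algebra_def by (elim conjE exE)
 interpret A0: connected_dg_algebra K A by (rule conn)
 have res: "left_dg_module A X \<and> (\<exists>Cn. semibasis A X Cn) \<and> (\<exists>e. ground_resolution A X e)"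
  if X: "semifree_resolution A (trivial_module A) X f" for X :: "('a, 'x) dg" and f
  using A0.ground_resolution_of_trivial[of X f] X unfolding semifree_resolution_def by blast
 obtain e where Lm: "left_dg_module A L" and e: "ground_resolution A L e" using res[OF L(1)] by blast
 have L_res: "koszul_resolution K A L Bn e"
  by (intro koszul_resolution.intro koszul_resolution_axioms.intro conn Lm L e) (use L(4) in blast)
 obtain Cn \<epsilon>' where Pm: "left_dg_module A P" and P: "semibasis A P Cn" "ground_resolution A P \<epsilon>'"
  using res[OF assms(2)] by blast
 interpret P: koszul_transfer K A L Bn e P Cn \<epsilon>'
  by (intro koszul_transfer.intro koszul_transfer_axioms.intro L_res Pm P)
 obtain S :: "('a, 's) dg" and s0 where S: "semifree_resolution A (trivial_module A) S s0"
  and compact: "\<forall>(I :: 'u set) (M :: 'u => ('a, 'u => 'a) dg). (\<forall>i\<in>I. left_dg_module A (M i)) \<longrightarrow>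
   bij_betw (ext_dsum_map A S I M) (gr (dsum I (%i. ext_dg A S (M i))) 0) (gr (ext_dg A S (dsum I M)) 0)"
  using assms(4) unfolding compact_object_def by (elim exE conjE)
 obtain Sn \<sigma> where Sm: "left_dg_module A S" and S: "semibasis A S Sn" "ground_resolution A S \<sigma>"
  using res[OF S] by blast
 have S_transfer: "koszul_transfer K A L Bn e S Sn \<sigma>"
  by (intro koszul_transfer.intro koszul_transfer_axioms.intro L_res Sm S)
 have fin: "finite (\<Union>n. Bn n)"
  by (rule koszul_transfer.finite_basis[OF S_transfer]) (use compact in blast)
 have E: "E = P.E" by (simp add: assms(3) ext_algebra_def)
 have R: "dg_algebra K (ungraded E)" unfolding E by (rule ungraded_dg_algebra[OF P.XE.cohom_dg_algebra])
 have dual: "koszul_dual K A L Bn e (ungraded E) P.act"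
 proof (intro koszul_dual.intro koszul_dual_axioms.intro L_res R fin)
  show "(\<lambda>x\<in>carrier L. P.act U x) \<in> P.E0" if "U \<in>: (ungraded E)" for U
   using that P.act_E0 by (simp add: E)
  show "\<exists>U\<in>carrier (ungraded E). \<forall>x\<in>carrier L. P.act U x = f x" if "f \<in> P.E0" for f
   using P.act_full[OF that] by (simp add: E)
  show "U = \<zero>\<^bsub>ungraded E\<^esub>" if "U \<in>: (ungraded E)" "!!x. x \<in>: L ==> P.act U x = \<zero>\<^sub>L" for U
   using P.act_faithful[of U] that by (simp add: E)
 qed (simp_all add: E P.act_add P.act_mult P.act_one P.act_smult)
 have Qm: "left_dg_module (ungraded E) Q" using assms(5) by (simp add: projective_resolution_def)
 interpret D: koszul_dual_resolution K A L Bn e "ungraded E" P.act Q \<eta>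
  by (intro koszul_dual_resolution.intro koszul_dual_resolution_axioms.intro dual Qm assms(5))
 show ?thesis unfolding ext_algebra_def by (rule D.yoneda_algebra_isomorphic)
qed

end
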